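(* For $s\ge0$ and $n\ge1$ let $Y(s,n)=\sum_{1\le i,j\le n}a(i,j;n,s)\,e(i,j;n)$ be a random matrix. Assume that $a(i,j;n,s)=\overline{a(j,i;n,s)}$ and that $$\{\mathrm{Re}\, a(i,j;n,s): 1\le i\le j\le n,\ s\in\mathbb N\}\cup\{\mathrm{Im}\, a(i,j;n,s): 1\le i<j\le n,\ s\in\mathbb N\}$$ are independent Gaussian random variables, centered with variance $(2n)^{-1}$ if $i<j$ and centered with variance $n^{-1}$ if $i=j$. Let further $(B(j,n))_{j\in\mathbb N}$ be a family of elements of $\mathfrak M_n$, stable under multiplication and adjunction, which contains $p_1(n),\dots,p_d(n)$, such that for every $j$ the sequence $(\|E(B(j,n))\|)_n$ is bounded, and which converges in $\mathcal D$-distribution as $n\to\infty$. Then the family $(\{B(j,n):j\in\mathbb N\},(\{Y(s,n)\})_s)$ is asymptotically free with amalgamation over $\mathcal D$ as $n\to\infty$, and the limit $\mathcal D$-distribution of each $Y(s,n)$ is the $\mathcal D$-semicircular distribution with covariance $\varphi$.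
   Context: $(\mathcal A,\varphi)$ is a tracial $*$-noncommutative probability space with self-adjoint nonzero pairwise orthogonal projections $p_1,\dots,p_d$ with sum $1$; $\rho_i=\varphi(p_i)\ne0$; $\mathcal D=\mathrm{Span}\{p_1,\dots,p_d\}$; $E(x)=\sum_i\rho_i^{-1}\varphi(p_ixp_i)p_i$ is the conditional expectation $\mathcal A\to\mathcal D$. For $n\ge1$, $q_1(n),\dots,q_d(n)$ are positive integers with sum $n$ and $q_i(n)/n\to\rho_i$. $\mathfrak M_n$ is the algebra of (constant) complex $n\times n$ matrices, $e(i,j;n)$ its matrix units, $\mathrm{tr}$ the normalized trace. $\mathcal D$ is identified with a $*$-subalgebra of $\mathfrak M_n$ by $\sum\lambda_ip_i\mapsto\mathrm{diag}(\lambda_1I_{q_1(n)},\dots,\lambda_dI_{q_d(n)})$; $p_k(n)$ is the image of $p_k$. Random $n\times n$ matrices (with entries having all moments) form an algebra $M_n$ with state $\mathbb E\,\mathrm{tr}$, and $E:M_n\to\mathcal D$ is $E(X)=\sum_k\frac{\mathbb E\,\mathrm{Tr}(p_k(n)Xp_k(n))}{q_k(n)}p_k$. $\|\cdot\|$ on $\mathcal D$ is the operator norm. The $\mathcal D$-distribution of a family $(a_i)$ is the map sending each word $X_{i_0}^{\epsilon_0}d_0\cdots X_{i_m}^{\epsilon_m}d_m$ ($d_j\in\mathcal D$, $\epsilon_j\in\{1,*\}$) to $E(a_{i_0}^{\epsilon_0}d_0\cdots a_{i_m}^{\epsilon_m}d_m)$; convergence in $\mathcal D$-distribution is pointwise convergence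 of $\mathcal D$-distributions to that of a family in $\mathcal A$ (possibly after enlarging $(\mathcal A,\varphi)$). Subalgebras $(\mathcal A_i)_{i\in I}$ containing $\mathcal D$ are free with amalgamation over $\mathcal D$ if $E(x(1)\cdots x(m))=0$ whenever $i_1\neq\cdots\neq i_m$ (consecutive indices distinct) and $x(j)\in\mathcal A_{i_j}\cap\ker E$; subsets are free with amalgamation over $\mathcal D$ if they are contained in such subalgebras. A family of sets of matrices is asymptotically free with amalgamation over $\mathcal D$ if the whole collection of matrices converges jointly in $\mathcal D$-distribution and the corresponding sets of limit elements are free with amalgamation over $\mathcal D$. $\mathcal D$-valued cumulants $c_m:\mathcal A^{\otimes_{\mathcal D}m}\to\mathcal D$ are the $\mathcal D$-bimodule maps determined by $E(a_1\cdots a_m)=\sum_{\sigma\in NC(m)}c_\sigma(a_1\otimes\cdots\otimes a_m)$ (sum over noncrossing partitions, $c_\sigma$ the usual nested product of the $c_k$ over blocks). A self-adjoint $X$ has the $\mathcal D$-semicircular distribution with covariance $\varphi$ if $c_1(X)=0$, $c_2(Xd\otimes X)=\varphi(d)1$ for $d\in\mathcal D$, and $c_k(Xd_1\otimes\cdots\otimes Xd_k)=0$ for $k\ge3$, $d_i\in\mathcal D$. *)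

theory Defs
  imports
    "HOL-Probability.Probability"
    "HOL-Algebra.Subrings"
    "HOL-Algebra.Algebraic_Closure_Type"
    "Jordan_Normal_Form.Schur_Decomposition"
begin

section \<open>Tracial \<open>*\<close>-noncommutative probability spaces\<close>

text \<open>The field \<open>\<complex>\<close> acts by \<^const>\<open>smult\<close>; algebras have an explicit carrier. As usual, the
  linear form of a \<open>*\<close>-noncommutative probability space is unital and positive.\<close>

record 'u star_prob = "(complex, 'u) module" +
  star :: "'u \<Rightarrow> 'u"
  state :: "'u \<Rightarrow> complex"

locale tracial_star_prob_space =
  alg?: ring A + scal?: module "ring_of_type_algebra :: complex ring" A
  for A :: "'u star_prob" (structure) +
  assumes smult_mult_left:
      "\<lbrakk>x \<in> carrier A; y \<in> carrier A\<rbrakk> \<Longrightarrow> (c \<odot> x) \<otimes> y = c \<odot> (x \<otimes> y)"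
    and smult_mult_right:
      "\<lbrakk>x \<in> carrier A; y \<in> carrier A\<rbrakk> \<Longrightarrow> x \<otimes> (c \<odot> y) = c \<odot> (x \<otimes> y)"
    and star_closed: "x \<in> carrier A \<Longrightarrow> star A x \<in> carrier A"
    and star_star: "x \<in> carrier A \<Longrightarrow> star A (star A x) = x"
    and star_add: "\<lbrakk>x \<in> carrier A; y \<in> carrier A\<rbrakk> \<Longrightarrow> star A (x \<oplus> y) = star A x \<oplus> star A y"
    and star_smult: "x \<in> carrier A \<Longrightarrow> star A (c \<odot> x) = cnj c \<odot> star A x"
    and star_mult: "\<lbrakk>x \<in> carrier A; y \<in> carrier A\<rbrakk> \<Longrightarrow> star A (x \<otimes> y) = star A y \<otimes> star A x"
    and state_add: "\<lbrakk>x \<in> carrier A; y \<in> carrier A\<rbrakk> \<Longrightarrow> state A (x \<oplus> y) = state A x + state A y"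
    and state_smult: "x \<in> carrier A \<Longrightarrow> state A (c \<odot> x) = c * state A x"
    and state_one: "state A \<one> = 1"
    and state_pos: "x \<in> carrier A \<Longrightarrow>
      Im (state A (star A x \<otimes> x)) = 0 \<and> 0 \<le> Re (state A (star A x \<otimes> x))"
    and state_tracial: "\<lbrakk>x \<in> carrier A; y \<in> carrier A\<rbrakk> \<Longrightarrow> state A (x \<otimes> y) = state A (y \<otimes> x)"

text \<open>The projections \<open>p\<^sub>1, \<dots>, p\<^sub>d\<close> are \<open>p 0, \<dots>, p (d - 1)\<close>.\<close>

locale rectangular_prob_space = tracial_star_prob_space A
  for A :: "'u star_prob" (structure) and d :: nat and p :: "nat \<Rightarrow> 'u" +
  assumes proj_closed: "k < d \<Longrightarrow> p k \<in> carrier A"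
    and proj_nonzero: "k < d \<Longrightarrow> p k \<noteq> \<zero>"
    and proj_selfadjoint: "k < d \<Longrightarrow> star A (p k) = p k"
    and proj_idem: "k < d \<Longrightarrow> p k \<otimes> p k = p k"
    and proj_orthogonal: "\<lbrakk>k < d; l < d; k \<noteq> l\<rbrakk> \<Longrightarrow> p k \<otimes> p l = \<zero>"
    and proj_sum: "(\<Oplus>k\<in>{..<d}. p k) = \<one>"
    and proj_state_nonzero: "k < d \<Longrightarrow> state A (p k) \<noteq> 0"

text \<open>Enlarging \<open>(A, \<phi>)\<close> means embedding it, by an injective state-preserving unital
  \<open>*\<close>-homomorphism \<open>\<iota>\<close>, into another tracial space \<open>A'\<close>. Asking for \<open>A'\<close> on the same type is no
  restriction: an algebra generated by a copy of \<open>A\<close> and countably many further elements has the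
  cardinality of \<open>A\<close>, because \<open>A\<close> is a nonzero complex vector space.\<close>

definition enlargement :: "'u star_prob \<Rightarrow> 'u star_prob \<Rightarrow> ('u \<Rightarrow> 'u) \<Rightarrow> bool" where
  "enlargement A A' \<iota> \<longleftrightarrow>
     tracial_star_prob_space A' \<and>
     \<iota> \<in> Ring.ring_hom A A' \<and> inj_on \<iota> (carrier A) \<and>
     (\<forall>c. \<forall>x\<in>carrier A. \<iota> (c \<odot>\<^bsub>A\<^esub> x) = c \<odot>\<^bsub>A'\<^esub> \<iota> x) \<and>
     (\<forall>x\<in>carrier A. \<iota> (star A x) = star A' (\<iota> x)) \<and>
     (\<forall>x\<in>carrier A. state A' (\<iota> x) = state A x)"


section \<open>The subalgebra \<open>D\<close> and the conditional expectation\<close>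

text \<open>An element of \<open>D\<close> is given by its coefficients \<open>f 0, \<dots>, f (d - 1)\<close> on the projections (the
  other values of \<open>f\<close> are irrelevant). This is how \<open>D\<close> is identified with a subalgebra of \<open>A\<close>, of
  every enlargement of \<open>A\<close>, and of the matrices.\<close>

definition D_elem :: "'u star_prob \<Rightarrow> nat \<Rightarrow> (nat \<Rightarrow> 'u) \<Rightarrow> (nat \<Rightarrow> complex) \<Rightarrow> 'u" where
  "D_elem A d p f = (\<Oplus>\<^bsub>A\<^esub>k\<in>{..<d}. f k \<odot>\<^bsub>A\<^esub> p k)"

definition D_set :: "'u star_prob \<Rightarrow> nat \<Rightarrow> (nat \<Rightarrow> 'u) \<Rightarrow> 'u set" where
  "D_set A d p = range (D_elem A d p)"

definition E_coeff :: "'u star_prob \<Rightarrow> (nat \<Rightarrow> 'u) \<Rightarrow> 'u \<Rightarrow> nat \<Rightarrow> complex" where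
  "E_coeff A p x k = state A (p k \<otimes>\<^bsub>A\<^esub> x \<otimes>\<^bsub>A\<^esub> p k) / state A (p k)"

definition E :: "'u star_prob \<Rightarrow> nat \<Rightarrow> (nat \<Rightarrow> 'u) \<Rightarrow> 'u \<Rightarrow> 'u" where
  "E A d p x = D_elem A d p (E_coeff A p x)"

definition alg_prod :: "'u star_prob \<Rightarrow> 'u list \<Rightarrow> 'u" where
  "alg_prod A xs = foldr (\<lambda>x y. x \<otimes>\<^bsub>A\<^esub> y) xs \<one>\<^bsub>A\<^esub>"


section \<open>Freeness with amalgamation over \<open>D\<close>\<close>

definition D_subalgebra :: "'u star_prob \<Rightarrow> nat \<Rightarrow> (nat \<Rightarrow> 'u) \<Rightarrow> 'u set \<Rightarrow> bool" where
  "D_subalgebra A d p S \<longleftrightarrow>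
     subring S A \<and> (\<forall>c. \<forall>x\<in>S. c \<odot>\<^bsub>A\<^esub> x \<in> S) \<and> D_set A d p \<subseteq> S"

definition free_subalgebras ::
    "'u star_prob \<Rightarrow> nat \<Rightarrow> (nat \<Rightarrow> 'u) \<Rightarrow> ('i \<Rightarrow> 'u set) \<Rightarrow> bool" where
  "free_subalgebras A d p S \<longleftrightarrow>
     (\<forall>i. D_subalgebra A d p (S i)) \<and>
     (\<forall>xs :: ('i \<times> 'u) list.
        xs \<noteq> [] \<and> distinct_adj (map fst xs) \<and>
        (\<forall>(i, x)\<in>set xs. x \<in> S i \<and> E A d p x = \<zero>\<^bsub>A\<^esub>) \<longrightarrow>
        E A d p (alg_prod A (map snd xs)) = \<zero>\<^bsub>A\<^esub>)"

definition free_subsets ::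
    "'u star_prob \<Rightarrow> nat \<Rightarrow> (nat \<Rightarrow> 'u) \<Rightarrow> ('i \<Rightarrow> 'u set) \<Rightarrow> bool" where
  "free_subsets A d p \<Xi> \<longleftrightarrow> (\<exists>S. free_subalgebras A d p S \<and> (\<forall>i. \<Xi> i \<subseteq> S i))"


section \<open>\<open>D\<close>-valued cumulants and the \<open>D\<close>-semicircular distribution\<close>

definition noncrossing :: "nat set set \<Rightarrow> bool" where
  "noncrossing \<sigma> \<longleftrightarrow>
     (\<forall>V\<in>\<sigma>. \<forall>W\<in>\<sigma>. \<forall>a\<in>V. \<forall>b\<in>W. \<forall>a'\<in>V. \<forall>b'\<in>W. a < b \<and> b < a' \<and> a' < b' \<longrightarrow> V = W)"

definition NC :: "nat \<Rightarrow> nat set set set" where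
  "NC m = {\<sigma>. partition_on {..<m} \<sigma> \<and> noncrossing \<sigma>}"

text \<open>The nested product of the cumulants over the blocks of \<open>\<sigma>\<close> lying in \<open>{l..<h}\<close>. If the block
  of \<open>l\<close> is \<open>v\<^sub>1 < \<dots> < v\<^sub>k\<close>, then
  \<open>c\<^sub>\<sigma>[l, h) = c\<^sub>k (a\<^bsub>v\<^sub>1\<^esub> c\<^sub>\<sigma>[v\<^sub>1 + 1, v\<^sub>2) \<otimes> \<dots> \<otimes> a\<^bsub>v\<^sub>k\<^sub>-\<^sub>1\<^esub> c\<^sub>\<sigma>[v\<^sub>k\<^sub>-\<^sub>1 + 1, v\<^sub>k) \<otimes> a\<^bsub>v\<^sub>k\<^esub>) \<cdot> c\<^sub>\<sigma>[v\<^sub>k + 1, h)\<close>.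
  For a noncrossing partition \<open>\<sigma>\<close> of \<open>{..<m}\<close>, all intervals met when starting from \<open>{0..<m}\<close> are
  unions of blocks; the intersection with \<open>{l..<h}\<close> and the \<^const>\<open>insert\<close> only serve termination
  on other arguments.\<close>

function nested_cumulant ::
    "'u star_prob \<Rightarrow> ('u list \<Rightarrow> 'u) \<Rightarrow> nat set set \<Rightarrow> 'u list \<Rightarrow> nat \<Rightarrow> nat \<Rightarrow> 'u" where
  "nested_cumulant A c \<sigma> as l h =
     (if h \<le> l then \<one>\<^bsub>A\<^esub>
      else let vs = sorted_list_of_set (insert l (\<Union>{V \<in> \<sigma>. l \<in> V} \<inter> {l..<h})) in
        c (map (\<lambda>i. if Suc i < length vs
                    then as ! (vs ! i) \<otimes>\<^bsub>A\<^esub> nested_cumulant A c \<sigma> as (Suc (vs ! i)) (vs ! Suc i)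
                    else as ! (vs ! i))
               [0..<length vs])
        \<otimes>\<^bsub>A\<^esub> nested_cumulant A c \<sigma> as (Suc (last vs)) h)"
  by pat_completeness auto
termination
proof (relation "Wellfounded.measure (\<lambda>(A, c, \<sigma>, as, l, h). h - l)", goal_cases)
  case 1
  then show ?case by simp
next
  case (2 A c \<sigma> as l h vs i)
  let ?B = "insert l (\<Union>{V \<in> \<sigma>. l \<in> V} \<inter> {l..<h})"
  have vs: "set vs = ?B" using 2(2) by (auto simp: set_insort_key)
  have "vs ! i \<in> ?B" "vs ! Suc i \<in> ?B" using 2(4) vs nth_mem[of _ vs] by (metis Suc_lessD)+
  then show ?case using 2(1) by auto
next
  case (3 A c \<sigma> as l h vs)
  let ?B = "insert l (\<Union>{V \<in> \<sigma>. l \<in> V} \<inter> {l..<h})"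
  have vs: "set vs = ?B" using 3(2) by (auto simp: set_insort_key)
  then have "vs \<noteq> []" by auto
  then have "last vs \<in> ?B" using vs last_in_set by metis
  then show ?case using 3(1) by auto
qed

declare nested_cumulant.simps [simp del]

text \<open>\<open>c [a\<^sub>1, \<dots>, a\<^sub>m]\<close> is \<open>c\<^sub>m(a\<^sub>1 \<otimes> \<dots> \<otimes> a\<^sub>m)\<close>. Being a \<open>D\<close>-bimodule map on the \<open>m\<close>-fold tensor
  product over \<open>D\<close> means being additive in every argument, \<open>D\<close>-balanced, and left and right
  \<open>D\<close>-linear; \<open>\<complex>\<close>-linearity is included as \<open>\<complex>1 \<subseteq> D\<close>.\<close>

definition D_cumulants :: "'u star_prob \<Rightarrow> nat \<Rightarrow> (nat \<Rightarrow> 'u) \<Rightarrow> ('u list \<Rightarrow> 'u) \<Rightarrow> bool" where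
  "D_cumulants A d p c \<longleftrightarrow>
     (\<forall>as. as \<noteq> [] \<and> set as \<subseteq> carrier A \<longrightarrow> c as \<in> D_set A d p) \<and>
     (\<forall>as bs. \<forall>x\<in>carrier A. \<forall>y\<in>carrier A. set as \<subseteq> carrier A \<and> set bs \<subseteq> carrier A \<longrightarrow>
        c (as @ (x \<oplus>\<^bsub>A\<^esub> y) # bs) = c (as @ x # bs) \<oplus>\<^bsub>A\<^esub> c (as @ y # bs)) \<and>
     (\<forall>as bs. \<forall>x\<in>carrier A. \<forall>y\<in>carrier A. \<forall>e\<in>D_set A d p.
        set as \<subseteq> carrier A \<and> set bs \<subseteq> carrier A \<longrightarrow>
        c (as @ (x \<otimes>\<^bsub>A\<^esub> e) # y # bs) = c (as @ x # (e \<otimes>\<^bsub>A\<^esub> y) # bs)) \<and>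
     (\<forall>as. \<forall>x\<in>carrier A. \<forall>e\<in>D_set A d p. set as \<subseteq> carrier A \<longrightarrow>
        c ((e \<otimes>\<^bsub>A\<^esub> x) # as) = e \<otimes>\<^bsub>A\<^esub> c (x # as) \<and>
        c (as @ [x \<otimes>\<^bsub>A\<^esub> e]) = c (as @ [x]) \<otimes>\<^bsub>A\<^esub> e) \<and>
     (\<forall>as. as \<noteq> [] \<and> set as \<subseteq> carrier A \<longrightarrow>
        E A d p (alg_prod A as) =
          (\<Oplus>\<^bsub>A\<^esub>\<sigma>\<in>NC (length as). nested_cumulant A c \<sigma> as 0 (length as)))"

definition D_semicircular :: "'u star_prob \<Rightarrow> nat \<Rightarrow> (nat \<Rightarrow> 'u) \<Rightarrow> 'u \<Rightarrow> bool" where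
  "D_semicircular A d p y \<longleftrightarrow>
     y \<in> carrier A \<and> star A y = y \<and>
     (\<exists>c. D_cumulants A d p c \<and>
        c [y] = \<zero>\<^bsub>A\<^esub> \<and>
        (\<forall>e\<in>D_set A d p. c [y \<otimes>\<^bsub>A\<^esub> e, y] = state A e \<odot>\<^bsub>A\<^esub> \<one>\<^bsub>A\<^esub>) \<and>
        (\<forall>es. set es \<subseteq> D_set A d p \<and> 3 \<le> length es \<longrightarrow>
           c (map (\<lambda>e. y \<otimes>\<^bsub>A\<^esub> e) es) = \<zero>\<^bsub>A\<^esub>))"


section \<open>Matrices\<close>

text \<open>\<open>q k n\<close> is the size of the \<open>k\<close>-th diagonal block of an \<open>n \<times> n\<close> matrix.\<close>

definition D_mat :: "(nat \<Rightarrow> nat \<Rightarrow> nat) \<Rightarrow> nat \<Rightarrow> nat \<Rightarrow> (nat \<Rightarrow> complex) \<Rightarrow> complex mat" where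
  "D_mat q d n f = diag_block_mat (map (\<lambda>k. smult_mat (f k) (one_mat (q k n))) [0..<d])"

definition proj_mat :: "(nat \<Rightarrow> nat \<Rightarrow> nat) \<Rightarrow> nat \<Rightarrow> nat \<Rightarrow> nat \<Rightarrow> complex mat" where
  "proj_mat q d n k = D_mat q d n (\<lambda>l. if l = k then 1 else 0)"

definition mat_trace :: "complex mat \<Rightarrow> complex" where
  "mat_trace M = (\<Sum>i<dim_row M. M $$ (i, i))"

definition random_mats :: "'w measure \<Rightarrow> nat \<Rightarrow> ('w \<Rightarrow> complex mat) set" where
  "random_mats P n = {M.
     (\<forall>\<omega>\<in>space P. M \<omega> \<in> carrier_mat n n) \<and>
     (\<forall>i<n. \<forall>j<n. (\<lambda>\<omega>. M \<omega> $$ (i, j)) \<in> borel_measurable P \<and>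
        (\<forall>m. integrable P (\<lambda>\<omega>. cmod (M \<omega> $$ (i, j)) ^ m)))}"

definition mat_E_coeff ::
    "'w measure \<Rightarrow> (nat \<Rightarrow> nat \<Rightarrow> nat) \<Rightarrow> nat \<Rightarrow> nat \<Rightarrow> ('w \<Rightarrow> complex mat) \<Rightarrow> nat \<Rightarrow> complex" where
  "mat_E_coeff P q d n M k =
     (\<integral>\<omega>. mat_trace (proj_mat q d n k * M \<omega> * proj_mat q d n k) \<partial>P) / of_nat (q k n)"

definition vec_euclidean_norm :: "complex Matrix.vec \<Rightarrow> real" where
  "vec_euclidean_norm v = L2_set (\<lambda>i. cmod (vec_index v i)) {..<dim_vec v}"

definition operator_norm :: "complex mat \<Rightarrow> real" where
  "operator_norm M =
     (SUP v\<in>{v \<in> carrier_vec (dim_col M). vec_euclidean_norm v \<le> 1}.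
        vec_euclidean_norm (mult_mat_vec M v))"


section \<open>Convergence in \<open>D\<close>-distribution\<close>

text \<open>The word \<open>M\<^bsub>i\<^sub>0\<^esub>\<^sup>\<epsilon>\<^sup>0 d\<^sub>0 \<dots> M\<^bsub>i\<^sub>m\<^esub>\<^sup>\<epsilon>\<^sup>m d\<^sub>m\<close> is the list of its \<open>m + 1\<close> letters \<open>(i, \<epsilon>, f)\<close>, where \<open>\<epsilon>\<close> says
  whether the adjoint is taken and \<open>f\<close> is the coefficient function of the element of \<open>D\<close>.\<close>

type_synonym 'i letter = "'i \<times> bool \<times> (nat \<Rightarrow> complex)"

definition alg_word ::
    "'u star_prob \<Rightarrow> nat \<Rightarrow> (nat \<Rightarrow> 'u) \<Rightarrow> ('i \<Rightarrow> 'u) \<Rightarrow> 'i letter list \<Rightarrow> 'u" where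
  "alg_word A d p x w =
     foldr (\<lambda>(i, \<epsilon>, f) y. (if \<epsilon> then star A (x i) else x i) \<otimes>\<^bsub>A\<^esub> D_elem A d p f \<otimes>\<^bsub>A\<^esub> y) w \<one>\<^bsub>A\<^esub>"

definition mat_word ::
    "(nat \<Rightarrow> nat \<Rightarrow> nat) \<Rightarrow> nat \<Rightarrow> nat \<Rightarrow> ('i \<Rightarrow> complex mat) \<Rightarrow> 'i letter list \<Rightarrow> complex mat" where
  "mat_word q d n M w =
     foldr (\<lambda>(i, \<epsilon>, f) Z. (if \<epsilon> then mat_adjoint (M i) else M i) * D_mat q d n f * Z) w (one_mat n)"

text \<open>Positive block sizes \<open>q 0 n, \<dots>, q (d - 1) n\<close> of sum \<open>n\<close> exist only for \<open>n \<ge> d\<close>, so sequences of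
  matrices are considered from \<open>n = d\<close> on. As \<open>D\<close> is finite-dimensional with basis the projections,
  convergence in \<open>D\<close> is convergence of the coefficients.\<close>

definition converges_in_D_distribution ::
    "'w measure \<Rightarrow> (nat \<Rightarrow> nat \<Rightarrow> nat) \<Rightarrow> nat \<Rightarrow> ('i \<Rightarrow> nat \<Rightarrow> 'w \<Rightarrow> complex mat) \<Rightarrow>
     'u star_prob \<Rightarrow> (nat \<Rightarrow> 'u) \<Rightarrow> ('i \<Rightarrow> 'u) \<Rightarrow> bool" where
  "converges_in_D_distribution P q d M A p x \<longleftrightarrow>
     (\<forall>n\<ge>d. \<forall>i. M i n \<in> random_mats P n) \<and>
     (\<forall>i. x i \<in> carrier A) \<and>
     (\<forall>w. w \<noteq> [] \<longrightarrow> (\<forall>k<d.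
        (\<lambda>n. mat_E_coeff P q d n (\<lambda>\<omega>. mat_word q d n (\<lambda>i. M i n \<omega>) w) k)
          \<longlonglongrightarrow> E_coeff A p (alg_word A d p x w) k))"

text \<open>Asymptotic freeness of the sets of matrices \<open>{M i n | i \<in> G g}\<close>, indexed by \<open>g\<close>, with
  \<open>(x i)\<close> as joint limit in \<open>A\<close>.\<close>

definition asymptotically_free ::
    "'w measure \<Rightarrow> (nat \<Rightarrow> nat \<Rightarrow> nat) \<Rightarrow> nat \<Rightarrow> ('i \<Rightarrow> nat \<Rightarrow> 'w \<Rightarrow> complex mat) \<Rightarrow> ('g \<Rightarrow> 'i set) \<Rightarrow>
     'u star_prob \<Rightarrow> (nat \<Rightarrow> 'u) \<Rightarrow> ('i \<Rightarrow> 'u) \<Rightarrow> bool" where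
  "asymptotically_free P q d M G A p x \<longleftrightarrow>
     converges_in_D_distribution P q d M A p x \<and>
     free_subsets A d p (\<lambda>g. x ` G g)"

end

theory Submission
  imports Defs
begin

text \<open>Integration by parts for Gaussian variables gives the Schwinger-Dyson equations: the expectation of
  a product of normalized traces, the first one of a word \<open>Y\<^sub>s w\<close>, is the sum over all
  decompositions \<open>w = u Y\<^sub>s v\<close> of the expectation with \<open>tr (Y\<^sub>s w)\<close> replaced by
  \<open>tr u \<cdot> tr v\<close>, up to terms of order \<open>n\<^sup>-\<^sup>2\<close>. Hence expected traces converge, by induction on
  the number of Gaussian letters, to a functional with \<open>\<tau> (Y\<^sub>s w) = \<Sum> \<tau> u \<cdot> \<tau> v\<close>.

  This recursion defines a tracial functional on words in elements of the limit algebra \<open>A'\<close> of the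
  constant matrices and in letters \<open>Y\<^sub>s\<close>. It is positive because it is the vacuum expectation on a
  Fock space, and dividing by its kernel gives the enlargement carrying the limit elements. Moving the leftmost
  \<open>Y\<^sub>s\<close> through an alternating product of centered elements yields freeness over \<open>D\<close>. The
  cumulants are constructed by recursion over the block of the first letter, and comparing their
  recursion with that of \<open>\<tau>\<close> shows that \<open>c\<^sub>2\<close> is the only nonzero cumulant of \<open>Y\<^sub>s\<close>.\<close>

text \<open>Three obstacles shape the construction. Positivity of the limit functional on all of
  \<open>A'\<close> cannot be read off from the matrices, since elements of \<open>A'\<close> need
  not be limits of constant matrices; hence the explicit Fock space. The trace need not be faithful,
  while an enlargement must be injective, so the quotient also remembers a homomorphism back to the
  base algebra. Finally, an enlargement has to live on the given type \<open>'u\<close>, so word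
  polynomials are coded as elements of \<open>'u\<close>. The recursion makes each limit of
  \<open>Y_s\<close> semicircular over the whole base algebra with covariance \<phi>. As this
  covariance is scalar-valued, words in \<open>Y_s\<close> and D have conditional expectations in D,
  and freeness and cumulants descend to D. The error of order \<open>n^-2\<close> comes from the
  covariance 1/n of mirror entries: a pairing inside one trace closes two index loops, a pairing
  between two traces only one. Products of traces are considered because the equation for a single
  trace already produces them.\<close>

section \<open>Sums over the splittings of a word at a semicircular letter\<close>

fun splits :: "'s \<Rightarrow> ('c + 's) list \<Rightarrow> (('c + 's) list \<times> ('c + 's) list) list" where
  "splits s [] = []"
| "splits s (x # w) =
     (if x = Inr s then [([], w)] else []) @ map (\<lambda>(u, v). (x # u, v)) (splits s w)"

text \<open>A sum over positions of the word, kept as a list so that most identities below are a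
  single induction over the word.\<close>

definition split_sum ::
    "'s \<Rightarrow> ('c + 's) list \<Rightarrow> (('c + 's) list \<Rightarrow> ('c + 's) list \<Rightarrow> 'a::comm_monoid_add) \<Rightarrow> 'a" where
  "split_sum s w f = (\<Sum>(u, v)\<leftarrow>splits s w. f u v)"

lemma splits_iff: "(u, v) \<in> set (splits s w) \<longleftrightarrow> w = u @ Inr s # v"
  by (induction w arbitrary: u) (auto simp: Cons_eq_append_conv)

lemma split_sum_Nil [simp]: "split_sum s [] f = 0"
  by (simp add: split_sum_def)

lemma split_sum_Cons [simp]:
  "split_sum s (x # w) f = (if x = Inr s then f [] w else 0) + split_sum s w (\<lambda>u. f (x # u))"
  by (simp add: split_sum_def comp_def case_prod_unfold)

lemma split_sum_cong:
  assumes "\<And>u v. w = u @ Inr s # v \<Longrightarrow> f u v = g u v"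
  shows "split_sum s w f = split_sum s w g"
  unfolding split_sum_def
  by (intro arg_cong[of _ _ sum_list] map_cong) (auto simp: splits_iff assms)

lemma split_sum_append:
  "split_sum s (u @ v) f =
     split_sum s u (\<lambda>x y. f x (y @ v)) + split_sum s v (\<lambda>x. f (u @ x))"
  by (induction u arbitrary: f) (simp_all add: add.assoc)

lemma split_sum_zero [simp]: "split_sum s w (\<lambda>u v. 0) = 0"
  by (induction w) simp_all

lemma split_sum_add:
  "split_sum s w (\<lambda>u v. f u v + g u v) = split_sum s w f + split_sum s w g"
  by (simp add: split_sum_def case_prod_unfold sum_list_addf)

lemma split_sum_mult_left:
  fixes c :: "'a::semiring_0"
  shows "split_sum s w (\<lambda>u v. c * f u v) = c * split_sum s w f"
  by (simp add: split_sum_def case_prod_unfold sum_list_const_mult)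

lemma split_sum_mult_right:
  fixes c :: "'a::semiring_0"
  shows "split_sum s w (\<lambda>u v. f u v * c) = split_sum s w f * c"
  by (simp add: split_sum_def case_prod_unfold sum_list_mult_const)

text \<open>Coassociativity of deconcatenation: both sides run over the splittings of
  \<open>w\<close> as \<open>u\<close>, \<open>t\<close>, \<open>y\<close>, \<open>s\<close>,
  \<open>v\<close>. It reconciles the two orders in which two pairings can be carried out.\<close>

lemma split_sum_split_sum:
  "split_sum t w (\<lambda>u x. split_sum s x (f u)) = split_sum s w (\<lambda>x v. split_sum t x (\<lambda>u y. f u y v))"
  by (induction w arbitrary: f) (simp_all add: split_sum_add)

lemma split_sum_rev: "split_sum s (rev w) f = split_sum s w (\<lambda>u v. f (rev v) (rev u))"
  by (induction w arbitrary: f) (simp_all add: split_sum_append add.commute)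

lemma split_sum_map:
  assumes "\<And>x. g x = Inr s \<longleftrightarrow> x = Inr s"
  shows "split_sum s (map g w) f = split_sum s w (\<lambda>u v. f (map g u) (map g v))"
  by (induction w arbitrary: f) (simp_all add: assms)

lemma split_sum_hom:
  assumes "h 0 = 0" "\<And>x y. h (x + y) = h x + h y"
  shows "h (split_sum s w f) = split_sum s w (\<lambda>u v. h (f u v))"
  by (induction w arbitrary: f) (simp_all add: assms)

lemma sum_split_sum:
  "(\<Sum>i\<in>S. split_sum s w (f i)) = split_sum s w (\<lambda>u v. \<Sum>i\<in>S. f i u v)"
  by (induction w arbitrary: f) (simp_all add: sum.distrib)

section \<open>Gaussian integration by parts\<close>

definition gmon :: "('g \<Rightarrow> 'w \<Rightarrow> real) \<Rightarrow> 'g list \<Rightarrow> 'w \<Rightarrow> complex" where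
  "gmon G \<gamma>s \<omega> = (\<Prod>\<gamma>\<leftarrow>\<gamma>s. complex_of_real (G \<gamma> \<omega>))"

text \<open>The derivation on monomials that sends the variable \<gamma> to
  \<open>v \<gamma>\<close>. With \<open>v\<close> a vector of covariances it gives the right-hand
  side of Gaussian integration by parts.\<close>

primrec dmon :: "('g \<Rightarrow> 'w \<Rightarrow> real) \<Rightarrow> ('g \<Rightarrow> complex) \<Rightarrow> 'g list \<Rightarrow> 'w \<Rightarrow> complex" where
  "dmon G v [] \<omega> = 0"
| "dmon G v (\<gamma> # \<gamma>s) \<omega> = v \<gamma> * gmon G \<gamma>s \<omega> + complex_of_real (G \<gamma> \<omega>) * dmon G v \<gamma>s \<omega>"

text \<open>A relation between random variables instead of an operation on formal polynomials: a
  function of \<omega> need not determine the polynomial it comes from, so a derivative is attached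
  to each way of building the function.\<close>

inductive poly_deriv ::
    "('g \<Rightarrow> 'w \<Rightarrow> real) \<Rightarrow> 'g set \<Rightarrow> ('g \<Rightarrow> complex) \<Rightarrow> ('w \<Rightarrow> complex) \<Rightarrow> ('w \<Rightarrow> complex) \<Rightarrow> bool"
  for G I v where
  const: "poly_deriv G I v (\<lambda>\<omega>. c) (\<lambda>\<omega>. 0)"
| mult: "\<gamma> \<in> I \<Longrightarrow> poly_deriv G I v F F' \<Longrightarrow>
    poly_deriv G I v (\<lambda>\<omega>. complex_of_real (G \<gamma> \<omega>) * F \<omega>)
      (\<lambda>\<omega>. v \<gamma> * F \<omega> + complex_of_real (G \<gamma> \<omega>) * F' \<omega>)"
| add: "poly_deriv G I v F F' \<Longrightarrow> poly_deriv G I v H H' \<Longrightarrow>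
    poly_deriv G I v (\<lambda>\<omega>. F \<omega> + H \<omega>) (\<lambda>\<omega>. F' \<omega> + H' \<omega>)"

lemma gmon_Nil [simp]: "gmon G [] \<omega> = 1"
  and gmon_Cons [simp]: "gmon G (\<gamma> # \<gamma>s) \<omega> = complex_of_real (G \<gamma> \<omega>) * gmon G \<gamma>s \<omega>"
  by (simp_all add: gmon_def)

lemma poly_deriv_smult:
  "poly_deriv G I v F F' \<Longrightarrow> poly_deriv G I v (\<lambda>\<omega>. c * F \<omega>) (\<lambda>\<omega>. c * F' \<omega>)"
proof (induction rule: poly_deriv.induct)
  case (const c')
  show ?case using poly_deriv.const[of G I v "c * c'"] by simp
next
  case (mult \<gamma> F F')
  show ?case using poly_deriv.mult[OF mult.hyps(1) mult.IH] by (simp add: algebra_simps)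
next
  case (add F F' H H')
  show ?case using poly_deriv.add[OF add.IH] by (simp add: algebra_simps)
qed

lemma poly_deriv_times:
  "poly_deriv G I v F F' \<Longrightarrow> poly_deriv G I v H H' \<Longrightarrow>
     poly_deriv G I v (\<lambda>\<omega>. F \<omega> * H \<omega>) (\<lambda>\<omega>. F' \<omega> * H \<omega> + F \<omega> * H' \<omega>)"
proof (induction rule: poly_deriv.induct)
  case (const c)
  then show ?case using poly_deriv_smult[of G I v H H' c] by simp
next
  case (mult \<gamma> F F')
  show ?case using poly_deriv.mult[OF mult.hyps(1) mult.IH[OF mult.prems]]
    by (simp add: algebra_simps)
next
  case (add F F' K K')
  show ?case using poly_deriv.add[OF add.IH(1)[OF add.prems] add.IH(2)[OF add.prems]]
    by (simp add: algebra_simps)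
qed

lemma poly_deriv_sum:
  assumes "finite S" "\<And>i. i \<in> S \<Longrightarrow> poly_deriv G I v (F i) (F' i)"
  shows "poly_deriv G I v (\<lambda>\<omega>. \<Sum>i\<in>S. F i \<omega>) (\<lambda>\<omega>. \<Sum>i\<in>S. F' i \<omega>)"
  using assms
proof (induction S)
  case empty
  then show ?case using poly_deriv.const[of G I v 0] by simp
next
  case (insert x S)
  then show ?case using poly_deriv.add[of G I v "F x" "F' x"] by simp
qed

lemma dmon_add: "dmon G (\<lambda>\<gamma>. u \<gamma> + v \<gamma>) \<gamma>s \<omega> = dmon G u \<gamma>s \<omega> + dmon G v \<gamma>s \<omega>"
  by (induction \<gamma>s) (simp_all add: algebra_simps)

lemma dmon_smult: "dmon G (\<lambda>\<gamma>. c * v \<gamma>) \<gamma>s \<omega> = c * dmon G v \<gamma>s \<omega>"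
  by (induction \<gamma>s) (simp_all add: algebra_simps)

lemma gmon_filter:
  "gmon G \<gamma>s \<omega> = complex_of_real (G \<gamma> \<omega>) ^ count_list \<gamma>s \<gamma> * gmon G (filter (\<lambda>\<beta>. \<beta> \<noteq> \<gamma>) \<gamma>s) \<omega>"
  by (induction \<gamma>s) auto

lemma dmon_single:
  "dmon G (\<lambda>\<beta>. if \<beta> = \<gamma> then c else 0) \<gamma>s \<omega> =
     c * of_nat (count_list \<gamma>s \<gamma>) * complex_of_real (G \<gamma> \<omega>) ^ (count_list \<gamma>s \<gamma> - 1) *
       gmon G (filter (\<lambda>\<beta>. \<beta> \<noteq> \<gamma>) \<gamma>s) \<omega>"
proof (induction \<gamma>s)
  case (Cons \<beta> \<gamma>s)
  show ?case
  proof (cases "\<beta> = \<gamma>")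
    case True
    then show ?thesis using Cons gmon_filter[of G \<gamma>s \<omega> \<gamma>]
      by (cases "count_list \<gamma>s \<gamma>") (simp_all add: algebra_simps)
  next
    case False
    then show ?thesis using Cons by simp
  qed
qed simp

lemma gmon_eq_prod:
  assumes "finite S" "set \<gamma>s \<subseteq> S"
  shows "gmon G \<gamma>s \<omega> = (\<Prod>\<gamma>\<in>S. complex_of_real (G \<gamma> \<omega>) ^ count_list \<gamma>s \<gamma>)"
  using assms
proof (induction \<gamma>s)
  case (Cons \<beta> \<gamma>s)
  have "(\<Prod>\<gamma>\<in>S. complex_of_real (G \<gamma> \<omega>) ^ count_list (\<beta> # \<gamma>s) \<gamma>) =
      (\<Prod>\<gamma>\<in>S. (if \<gamma> = \<beta> then complex_of_real (G \<gamma> \<omega>) else 1) * complex_of_real (G \<gamma> \<omega>) ^ count_list \<gamma>s \<gamma>)"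
    by (intro prod.cong) auto
  also have "\<dots> = complex_of_real (G \<beta> \<omega>) * (\<Prod>\<gamma>\<in>S. complex_of_real (G \<gamma> \<omega>) ^ count_list \<gamma>s \<gamma>)"
    using Cons.prems by (simp add: prod.distrib prod.delta)
  finally show ?case using Cons by simp
qed simp

locale gaussian_family = prob_space P
  for P :: "'w measure" and G :: "'g \<Rightarrow> 'w \<Rightarrow> real" and I :: "'g set" and var :: "'g \<Rightarrow> real" +
  assumes indep: "indep_vars (\<lambda>_. borel) G I"
    and var_pos: "\<gamma> \<in> I \<Longrightarrow> 0 < var \<gamma>"
    and gauss: "\<gamma> \<in> I \<Longrightarrow> distributed P lborel (G \<gamma>) (normal_density 0 (sqrt (var \<gamma>)))"
begin

lemma G_measurable: "\<gamma> \<in> I \<Longrightarrow> G \<gamma> \<in> borel_measurable P"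
  using indep by (auto simp: indep_vars_def)

lemma integrable_G_power:
  assumes "\<gamma> \<in> I"
  shows "integrable P (\<lambda>\<omega>. G \<gamma> \<omega> ^ k)"
proof -
  have "integrable lborel (\<lambda>x. normal_density 0 (sqrt (var \<gamma>)) x * x ^ k)"
    using integrable_normal_moment[of "sqrt (var \<gamma>)" 0 k] var_pos[OF assms] by simp
  then show ?thesis
    by (subst (asm) distributed_integrable[OF gauss[OF assms]]) auto
qed

lemma expectation_G_power:
  assumes "\<gamma> \<in> I"
  shows "expectation (\<lambda>\<omega>. G \<gamma> \<omega> ^ k) = (\<integral>x. normal_density 0 (sqrt (var \<gamma>)) x * x ^ k \<partial>lborel)"
  by (subst distributed_integral[OF gauss[OF assms]]) auto

text \<open>Stein's identity for powers, read off from the closed formulas for even and odd moments.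
  For \<open>k = 0\<close> the truncated \<open>k - 1\<close> is harmless because of the factor
  \<open>real k\<close>.\<close>

lemma expectation_G_power_Suc:
  assumes "\<gamma> \<in> I"
  shows "expectation (\<lambda>\<omega>. G \<gamma> \<omega> ^ Suc k) = var \<gamma> * real k * expectation (\<lambda>\<omega>. G \<gamma> \<omega> ^ (k - 1))"
proof -
  have v: "0 < var \<gamma>" using var_pos[OF assms] .
  then have s: "0 < sqrt (var \<gamma>)" by simp
  have odd: "expectation (\<lambda>\<omega>. G \<gamma> \<omega> ^ (2 * j + 1)) = 0" for j
    unfolding expectation_G_power[OF assms] using integral_normal_moment_odd[OF s, of 0 j] by simp
  have even: "expectation (\<lambda>\<omega>. G \<gamma> \<omega> ^ (2 * j)) = fact (2 * j) / ((2 / var \<gamma>) ^ j * fact j)" for j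
    using integral_normal_moment_even[OF s, of 0 j] expectation_G_power[OF assms] v by simp
  show ?thesis
  proof (cases "even k")
    case True
    then obtain j where k: "k = 2 * j" by (elim evenE)
    show ?thesis
    proof (cases j)
      case 0
      then show ?thesis using odd[of 0] k by simp
    next
      case (Suc i)
      then have "Suc k = 2 * j + 1" "k - 1 = 2 * i + 1" using k by auto
      then show ?thesis using odd[of j] odd[of i] by (metis mult_zero_right)
    qed
  next
    case False
    then obtain j where k: "k = 2 * j + 1" by (elim oddE)
    have "expectation (\<lambda>\<omega>. G \<gamma> \<omega> ^ Suc k) = fact (2 * Suc j) / ((2 / var \<gamma>) ^ Suc j * fact (Suc j))"
      using even[of "Suc j"] k by simp
    also have "\<dots> = var \<gamma> * real k * (fact (2 * j) / ((2 / var \<gamma>) ^ j * fact j))"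
    proof -
      have 1: "fact (2 * Suc j) = (2 * (real j + 1)) * (2 * real j + 1) * fact (2 * j)"
        by (simp add: algebra_simps)
      have 2: "(fact (Suc j) :: real) = (real j + 1) * fact j" by simp
      \<comment> \<open>The comparison of the closed formulas, with factorials and powers replaced
        by positive reals so that clearing denominators is elementary.\<close>
      have gen: "(2 * (r + 1)) * (2 * r + 1) * c / ((2 / y * e) * ((r + 1) * b)) = y * (2 * r + 1) * (c / (e * b))"
        if "0 < y" "0 \<le> r" "0 < e" "0 < b" for r c y e b :: real
        using that by (simp add: divide_simps)
      show ?thesis
        unfolding 1 2 power_Suc k using gen[of "var \<gamma>" "real j" "(2 / var \<gamma>) ^ j" "fact j"] v by simp
    qed
    also have "\<dots> = var \<gamma> * real k * expectation (\<lambda>\<omega>. G \<gamma> \<omega> ^ (k - 1))"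
      using even[of j] k by simp
    finally show ?thesis .
  qed
qed

lemma
  assumes S: "finite S" "S \<subseteq> I"
  shows integrable_power_prod: "integrable P (\<lambda>\<omega>. \<Prod>\<gamma>\<in>S. complex_of_real (G \<gamma> \<omega>) ^ m \<gamma>)"
    and expectation_power_prod: "(\<integral>\<omega>. (\<Prod>\<gamma>\<in>S. complex_of_real (G \<gamma> \<omega>) ^ m \<gamma>) \<partial>P) =
      (\<Prod>\<gamma>\<in>S. complex_of_real (expectation (\<lambda>\<omega>. G \<gamma> \<omega> ^ m \<gamma>)))"
proof -
  have ind: "indep_vars (\<lambda>_. borel) (\<lambda>\<gamma> \<omega>. complex_of_real (G \<gamma> \<omega>) ^ m \<gamma>) S"
    by (rule indep_vars_compose2[OF indep_vars_subset[OF indep S(2)]]) auto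
  have int: "integrable P (\<lambda>\<omega>. complex_of_real (G \<gamma> \<omega>) ^ m \<gamma>)" if "\<gamma> \<in> S" for \<gamma>
    using integrable_of_real[where 'a=complex, OF integrable_G_power[of \<gamma> "m \<gamma>"]] that S(2) by auto
  have exp: "(\<integral>\<omega>. complex_of_real (G \<gamma> \<omega>) ^ m \<gamma> \<partial>P) = complex_of_real (expectation (\<lambda>\<omega>. G \<gamma> \<omega> ^ m \<gamma>))" for \<gamma>
    by (simp add: of_real_power[symmetric] del: of_real_power)
  show "integrable P (\<lambda>\<omega>. \<Prod>\<gamma>\<in>S. complex_of_real (G \<gamma> \<omega>) ^ m \<gamma>)"
    by (rule indep_vars_integrable[OF S(1) ind int])
  show "(\<integral>\<omega>. (\<Prod>\<gamma>\<in>S. complex_of_real (G \<gamma> \<omega>) ^ m \<gamma>) \<partial>P) =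
      (\<Prod>\<gamma>\<in>S. complex_of_real (expectation (\<lambda>\<omega>. G \<gamma> \<omega> ^ m \<gamma>)))"
    by (subst indep_vars_lebesgue_integral[OF S(1) ind int]) (simp_all add: exp)
qed

lemma integrable_gmon: "set \<gamma>s \<subseteq> I \<Longrightarrow> integrable P (gmon G \<gamma>s)"
  using integrable_power_prod[of "set \<gamma>s" "count_list \<gamma>s"]
  by (simp flip: gmon_eq_prod[OF finite_set order_refl])

text \<open>The product rule leaves a differentiated monomial multiplied by the variables already
  passed; the prefix \<open>\<beta>s\<close> collects them so that the induction closes.\<close>

lemma integrable_dmon: "set \<gamma>s \<subseteq> I \<Longrightarrow> set \<beta>s \<subseteq> I \<Longrightarrow> integrable P (\<lambda>\<omega>. gmon G \<beta>s \<omega> * dmon G v \<gamma>s \<omega>)"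
proof (induction \<gamma>s arbitrary: \<beta>s)
  case (Cons \<gamma> \<gamma>s)
  have app: "gmon G (\<beta>s @ \<gamma>s) \<omega> = gmon G \<beta>s \<omega> * gmon G \<gamma>s \<omega>" for \<omega> by (simp add: gmon_def)
  have "integrable P (\<lambda>\<omega>. v \<gamma> * gmon G (\<beta>s @ \<gamma>s) \<omega>)"
    using Cons.prems by (intro integrable_mult_right integrable_gmon) auto
  moreover have "integrable P (\<lambda>\<omega>. gmon G (\<gamma> # \<beta>s) \<omega> * dmon G v \<gamma>s \<omega>)"
    using Cons.prems by (intro Cons.IH) auto
  ultimately show ?case
    by (subst Bochner_Integration.integrable_cong[OF refl, of P _ "\<lambda>\<omega>. v \<gamma> * gmon G (\<beta>s @ \<gamma>s) \<omega> + gmon G (\<gamma> # \<beta>s) \<omega> * dmon G v \<gamma>s \<omega>"])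
      (auto simp: app algebra_simps)
qed simp

lemma expectation_G_gmon:
  assumes "\<gamma> \<in> I" "set \<gamma>s \<subseteq> I"
  shows "(\<integral>\<omega>. complex_of_real (G \<gamma> \<omega>) * gmon G \<gamma>s \<omega> \<partial>P) =
    (\<integral>\<omega>. dmon G (\<lambda>\<beta>. if \<beta> = \<gamma> then complex_of_real (var \<gamma>) else 0) \<gamma>s \<omega> \<partial>P)"
proof -
  define k where "k = count_list \<gamma>s \<gamma>"
  define supp where "supp = set \<gamma>s - {\<gamma>}"
  define ds where "ds = filter (\<lambda>\<beta>. \<beta> \<noteq> \<gamma>) \<gamma>s"
  have supp: "finite supp" "supp \<subseteq> I" "\<gamma> \<notin> supp" "set ds = supp" using assms by (auto simp: supp_def ds_def)
  define cX where "cX = (\<Prod>\<beta>\<in>supp. complex_of_real (expectation (\<lambda>\<omega>. G \<beta> \<omega> ^ count_list ds \<beta>)))"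
  \<comment> \<open>By independence the other variables contribute the same constant
    \<open>cX\<close> for every power \<open>j\<close> of \<open>G \<gamma>\<close>. The claim thus
    reduces to the moment recursion between the powers \<open>k + 1\<close> and
    \<open>k - 1\<close>.\<close>
  have Ej: "(\<integral>\<omega>. complex_of_real (G \<gamma> \<omega>) ^ j * gmon G ds \<omega> \<partial>P) =
      complex_of_real (expectation (\<lambda>\<omega>. G \<gamma> \<omega> ^ j)) * cX" for j
  proof -
    define m where "m = (count_list ds)(\<gamma> := j)"
    have "complex_of_real (G \<gamma> \<omega>) ^ j * gmon G ds \<omega> = (\<Prod>\<beta>\<in>insert \<gamma> supp. complex_of_real (G \<beta> \<omega>) ^ m \<beta>)" for \<omega>
    proof -
      have "(\<Prod>\<beta>\<in>supp. complex_of_real (G \<beta> \<omega>) ^ m \<beta>) = gmon G ds \<omega>"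
        unfolding gmon_eq_prod[OF supp(1) eq_refl[OF supp(4)], of G \<omega>]
        using supp(3) by (intro prod.cong) (auto simp: m_def)
      then show ?thesis using supp by (simp add: m_def)
    qed
    then have "(\<integral>\<omega>. complex_of_real (G \<gamma> \<omega>) ^ j * gmon G ds \<omega> \<partial>P) =
        (\<Prod>\<beta>\<in>insert \<gamma> supp. complex_of_real (expectation (\<lambda>\<omega>. G \<beta> \<omega> ^ m \<beta>)))"
      using supp assms expectation_power_prod[of "insert \<gamma> supp" m] by simp
    also have "\<dots> = complex_of_real (expectation (\<lambda>\<omega>. G \<gamma> \<omega> ^ j)) * cX"
      using supp by (auto simp: m_def cX_def intro!: prod.cong)
    finally show ?thesis .
  qed
  have "(\<integral>\<omega>. complex_of_real (G \<gamma> \<omega>) * gmon G \<gamma>s \<omega> \<partial>P) =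
      (\<integral>\<omega>. complex_of_real (G \<gamma> \<omega>) ^ Suc k * gmon G ds \<omega> \<partial>P)"
    by (intro Bochner_Integration.integral_cong refl)
       (subst gmon_filter[of G \<gamma>s _ \<gamma>], simp add: k_def ds_def)
  also have "\<dots> = complex_of_real (var \<gamma>) * of_nat k * (\<integral>\<omega>. complex_of_real (G \<gamma> \<omega>) ^ (k - 1) * gmon G ds \<omega> \<partial>P)"
    unfolding Ej using expectation_G_power_Suc[OF assms(1), of k] by simp
  also have "\<dots> = (\<integral>\<omega>. complex_of_real (var \<gamma>) * of_nat k * (complex_of_real (G \<gamma> \<omega>) ^ (k - 1) * gmon G ds \<omega>) \<partial>P)"
    by (rule integral_mult_right_zero[symmetric])
  also have "\<dots> = (\<integral>\<omega>. dmon G (\<lambda>\<beta>. if \<beta> = \<gamma> then complex_of_real (var \<gamma>) else 0) \<gamma>s \<omega> \<partial>P)"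
    by (intro Bochner_Integration.integral_cong refl) (simp add: dmon_single k_def ds_def mult.assoc)
  finally show ?thesis .
qed

text \<open>\<open>Z\<close> is a linear combination of the \<open>G \<gamma>\<close> and \<open>v \<gamma>\<close> its covariance with \<open>G \<gamma>\<close>.\<close>

definition covariance_vector :: "('w \<Rightarrow> complex) \<Rightarrow> ('g \<Rightarrow> complex) \<Rightarrow> bool" where
  "covariance_vector Z v \<longleftrightarrow> (\<forall>\<gamma>s. set \<gamma>s \<subseteq> I \<longrightarrow> integrable P (\<lambda>\<omega>. Z \<omega> * gmon G \<gamma>s \<omega>) \<and>
     (\<integral>\<omega>. Z \<omega> * gmon G \<gamma>s \<omega> \<partial>P) = (\<integral>\<omega>. dmon G v \<gamma>s \<omega> \<partial>P))"

lemma covariance_vector_G: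
  assumes "\<gamma> \<in> I"
  shows "covariance_vector (\<lambda>\<omega>. complex_of_real (G \<gamma> \<omega>)) (\<lambda>\<beta>. if \<beta> = \<gamma> then complex_of_real (var \<gamma>) else 0)"
  unfolding covariance_vector_def
proof (intro allI impI conjI)
  fix \<gamma>s assume "set \<gamma>s \<subseteq> I"
  then show "integrable P (\<lambda>\<omega>. complex_of_real (G \<gamma> \<omega>) * gmon G \<gamma>s \<omega>)"
    using integrable_gmon[of "\<gamma> # \<gamma>s"] assms by (simp add: gmon_Cons[abs_def])
qed (rule expectation_G_gmon[OF assms])

lemma covariance_vector_smult:
  assumes "covariance_vector Z v"
  shows "covariance_vector (\<lambda>\<omega>. c * Z \<omega>) (\<lambda>\<gamma>. c * v \<gamma>)"
  using assms by (simp add: covariance_vector_def dmon_smult mult.assoc)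

lemma covariance_vector_add:
  assumes "covariance_vector Z v" "covariance_vector Z' v'"
  shows "covariance_vector (\<lambda>\<omega>. Z \<omega> + Z' \<omega>) (\<lambda>\<gamma>. v \<gamma> + v' \<gamma>)"
  unfolding covariance_vector_def
proof (intro allI impI conjI)
  fix \<gamma>s assume s: "set \<gamma>s \<subseteq> I"
  note 1 = assms[unfolded covariance_vector_def, rule_format, OF s]
  have i: "integrable P (dmon G u \<gamma>s)" for u
    using integrable_dmon[OF s, of "[]" u] by simp
  show "integrable P (\<lambda>\<omega>. (Z \<omega> + Z' \<omega>) * gmon G \<gamma>s \<omega>)"
    using 1 by (simp add: distrib_right)
  show "(\<integral>\<omega>. (Z \<omega> + Z' \<omega>) * gmon G \<gamma>s \<omega> \<partial>P) = (\<integral>\<omega>. dmon G (\<lambda>\<gamma>. v \<gamma> + v' \<gamma>) \<gamma>s \<omega> \<partial>P)"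
    using 1 i by (simp add: distrib_right dmon_add)
qed

text \<open>The extra monomial in front makes the induction work: multiplying \<open>F\<close> by a
  variable moves that variable into the monomial, and the constant case is the definition of
  \<open>covariance_vector\<close>. Integrability travels along because splitting the integrals
  needs it.\<close>

lemma covariance_vector_poly_deriv_aux:
  assumes "poly_deriv G I v F F'" "covariance_vector Z v" "set \<gamma>s \<subseteq> I"
  shows "integrable P (\<lambda>\<omega>. gmon G \<gamma>s \<omega> * F \<omega>) \<and> integrable P (\<lambda>\<omega>. gmon G \<gamma>s \<omega> * F' \<omega>) \<and>
    integrable P (\<lambda>\<omega>. dmon G v \<gamma>s \<omega> * F \<omega>) \<and> integrable P (\<lambda>\<omega>. Z \<omega> * gmon G \<gamma>s \<omega> * F \<omega>) \<and>
    (\<integral>\<omega>. Z \<omega> * gmon G \<gamma>s \<omega> * F \<omega> \<partial>P) = (\<integral>\<omega>. dmon G v \<gamma>s \<omega> * F \<omega> + gmon G \<gamma>s \<omega> * F' \<omega> \<partial>P)"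
  using assms(1,3)
proof (induction arbitrary: \<gamma>s rule: poly_deriv.induct)
  case (const c)
  have "integrable P (dmon G v \<gamma>s)"
    using integrable_dmon[OF const, of "[]" v] by simp
  then show ?case
    using assms(2)[unfolded covariance_vector_def, rule_format, OF const] integrable_gmon[OF const]
    by auto
next
  case (mult \<gamma> F F')
  note IH = mult.IH[of "\<gamma> # \<gamma>s"]
  have "integrable P (\<lambda>\<omega>. (gmon G (\<gamma> # \<gamma>s) \<omega> * F' \<omega>) + v \<gamma> * (gmon G \<gamma>s \<omega> * F \<omega>))"
    using IH mult.IH[of \<gamma>s] mult.prems mult.hyps(1)
    by (intro Bochner_Integration.integrable_add integrable_mult_right) auto
  moreover have "integrable P (\<lambda>\<omega>. dmon G v (\<gamma> # \<gamma>s) \<omega> * F \<omega> - v \<gamma> * (gmon G \<gamma>s \<omega> * F \<omega>))"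
    using IH mult.IH[of \<gamma>s] mult.prems mult.hyps(1)
    by (intro Bochner_Integration.integrable_diff integrable_mult_right) auto
  ultimately show ?case
    using IH mult.prems mult.hyps(1) by (simp add: algebra_simps)
next
  case (add F F' H H')
  note IH = add.IH(1)[OF add.prems] add.IH(2)[OF add.prems]
  then show ?case by (simp add: distrib_left)
qed

lemma
  assumes "poly_deriv G I v F F'" "covariance_vector Z v"
  shows integrable_covariance_mult: "integrable P (\<lambda>\<omega>. Z \<omega> * F \<omega>)"
    and integrable_poly_deriv: "integrable P F'"
    and integration_by_parts: "(\<integral>\<omega>. Z \<omega> * F \<omega> \<partial>P) = (\<integral>\<omega>. F' \<omega> \<partial>P)"
  using covariance_vector_poly_deriv_aux[OF assms, of "[]"] by simp_all

text \<open>With \<open>Z = 0\<close> and zero covariances, the machinery for integration by parts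
  yields the plain integrability of polynomials in the Gaussian variables.\<close>

lemma covariance_vector_zero: "covariance_vector (\<lambda>_. 0) (\<lambda>_. 0)"
proof -
  have "dmon G (\<lambda>_. 0) \<gamma>s \<omega> = 0" for \<gamma>s \<omega> by (induction \<gamma>s) simp_all
  then show ?thesis by (simp add: covariance_vector_def)
qed

lemma integrable_poly:
  assumes "poly_deriv G I (\<lambda>_. 0) F F'"
  shows "integrable P F"
  using covariance_vector_poly_deriv_aux[OF assms covariance_vector_zero, of "[]"] by simp

end

section \<open>Schwinger-Dyson equations\<close>

subsection \<open>Traces of words in matrices\<close>

text \<open>Matrices are plain functions of two indices here, so that every entry can be treated as
  a random variable of its own and differentiated.\<close>

fun ent :: "nat \<Rightarrow> ('l \<Rightarrow> nat \<Rightarrow> nat \<Rightarrow> complex) \<Rightarrow> 'l list \<Rightarrow> nat \<Rightarrow> nat \<Rightarrow> complex" where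
  "ent n M [] i j = (if i = j then 1 else 0)"
| "ent n M (x # w) i j = (\<Sum>k<n. M x i k * ent n M w k j)"

definition wtr :: "nat \<Rightarrow> ('l \<Rightarrow> nat \<Rightarrow> nat \<Rightarrow> complex) \<Rightarrow> 'l list \<Rightarrow> complex" where
  "wtr n M w = (\<Sum>i<n. ent n M w i i) / of_nat n"

lemma ent_append:
  assumes "i < n"
  shows "ent n M (u @ v) i j = (\<Sum>k<n. ent n M u i k * ent n M v k j)"
  using assms
proof (induction u arbitrary: i)
  case Nil
  have "(\<Sum>k<n. ent n M [] i k * ent n M v k j) = (\<Sum>k<n. if k = i then ent n M v k j else 0)"
    by (intro sum.cong) auto
  then show ?case using Nil by simp
next
  case (Cons x u)
  have "ent n M ((x # u) @ v) i j = (\<Sum>l<n. M x i l * (\<Sum>k<n. ent n M u l k * ent n M v k j))"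
    using Cons.IH by simp
  also have "\<dots> = (\<Sum>k<n. \<Sum>l<n. M x i l * ent n M u l k * ent n M v k j)"
    by (subst sum.swap) (simp add: sum_distrib_left mult.assoc)
  finally show ?case by (simp add: sum_distrib_right)
qed

lemma wtr_append_commute: "wtr n M (u @ v) = wtr n M (v @ u)"
proof -
  have "(\<Sum>i<n. ent n M (u @ v) i i) = (\<Sum>i<n. \<Sum>k<n. ent n M u i k * ent n M v k i)"
    by (simp add: ent_append)
  also have "\<dots> = (\<Sum>k<n. \<Sum>i<n. ent n M v k i * ent n M u i k)"
    by (subst sum.swap) (simp add: mult.commute)
  also have "\<dots> = (\<Sum>i<n. ent n M (v @ u) i i)"
    by (simp add: ent_append)
  finally show ?thesis by (simp add: wtr_def)
qed

lemma wtr_Cons: "wtr n M (x # w) = (\<Sum>i<n. \<Sum>j<n. M x i j * ent n M w j i) / of_nat n"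
  by (simp add: wtr_def)

fun remove_each :: "'a list \<Rightarrow> ('a \<times> 'a list) list" where
  "remove_each [] = []"
| "remove_each (x # xs) = (x, xs) # map (\<lambda>(y, ys). (y, x # ys)) (remove_each xs)"

lemma remove_each_eq: "(y, ys) \<in> set (remove_each xs) \<Longrightarrow> \<exists>us vs. xs = us @ y # vs \<and> ys = us @ vs"
proof (induction xs arbitrary: ys)
  case (Cons x xs)
  show ?case
  proof (cases "y = x \<and> ys = xs")
    case True
    then show ?thesis by (intro exI[of _ "[]"] exI[of _ xs]) simp
  next
    case False
    then obtain zs where "(y, zs) \<in> set (remove_each xs)" "ys = x # zs"
      using Cons.prems by auto
    with Cons.IH obtain us vs where "xs = us @ y # vs" "zs = us @ vs" by blast
    with \<open>ys = x # zs\<close> show ?thesis by (intro exI[of _ "x # us"] exI[of _ vs]) simp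
  qed
qed simp

definition trprod :: "nat \<Rightarrow> ('l \<Rightarrow> nat \<Rightarrow> nat \<Rightarrow> complex) \<Rightarrow> 'l list list \<Rightarrow> complex" where
  "trprod n M ws = (\<Prod>w\<leftarrow>ws. wtr n M w)"

lemma trprod_simps [simp]:
  "trprod n M [] = 1" "trprod n M (w # ws) = wtr n M w * trprod n M ws"
  "trprod n M (us @ vs) = trprod n M us * trprod n M vs"
  by (simp_all add: trprod_def)

text \<open>Partial derivatives with respect to the entry \<open>(i, j)\<close> of the \<open>s\<close>-th Hermitian Gaussian matrix; since
  \<open>a\<^sub>i\<^sub>j\<close> is correlated with \<open>a\<^sub>j\<^sub>i\<close> only, this replaces an occurrence of the matrix by \<open>e\<^sub>j\<^sub>i / n\<close>.\<close>

definition dent ::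
    "nat \<Rightarrow> ('c + nat \<Rightarrow> nat \<Rightarrow> nat \<Rightarrow> complex) \<Rightarrow> nat \<Rightarrow> nat \<Rightarrow> nat \<Rightarrow> ('c + nat) list \<Rightarrow> nat \<Rightarrow> nat \<Rightarrow> complex" where
  "dent n M s i j w k l = split_sum s w (\<lambda>u v. ent n M u k j * ent n M v i l) / of_nat n"

definition dtrprod ::
    "nat \<Rightarrow> ('c + nat \<Rightarrow> nat \<Rightarrow> nat \<Rightarrow> complex) \<Rightarrow> nat \<Rightarrow> nat \<Rightarrow> nat \<Rightarrow> ('c + nat) list list \<Rightarrow> complex" where
  "dtrprod n M s i j ws =
     (\<Sum>(w, us)\<leftarrow>remove_each ws. split_sum s w (\<lambda>u v. ent n M (v @ u) i j) / of_nat n ^ 2 * trprod n M us)"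

lemma dent_Cons:
  assumes "k < n" "i < n"
  shows "dent n M s i j (x # w) k l =
    (if x = Inr s then if k = j then ent n M w i l / of_nat n else 0 else 0) + (\<Sum>m<n. M x k m * dent n M s i j w m l)"
proof -
  have "split_sum s w (\<lambda>u v. ent n M (x # u) k j * ent n M v i l) =
      (\<Sum>m<n. M x k m * split_sum s w (\<lambda>u v. ent n M u m j * ent n M v i l))"
    by (simp add: split_sum_mult_left[symmetric] sum_split_sum sum_distrib_right mult.assoc)
  then show ?thesis
    by (simp add: dent_def add_divide_distrib sum_divide_distrib)
qed

lemma dtrprod_Cons:
  "dtrprod n M s i j (w # ws) =
     split_sum s w (\<lambda>u v. ent n M (v @ u) i j) / of_nat n ^ 2 * trprod n M ws + wtr n M w * dtrprod n M s i j ws"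
  by (simp add: dtrprod_def comp_def case_prod_unfold sum_list_const_mult[symmetric] mult_ac)

text \<open>Differentiating one occurrence opens the closed index loop of the trace; the remaining
  pieces \<open>u\<close> and \<open>v\<close> rejoin in the cyclic order
  \<open>v @ u\<close>.\<close>

lemma dent_trace:
  assumes "i < n"
  shows "(\<Sum>k<n. dent n M s i j w k k) / of_nat n = split_sum s w (\<lambda>u v. ent n M (v @ u) i j) / of_nat n ^ 2"
proof -
  have "(\<Sum>k<n. split_sum s w (\<lambda>u v. ent n M u k j * ent n M v i k)) = split_sum s w (\<lambda>u v. ent n M (v @ u) i j)"
    by (simp add: sum_split_sum ent_append[OF assms] mult.commute)
  then show ?thesis
    by (simp add: dent_def sum_divide_distrib[symmetric] power2_eq_square)
qed

text \<open>Through the real Gaussian coordinates the last two assumptions express that the entries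
  are centered and that E(a(i,j) a(k,l)) is 1/n if k = j and l = i and 0 otherwise, different
  matrices being uncorrelated. The letters \<open>Inl\<close> are constant matrices.\<close>

locale gaussian_matrices = gaussian_family P G I var
  for P :: "'w measure" and G :: "'g \<Rightarrow> 'w \<Rightarrow> real" and I :: "'g set" and var :: "'g \<Rightarrow> real" +
  fixes n :: nat
    and M :: "'c + nat \<Rightarrow> nat \<Rightarrow> nat \<Rightarrow> 'w \<Rightarrow> complex"
    and cov :: "nat \<Rightarrow> nat \<Rightarrow> nat \<Rightarrow> 'g \<Rightarrow> complex"
  assumes n_pos: "0 < n"
    and deterministic: "M (Inl c) i j \<omega> = M (Inl c) i j \<omega>'"
    and covariance: "i < n \<Longrightarrow> j < n \<Longrightarrow> covariance_vector (M (Inr s) i j) (cov s i j)"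
    and entry_deriv: "i < n \<Longrightarrow> j < n \<Longrightarrow> k < n \<Longrightarrow> l < n \<Longrightarrow>
      poly_deriv G I (cov s i j) (M (Inr t) k l)
        (\<lambda>\<omega>. if s = t \<and> k = j \<and> i = l then 1 / of_nat n else 0)"
begin

abbreviation "entries \<omega> \<equiv> \<lambda>x i j. M x i j \<omega>"

lemma poly_deriv_ent:
  assumes ij: "i < n" "j < n" and "k < n" "l < n"
  shows "poly_deriv G I (cov s i j) (\<lambda>\<omega>. ent n (entries \<omega>) w k l) (\<lambda>\<omega>. dent n (entries \<omega>) s i j w k l)"
  using assms(3,4)
proof (induction w arbitrary: k)
  case Nil
  then show ?case using poly_deriv.const[of G I "cov s i j" "if k = l then 1 else 0"] by (simp add: dent_def)
next
  case (Cons x w)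
  have x: "poly_deriv G I (cov s i j) (M x k m) (\<lambda>\<omega>. if x = Inr s \<and> k = j \<and> i = m then 1 / of_nat n else 0)"
    if "m < n" for m
  proof (cases x)
    case (Inl c)
    have "M x k m = (\<lambda>\<omega>. M x k m undefined)"
      using deterministic Inl by auto
    then show ?thesis using poly_deriv.const[of G I "cov s i j" "M x k m undefined"] Inl by simp
  next
    case (Inr t)
    have "(s = t \<and> k = j \<and> i = m) = (x = Inr s \<and> k = j \<and> i = m)" using Inr by auto
    then show ?thesis using entry_deriv[OF ij Cons.prems(1) that, of s t] Inr by simp
  qed
  have "poly_deriv G I (cov s i j)
      (\<lambda>\<omega>. \<Sum>m<n. M x k m \<omega> * ent n (entries \<omega>) w m l)
      (\<lambda>\<omega>. \<Sum>m<n. (if x = Inr s \<and> k = j \<and> i = m then 1 / of_nat n else 0) * ent n (entries \<omega>) w m l +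
        M x k m \<omega> * dent n (entries \<omega>) s i j w m l)"
    using Cons.prems(2) by (intro poly_deriv_sum poly_deriv_times x Cons.IH) auto
  moreover have "(\<Sum>m<n. (if x = Inr s \<and> k = j \<and> i = m then 1 / of_nat n else 0) * ent n (entries \<omega>) w m l) =
      (if x = Inr s then if k = j then ent n (entries \<omega>) w i l / of_nat n else 0 else 0)" for \<omega>
  proof -
    have "(\<Sum>m<n. (if x = Inr s \<and> k = j \<and> i = m then 1 / of_nat n else 0) * ent n (entries \<omega>) w m l) =
      (\<Sum>m<n. if m = i then (if x = Inr s \<and> k = j then ent n (entries \<omega>) w m l / of_nat n else 0) else 0)"
      by (intro sum.cong) auto
    then show ?thesis using ij by simp
  qed
  ultimately show ?case
    by (simp add: dent_Cons[OF Cons.prems(1) ij(1)] sum.distrib)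
qed

lemma poly_deriv_wtr:
  assumes ij: "i < n" "j < n"
  shows "poly_deriv G I (cov s i j) (\<lambda>\<omega>. wtr n (entries \<omega>) w)
    (\<lambda>\<omega>. split_sum s w (\<lambda>u v. ent n (entries \<omega>) (v @ u) i j) / of_nat n ^ 2)"
proof -
  have "poly_deriv G I (cov s i j) (\<lambda>\<omega>. 1 / of_nat n * (\<Sum>k<n. ent n (entries \<omega>) w k k))
      (\<lambda>\<omega>. 1 / of_nat n * (\<Sum>k<n. dent n (entries \<omega>) s i j w k k))"
    using ij by (intro poly_deriv_smult poly_deriv_sum poly_deriv_ent) auto
  then show ?thesis by (simp add: wtr_def dent_trace[OF ij(1), symmetric])
qed

lemma poly_deriv_trprod:
  assumes ij: "i < n" "j < n"
  shows "poly_deriv G I (cov s i j) (\<lambda>\<omega>. trprod n (entries \<omega>) ws) (\<lambda>\<omega>. dtrprod n (entries \<omega>) s i j ws)"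
proof (induction ws)
  case Nil
  then show ?case using poly_deriv.const[of G I "cov s i j" 1] by (simp add: dtrprod_def)
next
  case (Cons w ws)
  show ?case
    using poly_deriv_times[OF poly_deriv_wtr[OF ij, of s w] Cons] by (simp add: dtrprod_Cons)
qed

lemma integrable_trprod: "integrable P (\<lambda>\<omega>. trprod n (entries \<omega>) ws)"
  using covariance_vector_poly_deriv_aux[OF poly_deriv_trprod[OF n_pos n_pos] covariance[OF n_pos n_pos], of "[]"]
  by simp

text \<open>A pairing inside the word closes two index loops. The two factors \<open>1 / n\<close>,
  one from the covariance and one from the normalization of the trace, are exactly what normalizes
  the two new traces.\<close>

lemma sum_dent:
  "(\<Sum>i<n. \<Sum>j<n. dent n Z s i j w j i) / of_nat n = split_sum s w (\<lambda>u v. wtr n Z u * wtr n Z v)"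
proof -
  have "(\<Sum>i<n. \<Sum>j<n. split_sum s w (\<lambda>u v. ent n Z u j j * ent n Z v i i)) =
      split_sum s w (\<lambda>u v. (\<Sum>j<n. ent n Z u j j) * (\<Sum>i<n. ent n Z v i i))"
    by (simp add: sum_split_sum sum_product) (subst sum.swap, simp)
  then have "(\<Sum>i<n. \<Sum>j<n. dent n Z s i j w j i) / of_nat n =
      1 / of_nat n ^ 2 * split_sum s w (\<lambda>u v. (\<Sum>j<n. ent n Z u j j) * (\<Sum>i<n. ent n Z v i i))"
    by (simp add: dent_def sum_divide_distrib[symmetric] power2_eq_square)
  then show ?thesis
    unfolding split_sum_mult_left[symmetric] by (simp add: wtr_def power2_eq_square)
qed

text \<open>A pairing with a letter of another trace merges both words into one index loop, worth
  \<open>n\<close>. Against it stand factors \<open>1 / n\<close> from the covariance and from each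
  of the two normalizations, which leaves \<open>1 / n^2\<close>.\<close>

lemma sum_ent_dtrprod:
  "(\<Sum>i<n. \<Sum>j<n. ent n Z w j i * dtrprod n Z s i j ws) / of_nat n =
     (\<Sum>(w', us)\<leftarrow>remove_each ws. split_sum s w' (\<lambda>u v. trprod n Z ((w @ v @ u) # us))) / of_nat n ^ 2"
proof -
  have 1: "(\<Sum>i<n. \<Sum>j<n. ent n Z w j i * split_sum s w' (\<lambda>u v. ent n Z (v @ u) i j)) =
      of_nat n * split_sum s w' (\<lambda>u v. wtr n Z (w @ v @ u))" for w'
  proof -
    have "(\<Sum>i<n. \<Sum>j<n. ent n Z w j i * split_sum s w' (\<lambda>u v. ent n Z (v @ u) i j)) =
        split_sum s w' (\<lambda>u v. \<Sum>i<n. \<Sum>j<n. ent n Z w j i * ent n Z (v @ u) i j)"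
      by (simp add: split_sum_mult_left[symmetric] sum_split_sum)
    also have "\<dots> = split_sum s w' (\<lambda>u v. \<Sum>j<n. ent n Z (w @ v @ u) j j)"
      by (subst sum.swap) (simp add: ent_append[of _ n Z w])
    also have "\<dots> = of_nat n * split_sum s w' (\<lambda>u v. wtr n Z (w @ v @ u))"
      using n_pos by (simp add: wtr_def split_sum_mult_left[symmetric])
    finally show ?thesis .
  qed
  have 2: "(\<Sum>i<n. \<Sum>j<n. ent n Z w j i * (\<Sum>(w', us)\<leftarrow>xs. split_sum s w' (\<lambda>u v. ent n Z (v @ u) i j) / of_nat n ^ 2 * trprod n Z us))
     = of_nat n * (\<Sum>(w', us)\<leftarrow>xs. split_sum s w' (\<lambda>u v. wtr n Z (w @ v @ u)) / of_nat n ^ 2 * trprod n Z us)" for xs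
  proof (induction xs)
    case (Cons x xs)
    obtain w' us where x: "x = (w', us)" by force
    have "(\<Sum>i<n. \<Sum>j<n. ent n Z w j i * (split_sum s w' (\<lambda>u v. ent n Z (v @ u) i j) / of_nat n ^ 2 * trprod n Z us)) =
       (\<Sum>i<n. \<Sum>j<n. ent n Z w j i * split_sum s w' (\<lambda>u v. ent n Z (v @ u) i j)) / of_nat n ^ 2 * trprod n Z us"
      by (simp add: sum_divide_distrib sum_distrib_right mult.assoc)
    then show ?case using Cons by (simp add: x distrib_left sum.distrib 1)
  qed simp
  have 3: "(\<Sum>(w', us)\<leftarrow>xs. split_sum s w' (\<lambda>u v. wtr n Z (w @ v @ u)) / of_nat n ^ 2 * trprod n Z us) =
      (\<Sum>(w', us)\<leftarrow>xs. split_sum s w' (\<lambda>u v. trprod n Z ((w @ v @ u) # us))) / of_nat n ^ 2" for xs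
    by (induction xs) (auto simp: add_divide_distrib split_sum_mult_right)
  show ?thesis
    unfolding dtrprod_def 2 3 using n_pos by simp
qed

text \<open>Every entry of the leading matrix is integrated by parts against the rest of the
  product; \<open>sum_dent\<close> and \<open>sum_ent_dtrprod\<close> collect the two kinds of
  pairings.\<close>

lemma expectation_trprod:
  "(\<integral>\<omega>. trprod n (entries \<omega>) ((Inr s # w) # ws) \<partial>P) =
     split_sum s w (\<lambda>u v. \<integral>\<omega>. trprod n (entries \<omega>) (u # v # ws) \<partial>P) +
     (\<Sum>(w', us)\<leftarrow>remove_each ws. split_sum s w' (\<lambda>u v. \<integral>\<omega>. trprod n (entries \<omega>) ((w @ v @ u) # us) \<partial>P)) / of_nat n ^ 2"
proof -
  have deriv: "poly_deriv G I (cov s i j) (\<lambda>\<omega>. ent n (entries \<omega>) w j i * trprod n (entries \<omega>) ws)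
     (\<lambda>\<omega>. dent n (entries \<omega>) s i j w j i * trprod n (entries \<omega>) ws + ent n (entries \<omega>) w j i * dtrprod n (entries \<omega>) s i j ws)"
    if "i < n" "j < n" for i j
    using that by (intro poly_deriv_times poly_deriv_ent poly_deriv_trprod)
  have int_split: "integrable P (\<lambda>\<omega>. split_sum s w (\<lambda>u v. f u v \<omega>)) \<and>
      (\<integral>\<omega>. split_sum s w (\<lambda>u v. f u v \<omega>) \<partial>P) = split_sum s w (\<lambda>u v. \<integral>\<omega>. f u v \<omega> \<partial>P)"
    if "\<And>u v. integrable P (f u v)" for f :: "_ \<Rightarrow> _ \<Rightarrow> _ \<Rightarrow> complex" and w :: "('c + nat) list"
    using that by (induction w arbitrary: f) auto
  have int_sum: "(\<integral>\<omega>. (\<Sum>i<n. \<Sum>j<n. f i j \<omega>) / of_nat n \<partial>P) = (\<Sum>i<n. \<Sum>j<n. \<integral>\<omega>. f i j \<omega> \<partial>P) / of_nat n"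
    if "\<And>i j. i < n \<Longrightarrow> j < n \<Longrightarrow> integrable P (f i j)" for f :: "nat \<Rightarrow> nat \<Rightarrow> 'w \<Rightarrow> complex"
  proof -
    have "(\<integral>\<omega>. (\<Sum>i<n. \<Sum>j<n. f i j \<omega>) \<partial>P) = (\<Sum>i<n. \<integral>\<omega>. (\<Sum>j<n. f i j \<omega>) \<partial>P)"
      using that by (intro Bochner_Integration.integral_sum Bochner_Integration.integrable_sum) auto
    also have "\<dots> = (\<Sum>i<n. \<Sum>j<n. \<integral>\<omega>. f i j \<omega> \<partial>P)"
      using that by (intro sum.cong refl Bochner_Integration.integral_sum) auto
    finally show ?thesis by simp
  qed
  have "(\<integral>\<omega>. trprod n (entries \<omega>) ((Inr s # w) # ws) \<partial>P) =
      (\<integral>\<omega>. (\<Sum>i<n. \<Sum>j<n. M (Inr s) i j \<omega> * (ent n (entries \<omega>) w j i * trprod n (entries \<omega>) ws)) / of_nat n \<partial>P)"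
    by (simp add: wtr_Cons sum_distrib_right mult.assoc)
  also have "\<dots> = (\<Sum>i<n. \<Sum>j<n. \<integral>\<omega>. M (Inr s) i j \<omega> * (ent n (entries \<omega>) w j i * trprod n (entries \<omega>) ws) \<partial>P) / of_nat n"
    using integrable_covariance_mult[OF deriv covariance] by (intro int_sum) auto
  also have "\<dots> = (\<Sum>i<n. \<Sum>j<n. \<integral>\<omega>. dent n (entries \<omega>) s i j w j i * trprod n (entries \<omega>) ws + ent n (entries \<omega>) w j i * dtrprod n (entries \<omega>) s i j ws \<partial>P) / of_nat n"
    using integration_by_parts[OF deriv covariance] by simp
  also have "\<dots> = (\<integral>\<omega>. (\<Sum>i<n. \<Sum>j<n. dent n (entries \<omega>) s i j w j i * trprod n (entries \<omega>) ws + ent n (entries \<omega>) w j i * dtrprod n (entries \<omega>) s i j ws) / of_nat n \<partial>P)"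
    using integrable_poly_deriv[OF deriv covariance] by (intro int_sum[symmetric]) auto
  also have "\<dots> = (\<integral>\<omega>. split_sum s w (\<lambda>u v. trprod n (entries \<omega>) (u # v # ws)) +
      (\<Sum>(w', us)\<leftarrow>remove_each ws. split_sum s w' (\<lambda>u v. trprod n (entries \<omega>) ((w @ v @ u) # us))) / of_nat n ^ 2 \<partial>P)"
  proof (intro Bochner_Integration.integral_cong refl)
    fix \<omega>
    have "(\<Sum>i<n. \<Sum>j<n. dent n (entries \<omega>) s i j w j i * trprod n (entries \<omega>) ws) / of_nat n =
        split_sum s w (\<lambda>u v. trprod n (entries \<omega>) (u # v # ws))"
      using sum_dent[of "entries \<omega>" s w]
      by (simp add: sum_distrib_right[symmetric] split_sum_mult_right[symmetric] mult.assoc times_divide_eq_left[symmetric]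
          del: times_divide_eq_left)
    then show "(\<Sum>i<n. \<Sum>j<n. dent n (entries \<omega>) s i j w j i * trprod n (entries \<omega>) ws + ent n (entries \<omega>) w j i * dtrprod n (entries \<omega>) s i j ws) / of_nat n =
      split_sum s w (\<lambda>u v. trprod n (entries \<omega>) (u # v # ws)) +
      (\<Sum>(w', us)\<leftarrow>remove_each ws. split_sum s w' (\<lambda>u v. trprod n (entries \<omega>) ((w @ v @ u) # us))) / of_nat n ^ 2"
      using sum_ent_dtrprod[of "entries \<omega>" w s ws] by (simp add: sum.distrib add_divide_distrib)
  qed
  also have "\<dots> = split_sum s w (\<lambda>u v. \<integral>\<omega>. trprod n (entries \<omega>) (u # v # ws) \<partial>P) +
     (\<Sum>(w', us)\<leftarrow>remove_each ws. split_sum s w' (\<lambda>u v. \<integral>\<omega>. trprod n (entries \<omega>) ((w @ v @ u) # us) \<partial>P)) / of_nat n ^ 2"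
  proof -
    have sl: "integrable P (\<lambda>\<omega>. \<Sum>(w', us)\<leftarrow>xs. split_sum s w' (\<lambda>u v. trprod n (entries \<omega>) ((w @ v @ u) # us))) \<and>
        (\<integral>\<omega>. (\<Sum>(w', us)\<leftarrow>xs. split_sum s w' (\<lambda>u v. trprod n (entries \<omega>) ((w @ v @ u) # us))) \<partial>P) =
        (\<Sum>(w', us)\<leftarrow>xs. split_sum s w' (\<lambda>u v. \<integral>\<omega>. trprod n (entries \<omega>) ((w @ v @ u) # us) \<partial>P))" for xs
    proof (induction xs)
      case (Cons x xs)
      obtain w' us where x: "x = (w', us)" by force
      show ?case using Cons int_split[of "\<lambda>u v \<omega>. trprod n (entries \<omega>) ((w @ v @ u) # us)" w'] integrable_trprod
        by (simp add: x del: trprod_simps)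
    qed simp
    show ?thesis
      using sl[of "remove_each ws"] int_split[of "\<lambda>u v \<omega>. trprod n (entries \<omega>) (u # v # ws)" w] integrable_trprod
      by (simp del: trprod_simps)
  qed
  finally show ?thesis .
qed

end

subsection \<open>Asymptotic factorization\<close>

abbreviation gaussian_count :: "('c + nat) list list \<Rightarrow> nat" where
  "gaussian_count ws \<equiv> length (filter (\<lambda>x. \<not> isl x) (concat ws))"

lemma tendsto_split_sum:
  fixes f :: "'a \<Rightarrow> _ \<Rightarrow> _ \<Rightarrow> 'b::topological_comm_monoid_add"
  assumes "\<And>u v. w = u @ Inr s # v \<Longrightarrow> ((\<lambda>n. f n u v) \<longlongrightarrow> g u v) F"
  shows "((\<lambda>n. split_sum s w (f n)) \<longlongrightarrow> split_sum s w g) F"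
  using assms
proof (induction w arbitrary: f g)
  case (Cons x w)
  have "((\<lambda>n. split_sum s w (\<lambda>u. f n (x # u))) \<longlongrightarrow> split_sum s w (\<lambda>u. g (x # u))) F"
    using Cons.prems by (intro Cons.IH) auto
  then show ?case using Cons.prems[of "[]" w] by (auto intro: tendsto_add)
qed simp

lemma wtr_Inl_cong:
  assumes "\<And>c i j. M (Inl c) i j = M' (Inl c) i j"
  shows "wtr n M (map Inl cs) = wtr n M' (map Inl cs)"
proof -
  have "ent n M (map Inl cs) i j = ent n M' (map Inl cs) i j" for i j
    by (induction cs arbitrary: i) (simp_all add: assms)
  then show ?thesis by (simp add: wtr_def)
qed

lemma gaussian_count_eq_0:
  assumes "gaussian_count ws = 0"
  obtains css where "ws = map (map Inl) css"
proof -
  have "\<exists>cs. w = map Inl cs" if "\<forall>x\<in>set w. isl x" for w :: "('a + nat) list"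
    using that by (intro exI[of _ "map projl w"]) (simp add: map_idI)
  moreover have "\<forall>w\<in>set ws. \<forall>x\<in>set w. isl x"
    using assms by (auto simp: filter_empty_conv)
  ultimately obtain f where "\<forall>w\<in>set ws. w = map Inl (f w)" by metis
  then have "ws = map (map Inl) (map f ws)" by (simp add: map_idI)
  then show thesis using that by blast
qed

text \<open>Factorization in the limit needs no variance estimate: the traces not touched by a
  pairing are carried along as factors, and every term on the right has two Gaussian letters fewer.
  Products without Gaussian letters are constant in \<omega>.\<close>

theorem expectation_trprod_tendsto:
  fixes M :: "nat \<Rightarrow> 'c + nat \<Rightarrow> nat \<Rightarrow> nat \<Rightarrow> 'w \<Rightarrow> complex"
  assumes gm: "\<And>n. N \<le> n \<Longrightarrow> gaussian_matrices P (G n) (I n) (vr n) n (M n) (cov n)"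
    and det: "\<And>cs \<omega>. (\<lambda>n. wtr n (\<lambda>x i j. M n x i j \<omega>) (map Inl cs)) \<longlonglongrightarrow> \<tau> (map Inl cs)"
    and rec: "\<And>s w. \<tau> (Inr s # w) = split_sum s w (\<lambda>u v. \<tau> u * \<tau> v)"
    and cyc: "\<And>u v. \<tau> (u @ v) = \<tau> (v @ u)"
  shows "(\<lambda>n. \<integral>\<omega>. trprod n (\<lambda>x i j. M n x i j \<omega>) ws \<partial>P) \<longlonglongrightarrow> (\<Prod>w\<leftarrow>ws. \<tau> w)"
proof (induction "gaussian_count ws" arbitrary: ws rule: less_induct)
  case less
  define m where "m n \<omega> = (\<lambda>x i j. M n x i j \<omega>)" for n \<omega>
  show ?case
  proof (cases "gaussian_count ws = 0")
    case True
    then obtain css where ws: "ws = map (map Inl) css" by (rule gaussian_count_eq_0)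
    have lim: "(\<lambda>n. trprod n (m n undefined) ws) \<longlonglongrightarrow> (\<Prod>w\<leftarrow>ws. \<tau> w)"
      unfolding ws by (induction css) (auto intro!: tendsto_mult det simp: m_def)
    have "(\<integral>\<omega>. trprod n (m n \<omega>) ws \<partial>P) = trprod n (m n undefined) ws" if "N \<le> n" for n
    proof -
      interpret gaussian_matrices P "G n" "I n" "vr n" n "M n" "cov n" by (rule gm[OF that])
      have "trprod n (m n \<omega>) ws = trprod n (m n undefined) ws" for \<omega>
        unfolding ws trprod_def map_map comp_def m_def
        by (intro arg_cong[of _ _ prod_list] map_cong refl wtr_Inl_cong) (simp add: deterministic[of _ _ _ \<omega> undefined])
      then have "(\<integral>\<omega>. trprod n (m n \<omega>) ws \<partial>P) = (\<integral>\<omega>. trprod n (m n undefined) ws \<partial>P)"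
        by (intro Bochner_Integration.integral_cong refl)
      then show ?thesis by (simp add: prob_space)
    qed
    then have "\<forall>\<^sub>F n in sequentially. trprod n (m n undefined) ws = (\<integral>\<omega>. trprod n (m n \<omega>) ws \<partial>P)"
      unfolding eventually_sequentially by metis
    from Lim_transform_eventually[OF lim this] show ?thesis by (simp add: m_def)
  next
    case False
    then obtain w x where wx: "w \<in> set ws" "x \<in> set w" "\<not> isl x"
      by (auto simp: filter_empty_conv)
    from wx(3) obtain s where "x = Inr s" by (cases x) auto
    with wx obtain us vs y z where ws: "ws = us @ w # vs" and w: "w = y @ Inr s # z"
      by (metis split_list)
    \<comment> \<open>By cyclicity the chosen Gaussian letter may be read as the first letter of its
      trace.\<close>
    define w' where "w' = z @ y"
    define rs where "rs = us @ vs"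
    have cnt: "gaussian_count ws = Suc (gaussian_count (w' # rs))"
      by (simp add: ws w w'_def rs_def)
    have eq: "trprod n Z ws = trprod n Z ((Inr s # w') # rs)" for n Z
      using wtr_append_commute[of n Z y "Inr s # z"] by (simp add: ws w w'_def rs_def mult_ac)
    have \<tau>eq: "(\<Prod>w\<leftarrow>ws. \<tau> w) = \<tau> (Inr s # w') * (\<Prod>w\<leftarrow>rs. \<tau> w)"
      using cyc[of y "Inr s # z"] by (simp add: ws w w'_def rs_def mult_ac)
    have 1: "(\<lambda>n. split_sum s w' (\<lambda>u v. \<integral>\<omega>. trprod n (m n \<omega>) (u # v # rs) \<partial>P))
        \<longlonglongrightarrow> split_sum s w' (\<lambda>u v. \<Prod>w\<leftarrow>u # v # rs. \<tau> w)"
      unfolding m_def by (intro tendsto_split_sum less.hyps) (auto simp: cnt)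
    \<comment> \<open>Stated for lists of such removals so that the finitely many merged terms can
      be added one by one; each of them falls under the induction hypothesis.\<close>
    have 2: "(\<lambda>n. \<Sum>(w'', us)\<leftarrow>xs. split_sum s w'' (\<lambda>u v. \<integral>\<omega>. trprod n (m n \<omega>) ((w' @ v @ u) # us) \<partial>P))
        \<longlonglongrightarrow> (\<Sum>(w'', us)\<leftarrow>xs. split_sum s w'' (\<lambda>u v. \<Prod>w\<leftarrow>(w' @ v @ u) # us. \<tau> w))"
      if "set xs \<subseteq> set (remove_each rs)" for xs
      using that
    proof (induction xs)
      case (Cons p xs)
      obtain w'' us' where p: "p = (w'', us')" by force
      with Cons.prems obtain as bs where "rs = as @ w'' # bs" "us' = as @ bs"
        using remove_each_eq[of w'' us' rs] by auto
      then have "(\<lambda>n. split_sum s w'' (\<lambda>u v. \<integral>\<omega>. trprod n (m n \<omega>) ((w' @ v @ u) # us') \<partial>P))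
        \<longlonglongrightarrow> split_sum s w'' (\<lambda>u v. \<Prod>w\<leftarrow>(w' @ v @ u) # us'. \<tau> w)"
        unfolding m_def by (intro tendsto_split_sum less.hyps) (auto simp: cnt)
      then show ?case using Cons by (auto simp: p intro!: tendsto_add)
    qed simp
    define c where "c = (\<Sum>(w'', us)\<leftarrow>remove_each rs. split_sum s w'' (\<lambda>u v. \<Prod>w\<leftarrow>(w' @ v @ u) # us. \<tau> w))"
    \<comment> \<open>The merged terms converge as well, so this prefactor removes them from the
      limit.\<close>
    have inv: "(\<lambda>n. 1 / of_nat n ^ 2 :: complex) \<longlonglongrightarrow> 0"
      using tendsto_power[OF lim_1_over_n[where 'a=complex], of 2] by (simp add: power_divide)
    have "(\<lambda>n. split_sum s w' (\<lambda>u v. \<integral>\<omega>. trprod n (m n \<omega>) (u # v # rs) \<partial>P) +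
        (\<Sum>(w'', us)\<leftarrow>remove_each rs. split_sum s w'' (\<lambda>u v. \<integral>\<omega>. trprod n (m n \<omega>) ((w' @ v @ u) # us) \<partial>P)) * (1 / of_nat n ^ 2))
        \<longlonglongrightarrow> split_sum s w' (\<lambda>u v. \<Prod>w\<leftarrow>u # v # rs. \<tau> w) + c * 0"
      unfolding c_def by (intro tendsto_add tendsto_mult 1 2 inv order_refl)
    moreover have "split_sum s w' (\<lambda>u v. \<Prod>w\<leftarrow>u # v # rs. \<tau> w) + c * 0 = (\<Prod>w\<leftarrow>ws. \<tau> w)"
      by (simp add: \<tau>eq rec split_sum_mult_right[symmetric] mult.assoc)
    ultimately have lim: "(\<lambda>n. split_sum s w' (\<lambda>u v. \<integral>\<omega>. trprod n (m n \<omega>) (u # v # rs) \<partial>P) +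
        (\<Sum>(w'', us)\<leftarrow>remove_each rs. split_sum s w'' (\<lambda>u v. \<integral>\<omega>. trprod n (m n \<omega>) ((w' @ v @ u) # us) \<partial>P)) / of_nat n ^ 2)
        \<longlonglongrightarrow> (\<Prod>w\<leftarrow>ws. \<tau> w)"
      by simp
    have "split_sum s w' (\<lambda>u v. \<integral>\<omega>. trprod n (m n \<omega>) (u # v # rs) \<partial>P) +
        (\<Sum>(w'', us)\<leftarrow>remove_each rs. split_sum s w'' (\<lambda>u v. \<integral>\<omega>. trprod n (m n \<omega>) ((w' @ v @ u) # us) \<partial>P)) / of_nat n ^ 2
        = (\<integral>\<omega>. trprod n (m n \<omega>) ws \<partial>P)" if "N \<le> n" for n
    proof -
      interpret gaussian_matrices P "G n" "I n" "vr n" n "M n" "cov n" by (rule gm[OF that])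
      show ?thesis unfolding eq m_def by (rule expectation_trprod[symmetric])
    qed
    then have "\<forall>\<^sub>F n in sequentially. split_sum s w' (\<lambda>u v. \<integral>\<omega>. trprod n (m n \<omega>) (u # v # rs) \<partial>P) +
        (\<Sum>(w'', us)\<leftarrow>remove_each rs. split_sum s w'' (\<lambda>u v. \<integral>\<omega>. trprod n (m n \<omega>) ((w' @ v @ u) # us) \<partial>P)) / of_nat n ^ 2
        = (\<integral>\<omega>. trprod n (m n \<omega>) ws \<partial>P)"
      unfolding eventually_sequentially by metis
    from Lim_transform_eventually[OF lim this] show ?thesis by (simp add: m_def)
  qed
qed

section \<open>The semicircular extension\<close>

lemma sum_list_concat: "sum_list (concat xss) = (\<Sum>xs\<leftarrow>xss. sum_list xs)"
  by (induction xss) simp_all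

lemma sum_list_cnj: "cnj (\<Sum>x\<leftarrow>xs. f x) = (\<Sum>x\<leftarrow>xs. cnj (f x))"
  by (induction xs) simp_all

lemma sum_list_split_sum:
  "(\<Sum>f\<leftarrow>fs. split_sum s w (h f)) = split_sum s w (\<lambda>u v. \<Sum>f\<leftarrow>fs. h f u v)"
  by (induction fs) (simp_all add: split_sum_add)

text \<open>Positive semidefiniteness on \<open>S\<close> as an explicit sum of rank-one kernels. In
  this form products of kernels are again positive by multiplying the factors, where quadratic forms
  would call for the Schur product theorem.\<close>

definition gram :: "'a set \<Rightarrow> ('a \<Rightarrow> 'a \<Rightarrow> complex) \<Rightarrow> bool" where
  "gram S K \<longleftrightarrow> (\<exists>fs. \<forall>x\<in>S. \<forall>y\<in>S. K x y = (\<Sum>f\<leftarrow>fs. cnj (f x) * f y))"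

definition lin :: "('a \<Rightarrow> complex) \<Rightarrow> (complex \<times> 'a) list \<Rightarrow> complex" where
  "lin h ps = (\<Sum>(c, w)\<leftarrow>ps. c * h w)"

lemma lin_Nil [simp]: "lin h [] = 0"
  and lin_Cons [simp]: "lin h ((c, w) # ps) = c * h w + lin h ps"
  and lin_append [simp]: "lin h (ps @ qs) = lin h ps + lin h qs"
  by (simp_all add: lin_def)

lemma lin_add: "lin (\<lambda>w. f w + g w) ps = lin f ps + lin g ps"
  by (induction ps) (auto simp: distrib_left)

lemma lin_zero [simp]: "lin (\<lambda>w. 0) ps = 0"
  by (induction ps) auto

lemma lin_const_mult: "lin (\<lambda>w. c * f w) ps = c * lin f ps"
  by (induction ps) (auto simp: distrib_left)

lemma lin_mult_const: "lin (\<lambda>w. f w * c) ps = lin f ps * c"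
  by (induction ps) (auto simp: distrib_right)

lemma lin_cong: "(\<And>c w. (c, w) \<in> set ps \<Longrightarrow> f w = g w) \<Longrightarrow> lin f ps = lin g ps"
  unfolding lin_def by (intro arg_cong[of _ _ sum_list] map_cong) auto

lemma lin_swap: "lin (\<lambda>w. lin (g w) qs) ps = lin (\<lambda>x. lin (\<lambda>w. g w x) ps) qs"
  by (induction ps) (auto simp: lin_add lin_const_mult)

lemma lin_split_sum: "lin (\<lambda>x. split_sum s w (f x)) ps = split_sum s w (\<lambda>u v. lin (\<lambda>x. f x u v) ps)"
  by (induction ps) (auto simp: split_sum_add split_sum_mult_left)

context tracial_star_prob_space
begin

lemma scalar_ring_simps [simp]:
  "c \<in> carrier (ring_of_type_algebra :: complex ring)"
  "a \<oplus>\<^bsub>ring_of_type_algebra\<^esub> b = a + b" "a \<otimes>\<^bsub>ring_of_type_algebra\<^esub> b = a * b"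
  "\<one>\<^bsub>ring_of_type_algebra\<^esub> = (1::complex)" "\<zero>\<^bsub>ring_of_type_algebra\<^esub> = (0::complex)"
  by (simp_all add: ring_of_type_algebra_def)

lemma smult_in [simp, intro]: "x \<in> carrier A \<Longrightarrow> c \<odot> x \<in> carrier A"
  by simp

lemma smult_add_left: "x \<in> carrier A \<Longrightarrow> (a + b) \<odot> x = a \<odot> x \<oplus> b \<odot> x"
  using scal.smult_l_distr[of a b x] by simp

lemma smult_add_right: "x \<in> carrier A \<Longrightarrow> y \<in> carrier A \<Longrightarrow> c \<odot> (x \<oplus> y) = c \<odot> x \<oplus> c \<odot> y"
  using scal.smult_r_distr[of c x y] by simp

lemma smult_smult: "x \<in> carrier A \<Longrightarrow> a \<odot> (b \<odot> x) = (a * b) \<odot> x"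
  using scal.smult_assoc1[of a b x] by simp

lemma smult_1 [simp]: "x \<in> carrier A \<Longrightarrow> 1 \<odot> x = x"
  using scal.smult_one[of x] by simp

lemma smult_0 [simp]: "x \<in> carrier A \<Longrightarrow> 0 \<odot> x = \<zero>"
  using scal.smult_l_null[of x] by simp

lemma smult_zero_right [simp]: "c \<odot> \<zero> = \<zero>"
  using scal.smult_r_null[of c] by simp

lemma minus_eq_smult: "x \<in> carrier A \<Longrightarrow> \<ominus> x = (-1) \<odot> x"
proof -
  assume x: "x \<in> carrier A"
  then have "x \<oplus> (-1) \<odot> x = \<zero>" using smult_add_left[of x 1 "-1"] by simp
  then show ?thesis using x alg.add.inv_equality[of "(-1) \<odot> x" x] by (simp add: alg.a_comm)
qed

lemma star_in [simp, intro]: "x \<in> carrier A \<Longrightarrow> star A x \<in> carrier A"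
  by (rule star_closed)

lemma star_zero [simp]: "star A \<zero> = \<zero>"
  using star_smult[of \<zero> 0] by simp

lemma star_one [simp]: "star A \<one> = \<one>"
  using star_mult[of "star A \<one>" \<one>] star_star[of \<one>] by simp

lemma state_zero [simp]: "state A \<zero> = 0"
  using state_smult[of \<zero> 0] by simp

text \<open>Hermitian symmetry is a consequence of positivity: expanding \<phi> at
  \<open>x + c 1\<close> shows that c \<phi>(star x) + cnj c \<phi>(x) is real for every c, and the
  values c = 1 and c = \<i> settle the real and imaginary parts.\<close>

lemma state_star:
  assumes x: "x \<in> carrier A"
  shows "state A (star A x) = cnj (state A x)"
proof -
  have "Im (c * state A (star A x) + cnj c * state A x) = 0" for c
  proof -
    let ?y = "x \<oplus> c \<odot> \<one>"
    have "star A ?y \<otimes> ?y = (star A x \<otimes> x \<oplus> c \<odot> star A x) \<oplus> (cnj c \<odot> x \<oplus> (cnj c * c) \<odot> \<one>)"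
      using x by (simp add: star_add star_smult alg.l_distr alg.r_distr smult_mult_left smult_mult_right
        smult_smult smult_add_right mult.commute) (simp add: alg.a_ac)
    then have "state A (star A ?y \<otimes> ?y) =
        state A (star A x \<otimes> x) + c * state A (star A x) + (cnj c * state A x + cnj c * c)"
      using x by (simp add: state_add state_smult state_one)
    then have "Im (state A (star A x \<otimes> x) + c * state A (star A x) + (cnj c * state A x + cnj c * c)) = 0"
      using state_pos[of ?y] x by simp
    moreover have "Im (state A (star A x \<otimes> x)) = 0" using state_pos[of x] x by simp
    ultimately show ?thesis by simp
  qed
  from this[of 1] this[of \<i>] show ?thesis
    by (simp add: complex_eq_iff)
qed

abbreviation asum :: "'u list \<Rightarrow> 'u" where
  "asum xs \<equiv> foldr (\<oplus>) xs \<zero>"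

lemma asum_closed [simp, intro]: "set xs \<subseteq> carrier A \<Longrightarrow> asum xs \<in> carrier A"
  by (induction xs) auto

lemma state_mult_asum:
  assumes "a \<in> carrier A" "set xs \<subseteq> carrier A"
  shows "state A (a \<otimes> asum xs) = (\<Sum>x\<leftarrow>xs. state A (a \<otimes> x))"
  using assms(2) by (induction xs) (use assms(1) in \<open>auto simp: alg.r_distr state_add\<close>)

definition emb :: "'u \<Rightarrow> 'u" where
  "emb a = (if a \<in> carrier A then a else \<zero>)"

lemma emb_closed [simp, intro]: "emb a \<in> carrier A" and emb_id [simp]: "a \<in> carrier A \<Longrightarrow> emb a = a"
  by (simp_all add: emb_def)


subsection \<open>Free product with a family of semicirculars\<close>

text \<open>The conditional expectation onto \<open>A\<close> of a word in elements of \<open>A\<close> (letters \<open>Inl\<close>) and free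
  semicirculars of covariance \<open>\<phi>\<close> (letters \<open>Inr\<close>); letters outside the carrier stand for zero.\<close>

function cexp :: "('u + nat) list \<Rightarrow> 'u" where
  "cexp [] = \<one>"
| "cexp (Inl a # w) = emb a \<otimes> cexp w"
| "cexp (Inr s # w) = asum (map (\<lambda>(u, v). state A (cexp u) \<odot> cexp v) (splits s w))"
  by pat_completeness auto
termination
  by (relation "Wellfounded.measure length") (auto simp: splits_iff)

lemma cexp_closed [simp, intro]: "cexp w \<in> carrier A"
proof (induction w rule: cexp.induct)
  case (3 s w)
  then show ?case by (auto intro!: asum_closed)
qed auto

text \<open>The coefficient \<open>a\<close> absorbs leading letters from the base algebra, so that
  the recursion over the word closes.\<close>

definition moment :: "'u \<Rightarrow> ('u + nat) list \<Rightarrow> complex" where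
  "moment a w = state A (a \<otimes> cexp w)"

lemma moment_Nil [simp]: "a \<in> carrier A \<Longrightarrow> moment a [] = state A a"
  by (simp add: moment_def)

lemma moment_Inl [simp]: "a \<in> carrier A \<Longrightarrow> moment a (Inl b # w) = moment (a \<otimes> emb b) w"
  by (simp add: moment_def alg.m_assoc)

lemma moment_Inr [simp]:
  assumes "a \<in> carrier A"
  shows "moment a (Inr s # w) = split_sum s w (\<lambda>u v. moment \<one> u * moment a v)"
proof -
  have "moment a (Inr s # w) =
      (\<Sum>x\<leftarrow>map (\<lambda>(u, v). state A (cexp u) \<odot> cexp v) (splits s w). state A (a \<otimes> x))"
    unfolding moment_def cexp.simps using assms by (subst state_mult_asum) auto
  also have "\<dots> = split_sum s w (\<lambda>u v. moment \<one> u * moment a v)"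
    using assms
    by (auto simp: split_sum_def comp_def case_prod_unfold moment_def smult_mult_right state_smult
        intro!: arg_cong[of _ _ sum_list])
  finally show ?thesis .
qed

lemma moment_add:
  "a \<in> carrier A \<Longrightarrow> b \<in> carrier A \<Longrightarrow> moment (a \<oplus> b) w = moment a w + moment b w"
  by (simp add: moment_def alg.l_distr state_add)

lemma moment_smult: "a \<in> carrier A \<Longrightarrow> moment (c \<odot> a) w = c * moment a w"
  by (simp add: moment_def smult_mult_left state_smult)

lemma moment_zero [simp]: "moment \<zero> w = 0"
  by (simp add: moment_def)

text \<open>The trace property of \<phi> enters at the empty word: a letter at the far end acts on
  the coefficient from the left.\<close>

lemma moment_snoc_Inl:
  "a \<in> carrier A \<Longrightarrow> moment a (w @ [Inl b]) = moment (emb b \<otimes> a) w"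
proof (induction "length w" arbitrary: w a rule: less_induct)
  case less
  show ?case
  proof (cases w)
    case Nil
    then show ?thesis using less.prems by (simp add: state_tracial)
  next
    case (Cons x w')
    show ?thesis
    proof (cases x)
      case (Inl c)
      then show ?thesis using less.hyps[of w' "a \<otimes> emb c"] less.prems Cons by (simp add: alg.m_assoc)
    next
      case (Inr s)
      then show ?thesis using less.prems Cons
        by (auto simp: split_sum_append intro!: split_sum_cong less.hyps)
    qed
  qed
qed

text \<open>The mirror image of \<open>moment_Inr\<close>. If the first letter is \<open>t\<close>,
  then either it is paired with the last letter \<open>s\<close>, a case common to both sides, or
  both are paired inside, and \<open>split_sum_split_sum\<close> exchanges the order in which these
  pairs are resolved.\<close>

lemma moment_snoc_Inr:
  "a \<in> carrier A \<Longrightarrow> moment a (w @ [Inr s]) = split_sum s w (\<lambda>u v. moment a u * moment \<one> v)"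
proof (induction "length w" arbitrary: w a rule: less_induct)
  case less
  show ?case
  proof (cases w)
    case Nil
    then show ?thesis using less.prems by simp
  next
    case (Cons x w')
    show ?thesis
    proof (cases x)
      case (Inl c)
      then show ?thesis using less.hyps[of w' "a \<otimes> emb c"] less.prems Cons by simp
    next
      case (Inr t)
      have "split_sum t w' (\<lambda>p q. moment \<one> p * moment a (q @ [Inr s])) =
          split_sum t w' (\<lambda>p q. split_sum s q (\<lambda>u v. moment \<one> p * (moment a u * moment \<one> v)))"
        using less Cons by (intro split_sum_cong) (simp add: split_sum_mult_left)
      also have "\<dots> = split_sum s w' (\<lambda>u v. split_sum t u (\<lambda>p q. moment \<one> p * (moment a q * moment \<one> v)))"
        by (rule split_sum_split_sum)
      also have "\<dots> = split_sum s w' (\<lambda>u v. moment a (Inr t # u) * moment \<one> v)"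
        using less.prems by (simp add: split_sum_mult_right[symmetric] mult.assoc)
      finally show ?thesis using less.prems Cons Inr
        by (simp add: split_sum_append add.commute mult.commute state_one)
    qed
  qed
qed

text \<open>For the coefficient 1 the recursions at the first and at the last letter have the same
  right-hand side, so a letter can be moved from the front to the back.\<close>

lemma moment_append_commute: "moment \<one> (u @ v) = moment \<one> (v @ u)"
proof (induction u arbitrary: v)
  case (Cons x u)
  have "moment \<one> (x # u @ v) = moment \<one> ((u @ v) @ [x])"
    using moment_snoc_Inl[of \<one> "u @ v"] moment_snoc_Inr[of \<one> "u @ v"] by (cases x) simp_all
  then show ?case using Cons[of "v @ [x]"] by simp
qed simp

fun letter_star :: "'u + nat \<Rightarrow> 'u + nat" where
  "letter_star (Inl a) = Inl (if a \<in> carrier A then star A a else a)"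
| "letter_star (Inr s) = Inr s"

definition word_star :: "('u + nat) list \<Rightarrow> ('u + nat) list" where
  "word_star w = rev (map letter_star w)"

lemma letter_star_Inr: "letter_star x = Inr s \<longleftrightarrow> x = Inr s"
  by (cases x) auto

lemma word_star_simps [simp]:
  "word_star [] = []" "word_star (x # w) = word_star w @ [letter_star x]"
  "word_star (u @ v) = word_star v @ word_star u"
  by (simp_all add: word_star_def)

lemma letter_star_star [simp]: "letter_star (letter_star x) = x"
  by (cases x) (auto simp: star_star)

lemma word_star_star [simp]: "word_star (word_star w) = w"
  by (simp add: word_star_def rev_map comp_def)

lemma emb_star: "emb (if a \<in> carrier A then star A a else a) = star A (emb a)"
  by (simp add: emb_def)

text \<open>Reversing the word turns the recursion at the first letter into the one at the last
  letter, which the two lemmas on \<open>w @ [x]\<close> provide.\<close>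

lemma moment_star: "a \<in> carrier A \<Longrightarrow> moment (star A a) (word_star w) = cnj (moment a w)"
proof (induction "length w" arbitrary: w a rule: less_induct)
  case less
  show ?case
  proof (cases w)
    case Nil
    then show ?thesis using less.prems by (simp add: state_star)
  next
    case (Cons x w')
    show ?thesis
    proof (cases x)
      case (Inl c)
      then show ?thesis using less.hyps[of w' "a \<otimes> emb c"] less.prems Cons
        by (simp add: moment_snoc_Inl emb_star star_mult del: if_split)
    next
      case (Inr t)
      have "split_sum t (word_star w') (\<lambda>u v. moment (star A a) u * moment \<one> v) =
         split_sum t w' (\<lambda>u v. moment (star A a) (word_star v) * moment \<one> (word_star u))"
        by (simp add: word_star_def split_sum_rev split_sum_map letter_star_Inr rev_map)
      also have "\<dots> = split_sum t w' (\<lambda>u v. cnj (moment \<one> u * moment a v))"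
      proof (rule split_sum_cong)
        fix u v assume "w' = u @ Inr t # v"
        then show "moment (star A a) (word_star v) * moment \<one> (word_star u) = cnj (moment \<one> u * moment a v)"
          using less.hyps[of v a] less.hyps[of u \<one>] less.prems Cons by simp
      qed
      finally show ?thesis using less.prems Cons Inr
        by (simp add: moment_snoc_Inr split_sum_hom[where h = cnj])
    qed
  qed
qed


subsection \<open>Positivity\<close>

text \<open>\<open>moment \<one> (u\<^sup>* v)\<close> is the inner product of the vectors of \<open>u\<close> and \<open>v\<close> in a full Fock space. It is
  expanded over the letters \<open>Inr\<close> that remain uncontracted, which gives a sum of products of the
  kernels \<open>\<phi> (cexp u\<^sup>* cexp v)\<close>.\<close>

definition kernel0 :: "('u + nat) list \<Rightarrow> ('u + nat) list \<Rightarrow> complex" where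
  "kernel0 u v = moment (star A (cexp u)) v"

lemma kernel0_cnj: "kernel0 u v = cnj (kernel0 v u)"
proof -
  have "cnj (kernel0 v u) = state A (star A (star A (cexp v) \<otimes> cexp u))"
    by (simp add: kernel0_def moment_def state_star)
  then show ?thesis by (simp add: kernel0_def moment_def star_mult star_star)
qed

lemma kernel0_Nil: "kernel0 [] v = moment \<one> v"
  by (simp add: kernel0_def)

lemma kernel0_Inl: "kernel0 (Inl b # u) v = kernel0 u (letter_star (Inl b) # v)"
  by (simp add: kernel0_def emb_star star_mult del: if_split)

lemma kernel0_Inr_right: "kernel0 u (Inr t # v) = split_sum t v (\<lambda>p q. moment \<one> p * kernel0 u q)"
  by (simp add: kernel0_def)

lemma kernel0_Inr_left: "kernel0 (Inr t # u) v = split_sum t u (\<lambda>p q. cnj (moment \<one> p) * kernel0 q v)"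
  by (subst kernel0_cnj, subst kernel0_Inr_right, subst split_sum_hom[where h = cnj])
    (simp_all flip: kernel0_cnj)

lemma split_sum_fundef_cong [fundef_cong]:
  "w = w' \<Longrightarrow> s = s' \<Longrightarrow> (\<And>u v. w' = u @ Inr s' # v \<Longrightarrow> f u v = g u v) \<Longrightarrow> split_sum s w f = split_sum s' w' g"
  by (simp, rule split_sum_cong, simp)

text \<open>The letter \<open>s\<close> is the leftmost uncontracted one in both words, and
  \<open>u1\<close>, \<open>v1\<close> are the pieces before it. As the covariance is scalar-valued,
  the inner product of elementary tensors is a product of numbers. The bound \<open>N\<close> on the
  indices makes the sum finite.\<close>

function fock_kernel :: "nat \<Rightarrow> ('u + nat) list \<Rightarrow> ('u + nat) list \<Rightarrow> complex" where
  "fock_kernel N u v = kernel0 u v +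
     (\<Sum>s\<leftarrow>[0..<N]. split_sum s u (\<lambda>u1 u2. split_sum s v (\<lambda>v1 v2. kernel0 u1 v1 * fock_kernel N u2 v2)))"
  by pat_completeness auto
termination
  by (relation "Wellfounded.measure (\<lambda>(N, u, v). length u)") auto

declare fock_kernel.simps [simp del]

lemma fock_kernel_Nil: "fock_kernel N [] v = moment \<one> v"
  by (simp add: fock_kernel.simps[of N "[]"] kernel0_Nil)

lemma fock_kernel_Inl: "fock_kernel N (Inl b # u) v = fock_kernel N u (letter_star (Inl b) # v)"
  by (simp add: fock_kernel.simps[of N "Inl b # u"] fock_kernel.simps[of N u "_ # _"] kernel0_Inl del: letter_star.simps)
    (simp add: kernel0_Inl)

lemma sum_list_delta:
  "t < N \<Longrightarrow> (\<Sum>s\<leftarrow>[0..<N]. (if t = s then f s else (0::complex)) + g s) = f t + (\<Sum>s\<leftarrow>[0..<N]. g s)"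
  by (simp add: sum_list_addf sum_list_sum_nth sum.delta' atLeast0LessThan
      interv_sum_list_conv_sum_set_nat)

text \<open>The leading \<open>t\<close> is contracted with a later \<open>t\<close> of
  \<open>u\<close>, or stays uncontracted and meets a \<open>t\<close> of \<open>v\<close>:
  annihilation and creation part of the field operator. Up to conjugation the formula is symmetric
  in \<open>u\<close> and \<open>v\<close>.\<close>

lemma fock_kernel_Inr:
  assumes "t < N"
  shows "fock_kernel N (Inr t # u) v =
    split_sum t u (\<lambda>p q. cnj (moment \<one> p) * fock_kernel N q v) + split_sum t v (\<lambda>p q. moment \<one> p * fock_kernel N u q)"
proof -
  have "fock_kernel N (Inr t # u) v = kernel0 (Inr t # u) v +
      (\<Sum>s\<leftarrow>[0..<N]. (if t = s then split_sum s v (\<lambda>v1 v2. moment \<one> v1 * fock_kernel N u v2) else 0) +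
         split_sum s u (\<lambda>u1 u2. split_sum s v (\<lambda>v1 v2. kernel0 (Inr t # u1) v1 * fock_kernel N u2 v2)))"
    by (subst fock_kernel.simps) (simp add: kernel0_Nil if_distrib cong: if_cong)
  \<comment> \<open>If the partner of the leading \<open>t\<close> comes before the first
    uncontracted letter, the two splittings of \<open>u\<close> can be made in the other
    order.\<close>
  also have "(\<lambda>s. split_sum s u (\<lambda>u1 u2. split_sum s v (\<lambda>v1 v2. kernel0 (Inr t # u1) v1 * fock_kernel N u2 v2))) =
      (\<lambda>s. split_sum t u (\<lambda>p q'. cnj (moment \<one> p) * split_sum s q' (\<lambda>q u2. split_sum s v (\<lambda>v1 v2. kernel0 q v1 * fock_kernel N u2 v2))))"
  proof
    fix s
    have "split_sum s u (\<lambda>u1 u2. split_sum s v (\<lambda>v1 v2. kernel0 (Inr t # u1) v1 * fock_kernel N u2 v2)) =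
      split_sum s u (\<lambda>u1 u2. split_sum s v (\<lambda>v1 v2. split_sum t u1 (\<lambda>p q. cnj (moment \<one> p) * (kernel0 q v1 * fock_kernel N u2 v2))))"
      by (simp add: kernel0_Inr_left split_sum_mult_right[symmetric] mult.assoc)
    also have "\<dots> = split_sum s u (\<lambda>u1 u2. split_sum t u1 (\<lambda>p q. cnj (moment \<one> p) * split_sum s v (\<lambda>v1 v2. kernel0 q v1 * fock_kernel N u2 v2)))"
    proof -
      have sw: "split_sum s v (\<lambda>v1 v2. split_sum t u1 (\<lambda>p q. f p q v1 v2)) = split_sum t u1 (\<lambda>p q. split_sum s v (f p q))"
        for u1 and f :: "_ \<Rightarrow> _ \<Rightarrow> _ \<Rightarrow> _ \<Rightarrow> complex"
        by (induction u1 arbitrary: f) (simp_all add: split_sum_add)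
      show ?thesis by (simp add: sw split_sum_mult_left)
    qed
    also have "\<dots> = split_sum t u (\<lambda>p q'. split_sum s q' (\<lambda>q u2. cnj (moment \<one> p) * split_sum s v (\<lambda>v1 v2. kernel0 q v1 * fock_kernel N u2 v2)))"
      by (rule split_sum_split_sum[symmetric])
    finally show "split_sum s u (\<lambda>u1 u2. split_sum s v (\<lambda>v1 v2. kernel0 (Inr t # u1) v1 * fock_kernel N u2 v2)) =
       split_sum t u (\<lambda>p q'. cnj (moment \<one> p) * split_sum s q' (\<lambda>q u2. split_sum s v (\<lambda>v1 v2. kernel0 q v1 * fock_kernel N u2 v2)))"
      by (simp add: split_sum_mult_left)
  qed
  also have "(\<Sum>s\<leftarrow>[0..<N]. (if t = s then split_sum s v (\<lambda>v1 v2. moment \<one> v1 * fock_kernel N u v2) else 0) +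
      split_sum t u (\<lambda>p q'. cnj (moment \<one> p) * split_sum s q' (\<lambda>q u2. split_sum s v (\<lambda>v1 v2. kernel0 q v1 * fock_kernel N u2 v2)))) =
     split_sum t v (\<lambda>v1 v2. moment \<one> v1 * fock_kernel N u v2) +
     split_sum t u (\<lambda>p q'. cnj (moment \<one> p) * (\<Sum>s\<leftarrow>[0..<N]. split_sum s q' (\<lambda>q u2. split_sum s v (\<lambda>v1 v2. kernel0 q v1 * fock_kernel N u2 v2))))"
  proof -
    have sw: "(\<Sum>s\<leftarrow>xs. split_sum t u (\<lambda>p q'. c p * f s q')) = split_sum t u (\<lambda>p q'. c p * (\<Sum>s\<leftarrow>xs. f s q'))"
      for xs :: "nat list" and f :: "_ \<Rightarrow> _ \<Rightarrow> complex" and c :: "_ \<Rightarrow> complex"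
      by (induction xs) (simp_all add: split_sum_add distrib_left)
    show ?thesis by (simp add: sum_list_delta[OF assms] sw)
  qed
  also have "kernel0 (Inr t # u) v + (split_sum t v (\<lambda>v1 v2. moment \<one> v1 * fock_kernel N u v2) +
     split_sum t u (\<lambda>p q'. cnj (moment \<one> p) * (\<Sum>s\<leftarrow>[0..<N]. split_sum s q' (\<lambda>q u2. split_sum s v (\<lambda>v1 v2. kernel0 q v1 * fock_kernel N u2 v2))))) =
     split_sum t u (\<lambda>p q. cnj (moment \<one> p) * fock_kernel N q v) + split_sum t v (\<lambda>p q. moment \<one> p * fock_kernel N u q)"
    by (simp add: fock_kernel.simps[of N _ v] kernel0_Inr_left split_sum_add distrib_left)
  finally show ?thesis .
qed

lemma fock_kernel_cnj: "fock_kernel N u v = cnj (fock_kernel N v u)"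
proof (induction "length u" arbitrary: u v rule: less_induct)
  case less
  have "split_sum s u (\<lambda>u1 u2. split_sum s v (\<lambda>v1 v2. kernel0 u1 v1 * fock_kernel N u2 v2)) =
      cnj (split_sum s v (\<lambda>v1 v2. split_sum s u (\<lambda>u1 u2. kernel0 v1 u1 * fock_kernel N v2 u2)))" for s
  proof -
    have sw: "split_sum s u (\<lambda>p q. split_sum s v (f p q)) = split_sum s v (\<lambda>p' q'. split_sum s u (\<lambda>p q. f p q p' q'))"
      for f :: "_ \<Rightarrow> _ \<Rightarrow> _ \<Rightarrow> _ \<Rightarrow> complex"
      by (induction u arbitrary: f) (simp_all add: split_sum_add)
    have "split_sum s u (\<lambda>u1 u2. split_sum s v (\<lambda>v1 v2. kernel0 u1 v1 * fock_kernel N u2 v2)) =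
        split_sum s u (\<lambda>u1 u2. split_sum s v (\<lambda>v1 v2. cnj (kernel0 v1 u1 * fock_kernel N v2 u2)))"
      by (intro split_sum_cong) (metis complex_cnj_mult kernel0_cnj less add_Suc_right length_Cons length_append less_add_Suc2)
    then show ?thesis by (simp add: sw split_sum_hom[where h = cnj])
  qed
  then show ?case
    by (subst (1 2) fock_kernel.simps) (simp add: kernel0_cnj[of u v] sum_list_cnj comp_def)
qed

text \<open>Self-adjointness of the field operator \<open>t\<close>, from the Hermitian symmetry of
  the formula in \<open>fock_kernel_Inr\<close>.\<close>

lemma fock_kernel_Inr_right:
  assumes "t < N"
  shows "fock_kernel N u (Inr t # v) = fock_kernel N (Inr t # u) v"
proof -
  have "fock_kernel N u (Inr t # v) = cnj (fock_kernel N (Inr t # v) u)" by (rule fock_kernel_cnj)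
  also have "\<dots> = split_sum t v (\<lambda>p q. moment \<one> p * cnj (fock_kernel N q u)) +
      split_sum t u (\<lambda>p q. cnj (moment \<one> p) * cnj (fock_kernel N v q))"
    by (simp add: fock_kernel_Inr[OF assms] split_sum_hom[where h = cnj])
  finally show ?thesis by (simp add: fock_kernel_Inr[OF assms] flip: fock_kernel_cnj)
qed

text \<open>The letters of \<open>u\<close> cross from one side of the inner product to the other
  one at a time, each as the adjoint operator; with the empty word on the left the kernel is the
  vacuum expectation.\<close>

lemma moment_word_star_append:
  "\<forall>s. Inr s \<in> set u \<longrightarrow> s < N \<Longrightarrow> moment \<one> (word_star u @ v) = fock_kernel N u v"
proof (induction u arbitrary: v)
  case Nil
  then show ?case by (simp add: fock_kernel_Nil)
next
  case (Cons x u)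
  have "moment \<one> (word_star (x # u) @ v) = fock_kernel N u (letter_star x # v)"
    using Cons by simp
  also have "\<dots> = fock_kernel N (x # u) v"
    using Cons.prems fock_kernel_Inr_right fock_kernel_Inl by (cases x) (simp_all del: letter_star.simps(1))
  finally show ?case .
qed

text \<open>The degenerate case of the Cauchy-Schwarz inequality.\<close>

lemma state_null:
  assumes x: "x \<in> carrier A" and y: "y \<in> carrier A" and 0: "state A (star A x \<otimes> x) = 0"
  shows "state A (star A x \<otimes> y) = 0"
proof (rule ccontr)
  define b where "b = state A (star A x \<otimes> y)"
  define c where "c = Re (state A (star A y \<otimes> y))"
  assume "state A (star A x \<otimes> y) \<noteq> 0"
  then have b: "b \<noteq> 0" by (simp add: b_def)
  \<comment> \<open>Chosen such that \<open>c + 2 Re (t cnj b)\<close> becomes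
    \<open>c - (c + 1) = -1\<close>, against positivity.\<close>
  define t where "t = complex_of_real (- (c + 1) / (2 * (cmod b)\<^sup>2)) * b"
  let ?z = "y \<oplus> t \<odot> x"
  have yx: "state A (star A y \<otimes> x) = cnj b"
    using state_star[of "star A x \<otimes> y"] x y by (simp add: b_def star_mult star_star)
  have "star A ?z \<otimes> ?z = (star A y \<otimes> y \<oplus> t \<odot> (star A y \<otimes> x)) \<oplus>
      (cnj t \<odot> (star A x \<otimes> y) \<oplus> (cnj t * t) \<odot> (star A x \<otimes> x))"
    using x y by (simp add: star_add star_smult alg.l_distr alg.r_distr smult_mult_left smult_mult_right
        smult_smult smult_add_right alg.a_ac mult.commute)
  then have "state A (star A ?z \<otimes> ?z) = state A (star A y \<otimes> y) + t * cnj b + cnj t * b"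
    using x y 0 by (simp add: state_add state_smult yx b_def)
  then have "Re (state A (star A ?z \<otimes> ?z)) = c + 2 * Re (t * cnj b)"
    by (simp add: c_def)
  also have "t * cnj b = complex_of_real (- (c + 1) / (2 * (cmod b)\<^sup>2) * (cmod b)\<^sup>2)"
    unfolding t_def using complex_norm_square[of b] by (simp add: mult.assoc)
  also have "\<dots> = complex_of_real (- (c + 1) / 2)" using b by simp
  finally have "Re (state A (star A ?z \<otimes> ?z)) = - 1" by simp
  moreover have "0 \<le> Re (state A (star A ?z \<otimes> ?z))" using state_pos[of ?z] x y by simp
  ultimately show False by simp
qed

text \<open>Gram-Schmidt elimination: removing the component along \<open>z k\<close> from all
  vectors splits off one rank-one term and leaves the kernel of the remaining vectors.\<close>

lemma gram_state:
  assumes "finite S" "\<And>i. i \<in> S \<Longrightarrow> z i \<in> carrier A"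
  shows "gram S (\<lambda>i j. state A (star A (z i) \<otimes> z j))"
  using assms
proof (induction S arbitrary: z)
  case empty
  then show ?case by (simp add: gram_def)
next
  case (insert k S)
  note [simp] = insert.prems
  define c where "c = state A (star A (z k) \<otimes> z k)"
  define r where "r i = (if c = 0 then 0 else state A (star A (z k) \<otimes> z i) / c)" for i
  define z' where "z' i = z i \<oplus> (- r i) \<odot> z k" for i
  have [simp]: "z' i \<in> carrier A" if "i \<in> insert k S" for i using that by (simp add: z'_def)
  obtain fs where fs: "\<And>i j. i \<in> S \<Longrightarrow> j \<in> S \<Longrightarrow> state A (star A (z' i) \<otimes> z' j) = (\<Sum>f\<leftarrow>fs. cnj (f i) * f j)"
    using insert.IH[of z'] unfolding gram_def by auto
  have c: "c = complex_of_real (Re c)" "0 \<le> Re c"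
    using state_pos[of "z k"] by (simp_all add: c_def complex_eq_iff)
  have kz: "state A (star A (z k) \<otimes> z i) = r i * c" if "i \<in> insert k S" for i
    using state_null[of "z k" "z i"] that by (auto simp: r_def c_def)
  have zk: "state A (star A (z i) \<otimes> z k) = cnj (r i) * c" if "i \<in> insert k S" for i
  proof -
    have "state A (star A (z i) \<otimes> z k) = cnj (state A (star A (z k) \<otimes> z i))"
      using that by (simp add: star_mult star_star flip: state_star)
    also have "\<dots> = cnj (r i) * c" using c(1) by (simp add: kz[OF that]) (metis complex_cnj_complex_of_real)
    finally show ?thesis .
  qed
  have z: "state A (star A (z i) \<otimes> z j) = state A (star A (z' i) \<otimes> z' j) + cnj (r i) * r j * c"
    if "i \<in> insert k S" "j \<in> insert k S" for i j
  proof -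
    have "star A (z' i) \<otimes> z' j = (star A (z i) \<otimes> z j \<oplus> (- r j) \<odot> (star A (z i) \<otimes> z k)) \<oplus>
       ((- cnj (r i)) \<odot> (star A (z k) \<otimes> z j) \<oplus> (cnj (r i) * r j) \<odot> (star A (z k) \<otimes> z k))"
      using that by (simp add: z'_def star_add star_smult alg.l_distr alg.r_distr smult_mult_left smult_mult_right
        smult_smult smult_add_right alg.a_ac mult.commute)
    then have "state A (star A (z' i) \<otimes> z' j) = state A (star A (z i) \<otimes> z j) - r j * (cnj (r i) * c)
       - cnj (r i) * (r j * c) + cnj (r i) * r j * c"
      using that by (simp add: state_add state_smult zk kz c_def[symmetric])
    then show ?thesis by (simp add: algebra_simps)
  qed
  have rk: "r k * c = c" by (simp add: r_def c_def)
  have z'k: "state A (star A (z' i) \<otimes> z' j) = 0" if "i = k \<or> j = k" "i \<in> insert k S" "j \<in> insert k S" for i j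
    using z[OF that(2,3)] that kz[of j] zk[of i] rk by (auto simp: mult.commute mult.left_commute)
  define g where "g i = complex_of_real (sqrt (Re c)) * r i" for i
  \<comment> \<open>The factors from the induction hypothesis are uncontrolled at \<open>k\<close>.
    They are set to 0 there, which is consistent because \<open>z' k\<close> is orthogonal to every
    \<open>z' i\<close>.\<close>
  have "state A (star A (z i) \<otimes> z j) =
      (\<Sum>f\<leftarrow>g # map (\<lambda>f. f(k := 0)) fs. cnj (f i) * f j)" if "i \<in> insert k S" "j \<in> insert k S" for i j
  proof -
    have "complex_of_real (sqrt (Re c)) * complex_of_real (sqrt (Re c)) = c"
      using c by (simp flip: of_real_mult)
    then have "cnj (g i) * g j = cnj (r i) * r j * c"
      by (simp add: g_def algebra_simps)
    moreover have "state A (star A (z' i) \<otimes> z' j) = (\<Sum>f\<leftarrow>map (\<lambda>f. f(k := 0)) fs. cnj (f i) * f j)"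
    proof (cases "i = k \<or> j = k")
      case True
      then have "(\<Sum>f\<leftarrow>map (\<lambda>f. f(k := 0)) fs. cnj (f i) * f j) = 0"
        by (induction fs) auto
      then show ?thesis using z'k[OF True that] by simp
    next
      case False
      then show ?thesis using that fs[of i j] insert.hyps by (simp add: comp_def)
    qed
    ultimately show ?thesis using z[OF that] by simp
  qed
  then show ?case unfolding gram_def by blast
qed

text \<open>Induction on the length, as the pieces behind the uncontracted letter are shorter. A
  factor \<open>f\<close> of \<open>kernel0\<close> and a factor \<open>g\<close> of the shorter
  kernel combine to one new factor, the sum of \<open>f u1 * g u2\<close> over the
  splittings.\<close>

lemma gram_fock_kernel:
  assumes L: "finite L"
  shows "gram {w. set w \<subseteq> L \<and> length w \<le> l} (fock_kernel N)"
proof (induction l)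
  have fin: "finite {w. set w \<subseteq> L \<and> length w \<le> l}" for l
    using finite_lists_length_le[OF L] by simp
  have k0: "gram {w. set w \<subseteq> L \<and> length w \<le> l} kernel0" for l
    using gram_state[OF fin, of l cexp] by (simp add: kernel0_def[abs_def] moment_def)
  {
    case 0
    have "fock_kernel N u v = kernel0 u v" if "u \<in> {w. set w \<subseteq> L \<and> length w \<le> 0}" for u v
      using that by (simp add: fock_kernel_Nil kernel0_Nil)
    moreover obtain fs where "\<forall>u\<in>{w. set w \<subseteq> L \<and> length w \<le> 0}. \<forall>v\<in>{w. set w \<subseteq> L \<and> length w \<le> 0}.
        kernel0 u v = (\<Sum>f\<leftarrow>fs. cnj (f u) * f v)"
      using k0[of 0] unfolding gram_def by blast
    ultimately show ?case unfolding gram_def by (intro exI[of _ fs]) auto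
  next
    case (Suc l)
    let ?S = "{w. set w \<subseteq> L \<and> length w \<le> l}" and ?S' = "{w. set w \<subseteq> L \<and> length w \<le> Suc l}"
    obtain fs where fs: "\<forall>u\<in>?S'. \<forall>v\<in>?S'. kernel0 u v = (\<Sum>f\<leftarrow>fs. cnj (f u) * f v)"
      using k0[of "Suc l"] unfolding gram_def by blast
    obtain gs where gs: "\<forall>u\<in>?S. \<forall>v\<in>?S. fock_kernel N u v = (\<Sum>g\<leftarrow>gs. cnj (g u) * g v)"
      using Suc unfolding gram_def by blast
    define hs where "hs = [\<lambda>u. split_sum s u (\<lambda>u1 u2. f u1 * g u2). s \<leftarrow> [0..<N], f \<leftarrow> fs, g \<leftarrow> gs]"
    have "fock_kernel N u v = (\<Sum>f\<leftarrow>fs @ hs. cnj (f u) * f v)" if uv: "u \<in> ?S'" "v \<in> ?S'" for u v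
    proof -
      have "split_sum s u (\<lambda>u1 u2. split_sum s v (\<lambda>v1 v2. kernel0 u1 v1 * fock_kernel N u2 v2)) =
          (\<Sum>f\<leftarrow>fs. \<Sum>g\<leftarrow>gs. cnj (split_sum s u (\<lambda>u1 u2. f u1 * g u2)) * split_sum s v (\<lambda>u1 u2. f u1 * g u2))" for s
      proof -
        have "split_sum s u (\<lambda>u1 u2. split_sum s v (\<lambda>v1 v2. kernel0 u1 v1 * fock_kernel N u2 v2)) =
          split_sum s u (\<lambda>u1 u2. split_sum s v (\<lambda>v1 v2. \<Sum>f\<leftarrow>fs. \<Sum>g\<leftarrow>gs. cnj (f u1 * g u2) * (f v1 * g v2)))"
        proof (intro split_sum_cong)
          fix u1 u2 v1 v2 assume "u = u1 @ Inr s # u2" "v = v1 @ Inr s # v2"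
          then have "kernel0 u1 v1 * fock_kernel N u2 v2 = (\<Sum>f\<leftarrow>fs. cnj (f u1) * f v1) * (\<Sum>g\<leftarrow>gs. cnj (g u2) * g v2)"
            using uv by (intro arg_cong2[of _ _ _ _ "(*)"] fs[rule_format] gs[rule_format]) auto
          also have "\<dots> = (\<Sum>f\<leftarrow>fs. \<Sum>g\<leftarrow>gs. cnj (f u1 * g u2) * (f v1 * g v2))"
            unfolding sum_list_mult_const[symmetric] by (simp add: sum_list_const_mult[symmetric] mult_ac)
          finally show "kernel0 u1 v1 * fock_kernel N u2 v2 = (\<Sum>f\<leftarrow>fs. \<Sum>g\<leftarrow>gs. cnj (f u1 * g u2) * (f v1 * g v2))" .
        qed
        also have "\<dots> = (\<Sum>f\<leftarrow>fs. \<Sum>g\<leftarrow>gs. split_sum s u (\<lambda>u1 u2. split_sum s v (\<lambda>v1 v2. cnj (f u1 * g u2) * (f v1 * g v2))))"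
          by (simp only: sum_list_split_sum)
        also have "\<dots> = (\<Sum>f\<leftarrow>fs. \<Sum>g\<leftarrow>gs. cnj (split_sum s u (\<lambda>u1 u2. f u1 * g u2)) * split_sum s v (\<lambda>u1 u2. f u1 * g u2))"
          by (simp add: split_sum_mult_left split_sum_mult_right split_sum_hom[where h = cnj])
        finally show ?thesis .
      qed
      then show ?thesis
        using fs[rule_format, OF uv] by (simp add: fock_kernel.simps[of N u] hs_def map_concat sum_list_concat comp_def)
    qed
    then show ?case unfolding gram_def by blast
  }
qed

lemma moment_positive:
  fixes ps :: "(complex \<times> ('u + nat) list) list"
  defines "m \<equiv> (\<Sum>(c, u)\<leftarrow>ps. cnj c * lin (\<lambda>v. moment \<one> (word_star u @ v)) ps)"
  shows "Im m = 0 \<and> 0 \<le> Re m"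
proof -
  \<comment> \<open>The rank-one representation is available on finite sets of words only;
    \<open>L\<close>, \<open>l\<close> and \<open>N\<close> bound the letters, lengths and
    semicircular indices that occur in \<open>ps\<close>.\<close>
  define L where "L = (\<Union>(c, w)\<in>set ps. set w)"
  define l where "l = (\<Sum>(c, w)\<leftarrow>ps. length w)"
  obtain N where N: "\<forall>s. Inr s \<in> L \<longrightarrow> s < N"
  proof -
    have "finite (Inr -` L)" unfolding L_def by (intro finite_vimageI) auto
    then show thesis using that by (metis finite_nat_set_iff_bounded vimageI)
  qed
  have "finite L" by (auto simp: L_def)
  from gram_fock_kernel[OF this, of l N] obtain fs where
    fs: "\<And>u v. set u \<subseteq> L \<Longrightarrow> length u \<le> l \<Longrightarrow> set v \<subseteq> L \<Longrightarrow> length v \<le> l \<Longrightarrow> fock_kernel N u v = (\<Sum>f\<leftarrow>fs. cnj (f u) * f v)"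
    unfolding gram_def by blast
  have in_L: "set w \<subseteq> L \<and> length w \<le> l" if "(c, w) \<in> set ps" for c w
    using that member_le_sum_list[of "length w" "map (\<lambda>(c, w). length w) ps"] by (force simp: L_def l_def)
  have mk: "moment \<one> (word_star u @ v) = (\<Sum>f\<leftarrow>fs. cnj (f u) * f v)"
    if "(c, u) \<in> set ps" "(d, v) \<in> set ps" for c d u v
    using moment_word_star_append[of u N v] N in_L[OF that(1)] in_L[OF that(2)] fs by auto
  have "m = (\<Sum>(c, u)\<leftarrow>ps. cnj c * lin (\<lambda>v. \<Sum>f\<leftarrow>fs. cnj (f u) * f v) ps)"
    unfolding m_def lin_def using mk by (intro arg_cong[of _ _ sum_list] map_cong) (auto intro!: arg_cong[of _ _ sum_list])
  also have "\<dots> = (\<Sum>f\<leftarrow>fs. (\<Sum>(c, u)\<leftarrow>ps. cnj c * cnj (f u)) * lin f ps)"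
  proof -
    have 1: "lin (\<lambda>v. \<Sum>f\<leftarrow>fs. cnj (f u) * f v) Y = (\<Sum>f\<leftarrow>fs. cnj (f u) * lin f Y)" for u Y
      by (induction fs) (auto simp: lin_def case_prod_unfold distrib_left sum_list_addf sum_list_const_mult[symmetric] mult_ac)
    have 2: "(\<Sum>(c, u)\<leftarrow>Y. cnj c * (\<Sum>f\<leftarrow>fs. cnj (f u) * g f)) = (\<Sum>f\<leftarrow>fs. (\<Sum>(c, u)\<leftarrow>Y. cnj c * cnj (f u)) * g f)"
      for Y and g :: "_ \<Rightarrow> complex"
    proof (induction Y)
      case (Cons y Y)
      have "(\<Sum>f\<leftarrow>fs. (cnj c * cnj (f u) + k f) * g f) = cnj c * (\<Sum>f\<leftarrow>fs. cnj (f u) * g f) + (\<Sum>f\<leftarrow>fs. k f * g f)"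
        for c u and k :: "_ \<Rightarrow> complex"
        by (simp add: distrib_right sum_list_addf sum_list_const_mult mult.assoc)
      then show ?case using Cons by (cases y) simp
    qed simp
    show ?thesis unfolding 1 by (rule 2)
  qed
  also have "\<dots> = (\<Sum>f\<leftarrow>fs. cnj (lin f ps) * lin f ps)"
    by (simp add: lin_def sum_list_cnj comp_def case_prod_unfold)
  also have "\<dots> = complex_of_real (\<Sum>f\<leftarrow>fs. (cmod (lin f ps))\<^sup>2)"
    by (induction fs) (simp_all add: complex_norm_square mult.commute del: of_real_power)
  finally have "m = complex_of_real (\<Sum>f\<leftarrow>fs. (cmod (lin f ps))\<^sup>2)" .
  then show ?thesis by (auto intro!: sum_list_nonneg)
qed

end

section \<open>Word polynomials, their coding in the given type, and the quotient\<close>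

text \<open>The enlargement is to be built on the type \<open>'u\<close> itself, so formal word
  polynomials must inject into it. An infinite type is equipotent with its square, and iterated
  pairing codes lists.\<close>

lemma inj_list_if_infinite:
  assumes inf: "infinite (UNIV :: 'a set)"
  shows "\<exists>f :: 'a list \<Rightarrow> 'a. inj f"
proof -
  have "\<exists>f. bij_betw f ((UNIV :: 'a set) \<times> (UNIV :: 'a set)) (UNIV :: 'a set)"
    using card_of_Times_same_infinite[OF inf] card_of_ordIso by blast
  then obtain pr :: "'a \<times> 'a \<Rightarrow> 'a" where "inj pr"
    using bij_betw_imp_inj_on by fastforce
  then have pr: "pr (a, b) = pr (c, d) \<longleftrightarrow> a = c \<and> b = d" for a b c d
    by (auto dest: injD)
  obtain z :: "nat \<Rightarrow> 'a" where z: "inj z"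
    using infinite_countable_subset[OF inf] by auto
  define g where "g xs = foldr (\<lambda>x y. pr (x, y)) xs (z 0)" for xs
  have g: "length xs = length ys \<Longrightarrow> g xs = g ys \<Longrightarrow> xs = ys" for xs ys
    by (induction xs ys rule: list_induct2) (auto simp: g_def pr)
  \<comment> \<open>Iterated pairing separates only lists of equal length, hence the length as first
    component.\<close>
  have "inj (\<lambda>xs. pr (z (length xs), g xs))"
    by (auto intro!: injI simp: pr inj_eq[OF z] intro: g)
  then show ?thesis by blast
qed

type_synonym 'u word_poly = "(complex \<times> ('u + nat) list) list"

definition pmul :: "(complex \<times> 'a list) list \<Rightarrow> (complex \<times> 'a list) list \<Rightarrow> (complex \<times> 'a list) list" where
  "pmul ps qs = concat (map (\<lambda>(c, w). map (\<lambda>(d, x). (c * d, w @ x)) qs) ps)"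

definition psmult :: "complex \<Rightarrow> (complex \<times> 'a) list \<Rightarrow> (complex \<times> 'a) list" where
  "psmult k ps = map (\<lambda>(c, w). (k * c, w)) ps"

lemma pmul_simps [simp]:
  "pmul [] qs = []" "pmul ((c, w) # ps) qs = map (\<lambda>(d, x). (c * d, w @ x)) qs @ pmul ps qs"
  by (simp_all add: pmul_def)

lemma lin_pmul: "lin h (pmul ps qs) = lin (\<lambda>w. lin (\<lambda>x. h (w @ x)) qs) ps"
proof -
  have "lin h (map (\<lambda>(d, x). (c * d, w @ x)) qs) = c * lin (\<lambda>x. h (w @ x)) qs" for c w
    by (induction qs) (auto simp: distrib_left)
  then show ?thesis by (induction ps) auto
qed

lemma lin_psmult: "lin h (psmult k ps) = k * lin h ps"
  by (induction ps) (auto simp: psmult_def distrib_left)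

context tracial_star_prob_space
begin

text \<open>Relations of the base algebra stay valid inside every word. As \<open>x\<close> has only
  letters of the base algebra, a pairing of the leading semicircular splits \<open>u @ x @ v\<close>
  inside \<open>u\<close> or inside \<open>v\<close>, and the piece that contains \<open>x\<close>
  has the same form with a shorter prefix.\<close>

lemma lin_moment_insert:
  assumes "\<And>c x. (c, x) \<in> set ps \<union> set qs \<Longrightarrow> x \<in> range (map Inl)"
    and eq: "\<And>a v. a \<in> carrier A \<Longrightarrow> lin (\<lambda>x. moment a (x @ v)) ps = lin (\<lambda>x. moment a (x @ v)) qs"
    and "a \<in> carrier A"
  shows "lin (\<lambda>x. moment a (u @ x @ v)) ps = lin (\<lambda>x. moment a (u @ x @ v)) qs"
  using assms(3)
proof (induction "length u" arbitrary: u v a rule: less_induct)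
  case less
  show ?case
  proof (cases u)
    case Nil
    then show ?thesis using eq less.prems by simp
  next
    case (Cons y u')
    show ?thesis
    proof (cases y)
      case (Inl b)
      then show ?thesis using less.hyps[of u' "a \<otimes> emb b" v] less.prems Cons by simp
    next
      case (Inr s)
      have no_split: "split_sum s (map Inl x) f = 0" for x and f :: "_ \<Rightarrow> _ \<Rightarrow> complex"
        by (induction x arbitrary: f) auto
      have *: "lin (\<lambda>x. moment a (u @ x @ v)) rs =
          split_sum s u' (\<lambda>p q. moment \<one> p * lin (\<lambda>x. moment a (q @ x @ v)) rs) +
          split_sum s v (\<lambda>p q. lin (\<lambda>x. moment \<one> (u' @ x @ p)) rs * moment a q)"
        if "set rs \<subseteq> set ps \<union> set qs" for rs
      proof -
        have "lin (\<lambda>x. moment a (u @ x @ v)) rs =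
          lin (\<lambda>x. split_sum s u' (\<lambda>p q. moment \<one> p * moment a (q @ x @ v)) +
            split_sum s v (\<lambda>p q. moment \<one> (u' @ x @ p) * moment a q)) rs"
        proof (rule lin_cong)
          fix c x assume "(c, x) \<in> set rs"
          then have "(c, x) \<in> set ps \<union> set qs" using that by blast
          then obtain x' where "x = map Inl x'" using assms(1)[of c x] by blast
          then show "moment a (u @ x @ v) = split_sum s u' (\<lambda>p q. moment \<one> p * moment a (q @ x @ v)) +
            split_sum s v (\<lambda>p q. moment \<one> (u' @ x @ p) * moment a q)"
            using Cons Inr less.prems by (simp add: split_sum_append no_split)
        qed
        then show ?thesis
          by (simp add: lin_add lin_split_sum lin_const_mult lin_mult_const)
      qed
      show ?thesis
        unfolding *[OF Un_upper1] *[OF Un_upper2]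
      proof (rule arg_cong2[of _ _ _ _ "(+)"]; rule split_sum_cong)
        fix p q assume "u' = p @ Inr s # q"
        then show "moment \<one> p * lin (\<lambda>x. moment a (q @ x @ v)) ps = moment \<one> p * lin (\<lambda>x. moment a (q @ x @ v)) qs"
          using less.hyps[of q a v] less.prems Cons by simp
      next
        fix p q
        show "lin (\<lambda>x. moment \<one> (u' @ x @ p)) ps * moment a q = lin (\<lambda>x. moment \<one> (u' @ x @ p)) qs * moment a q"
          using less.hyps[of u' \<one> p] Cons by simp
      qed
    qed
  qed
qed

text \<open>The homomorphism that maps the semicirculars to zero. It keeps \<open>A\<close> embedded in the quotient
  although \<open>\<phi>\<close> need not be faithful.\<close>

fun word_val :: "('u + nat) list \<Rightarrow> 'u" where
  "word_val [] = \<one>"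
| "word_val (Inl a # w) = emb a \<otimes> word_val w"
| "word_val (Inr s # w) = \<zero>"

definition poly_val :: "'u word_poly \<Rightarrow> 'u" where
  "poly_val ps = asum (map (\<lambda>(c, w). c \<odot> word_val w) ps)"

definition ev :: "('u + nat) list \<Rightarrow> ('u + nat) list \<Rightarrow> 'u word_poly \<Rightarrow> complex" where
  "ev u v ps = lin (\<lambda>w. moment \<one> (u @ w @ v)) ps"

text \<open>The first part is congruence modulo the kernel of the trace form; letting
  \<open>u\<close> and \<open>v\<close> vary on both sides makes the compatibility with products
  immediate.\<close>

definition peq :: "'u word_poly \<Rightarrow> 'u word_poly \<Rightarrow> bool" where
  "peq ps qs \<longleftrightarrow> (\<forall>u v. ev u v ps = ev u v qs) \<and> poly_val ps = poly_val qs"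

definition pstar :: "'u word_poly \<Rightarrow> 'u word_poly" where
  "pstar ps = map (\<lambda>(c, w). (cnj c, word_star w)) ps"

lemma word_val_closed [simp, intro]: "word_val w \<in> carrier A"
  by (induction w rule: word_val.induct) auto

lemma word_val_append: "word_val (u @ v) = word_val u \<otimes> word_val v"
  by (induction u rule: word_val.induct) (auto simp: alg.m_assoc)

lemma poly_val_closed [simp, intro]: "poly_val ps \<in> carrier A"
  by (auto simp: poly_val_def intro!: asum_closed)

lemma poly_val_simps [simp]:
  "poly_val [] = \<zero>" "poly_val ((c, w) # ps) = c \<odot> word_val w \<oplus> poly_val ps"
  by (simp_all add: poly_val_def)

lemma poly_val_append [simp]: "poly_val (ps @ qs) = poly_val ps \<oplus> poly_val qs"
  by (induction ps) (auto simp: alg.a_assoc)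

lemma poly_val_pmul: "poly_val (pmul ps qs) = poly_val ps \<otimes> poly_val qs"
proof -
  have "poly_val (map (\<lambda>(d, x). (c * d, w @ x)) qs) = (c \<odot> word_val w) \<otimes> poly_val qs" for c w
    by (induction qs)
      (auto simp: word_val_append alg.r_distr smult_mult_left smult_mult_right smult_smult smult_add_right)
  then show ?thesis by (induction ps) (auto simp: alg.l_distr)
qed

lemma poly_val_psmult: "poly_val (psmult k ps) = k \<odot> poly_val ps"
  by (induction ps) (auto simp: psmult_def smult_add_right smult_smult)

lemma word_val_star: "word_val (word_star w) = star A (word_val w)"
proof (induction w)
  case (Cons x w)
  then show ?case
    by (cases x) (auto simp: word_val_append star_mult emb_star simp del: if_split)
qed simp

lemma poly_val_pstar: "poly_val (pstar ps) = star A (poly_val ps)"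
  by (induction ps) (auto simp: pstar_def star_add star_smult word_val_star)

lemma ev_pmul: "ev u v (pmul ps qs) = lin (\<lambda>w. ev (u @ w) v qs) ps"
  by (simp add: ev_def lin_pmul)

lemma ev_pmul': "ev u v (pmul ps qs) = lin (\<lambda>x. ev u (x @ v) ps) qs"
  by (simp add: ev_def lin_pmul lin_swap[of _ qs])

lemma ev_pstar: "ev u v (pstar ps) = cnj (ev (word_star v) (word_star u) ps)"
proof -
  have "moment \<one> (u @ word_star w @ v) = cnj (moment \<one> (word_star v @ w @ word_star u))" for w
    using moment_star[of \<one> "word_star v @ w @ word_star u"] by simp
  then show ?thesis by (induction ps) (auto simp: ev_def pstar_def)
qed

lemma peq_refl: "peq ps ps" and peq_sym: "peq ps qs \<Longrightarrow> peq qs ps"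
  and peq_trans: "peq ps qs \<Longrightarrow> peq qs rs \<Longrightarrow> peq ps rs"
  by (auto simp: peq_def)

lemma peq_append: "peq ps ps' \<Longrightarrow> peq qs qs' \<Longrightarrow> peq (ps @ qs) (ps' @ qs')"
  by (simp add: peq_def ev_def)

lemma peq_pmul: "peq ps ps' \<Longrightarrow> peq qs qs' \<Longrightarrow> peq (pmul ps qs) (pmul ps' qs')"
proof -
  assume 1: "peq ps ps'" and 2: "peq qs qs'"
  have "ev u v (pmul ps qs) = ev u v (pmul ps' qs')" for u v
  proof -
    have "ev u v (pmul ps qs) = ev u v (pmul ps qs')"
      using 2 by (simp add: ev_pmul peq_def)
    also have "\<dots> = ev u v (pmul ps' qs')"
      using 1 by (simp add: ev_pmul' peq_def)
    finally show ?thesis .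
  qed
  then show ?thesis using 1 2 by (simp add: peq_def poly_val_pmul)
qed

lemma peq_psmult: "peq ps qs \<Longrightarrow> peq (psmult k ps) (psmult k qs)"
  by (simp add: peq_def ev_def lin_psmult poly_val_psmult)

lemma peq_pstar: "peq ps qs \<Longrightarrow> peq (pstar ps) (pstar qs)"
  by (simp add: peq_def ev_pstar poly_val_pstar)

text \<open>The type is infinite because \<phi>(1) = 1 separates the scalar multiples of the unit;
  these multiples also serve as codes of complex numbers.\<close>

lemma ex_poly_code: "\<exists>g :: 'u word_poly \<Rightarrow> 'u. inj g"
proof -
  have inj_k: "inj (\<lambda>c :: complex. c \<odot> \<one>)"
    by (rule injI) (metis state_smult state_one mult.right_neutral alg.one_closed)
  then have inf: "infinite (UNIV :: 'u set)"
    by (metis UNIV_I ex_new_if_finite finite_imageD infinite_UNIV_char_0 finite_subset subset_UNIV)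
  obtain r :: "'u list \<Rightarrow> 'u" where r: "inj r" using inj_list_if_infinite[OF inf] by blast
  define k where "k c = c \<odot> \<one>" for c :: complex
  have k: "inj k" unfolding k_def by (rule inj_k)
  define f where "f x = (case x of Inl a \<Rightarrow> r [a] | Inr s \<Rightarrow> r [k (of_nat s), k (of_nat s)])" for x :: "'u + nat"
  have f: "inj f"
    by (auto intro!: injI simp: f_def inj_eq[OF r] inj_eq[OF k] split: sum.splits)
  define h where "h = (\<lambda>(c, w). r [k c, r (map f w)])"
  have h: "inj h"
    by (auto intro!: injI simp: h_def inj_eq[OF r] inj_eq[OF k] inj_eq[OF inj_mapI[OF f]])
  have "inj (\<lambda>ps. r (map h ps))"
    using inj_compose[OF r inj_mapI[OF h]] by (simp add: comp_def)
  then show ?thesis by blast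
qed

text \<open>The quotient by \<open>peq\<close> realized inside \<open>'u\<close>: a representative
  of the class is chosen and then coded injectively. Equivalent polynomials get the same code
  because \<open>peq ps\<close> and \<open>peq qs\<close> are then equal predicates.\<close>

definition code :: "'u word_poly \<Rightarrow> 'u" where
  "code ps = (SOME g :: 'u word_poly \<Rightarrow> 'u. inj g) (SOME qs. peq ps qs)"

definition decode :: "'u \<Rightarrow> 'u word_poly" where
  "decode x = (SOME ps. code ps = x)"

lemma code_eq_iff: "code ps = code qs \<longleftrightarrow> peq ps qs"
proof
  have inj: "inj (SOME g :: 'u word_poly \<Rightarrow> 'u. inj g)"
    using ex_poly_code by (rule someI_ex)
  assume "code ps = code qs"
  then have "(SOME rs. peq ps rs) = (SOME rs. peq qs rs)"
    unfolding code_def by (rule injD[OF inj])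
  moreover have "peq ps (SOME rs. peq ps rs)" "peq qs (SOME rs. peq qs rs)"
    using peq_refl by (blast intro: someI)+
  ultimately show "peq ps qs" by (metis peq_sym peq_trans)
next
  assume "peq ps qs"
  then have "peq ps = peq qs" using peq_sym peq_trans by blast
  then show "code ps = code qs" by (simp add: code_def)
qed

lemma peq_decode: "peq (decode (code ps)) ps"
  unfolding decode_def code_eq_iff[symmetric] by (rule someI) simp

text \<open>The operations act on arbitrary representatives; the congruence properties of
  \<open>peq\<close> remove \<open>decode\<close> from all rules that follow.\<close>

definition semicircular_extension :: "'u star_prob" where
  "semicircular_extension = \<lparr>
     carrier = range code,
     monoid.mult = (\<lambda>x y. code (pmul (decode x) (decode y))),
     one = code [(1, [])],
     ring.zero = code [],
     add = (\<lambda>x y. code (decode x @ decode y)),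
     smult = (\<lambda>c x. code (psmult c (decode x))),
     star = (\<lambda>x. code (pstar (decode x))),
     state = (\<lambda>x. ev [] [] (decode x))\<rparr>"

abbreviation "B \<equiv> semicircular_extension"

lemma carrier_ext: "carrier B = range code"
  and mult_ext: "code ps \<otimes>\<^bsub>B\<^esub> code qs = code (pmul ps qs)"
  and one_ext: "\<one>\<^bsub>B\<^esub> = code [(1, [])]"
  and zero_ext: "\<zero>\<^bsub>B\<^esub> = code []"
  and add_ext: "code ps \<oplus>\<^bsub>B\<^esub> code qs = code (ps @ qs)"
  and smult_ext: "c \<odot>\<^bsub>B\<^esub> code ps = code (psmult c ps)"
  and star_ext: "star B (code ps) = code (pstar ps)"
  using peq_decode[of ps] peq_decode[of qs]
  by (simp_all add: semicircular_extension_def code_eq_iff peq_pmul peq_append peq_psmult peq_pstar)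

lemma state_ext: "state B (code ps) = lin (moment \<one>) ps"
proof -
  have "ev [] [] (decode (code ps)) = ev [] [] ps" using peq_decode[of ps] unfolding peq_def by blast
  then show ?thesis by (simp add: semicircular_extension_def ev_def)
qed

lemmas ext_simps = mult_ext one_ext zero_ext add_ext smult_ext star_ext state_ext

lemma ring_ext: "ring B"
proof (rule ringI)
  show "abelian_group B"
  proof (rule abelian_groupI)
    fix x assume "x \<in> carrier B"
    then obtain ps where x: "x = code ps" by (auto intro: rangeI simp: carrier_ext)
    have "code (psmult (-1) ps) \<oplus>\<^bsub>B\<^esub> x = \<zero>\<^bsub>B\<^esub>"
      by (simp add: x ext_simps code_eq_iff peq_def ev_def lin_psmult poly_val_psmult alg.l_neg flip: minus_eq_smult)
    then show "\<exists>y\<in>carrier B. y \<oplus>\<^bsub>B\<^esub> x = \<zero>\<^bsub>B\<^esub>" by (auto intro: rangeI simp: carrier_ext)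
  qed (auto intro: rangeI simp: carrier_ext ext_simps code_eq_iff peq_def ev_def alg.a_ac)
  show "Group.monoid B"
  proof (rule monoidI)
    fix x y z assume "x \<in> carrier B" "y \<in> carrier B" "z \<in> carrier B"
    then show "x \<otimes>\<^bsub>B\<^esub> y \<otimes>\<^bsub>B\<^esub> z = x \<otimes>\<^bsub>B\<^esub> (y \<otimes>\<^bsub>B\<^esub> z)"
      by (auto intro: rangeI simp: carrier_ext ext_simps code_eq_iff peq_def ev_def lin_pmul poly_val_pmul alg.m_assoc)
  qed (auto intro: rangeI simp: carrier_ext ext_simps code_eq_iff peq_def ev_def lin_pmul poly_val_pmul)
qed (auto intro: rangeI simp: carrier_ext ext_simps code_eq_iff peq_def ev_def lin_pmul lin_add poly_val_pmul alg.l_distr alg.r_distr)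

lemma tracial_star_prob_space_ext: "tracial_star_prob_space B"
proof -
  have "module (ring_of_type_algebra :: complex ring) B"
  proof (rule moduleI)
    show "cring (ring_of_type_algebra :: complex ring)" by (rule cring_from_type_algebra)
    show "abelian_group B" using ring_ext by (rule ring.axioms)
  qed (auto intro: rangeI simp: carrier_ext ext_simps code_eq_iff peq_def ev_def lin_psmult poly_val_psmult distrib_right distrib_left
      smult_add_left smult_add_right smult_smult)
  moreover have "tracial_star_prob_space_axioms B"
  proof
    fix x assume "x \<in> carrier B"
    then obtain ps where x: "x = code ps" by (auto intro: rangeI simp: carrier_ext)
    have "state B (star B x \<otimes>\<^bsub>B\<^esub> x) = (\<Sum>(c, u)\<leftarrow>ps. cnj c * lin (\<lambda>v. moment \<one> (word_star u @ v)) ps)"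
      by (simp add: x ext_simps lin_pmul pstar_def) (simp add: lin_def comp_def case_prod_unfold)
    then show "Im (state B (star B x \<otimes>\<^bsub>B\<^esub> x)) = 0 \<and> 0 \<le> Re (state B (star B x \<otimes>\<^bsub>B\<^esub> x))"
      using moment_positive[of ps] by simp
  next
    fix x y assume "x \<in> carrier B" "y \<in> carrier B"
    then obtain ps qs where xy: "x = code ps" "y = code qs" by (auto intro: rangeI simp: carrier_ext)
    show "state B (x \<otimes>\<^bsub>B\<^esub> y) = state B (y \<otimes>\<^bsub>B\<^esub> x)"
      by (simp add: xy ext_simps lin_pmul lin_swap[of _ qs ps]) (simp add: moment_append_commute)
    have *: "lin h (pstar (pmul ps qs)) = lin h (pmul (pstar qs) (pstar ps))" for h :: "_ \<Rightarrow> complex"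
    proof -
      have 1: "lin h (pstar rs) = cnj (lin (\<lambda>w. cnj (h (word_star w))) rs)" for rs and h :: "_ \<Rightarrow> complex"
        by (induction rs) (auto simp: pstar_def)
      show ?thesis by (simp add: 1 lin_pmul) (subst lin_swap, simp)
    qed
    show "star B (x \<otimes>\<^bsub>B\<^esub> y) = star B y \<otimes>\<^bsub>B\<^esub> star B x"
      by (simp add: xy ext_simps code_eq_iff peq_def ev_def * poly_val_pstar poly_val_pmul star_mult)
  qed (auto intro: rangeI simp: carrier_ext ext_simps code_eq_iff peq_def ev_pstar poly_val_pstar poly_val_pmul poly_val_psmult
      lin_pmul lin_psmult smult_mult_left smult_mult_right lin_const_mult star_star star_add star_smult state_one
      , auto simp: ev_pstar[unfolded ev_def] ev_def lin_pmul lin_psmult lin_const_mult)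
  ultimately show ?thesis
    using ring_ext by (simp add: tracial_star_prob_space_def)
qed

definition scalar_emb :: "'u \<Rightarrow> 'u" where
  "scalar_emb a = code [(1, [Inl a])]"

definition semicircular :: "nat \<Rightarrow> 'u" where
  "semicircular s = code [(1, [Inr s])]"

text \<open>The criterion behind the homomorphism property of \<open>scalar_emb\<close>: identities
  of the base algebra need to be tested only at the left end of a word.\<close>

lemma peq_Inl_words:
  assumes "\<And>c x. (c, x) \<in> set ps \<union> set qs \<Longrightarrow> x \<in> range (map Inl)"
    and "\<And>a v. a \<in> carrier A \<Longrightarrow> lin (\<lambda>x. moment a (x @ v)) ps = lin (\<lambda>x. moment a (x @ v)) qs"
    and "poly_val ps = poly_val qs"
  shows "peq ps qs"
  using lin_moment_insert[OF assms(1,2)] assms(3) by (simp add: peq_def ev_def)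

lemma Inl_in_range [simp]: "[] \<in> range (map Inl)" "Inl a # w \<in> range (map Inl) \<longleftrightarrow> w \<in> range (map Inl)"
  by (auto simp: image_iff) (metis list.simps(9))

lemma enlargement_ext: "enlargement A B scalar_emb"
  unfolding enlargement_def
proof (intro conjI ballI allI)
  show "scalar_emb \<in> Ring.ring_hom A B"
  proof (rule ring_hom_memI)
    fix x y assume xy: "x \<in> carrier A" "y \<in> carrier A"
    show "scalar_emb x \<in> carrier B" by (simp add: scalar_emb_def carrier_ext)
    show "scalar_emb (x \<otimes> y) = scalar_emb x \<otimes>\<^bsub>B\<^esub> scalar_emb y"
      unfolding scalar_emb_def ext_simps code_eq_iff using xy
      by (intro peq_Inl_words) (auto simp: alg.m_assoc)
    show "scalar_emb (x \<oplus> y) = scalar_emb x \<oplus>\<^bsub>B\<^esub> scalar_emb y"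
      unfolding scalar_emb_def ext_simps code_eq_iff using xy
      by (intro peq_Inl_words) (auto simp: alg.r_distr moment_add)
  next
    show "scalar_emb \<one> = \<one>\<^bsub>B\<^esub>"
      unfolding scalar_emb_def ext_simps code_eq_iff
      by (intro peq_Inl_words) auto
  qed
  show "inj_on scalar_emb (carrier A)"
    by (rule inj_onI) (auto simp: scalar_emb_def code_eq_iff peq_def)
  fix x assume x: "x \<in> carrier A"
  show "scalar_emb (c \<odot> x) = c \<odot>\<^bsub>B\<^esub> scalar_emb x" for c
    unfolding scalar_emb_def ext_simps code_eq_iff using x
    by (intro peq_Inl_words) (auto simp: psmult_def smult_mult_right moment_smult)
  show "scalar_emb (star A x) = star B (scalar_emb x)"
    using x by (simp add: scalar_emb_def ext_simps pstar_def)
  show "state B (scalar_emb x) = state A x"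
    using x by (simp add: scalar_emb_def ext_simps)
qed (rule tracial_star_prob_space_ext)

end

section \<open>The conditional expectation\<close>

context rectangular_prob_space
begin

abbreviation "De \<equiv> D_elem A d p"
abbreviation "Ds \<equiv> D_set A d p"

lemma proj_in [simp, intro]: "k < d \<Longrightarrow> p k \<in> carrier A"
  by (rule proj_closed)

lemma De_closed [simp, intro]: "De f \<in> carrier A"
  unfolding D_elem_def by (intro alg.finsum_closed) auto

lemma Ds_closed: "e \<in> Ds \<Longrightarrow> e \<in> carrier A"
  by (auto simp: D_set_def)

lemma De_in [simp, intro]: "De f \<in> Ds"
  by (simp add: D_set_def)

lemma De_cong: "(\<And>k. k < d \<Longrightarrow> f k = g k) \<Longrightarrow> De f = De g"
  unfolding D_elem_def by (intro alg.finsum_cong') auto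

lemma proj_De: "k < d \<Longrightarrow> p k \<otimes> De f = f k \<odot> p k"
proof -
  assume k: "k < d"
  have "p k \<otimes> De f = (\<Oplus>l\<in>{..<d}. p k \<otimes> (f l \<odot> p l))"
    unfolding D_elem_def using k by (intro alg.finsum_rdistr) auto
  also have "\<dots> = (\<Oplus>l\<in>{..<d}. if k = l then f l \<odot> p l else \<zero>)"
    using k by (intro alg.finsum_cong') (auto simp: smult_mult_right proj_idem proj_orthogonal)
  also have "\<dots> = f k \<odot> p k"
    using k by (intro alg.finsum_singleton) auto
  finally show ?thesis .
qed

lemma De_proj: "k < d \<Longrightarrow> De f \<otimes> p k = f k \<odot> p k"
proof -
  assume k: "k < d"
  have "De f \<otimes> p k = (\<Oplus>l\<in>{..<d}. (f l \<odot> p l) \<otimes> p k)"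
    unfolding D_elem_def using k by (intro alg.finsum_ldistr) auto
  also have "\<dots> = (\<Oplus>l\<in>{..<d}. if k = l then f l \<odot> p l else \<zero>)"
    using k by (intro alg.finsum_cong') (auto simp: smult_mult_left proj_idem proj_orthogonal)
  also have "\<dots> = f k \<odot> p k"
    using k by (intro alg.finsum_singleton) auto
  finally show ?thesis .
qed

lemma De_add: "De f \<oplus> De g = De (\<lambda>k. f k + g k)"
proof -
  have "De (\<lambda>k. f k + g k) = (\<Oplus>k\<in>{..<d}. f k \<odot> p k \<oplus> g k \<odot> p k)"
    unfolding D_elem_def by (intro alg.finsum_cong') (auto simp: smult_add_left)
  then show ?thesis unfolding D_elem_def by (simp add: alg.finsum_addf)
qed

lemma mult_De: "x \<in> carrier A \<Longrightarrow> x \<otimes> De f = (\<Oplus>k\<in>{..<d}. f k \<odot> (x \<otimes> p k))"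
  unfolding D_elem_def
  by (subst alg.finsum_rdistr) (auto simp: smult_mult_right intro!: alg.finsum_cong')

lemma De_mult: "x \<in> carrier A \<Longrightarrow> De f \<otimes> x = (\<Oplus>k\<in>{..<d}. f k \<odot> (p k \<otimes> x))"
  unfolding D_elem_def
  by (subst alg.finsum_ldistr) (auto simp: smult_mult_left intro!: alg.finsum_cong')

lemma De_De: "De f \<otimes> De g = De (\<lambda>k. f k * g k)"
  unfolding De_mult[OF De_closed]
  unfolding D_elem_def[of A d p "\<lambda>k. f k * g k"]
  by (intro alg.finsum_cong') (auto simp: proj_De smult_smult)

lemma De_smult: "c \<odot> De f = De (\<lambda>k. c * f k)"
proof -
  have "c \<odot> De f = (c \<odot> \<one>) \<otimes> De f" by (simp add: smult_mult_left)
  also have "\<dots> = De (\<lambda>k. c * f k)"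
    unfolding mult_De[OF smult_in[OF alg.one_closed]]
    unfolding D_elem_def by (intro alg.finsum_cong') (auto simp: smult_mult_left smult_smult mult.commute)
  finally show ?thesis .
qed

lemma De_one: "De (\<lambda>k. 1) = \<one>"
  unfolding D_elem_def proj_sum[symmetric] by (intro alg.finsum_cong') auto

lemma De_zero: "De (\<lambda>k. 0) = \<zero>"
  using De_smult[of 0 "\<lambda>k. 0"] by simp

lemma state_finsum:
  "finite S \<Longrightarrow> (\<And>k. k \<in> S \<Longrightarrow> g k \<in> carrier A) \<Longrightarrow> state A (\<Oplus>k\<in>S. g k) = (\<Sum>k\<in>S. state A (g k))"
proof (induction S rule: finite_induct)
  case (insert x S)
  then show ?case by (subst alg.finsum_insert) (auto simp: state_add intro!: alg.finsum_closed)
qed simp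

lemma state_mult_De: "x \<in> carrier A \<Longrightarrow> state A (x \<otimes> De f) = (\<Sum>k<d. f k * state A (x \<otimes> p k))"
  by (subst mult_De, assumption, subst state_finsum) (auto simp: state_smult)

lemma state_proj_De: "k < d \<Longrightarrow> state A (p k \<otimes> De f) = f k * state A (p k)"
  by (simp add: proj_De state_smult)

lemma De_eqD: "De f = De g \<Longrightarrow> k < d \<Longrightarrow> f k = g k"
  using state_proj_De[of k f] state_proj_De[of k g] proj_state_nonzero[of k] by simp

lemma Ds_simps [simp, intro]:
  "\<zero> \<in> Ds" "\<one> \<in> Ds"
  "e \<in> Ds \<Longrightarrow> e' \<in> Ds \<Longrightarrow> e \<oplus> e' \<in> Ds" "e \<in> Ds \<Longrightarrow> e' \<in> Ds \<Longrightarrow> e \<otimes> e' \<in> Ds" "e \<in> Ds \<Longrightarrow> c \<odot> e \<in> Ds"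
  using De_in[of "\<lambda>k. 0"] De_in[of "\<lambda>k. 1"]
  by (auto simp: De_one De_zero D_set_def De_add De_De De_smult)

lemma Ds_uminus: "e \<in> Ds \<Longrightarrow> \<ominus> e \<in> Ds"
  by (simp add: minus_eq_smult Ds_closed)

lemma Ds_asum: "set xs \<subseteq> Ds \<Longrightarrow> asum xs \<in> Ds"
  by (induction xs) auto

lemma proj_Ds: "k < d \<Longrightarrow> p k \<in> Ds"
proof -
  assume k: "k < d"
  have "De (\<lambda>l. if k = l then 1 else 0) = (\<Oplus>l\<in>{..<d}. if k = l then p l else \<zero>)"
    unfolding D_elem_def by (intro alg.finsum_cong') auto
  also have "\<dots> = p k" using k by (intro alg.finsum_singleton) auto
  finally show ?thesis by (metis De_in)
qed

lemma state_proj_mult_proj: "k < d \<Longrightarrow> x \<in> carrier A \<Longrightarrow> state A (p k \<otimes> x \<otimes> p k) = state A (p k \<otimes> x)"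
  by (subst state_tracial) (auto simp: proj_idem simp flip: alg.m_assoc)

lemma E_coeff_eq: "k < d \<Longrightarrow> x \<in> carrier A \<Longrightarrow> E_coeff A p x k = state A (p k \<otimes> x) / state A (p k)"
  by (simp add: E_coeff_def state_proj_mult_proj)

lemma E_in [simp, intro]: "E A d p x \<in> Ds"
  by (simp add: E_def)

lemma E_closed [simp, intro]: "E A d p x \<in> carrier A"
  by (simp add: E_def)

lemma E_eq_De: "x \<in> carrier A \<Longrightarrow> E A d p x = De (\<lambda>k. state A (p k \<otimes> x) / state A (p k))"
  unfolding E_def by (intro De_cong) (simp add: E_coeff_eq)

text \<open>As \<phi>(p_k) is nonzero, the coefficients of an element of D can be read off, and
  D-valued identities reduce to scalar ones with a projection in front.\<close>

lemma E_eq_zero_iff: "x \<in> carrier A \<Longrightarrow> E A d p x = \<zero> \<longleftrightarrow> (\<forall>k<d. state A (p k \<otimes> x) = 0)"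
proof
  assume x: "x \<in> carrier A" and "E A d p x = \<zero>"
  then have "De (\<lambda>k. state A (p k \<otimes> x) / state A (p k)) = De (\<lambda>k. 0)" by (simp add: E_eq_De De_zero)
  then show "\<forall>k<d. state A (p k \<otimes> x) = 0" using De_eqD proj_state_nonzero by fastforce
next
  assume "x \<in> carrier A" "\<forall>k<d. state A (p k \<otimes> x) = 0"
  then show "E A d p x = \<zero>" by (subst E_eq_De) (auto simp flip: De_zero intro!: De_cong)
qed

lemma E_eqI:
  assumes "x \<in> carrier A" "y \<in> carrier A" "\<And>k. k < d \<Longrightarrow> state A (p k \<otimes> x) = state A (p k \<otimes> y)"
  shows "E A d p x = E A d p y"
  using assms by (simp add: E_eq_De cong: De_cong)

lemma E_Ds: "e \<in> Ds \<Longrightarrow> E A d p e = e"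
  by (auto simp: D_set_def E_eq_De state_proj_De proj_state_nonzero intro!: De_cong)

lemma E_add: "x \<in> carrier A \<Longrightarrow> y \<in> carrier A \<Longrightarrow> E A d p (x \<oplus> y) = E A d p x \<oplus> E A d p y"
  by (auto simp: E_eq_De De_add alg.r_distr state_add add_divide_distrib intro!: De_cong)

lemma E_mult_left:
  assumes "e \<in> Ds" "x \<in> carrier A"
  shows "E A d p (e \<otimes> x) = e \<otimes> E A d p x"
proof -
  obtain f where e: "e = De f" using assms by (auto simp: D_set_def)
  show ?thesis using assms(2)
    by (auto simp: e E_eq_De De_De state_smult smult_mult_left proj_De simp flip: alg.m_assoc intro!: De_cong)
qed

text \<open>By traciality the element of D moves around to the left of \<open>p k\<close>, where it
  acts as a scalar.\<close>

lemma E_mult_right: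
  assumes "e \<in> Ds" "x \<in> carrier A"
  shows "E A d p (x \<otimes> e) = E A d p x \<otimes> e"
proof -
  obtain f where e: "e = De f" using assms by (auto simp: D_set_def)
  have "state A (p k \<otimes> (x \<otimes> De f)) = state A (p k \<otimes> x) * f k" if "k < d" for k
  proof -
    have "state A (p k \<otimes> (x \<otimes> De f)) = state A (De f \<otimes> (p k \<otimes> x))"
      using that assms(2) by (subst state_tracial) (auto simp flip: alg.m_assoc)
    then show ?thesis using that assms(2)
      by (simp add: De_proj smult_mult_left state_smult flip: alg.m_assoc)
  qed
  then show ?thesis using assms(2)
    by (auto simp: e E_eq_De De_De intro!: De_cong)
qed

end

section \<open>Transport of the projections and of D along enlargements\<close>

lemma enlargement_finsum:
  assumes "enlargement A A' \<iota>" "tracial_star_prob_space A" "finite S" "\<And>k. k \<in> S \<Longrightarrow> g k \<in> carrier A"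
  shows "\<iota> (\<Oplus>\<^bsub>A\<^esub>k\<in>S. g k) = (\<Oplus>\<^bsub>A'\<^esub>k\<in>S. \<iota> (g k))"
proof -
  interpret A: tracial_star_prob_space A by fact
  interpret A': tracial_star_prob_space A' using assms(1) by (simp add: enlargement_def)
  have hom: "\<iota> \<in> Ring.ring_hom A A'" using assms(1) by (simp add: enlargement_def)
  have c: "\<iota> x \<in> carrier A'" if "x \<in> carrier A" for x using ring_hom_closed[OF hom that] .
  have z: "\<iota> \<zero>\<^bsub>A\<^esub> = \<zero>\<^bsub>A'\<^esub>"
  proof -
    have "\<iota> (0 \<odot>\<^bsub>A\<^esub> \<zero>\<^bsub>A\<^esub>) = 0 \<odot>\<^bsub>A'\<^esub> \<iota> \<zero>\<^bsub>A\<^esub>"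
      using assms(1) A.alg.zero_closed unfolding enlargement_def by blast
    then show ?thesis using c[of "\<zero>\<^bsub>A\<^esub>"] by simp
  qed
  show ?thesis using assms(3,4)
  proof (induction S rule: finite_induct)
    case (insert x S)
    then show ?case
      by (subst A.alg.finsum_insert, simp_all, subst A'.alg.finsum_insert)
        (auto simp: ring_hom_add[OF hom] c intro!: A.alg.finsum_closed)
  qed (simp add: z)
qed

lemma enlargement_D_elem:
  assumes "enlargement A A' \<iota>" "rectangular_prob_space A d p"
  shows "D_elem A' d (\<iota> \<circ> p) f = \<iota> (D_elem A d p f)"
proof -
  interpret A: rectangular_prob_space A d p by fact
  interpret A': tracial_star_prob_space A' using assms(1) by (simp add: enlargement_def)
  have hom: "\<iota> \<in> Ring.ring_hom A A'" using assms(1) by (simp add: enlargement_def)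
  have "\<iota> (D_elem A d p f) = (\<Oplus>\<^bsub>A'\<^esub>k\<in>{..<d}. \<iota> (f k \<odot>\<^bsub>A\<^esub> p k))"
    unfolding D_elem_def
    by (intro enlargement_finsum[OF assms(1)] A.tracial_star_prob_space_axioms) auto
  also have "\<dots> = (\<Oplus>\<^bsub>A'\<^esub>k\<in>{..<d}. f k \<odot>\<^bsub>A'\<^esub> (\<iota> \<circ> p) k)"
    using assms(1) by (intro A'.alg.finsum_cong') (auto simp: enlargement_def ring_hom_closed[OF hom])
  finally show ?thesis by (simp add: D_elem_def)
qed

lemma enlargement_rectangular:
  assumes "enlargement A A' \<iota>" "rectangular_prob_space A d p"
  shows "rectangular_prob_space A' d (\<iota> \<circ> p)"
proof -
  interpret A: rectangular_prob_space A d p by fact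
  interpret A': tracial_star_prob_space A' using assms(1) by (simp add: enlargement_def)
  have hom: "\<iota> \<in> Ring.ring_hom A A'" and inj: "inj_on \<iota> (carrier A)"
    using assms(1) by (simp_all add: enlargement_def)
  have z: "\<iota> \<zero>\<^bsub>A\<^esub> = \<zero>\<^bsub>A'\<^esub>"
    using enlargement_finsum[OF assms(1) A.tracial_star_prob_space_axioms, of "{}" "\<lambda>x. x"] by simp
  show ?thesis
  proof
    fix k assume k: "k < d"
    show "(\<iota> \<circ> p) k \<in> carrier A'" using k by (simp add: ring_hom_closed[OF hom])
    show "(\<iota> \<circ> p) k \<noteq> \<zero>\<^bsub>A'\<^esub>"
      using k A.proj_nonzero[OF k] inj_onD[OF inj, of "p k" "\<zero>\<^bsub>A\<^esub>"] by (auto simp: z)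
    show "star A' ((\<iota> \<circ> p) k) = (\<iota> \<circ> p) k"
      using assms(1) k A.proj_selfadjoint[OF k] by (simp add: enlargement_def) (metis A.proj_in)
    show "(\<iota> \<circ> p) k \<otimes>\<^bsub>A'\<^esub> (\<iota> \<circ> p) k = (\<iota> \<circ> p) k"
      using k ring_hom_mult[OF hom, of "p k" "p k"] by (simp add: A.proj_idem)
    show "(\<iota> \<circ> p) k \<otimes>\<^bsub>A'\<^esub> (\<iota> \<circ> p) l = \<zero>\<^bsub>A'\<^esub>" if "l < d" "k \<noteq> l" for l
      using k that ring_hom_mult[OF hom, of "p k" "p l"] by (simp add: A.proj_orthogonal z)
    show "state A' ((\<iota> \<circ> p) k) \<noteq> 0"
      using k assms(1) A.proj_state_nonzero[OF k] by (simp add: enlargement_def)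
  next
    have "(\<Oplus>\<^bsub>A'\<^esub>k\<in>{..<d}. (\<iota> \<circ> p) k) = \<iota> (\<Oplus>\<^bsub>A\<^esub>k\<in>{..<d}. p k)"
      by (subst enlargement_finsum[OF assms(1) A.tracial_star_prob_space_axioms]) (auto simp: comp_def)
    then show "(\<Oplus>\<^bsub>A'\<^esub>k\<in>{..<d}. (\<iota> \<circ> p) k) = \<one>\<^bsub>A'\<^esub>"
      using ring_hom_one[OF hom] by (simp add: A.proj_sum)
  qed
qed

lemma enlargement_trans:
  assumes "enlargement A A' \<iota>" "enlargement A' A'' \<kappa>"
  shows "enlargement A A'' (\<kappa> \<circ> \<iota>)"
proof -
  have hom: "\<iota> \<in> Ring.ring_hom A A'" "\<kappa> \<in> Ring.ring_hom A' A''"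
    and inj: "inj_on \<iota> (carrier A)" "inj_on \<kappa> (carrier A')"
    using assms by (simp_all add: enlargement_def)
  have c: "\<iota> x \<in> carrier A'" if "x \<in> carrier A" for x using ring_hom_closed[OF hom(1) that] .
  have "inj_on (\<kappa> \<circ> \<iota>) (carrier A)"
    using inj c by (auto intro!: comp_inj_on inj_on_subset[OF inj(2)])
  then show ?thesis
    using assms c ring_hom_trans[OF hom] by (auto simp: enlargement_def)
qed

section \<open>Freeness with amalgamation\<close>

lemma lin_sum: "lin (\<lambda>w. \<Sum>k\<in>S. f k w) ps = (\<Sum>k\<in>S. lin (f k) ps)"
  by (induction S rule: infinite_finite_induct) (auto simp: lin_add)

context rectangular_prob_space
begin

abbreviation D_word :: "nat \<Rightarrow> ('u + nat) list \<Rightarrow> bool" where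
  "D_word s w \<equiv> set w \<subseteq> insert (Inr s) (Inl ` Ds)"

text \<open>The pairings of a letter \<open>s\<close> standing in front with the letters of
  \<open>ps\<close>: \<open>h\<close> sees what the pair encloses, \<open>f\<close> what comes after
  it.\<close>

abbreviation lin_split ::
    "nat \<Rightarrow> (('u + nat) list \<Rightarrow> complex) \<Rightarrow> (('u + nat) list \<Rightarrow> complex) \<Rightarrow> 'u word_poly \<Rightarrow> complex" where
  "lin_split s h f ps \<equiv> lin (\<lambda>v. split_sum s v (\<lambda>v1 v2. h v1 * f v2)) ps"

text \<open>No semicircular \<open>s\<close> placed to the left of \<open>ps\<close> can be paired through elements of \<open>D\<close> with a
  letter of \<open>ps\<close>.\<close>

definition unpaired :: "nat \<Rightarrow> 'u word_poly \<Rightarrow> bool" where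
  "unpaired s ps \<longleftrightarrow> (\<forall>e\<in>Ds. \<forall>f. lin_split s (moment e) f ps = 0)"

text \<open>Pairings contribute scalars, so a word over D never leads out of D.\<close>

lemma cexp_Ds: "D_word s w \<Longrightarrow> cexp w \<in> Ds"
proof (induction w rule: cexp.induct)
  case (2 a w)
  then show ?case by (auto simp: Ds_closed)
next
  case (3 t w)
  then show ?case unfolding cexp.simps by (intro Ds_asum) (auto simp: splits_iff)
qed auto

lemma moment_cyclic: "a \<in> carrier A \<Longrightarrow> moment (a \<otimes> cexp u) v = moment (cexp v \<otimes> a) u"
  using state_tracial[of "a \<otimes> cexp u" "cexp v"] by (simp add: moment_def alg.m_assoc)

lemma moment_mult_cexp_Inr:
  assumes "a \<in> carrier A"
  shows "moment (a \<otimes> cexp (Inr t # w)) v = split_sum t w (\<lambda>u1 u2. moment \<one> u1 * moment (a \<otimes> cexp u2) v)"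
  using assms by (simp add: moment_cyclic del: cexp.simps)

text \<open>A leading \<open>s\<close> of \<open>w\<close> is paired inside \<open>w\<close>, which
  leaves a shorter prefix, or with a letter of \<open>ps\<close>, and then the enclosed word again
  starts with a shorter prefix. Elements of D in the prefix only change \<open>b\<close>, which
  stays in D.\<close>

lemma unpaired_prefix:
  assumes "unpaired s ps" "D_word s w" "b \<in> Ds"
  shows "lin_split s (\<lambda>v. moment b (w @ v)) f ps = 0"
  using assms(2,3)
proof (induction "length w" arbitrary: w b f rule: less_induct)
  case less
  note [simp] = Ds_closed[OF less.prems(2)]
  show ?case
  proof (cases w)
    case Nil
    then show ?thesis using assms(1) less.prems(2) by (simp add: unpaired_def)
  next
    case (Cons x w')
    show ?thesis
    proof (cases x)
      case (Inl e)
      then have "e \<in> Ds" using Cons less.prems by auto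
      then show ?thesis using less.hyps[of w' "b \<otimes> e" f] less.prems Cons Inl by (simp add: Ds_closed)
    next
      case (Inr t)
      then have t: "x = Inr s" using Cons less.prems by auto
      \<comment> \<open>Everything behind the new pair is swallowed by the continuation; this is why
        \<open>f\<close> is arbitrary in the induction.\<close>
      define g where "g q = split_sum s q (\<lambda>u2 v2. moment b u2 * f v2)" for q
      have "lin_split s (\<lambda>v. moment b (w @ v)) f ps =
        lin (\<lambda>v. split_sum s w' (\<lambda>u1 u2. moment \<one> u1 * split_sum s v (\<lambda>v1 v2. moment b (u2 @ v1) * f v2)) +
          split_sum s v (\<lambda>u1 q. moment \<one> (w' @ u1) * g q)) ps"
      proof (rule lin_cong)
        fix c and v :: "('u + nat) list"
        have sw: "split_sum s v (\<lambda>v1 v2. split_sum s w' (\<lambda>u1 u2. h u1 u2 v1 v2)) = split_sum s w' (\<lambda>u1 u2. split_sum s v (h u1 u2))"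
          for h :: "_ \<Rightarrow> _ \<Rightarrow> _ \<Rightarrow> _ \<Rightarrow> complex"
          by (induction v arbitrary: h) (simp_all add: split_sum_add)
        have "split_sum s v (\<lambda>v1 v2. moment b (w @ v1) * f v2) =
            split_sum s v (\<lambda>v1 v2. split_sum s w' (\<lambda>u1 u2. moment \<one> u1 * moment b (u2 @ v1) * f v2)) +
            split_sum s v (\<lambda>v1 v2. split_sum s v1 (\<lambda>u1 u2. moment \<one> (w' @ u1) * (moment b u2 * f v2)))"
          by (simp add: Cons t split_sum_append distrib_right split_sum_add split_sum_mult_right[symmetric] mult.assoc)
        then show "split_sum s v (\<lambda>v1 v2. moment b (w @ v1) * f v2) =
          split_sum s w' (\<lambda>u1 u2. moment \<one> u1 * split_sum s v (\<lambda>v1 v2. moment b (u2 @ v1) * f v2)) +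
          split_sum s v (\<lambda>u1 q. moment \<one> (w' @ u1) * g q)"
          unfolding g_def sw by (simp add: split_sum_split_sum[symmetric] split_sum_mult_left mult.assoc)
      qed
      also have "\<dots> = split_sum s w' (\<lambda>u1 u2. moment \<one> u1 * lin_split s (\<lambda>v. moment b (u2 @ v)) f ps) +
          lin_split s (\<lambda>v. moment \<one> (w' @ v)) g ps"
        by (simp add: lin_add lin_split_sum lin_const_mult)
      also have "split_sum s w' (\<lambda>u1 u2. moment \<one> u1 * lin_split s (\<lambda>v. moment b (u2 @ v)) f ps) = split_sum s w' (\<lambda>u1 u2. 0)"
        using less.hyps[of _ b f] less.prems Cons by (intro split_sum_cong) auto
      also have "lin_split s (\<lambda>v. moment \<one> (w' @ v)) g ps = 0"
        using less.hyps[of w' \<one> g] less.prems Cons by auto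
      finally show ?thesis by simp
    qed
  qed
qed

text \<open>No pair connects the prefix \<open>w\<close> with \<open>ps\<close>, so the pairings of
  \<open>w\<close> stay within \<open>w\<close> and it can be replaced by its conditional
  expectation.\<close>

lemma moment_unpaired:
  assumes u: "unpaired t ps" and "D_word t w" "a \<in> carrier A"
  shows "lin (\<lambda>v. moment a (w @ v)) ps = lin (moment (a \<otimes> cexp w)) ps"
  using assms(2,3)
proof (induction "length w" arbitrary: w a rule: less_induct)
  case less
  note [simp] = less.prems(2)
  show ?case
  proof (cases w)
    case (Cons x w')
    show ?thesis
    proof (cases x)
      case (Inl e)
      then show ?thesis using less.hyps[of w' "a \<otimes> emb e"] less.prems Cons by (simp add: alg.m_assoc)
    next
      case (Inr t')
      then have t: "x = Inr t" using Cons less.prems by auto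
      have "lin (\<lambda>v. moment a (w @ v)) ps = split_sum t w' (\<lambda>u1 u2. moment \<one> u1 * lin (\<lambda>v. moment a (u2 @ v)) ps) +
          lin_split t (\<lambda>v. moment \<one> (w' @ v)) (moment a) ps"
        by (simp add: Cons t split_sum_append lin_add lin_split_sum lin_const_mult)
      also have "lin_split t (\<lambda>v. moment \<one> (w' @ v)) (moment a) ps = 0"
        using unpaired_prefix[OF u, of w' \<one> "moment a"] less.prems Cons by auto
      also have "split_sum t w' (\<lambda>u1 u2. moment \<one> u1 * lin (\<lambda>v. moment a (u2 @ v)) ps) =
          split_sum t w' (\<lambda>u1 u2. moment \<one> u1 * lin (moment (a \<otimes> cexp u2)) ps)"
        using less.hyps[of _ a] less.prems Cons by (intro split_sum_cong) auto
      also have "\<dots> = lin (moment (a \<otimes> cexp (Inr t # w'))) ps"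
        unfolding ext[of "moment (a \<otimes> cexp (Inr t # w'))", OF moment_mult_cexp_Inr[OF less.prems(2)]]
        by (simp add: lin_split_sum lin_const_mult)
      finally show ?thesis by (simp add: Cons t del: cexp.simps)
    qed
  qed simp
qed

text \<open>The same replacement when a further letter \<open>s\<close> in front of everything is
  paired with a letter of \<open>ps\<close>, so that \<open>w\<close> lies inside this pair.\<close>

lemma lin_split_unpaired:
  assumes u: "unpaired t ps" and "D_word t w" "a \<in> carrier A"
  shows "lin_split s (\<lambda>v. moment a (w @ v)) f ps = lin_split s (moment (a \<otimes> cexp w)) f ps"
  using assms(2,3)
proof (induction "length w" arbitrary: w a rule: less_induct)
  case less
  note [simp] = less.prems(2)
  show ?case
  proof (cases w)
    case (Cons x w')
    show ?thesis
    proof (cases x)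
      case (Inl e)
      then show ?thesis using less.hyps[of w' "a \<otimes> emb e"] less.prems Cons by (simp add: alg.m_assoc)
    next
      case (Inr t')
      then have t: "x = Inr t" using Cons less.prems by auto
      define g where "g q = split_sum s q (\<lambda>u2 v2. moment a u2 * f v2)" for q
      have sw: "split_sum s v (\<lambda>v1 v2. split_sum t w' (\<lambda>u1 u2. h u1 u2 v1 v2)) = split_sum t w' (\<lambda>u1 u2. split_sum s v (h u1 u2))"
        for v and h :: "_ \<Rightarrow> _ \<Rightarrow> _ \<Rightarrow> _ \<Rightarrow> complex"
        by (induction v arbitrary: h) (simp_all add: split_sum_add)
      have "lin_split s (\<lambda>v. moment a (w @ v)) f ps =
        lin (\<lambda>v. split_sum t w' (\<lambda>u1 u2. moment \<one> u1 * split_sum s v (\<lambda>v1 v2. moment a (u2 @ v1) * f v2)) +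
          split_sum t v (\<lambda>u1 q. moment \<one> (w' @ u1) * g q)) ps"
      proof (rule lin_cong)
        fix c and v :: "('u + nat) list"
        have "split_sum s v (\<lambda>v1 v2. moment a (w @ v1) * f v2) =
            split_sum s v (\<lambda>v1 v2. split_sum t w' (\<lambda>u1 u2. moment \<one> u1 * moment a (u2 @ v1) * f v2)) +
            split_sum s v (\<lambda>v1 v2. split_sum t v1 (\<lambda>u1 u2. moment \<one> (w' @ u1) * (moment a u2 * f v2)))"
          by (simp add: Cons t split_sum_append distrib_right split_sum_add split_sum_mult_right[symmetric] mult.assoc)
        then show "split_sum s v (\<lambda>v1 v2. moment a (w @ v1) * f v2) =
          split_sum t w' (\<lambda>u1 u2. moment \<one> u1 * split_sum s v (\<lambda>v1 v2. moment a (u2 @ v1) * f v2)) +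
          split_sum t v (\<lambda>u1 q. moment \<one> (w' @ u1) * g q)"
          unfolding g_def sw by (simp add: split_sum_split_sum[symmetric] split_sum_mult_left mult.assoc)
      qed
      also have "\<dots> = split_sum t w' (\<lambda>u1 u2. moment \<one> u1 * lin_split s (\<lambda>v. moment a (u2 @ v)) f ps) +
          lin_split t (\<lambda>v. moment \<one> (w' @ v)) g ps"
        by (simp add: lin_add lin_split_sum lin_const_mult)
      also have "lin_split t (\<lambda>v. moment \<one> (w' @ v)) g ps = 0"
        using unpaired_prefix[OF u, of w' \<one> g] less.prems Cons by auto
      also have "split_sum t w' (\<lambda>u1 u2. moment \<one> u1 * lin_split s (\<lambda>v. moment a (u2 @ v)) f ps) =
          split_sum t w' (\<lambda>u1 u2. moment \<one> u1 * lin_split s (moment (a \<otimes> cexp u2)) f ps)"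
        using less.hyps[of _ a] less.prems Cons by (intro split_sum_cong) auto
      also have "\<dots> = lin_split s (moment (a \<otimes> cexp (Inr t # w'))) f ps"
      proof -
        have "lin_split s (moment (a \<otimes> cexp (Inr t # w'))) f ps =
          lin (\<lambda>v. split_sum s v (\<lambda>v1 v2. split_sum t w' (\<lambda>u1 u2. moment \<one> u1 * (moment (a \<otimes> cexp u2) v1 * f v2)))) ps"
          by (simp add: moment_mult_cexp_Inr split_sum_mult_right[symmetric] mult.assoc del: cexp.simps)
        then show ?thesis
          unfolding sw by (simp add: lin_split_sum lin_const_mult split_sum_mult_left)
      qed
      finally show ?thesis by (simp add: Cons t)
    qed
  qed simp
qed

text \<open>Representatives of the elements of a component with expectation 0. For
  \<open>Some t\<close> the moments vanish against the whole base algebra and not only against D,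
  because the conditional expectations of such words lie in D.\<close>

primrec centered :: "nat option \<Rightarrow> 'u word_poly \<Rightarrow> bool" where
  "centered None ps \<longleftrightarrow> (\<exists>a\<in>carrier A. ps = [(1, [Inl a])] \<and> (\<forall>e\<in>Ds. state A (e \<otimes> a) = 0))"
| "centered (Some t) ps \<longleftrightarrow> (\<forall>(c, w)\<in>set ps. D_word t w) \<and> (\<forall>z\<in>carrier A. lin (moment z) ps = 0)"

text \<open>What is known by induction about an alternating product of centered elements.\<close>

primrec alternating :: "nat option \<Rightarrow> 'u word_poly \<Rightarrow> bool" where
  "alternating None rs \<longleftrightarrow> (\<forall>s. unpaired s rs) \<and> (\<forall>e\<in>Ds. lin (moment e) rs = 0)"
| "alternating (Some t) rs \<longleftrightarrow> (\<forall>a\<in>carrier A. lin (moment a) rs = 0) \<and>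
     (\<forall>s. s \<noteq> t \<longrightarrow> (\<forall>a\<in>carrier A. \<forall>f. lin_split s (moment a) f rs = 0)) \<and>
     (\<forall>z\<in>carrier A. (\<forall>e\<in>Ds. state A (e \<otimes> z) = 0) \<longrightarrow> (\<forall>f. lin_split t (moment z) f rs = 0))"

lemma split_sum_D_word: "D_word t w \<Longrightarrow> s \<noteq> t \<Longrightarrow> split_sum s w f = 0"
  by (induction w arbitrary: f) auto

text \<open>Nothing in \<open>rs\<close> can be paired with the letters \<open>t\<close> of
  \<open>ps\<close>, so each word of \<open>ps\<close> acts through its conditional expectation, and
  these sum to zero. In the third clause a pair may also end inside \<open>ps\<close>; it encloses a
  word with expectation in D, which the centered \<open>z\<close> annihilates.\<close>

lemma alternating_Some:
  assumes u: "unpaired t rs" and c: "centered (Some t) ps"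
  shows "alternating (Some t) (pmul ps rs)"
proof -
  have w: "D_word t w" if "(c, w) \<in> set ps" for c w using c that by auto
  have z: "lin (moment z) ps = 0" if "z \<in> carrier A" for z using c that by simp
  have z': "lin (\<lambda>w. moment (a \<otimes> cexp w) v) ps = 0" if "a \<in> carrier A" for a v
  proof -
    have "moment (a \<otimes> cexp w) v = moment (cexp v \<otimes> a) w" for w
      using that by (rule moment_cyclic)
    then show ?thesis using z[of "cexp v \<otimes> a"] that by simp
  qed
  have split0: "lin (\<lambda>w. lin_split s (\<lambda>v. moment a (w @ v)) f rs) ps = 0" if "a \<in> carrier A" for s a f
  proof -
    have "lin (\<lambda>w. lin_split s (\<lambda>v. moment a (w @ v)) f rs) ps = lin (\<lambda>w. lin_split s (moment (a \<otimes> cexp w)) f rs) ps"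
      using that w by (intro lin_cong lin_split_unpaired[OF u])
    also have "\<dots> = lin (\<lambda>v. split_sum s v (\<lambda>v1 v2. lin (\<lambda>w. moment (a \<otimes> cexp w) v1) ps * f v2)) rs"
      by (subst lin_swap) (simp add: lin_split_sum lin_mult_const)
    finally show ?thesis using z'[OF that] by simp
  qed
  have 1: "lin (moment a) (pmul ps rs) = 0" if "a \<in> carrier A" for a
  proof -
    have "lin (moment a) (pmul ps rs) = lin (\<lambda>w. lin (moment (a \<otimes> cexp w)) rs) ps"
      unfolding lin_pmul using that w by (intro lin_cong moment_unpaired[OF u])
    also have "\<dots> = lin (\<lambda>v. lin (\<lambda>w. moment (a \<otimes> cexp w) v) ps) rs" by (rule lin_swap)
    finally show ?thesis using z'[OF that] by simp
  qed
  have 2: "lin_split s (moment a) f (pmul ps rs) = 0" if "s \<noteq> t" "a \<in> carrier A" for s a f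
  proof -
    have "lin_split s (moment a) f (pmul ps rs) = lin (\<lambda>w. lin_split s (\<lambda>v. moment a (w @ v)) f rs) ps"
      unfolding lin_pmul
    proof (intro lin_cong)
      fix c w and v :: "('u + nat) list" assume "(c, w) \<in> set ps"
      from split_sum_D_word[OF w[OF this] that(1)]
      show "split_sum s (w @ v) (\<lambda>v1 v2. moment a v1 * f v2) = split_sum s v (\<lambda>v1 v2. moment a (w @ v1) * f v2)"
        by (simp add: split_sum_append)
    qed
    then show ?thesis using split0[OF that(2)] by simp
  qed
  have 3: "lin_split t (moment z) f (pmul ps rs) = 0"
    if "z \<in> carrier A" "\<forall>e\<in>Ds. state A (e \<otimes> z) = 0" for z f
  proof -
    have "lin_split t (moment z) f (pmul ps rs) = lin (\<lambda>w. lin_split t (\<lambda>v. moment z (w @ v)) f rs) ps"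
      unfolding lin_pmul
    proof (intro lin_cong)
      fix c w v assume cw: "(c, w) \<in> set ps"
      have "split_sum t w (\<lambda>w1 w2. moment z w1 * f (w2 @ v)) = split_sum t w (\<lambda>w1 w2. 0)"
      proof (rule split_sum_cong)
        fix w1 w2 assume "w = w1 @ Inr t # w2"
        then have "cexp w1 \<in> Ds" using w[OF cw] by (intro cexp_Ds[of _ t]) auto
        then have "moment z w1 = 0" using that by (simp add: moment_def state_tracial[of z])
        then show "moment z w1 * f (w2 @ v) = 0" by simp
      qed
      then show "split_sum t (w @ v) (\<lambda>v1 v2. moment z v1 * f v2) = split_sum t v (\<lambda>v1 v2. moment z (w @ v1) * f v2)"
        by (simp add: split_sum_append)
    qed
    then show ?thesis using split0[OF that(1)] by simp
  qed
  show ?thesis using 1 2 3 by simp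
qed

text \<open>The factor \<open>a\<close> is absorbed into the coefficient. As
  \<open>e \<otimes> a\<close> is centered again, pairings through it with \<open>t\<close> vanish
  by the third clause of \<open>alternating\<close> and those with other semicirculars by the
  second.\<close>

lemma alternating_None:
  assumes rs: "rs = [(1, [])] \<or> (\<exists>t. alternating (Some t) rs)" and c: "centered None ps"
  shows "alternating None (pmul ps rs)"
proof -
  obtain a where a: "a \<in> carrier A" "ps = [(1, [Inl a])]" and 0: "\<And>e. e \<in> Ds \<Longrightarrow> state A (e \<otimes> a) = 0"
    using c by auto
  have z: "e \<otimes> a \<in> carrier A" "\<forall>e'\<in>Ds. state A (e' \<otimes> (e \<otimes> a)) = 0" if "e \<in> Ds" for e
    using that a 0 by (auto simp: Ds_closed simp flip: alg.m_assoc)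
  have 1: "lin (moment e) (pmul ps rs) = 0" if e: "e \<in> Ds" for e
  proof -
    have "lin (moment e) (pmul ps rs) = lin (moment (e \<otimes> a)) rs"
      using a e by (simp add: lin_pmul Ds_closed del: pmul_simps)
    also have "\<dots> = 0"
    proof (cases "rs = [(1, [])]")
      case True
      then show ?thesis using 0[OF e] z(1)[OF e] by simp
    next
      case False
      then show ?thesis using rs z(1)[OF e] unfolding alternating.simps by blast
    qed
    finally show ?thesis .
  qed
  have 2: "lin_split s (moment e) f (pmul ps rs) = 0" if e: "e \<in> Ds" for e s f
  proof -
    have "lin_split s (moment e) f (pmul ps rs) = lin_split s (moment (e \<otimes> a)) f rs"
      using a e by (simp add: lin_pmul Ds_closed del: pmul_simps)
    also have "\<dots> = 0"
    proof (cases "rs = [(1, [])]")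
      case False
      then obtain t where t: "alternating (Some t) rs" using rs by blast
      show ?thesis
      proof (cases "s = t")
        case True
        show ?thesis using t z[OF e] unfolding True alternating.simps by blast
      next
        case False
        then show ?thesis using t z(1)[OF e] unfolding alternating.simps by blast
      qed
    qed simp
    finally show ?thesis .
  qed
  show ?thesis using 1 2 by (simp add: unpaired_def)
qed

lemma alternating_product:
  assumes "xs \<noteq> []" "distinct_adj (map fst xs)" "\<forall>(i, ps)\<in>set xs. centered i ps"
  shows "alternating (fst (hd xs)) (foldr pmul (map snd xs) [(1, [])])"
  using assms
proof (induction xs)
  case (Cons x xs)
  obtain i ps where x: "x = (i, ps)" by force
  let ?rs = "foldr pmul (map snd xs) [(1, [])]"
  have c: "centered i ps" using Cons.prems x by auto
  have rs: "xs = [] \<or> (alternating (fst (hd xs)) ?rs \<and> fst (hd xs) \<noteq> i)"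
    using Cons x by (cases xs) auto
  show ?case
  proof (cases i)
    case None
    have "?rs = [(1, [])] \<or> (\<exists>t. alternating (Some t) ?rs)"
    proof (cases "xs = []")
      case False
      then have "alternating (fst (hd xs)) ?rs" "fst (hd xs) \<noteq> None" using rs None by blast+
      then show ?thesis by (metis not_None_eq)
    qed simp
    from alternating_None[OF this] c show ?thesis
      unfolding None x list.map foldr.simps comp_def list.sel fst_conv snd_conv by blast
  next
    case (Some t)
    \<comment> \<open>The tail starts with another component, a different semicircular or the base
      algebra; in both cases \<open>t\<close> finds no partner through D.\<close>
    have "unpaired t ?rs"
    proof (cases "xs = []")
      case False
      then have "alternating (fst (hd xs)) ?rs" "fst (hd xs) \<noteq> Some t" using rs Some by blast+
      then show ?thesis by (cases "fst (hd xs)") (auto simp: unpaired_def Ds_closed)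
    qed (simp add: unpaired_def)
    from alternating_Some[OF this] c show ?thesis
      unfolding Some x list.map foldr.simps comp_def list.sel fst_conv snd_conv by blast
  qed
qed simp

lemma alternating_moment: "alternating i rs \<Longrightarrow> e \<in> Ds \<Longrightarrow> lin (moment e) rs = 0"
  by (cases i) (auto simp: Ds_closed)

definition free_component :: "nat option \<Rightarrow> 'u set" where
  "free_component i = (case i of None \<Rightarrow> scalar_emb ` carrier A
     | Some s \<Rightarrow> {code ps | ps. \<forall>(c, w)\<in>set ps. D_word s w})"

lemma rectangular_ext: "rectangular_prob_space B d (scalar_emb \<circ> p)"
  by (rule enlargement_rectangular[OF enlargement_ext rectangular_prob_space_axioms])

lemma D_elem_ext: "D_elem B d (scalar_emb \<circ> p) f = scalar_emb (De f)"
  by (rule enlargement_D_elem[OF enlargement_ext rectangular_prob_space_axioms])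

lemma scalar_emb_simps:
  assumes "x \<in> carrier A"
  shows "y \<in> carrier A \<Longrightarrow> scalar_emb (x \<otimes> y) = scalar_emb x \<otimes>\<^bsub>B\<^esub> scalar_emb y"
    and "y \<in> carrier A \<Longrightarrow> scalar_emb (x \<oplus> y) = scalar_emb x \<oplus>\<^bsub>B\<^esub> scalar_emb y"
    and "scalar_emb (c \<odot> x) = c \<odot>\<^bsub>B\<^esub> scalar_emb x"
    and "scalar_emb (star A x) = star B (scalar_emb x)"
    and "state B (scalar_emb x) = state A x"
    and "scalar_emb x \<in> carrier B"
    and "scalar_emb \<one> = \<one>\<^bsub>B\<^esub>"
  using enlargement_ext assms unfolding enlargement_def
  by (auto simp: ring_hom_mult ring_hom_add ring_hom_one ring_hom_closed)

lemma D_subalgebra_free_component: "D_subalgebra B d (scalar_emb \<circ> p) (free_component i)"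
proof -
  interpret B: rectangular_prob_space B d "scalar_emb \<circ> p" by (rule rectangular_ext)
  show ?thesis
  proof (cases i)
    case None
    then have fc: "free_component i = scalar_emb ` carrier A" by (simp add: free_component_def)
    have "subring (free_component i) B"
    proof (rule B.alg.subringI)
      show "\<ominus>\<^bsub>B\<^esub> h \<in> free_component i" if "h \<in> free_component i" for h
        using that unfolding fc by (auto simp: B.minus_eq_smult scalar_emb_simps simp flip: scalar_emb_simps(3))
      show "\<one>\<^bsub>B\<^esub> \<in> free_component i"
        unfolding fc using scalar_emb_simps(7) by (metis image_eqI alg.one_closed)
    qed (auto simp: fc scalar_emb_simps simp flip: scalar_emb_simps(1,2))
    then show ?thesis unfolding D_subalgebra_def fc
      by (auto simp: D_set_def D_elem_ext simp flip: scalar_emb_simps(3))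
  next
    case (Some s)
    then have fc: "free_component i = {code ps | ps. \<forall>(c, w)\<in>set ps. D_word s w}" by (simp add: free_component_def)
    have I: "code ps \<in> free_component i" if "\<forall>(c, w)\<in>set ps. D_word s w" for ps
      using that unfolding fc by blast
    have sm: "c \<odot>\<^bsub>B\<^esub> x \<in> free_component i" if "x \<in> free_component i" for c x
    proof -
      obtain ps where x: "x = code ps" and w: "\<forall>(c, w)\<in>set ps. D_word s w"
        using \<open>x \<in> free_component i\<close> unfolding fc by blast
      have "\<forall>(c', w)\<in>set (psmult c ps). D_word s w" using w by (simp add: psmult_def case_prod_unfold)
      then show ?thesis unfolding x smult_ext by (rule I)
    qed
    have "subring (free_component i) B"
    proof (rule B.alg.subringI)
      show c: "free_component i \<subseteq> carrier B" unfolding fc carrier_ext by blast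
      show "\<ominus>\<^bsub>B\<^esub> h \<in> free_component i" if "h \<in> free_component i" for h
      proof -
        have "h \<in> carrier B" using that c by blast
        then show ?thesis using sm[OF that, of "-1"] by (simp only: B.minus_eq_smult)
      qed
      show "\<one>\<^bsub>B\<^esub> \<in> free_component i" unfolding one_ext by (rule I) simp
    next
      fix x y assume "x \<in> free_component i" "y \<in> free_component i"
      then obtain ps qs where xy: "x = code ps" "y = code qs"
        and w: "\<forall>(c, w)\<in>set ps. D_word s w" "\<forall>(c, w)\<in>set qs. D_word s w"
        unfolding fc by blast
      have "\<forall>(c, w)\<in>set (ps @ qs). D_word s w" using w unfolding set_append ball_Un by blast
      then show "x \<oplus>\<^bsub>B\<^esub> y \<in> free_component i" unfolding xy add_ext by (rule I)
      have "D_word s w" if cw: "(c, w) \<in> set (pmul ps qs)" for c w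
      proof -
        obtain c1 w1 c2 w2 where "(c1, w1) \<in> set ps" "(c2, w2) \<in> set qs" "w = w1 @ w2"
          using cw unfolding pmul_def by auto
        moreover from this have "D_word s w1" "D_word s w2" using w by blast+
        ultimately show ?thesis by simp
      qed
      then show "x \<otimes>\<^bsub>B\<^esub> y \<in> free_component i" unfolding xy mult_ext by (intro I) blast
    qed
    then show ?thesis unfolding D_subalgebra_def using sm
      by (simp add: D_set_def D_elem_ext scalar_emb_def I image_subset_iff)
  qed
qed

lemma state_proj_code: "k < d \<Longrightarrow> state B (scalar_emb (p k) \<otimes>\<^bsub>B\<^esub> code ps) = lin (moment (p k)) ps"
  by (simp add: scalar_emb_def mult_ext state_ext lin_pmul del: pmul_simps)

lemma free_component_centered:
  assumes x: "x \<in> free_component i" and E: "E B d (scalar_emb \<circ> p) x = \<zero>\<^bsub>B\<^esub>"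
  shows "\<exists>ps. x = code ps \<and> centered i ps"
proof -
  interpret B: rectangular_prob_space B d "scalar_emb \<circ> p" by (rule rectangular_ext)
  have "x \<in> carrier B" using x D_subalgebra_free_component[of i] subringE(1) unfolding D_subalgebra_def by blast
  then have 0: "state B (scalar_emb (p k) \<otimes>\<^bsub>B\<^esub> x) = 0" if "k < d" for k
    using E that by (simp add: B.E_eq_zero_iff)
  show ?thesis
  proof (cases i)
    case None
    then obtain a where a: "a \<in> carrier A" "x = scalar_emb a" using x by (auto simp: free_component_def)
    have "state A (p k \<otimes> a) = 0" if "k < d" for k
      using 0[OF that] a that by (simp add: scalar_emb_simps flip: scalar_emb_simps(1))
    then have 1: "state A (a \<otimes> p k) = 0" if "k < d" for k
      using that state_tracial[OF a(1) proj_in[OF that]] by simp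
    have "state A (e \<otimes> a) = 0" if "e \<in> Ds" for e
    proof -
      obtain f where e: "e = De f" using \<open>e \<in> Ds\<close> by (auto simp: D_set_def)
      have "state A (e \<otimes> a) = state A (a \<otimes> De f)" unfolding e by (rule state_tracial[OF De_closed a(1)])
      then show ?thesis by (simp add: state_mult_De[OF a(1)] 1)
    qed
    then show ?thesis using a None by (auto simp: scalar_emb_def)
  next
    case (Some s)
    then obtain ps where ps: "x = code ps" "\<forall>(c, w)\<in>set ps. D_word s w" using x by (auto simp: free_component_def)
    have "lin (moment z) ps = 0" if z: "z \<in> carrier A" for z
    proof -
      \<comment> \<open>Conditional expectations of words over D are combinations of the
        projections, so moments against any \<open>z\<close> are determined by those against the
        \<open>p k\<close>.\<close>
      have "lin (moment z) ps = lin (\<lambda>w. \<Sum>k<d. state A (z \<otimes> p k) / state A (p k) * moment (p k) w) ps"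
      proof (rule lin_cong)
        fix c w assume "(c, w) \<in> set ps"
        then have "cexp w \<in> Ds" using ps by (intro cexp_Ds[of _ s]) auto
        then obtain f where f: "cexp w = De f" by (auto simp: D_set_def)
        show "moment z w = (\<Sum>k<d. state A (z \<otimes> p k) / state A (p k) * moment (p k) w)"
          using z by (auto simp: moment_def f state_mult_De[OF z] state_proj_De proj_state_nonzero intro!: sum.cong)
      qed
      also have "\<dots> = (\<Sum>k<d. state A (z \<otimes> p k) / state A (p k) * lin (moment (p k)) ps)"
        by (simp only: lin_sum lin_const_mult)
      also have "\<dots> = 0" using 0 ps(1) by (intro sum.neutral) (simp add: state_proj_code)
      finally show ?thesis .
    qed
    then show ?thesis using ps Some by auto
  qed
qed

theorem free_subalgebras_ext: "free_subalgebras B d (scalar_emb \<circ> p) free_component"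
  unfolding free_subalgebras_def
proof (intro conjI allI impI)
  interpret B: rectangular_prob_space B d "scalar_emb \<circ> p" by (rule rectangular_ext)
  fix xs :: "(nat option \<times> 'u) list"
  assume xs: "xs \<noteq> [] \<and> distinct_adj (map fst xs) \<and>
    (\<forall>(i, x)\<in>set xs. x \<in> free_component i \<and> E B d (scalar_emb \<circ> p) x = \<zero>\<^bsub>B\<^esub>)"
  then have "\<forall>ix\<in>set xs. \<exists>ps. snd ix = code ps \<and> centered (fst ix) ps"
    using free_component_centered by fastforce
  then obtain poly where poly: "\<And>ix. ix \<in> set xs \<Longrightarrow> snd ix = code (poly ix) \<and> centered (fst ix) (poly ix)"
    by metis
  define ys where "ys = map (\<lambda>ix. (fst ix, poly ix)) xs"
  have "alternating (fst (hd ys)) (foldr pmul (map snd ys) [(1, [])])"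
    using xs poly by (intro alternating_product) (auto simp: ys_def comp_def)
  then have "lin (moment (p k)) (foldr pmul (map snd ys) [(1, [])]) = 0" if "k < d" for k
    using alternating_moment proj_Ds[OF that] by blast
  moreover have prod: "alg_prod B (map snd xs) = code (foldr pmul (map snd ys) [(1, [])])"
  proof -
    have "\<forall>ix\<in>set xs. snd ix = code (poly ix)" using poly by blast
    then show ?thesis unfolding ys_def alg_prod_def
      by (induction xs) (auto simp: one_ext mult_ext)
  qed
  ultimately show "E B d (scalar_emb \<circ> p) (alg_prod B (map snd xs)) = \<zero>\<^bsub>B\<^esub>"
    by (subst B.E_eq_zero_iff) (auto simp: prod state_proj_code carrier_ext)
qed (rule D_subalgebra_free_component)

end

section \<open>Cumulants\<close>

text \<open>The algebraic clauses of \<open>D_cumulants\<close> without the moment formula: the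
  truncated families from which the cumulants are built have these properties too.\<close>

definition bimodule_map :: "'u star_prob \<Rightarrow> nat \<Rightarrow> (nat \<Rightarrow> 'u) \<Rightarrow> ('u list \<Rightarrow> 'u) \<Rightarrow> bool" where
  "bimodule_map A d p c \<longleftrightarrow>
     (\<forall>as. as \<noteq> [] \<and> set as \<subseteq> carrier A \<longrightarrow> c as \<in> D_set A d p) \<and>
     (\<forall>as bs. \<forall>x\<in>carrier A. \<forall>y\<in>carrier A. set as \<subseteq> carrier A \<and> set bs \<subseteq> carrier A \<longrightarrow>
        c (as @ (x \<oplus>\<^bsub>A\<^esub> y) # bs) = c (as @ x # bs) \<oplus>\<^bsub>A\<^esub> c (as @ y # bs)) \<and>
     (\<forall>as bs. \<forall>x\<in>carrier A. \<forall>y\<in>carrier A. \<forall>e\<in>D_set A d p.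
        set as \<subseteq> carrier A \<and> set bs \<subseteq> carrier A \<longrightarrow>
        c (as @ (x \<otimes>\<^bsub>A\<^esub> e) # y # bs) = c (as @ x # (e \<otimes>\<^bsub>A\<^esub> y) # bs)) \<and>
     (\<forall>as. \<forall>x\<in>carrier A. \<forall>e\<in>D_set A d p. set as \<subseteq> carrier A \<longrightarrow>
        c ((e \<otimes>\<^bsub>A\<^esub> x) # as) = e \<otimes>\<^bsub>A\<^esub> c (x # as) \<and>
        c (as @ [x \<otimes>\<^bsub>A\<^esub> e]) = c (as @ [x]) \<otimes>\<^bsub>A\<^esub> e)"

lemma D_cumulants_iff:
  "D_cumulants A d p c \<longleftrightarrow> bimodule_map A d p c \<and>
     (\<forall>as. as \<noteq> [] \<and> set as \<subseteq> carrier A \<longrightarrow>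
        E A d p (alg_prod A as) =
          (\<Oplus>\<^bsub>A\<^esub>\<sigma>\<in>NC (length as). nested_cumulant A c \<sigma> as 0 (length as)))"
  unfolding D_cumulants_def bimodule_map_def by blast

context tracial_star_prob_space
begin

lemma alg_prod_simps [simp]: "alg_prod A [] = \<one>" "alg_prod A (x # xs) = x \<otimes> alg_prod A xs"
  by (simp_all add: alg_prod_def)

lemma alg_prod_closed [simp, intro]: "set xs \<subseteq> carrier A \<Longrightarrow> alg_prod A xs \<in> carrier A"
  by (induction xs) auto

lemma alg_prod_append:
  "set xs \<subseteq> carrier A \<Longrightarrow> set ys \<subseteq> carrier A \<Longrightarrow> alg_prod A (xs @ ys) = alg_prod A xs \<otimes> alg_prod A ys"
  by (induction xs) (auto simp: alg.m_assoc)

lemma asum_add: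
  "(\<And>i. i \<in> set is \<Longrightarrow> f i \<in> carrier A \<and> g i \<in> carrier A) \<Longrightarrow>
     asum (map (\<lambda>i. f i \<oplus> g i) is) = asum (map f is) \<oplus> asum (map g is)"
proof (induction "is")
  case (Cons i "is")
  moreover have "asum (map f is) \<in> carrier A" "asum (map g is) \<in> carrier A"
    using Cons.prems by (auto intro!: asum_closed)
  ultimately show ?case by (simp add: alg.a_ac)
qed simp

lemma asum_mult_right:
  "(\<And>i. i \<in> set is \<Longrightarrow> f i \<in> carrier A) \<Longrightarrow> e \<in> carrier A \<Longrightarrow>
     asum (map f is) \<otimes> e = asum (map (\<lambda>i. f i \<otimes> e) is)"
proof (induction "is")
  case (Cons i "is")
  moreover have "asum (map f is) \<in> carrier A"
    using Cons.prems by (auto intro!: asum_closed)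
  ultimately show ?case by (simp add: alg.l_distr)
qed simp

lemma asum_mult_left:
  "(\<And>i. i \<in> set is \<Longrightarrow> f i \<in> carrier A) \<Longrightarrow> e \<in> carrier A \<Longrightarrow>
     e \<otimes> asum (map f is) = asum (map (\<lambda>i. e \<otimes> f i) is)"
proof (induction "is")
  case (Cons i "is")
  moreover have "asum (map f is) \<in> carrier A"
    using Cons.prems by (auto intro!: asum_closed)
  ultimately show ?case by (simp add: alg.r_distr)
qed simp

end

context rectangular_prob_space
begin

abbreviation Mo :: "'u list \<Rightarrow> 'u" where
  "Mo as \<equiv> E A d p (alg_prod A as)"

lemma E_one [simp]: "E A d p \<one> = \<one>"
  by (simp add: E_Ds)

lemma Mo_Nil: "Mo [] = \<one>"
  by simp

lemma Mo_add:
  "set as \<subseteq> carrier A \<Longrightarrow> set bs \<subseteq> carrier A \<Longrightarrow> x \<in> carrier A \<Longrightarrow> y \<in> carrier A \<Longrightarrow>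
     Mo (as @ (x \<oplus> y) # bs) = Mo (as @ x # bs) \<oplus> Mo (as @ y # bs)"
  by (simp add: alg_prod_append alg.l_distr alg.r_distr E_add)

lemma Mo_balanced:
  "set as \<subseteq> carrier A \<Longrightarrow> set bs \<subseteq> carrier A \<Longrightarrow> x \<in> carrier A \<Longrightarrow> y \<in> carrier A \<Longrightarrow> e \<in> Ds \<Longrightarrow>
     Mo (as @ (x \<otimes> e) # y # bs) = Mo (as @ x # (e \<otimes> y) # bs)"
  by (simp add: alg_prod_append alg.m_assoc Ds_closed)

lemma Mo_left:
  "set as \<subseteq> carrier A \<Longrightarrow> x \<in> carrier A \<Longrightarrow> e \<in> Ds \<Longrightarrow> Mo ((e \<otimes> x) # as) = e \<otimes> Mo (x # as)"
  by (simp add: alg.m_assoc Ds_closed E_mult_left)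

lemma Mo_right:
  "set as \<subseteq> carrier A \<Longrightarrow> x \<in> carrier A \<Longrightarrow> e \<in> Ds \<Longrightarrow> Mo (as @ [x \<otimes> e]) = Mo (as @ [x]) \<otimes> e"
  by (simp add: alg_prod_append Ds_closed E_mult_right flip: alg.m_assoc)

text \<open>The moment of \<open>as\<close> expanded over the block of the first element: \<open>bs\<close> collects the arguments of the
  cumulant of that block, and the gaps between its elements contribute moments.\<close>

function block_sum :: "('u list \<Rightarrow> 'u) \<Rightarrow> 'u list \<Rightarrow> 'u list \<Rightarrow> 'u" where
  "block_sum c bs [] = \<zero>"
| "block_sum c bs (x # xs) = c (bs @ [x]) \<otimes> Mo xs \<oplus>
     asum (map (\<lambda>i. block_sum c (bs @ [x \<otimes> Mo (take i xs)]) (drop i xs)) [0..<length xs])"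
  by pat_completeness auto
termination
  by (relation "Wellfounded.measure (\<lambda>(c, bs, as). length as)") auto

lemma set_take_closed: "set xs \<subseteq> S \<Longrightarrow> set (take i xs) \<subseteq> S"
  and set_drop_closed: "set xs \<subseteq> S \<Longrightarrow> set (drop i xs) \<subseteq> S"
  using set_take_subset set_drop_subset by fastforce+

context
  fixes c assumes c: "bimodule_map A d p c"
begin

lemma c_Ds: "as \<noteq> [] \<Longrightarrow> set as \<subseteq> carrier A \<Longrightarrow> c as \<in> Ds"
  using c by (simp add: bimodule_map_def)

lemma c_closed: "as \<noteq> [] \<Longrightarrow> set as \<subseteq> carrier A \<Longrightarrow> c as \<in> carrier A"
  using c_Ds Ds_closed by blast

lemma c_add:
  "set as \<subseteq> carrier A \<Longrightarrow> set bs \<subseteq> carrier A \<Longrightarrow> x \<in> carrier A \<Longrightarrow> y \<in> carrier A \<Longrightarrow>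
     c (as @ (x \<oplus> y) # bs) = c (as @ x # bs) \<oplus> c (as @ y # bs)"
  using c by (simp add: bimodule_map_def)

lemma c_balanced:
  "set as \<subseteq> carrier A \<Longrightarrow> set bs \<subseteq> carrier A \<Longrightarrow> x \<in> carrier A \<Longrightarrow> y \<in> carrier A \<Longrightarrow> e \<in> Ds \<Longrightarrow>
     c (as @ (x \<otimes> e) # y # bs) = c (as @ x # (e \<otimes> y) # bs)"
  using c by (simp add: bimodule_map_def)

lemma c_left:
  "set as \<subseteq> carrier A \<Longrightarrow> x \<in> carrier A \<Longrightarrow> e \<in> Ds \<Longrightarrow> c ((e \<otimes> x) # as) = e \<otimes> c (x # as)"
  using c by (simp add: bimodule_map_def)

lemma c_right:
  "set as \<subseteq> carrier A \<Longrightarrow> x \<in> carrier A \<Longrightarrow> e \<in> Ds \<Longrightarrow> c (as @ [x \<otimes> e]) = c (as @ [x]) \<otimes> e"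
  using c by (simp add: bimodule_map_def)

lemma block_sum_Ds:
  "set bs \<subseteq> carrier A \<Longrightarrow> set as \<subseteq> carrier A \<Longrightarrow> block_sum c bs as \<in> Ds"
proof (induction "length as" arbitrary: bs as rule: less_induct)
  case less
  show ?case
  proof (cases as)
    case (Cons x xs)
    have "block_sum c (bs @ [x \<otimes> Mo (take i xs)]) (drop i xs) \<in> Ds" for i
      using less.prems Cons by (intro less.hyps) (auto dest: in_set_dropD)
    moreover have "c (bs @ [x]) \<in> Ds" using less.prems Cons by (intro c_Ds) auto
    ultimately show ?thesis unfolding Cons block_sum.simps by (intro Ds_simps Ds_asum E_in) auto
  qed simp
qed

lemma block_sum_closed [simp]:
  "set bs \<subseteq> carrier A \<Longrightarrow> set as \<subseteq> carrier A \<Longrightarrow> block_sum c bs as \<in> carrier A"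
  using block_sum_Ds Ds_closed by blast

text \<open>The bimodule properties of \<open>c\<close> pass to \<open>block_sum\<close>, first for
  the arguments already collected. The statements for the remaining arguments rest on these, because
  a gap is absorbed into the collected argument before it.\<close>

lemma block_sum_prefix_add:
  assumes "set bs1 \<subseteq> carrier A" "set bs2 \<subseteq> carrier A" "x \<in> carrier A" "y \<in> carrier A" "set as \<subseteq> carrier A"
  shows "block_sum c (bs1 @ (x \<oplus> y) # bs2) as = block_sum c (bs1 @ x # bs2) as \<oplus> block_sum c (bs1 @ y # bs2) as"
  using assms(2,5)
proof (induction "length as" arbitrary: bs2 as rule: less_induct)
  case less
  note [simp] = assms(1,3,4) less.prems
  show ?case
  proof (cases as)
    case (Cons z zs)
    then have [simp]: "z \<in> carrier A" "set zs \<subseteq> carrier A" using less.prems by auto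
    have *: "block_sum c (bs1 @ (x \<oplus> y) # bs2 @ [z \<otimes> Mo (take i zs)]) (drop i zs) =
        block_sum c (bs1 @ x # bs2 @ [z \<otimes> Mo (take i zs)]) (drop i zs) \<oplus>
        block_sum c (bs1 @ y # bs2 @ [z \<otimes> Mo (take i zs)]) (drop i zs)" for i
      using less.hyps[of "drop i zs" "bs2 @ [z \<otimes> Mo (take i zs)]"] Cons by (simp add: set_drop_closed)
    have "c (bs1 @ (x \<oplus> y) # bs2 @ [z]) = c (bs1 @ x # bs2 @ [z]) \<oplus> c (bs1 @ y # bs2 @ [z])"
      by (intro c_add) auto
    moreover have "c (bs1 @ u # bs2 @ [z]) \<in> carrier A" if "u \<in> carrier A" for u
      using that by (intro c_closed) auto
    moreover have "asum (map (\<lambda>i. block_sum c (bs1 @ u # bs2 @ [z \<otimes> Mo (take i zs)]) (drop i zs)) is) \<in> carrier A"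
      if "u \<in> carrier A" for u and "is" :: "nat list"
      using that by (intro asum_closed) (auto simp: set_drop_closed)
    ultimately show ?thesis
      unfolding Cons by (simp add: * asum_add set_drop_closed alg.l_distr alg.a_ac)
  qed simp
qed

lemma block_sum_prefix_balanced:
  assumes "set bs1 \<subseteq> carrier A" "set bs2 \<subseteq> carrier A" "x \<in> carrier A" "y \<in> carrier A" "e \<in> Ds" "set as \<subseteq> carrier A"
  shows "block_sum c (bs1 @ (x \<otimes> e) # y # bs2) as = block_sum c (bs1 @ x # (e \<otimes> y) # bs2) as"
  using assms(2,6)
proof (induction "length as" arbitrary: bs2 as rule: less_induct)
  case less
  note [simp] = assms(1,3,4,5) less.prems
  show ?case
  proof (cases as)
    case (Cons z zs)
    then have [simp]: "z \<in> carrier A" "set zs \<subseteq> carrier A" using less.prems by auto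
    have *: "block_sum c (bs1 @ (x \<otimes> e) # y # bs2 @ [z \<otimes> Mo (take i zs)]) (drop i zs) =
        block_sum c (bs1 @ x # (e \<otimes> y) # bs2 @ [z \<otimes> Mo (take i zs)]) (drop i zs)" for i
      using less.hyps[of "drop i zs" "bs2 @ [z \<otimes> Mo (take i zs)]"] Cons by (simp add: set_drop_closed)
    have "c (bs1 @ (x \<otimes> e) # y # bs2 @ [z]) = c (bs1 @ x # (e \<otimes> y) # bs2 @ [z])"
      by (intro c_balanced) auto
    then show ?thesis unfolding Cons by (simp add: *)
  qed simp
qed

text \<open>The first remaining element always belongs to the block, so moving \<open>e\<close>
  across is balancedness of \<open>c\<close>.\<close>

lemma block_sum_balanced_Cons:
  assumes "set bs \<subseteq> carrier A" "x \<in> carrier A" "y \<in> carrier A" "e \<in> Ds" "set as \<subseteq> carrier A"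
  shows "block_sum c (bs @ [x \<otimes> e]) (y # as) = block_sum c (bs @ [x]) ((e \<otimes> y) # as)"
proof -
  have "c (bs @ [x \<otimes> e, y]) = c (bs @ [x, e \<otimes> y])"
    using assms c_balanced[of bs "[]" x y e] by simp
  moreover have "block_sum c (bs @ [x \<otimes> e, y \<otimes> Mo (take i as)]) (drop i as) =
      block_sum c (bs @ [x, e \<otimes> y \<otimes> Mo (take i as)]) (drop i as)" for i
    using assms block_sum_prefix_balanced[of bs "[]" x "y \<otimes> Mo (take i as)" e "drop i as"]
    by (simp add: set_drop_closed alg.m_assoc Ds_closed)
  ultimately show ?thesis by simp
qed

lemma block_sum_prefix_left:
  assumes "set bs \<subseteq> carrier A" "x \<in> carrier A" "e \<in> Ds" "set as \<subseteq> carrier A"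
  shows "block_sum c ((e \<otimes> x) # bs) as = e \<otimes> block_sum c (x # bs) as"
  using assms(1,4)
proof (induction "length as" arbitrary: bs as rule: less_induct)
  case less
  note [simp] = assms(2,3) less.prems Ds_closed[OF assms(3)]
  show ?case
  proof (cases as)
    case (Cons z zs)
    then have [simp]: "z \<in> carrier A" "set zs \<subseteq> carrier A" using less.prems by auto
    have *: "block_sum c ((e \<otimes> x) # bs @ [z \<otimes> Mo (take i zs)]) (drop i zs) =
        e \<otimes> block_sum c (x # bs @ [z \<otimes> Mo (take i zs)]) (drop i zs)" for i
      using less.hyps[of "drop i zs" "bs @ [z \<otimes> Mo (take i zs)]"] Cons by (simp add: set_drop_closed)
    have cl: "c (x # bs @ [z]) \<in> carrier A" by (intro c_closed) auto
    have as: "asum (map (\<lambda>i. block_sum c (x # bs @ [z \<otimes> Mo (take i zs)]) (drop i zs)) is) \<in> carrier A" for "is" :: "nat list"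
      by (intro asum_closed) (auto simp: set_drop_closed)
    have "c ((e \<otimes> x) # bs @ [z]) = e \<otimes> c (x # bs @ [z])"
      by (intro c_left) auto
    then show ?thesis unfolding Cons using cl as
      by (simp add: * asum_mult_left[symmetric] set_drop_closed alg.m_assoc alg.r_distr)
  qed simp
qed

lemma block_sum_left:
  assumes "set as \<subseteq> carrier A" "x \<in> carrier A" "e \<in> Ds"
  shows "block_sum c [] ((e \<otimes> x) # as) = e \<otimes> block_sum c [] (x # as)"
proof -
  note [simp] = assms Ds_closed[OF assms(3)]
  have *: "block_sum c [e \<otimes> (x \<otimes> Mo (take i as))] (drop i as) = e \<otimes> block_sum c [x \<otimes> Mo (take i as)] (drop i as)" for i
    using block_sum_prefix_left[of "[]" "x \<otimes> Mo (take i as)" e "drop i as"]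
    by (simp add: set_drop_closed)
  have cl: "c [x] \<in> carrier A" by (intro c_closed) auto
  have as: "asum (map (\<lambda>i. block_sum c [x \<otimes> Mo (take i as)] (drop i as)) is) \<in> carrier A" for "is" :: "nat list"
    by (intro asum_closed) (auto simp: set_drop_closed)
  have "c [e \<otimes> x] = e \<otimes> c [x]" by (intro c_left) auto
  then show ?thesis using cl as
    by (simp add: * asum_mult_left[symmetric] set_drop_closed alg.m_assoc alg.r_distr)
qed

lemma block_sum_add:
  assumes "set as2 \<subseteq> carrier A" "x \<in> carrier A" "y \<in> carrier A" "set as1 \<subseteq> carrier A" "set bs \<subseteq> carrier A"
  shows "block_sum c bs (as1 @ (x \<oplus> y) # as2) = block_sum c bs (as1 @ x # as2) \<oplus> block_sum c bs (as1 @ y # as2)"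
  using assms(4,5)
proof (induction "length as1" arbitrary: bs as1 rule: less_induct)
  case less
  note [simp] = assms(1-3) less.prems
  show ?case
  proof (cases as1)
    case Nil
    have *: "block_sum c (bs @ [x \<otimes> Mo (take i as2) \<oplus> y \<otimes> Mo (take i as2)]) (drop i as2) =
        block_sum c (bs @ [x \<otimes> Mo (take i as2)]) (drop i as2) \<oplus> block_sum c (bs @ [y \<otimes> Mo (take i as2)]) (drop i as2)" for i
      using block_sum_prefix_add[of bs "[]" "x \<otimes> Mo (take i as2)" "y \<otimes> Mo (take i as2)" "drop i as2"]
      by (simp add: set_drop_closed)
    have cl: "c (bs @ [u]) \<in> carrier A" if "u \<in> carrier A" for u using that by (intro c_closed) auto
    have as: "asum (map (\<lambda>i. block_sum c (bs @ [u \<otimes> Mo (take i as2)]) (drop i as2)) is) \<in> carrier A"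
      if "u \<in> carrier A" for u and "is" :: "nat list"
      using that by (intro asum_closed) (auto simp: set_drop_closed)
    have "c (bs @ [x \<oplus> y]) = c (bs @ [x]) \<oplus> c (bs @ [y])" by (intro c_add) auto
    then show ?thesis using Nil cl as
      by (simp add: * asum_add set_drop_closed alg.l_distr alg.a_ac)
  next
    case (Cons z zs)
    then have [simp]: "z \<in> carrier A" "set zs \<subseteq> carrier A" using less.prems by auto
    define g where "g u i = block_sum c (bs @ [z \<otimes> Mo (take i (zs @ u # as2))]) (drop i (zs @ u # as2))" for u i
    have g_closed: "g u i \<in> carrier A" if "u \<in> carrier A" for u i
      unfolding g_def using that by (intro block_sum_closed set_drop_closed) auto
    have g: "g (x \<oplus> y) i = g x i \<oplus> g y i" for i
    proof (cases "i \<le> length zs")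
      case True
      then show ?thesis
        using less.hyps[of "drop i zs" "bs @ [z \<otimes> Mo (take i zs)]"] Cons by (simp add: g_def set_drop_closed)
    next
      \<comment> \<open>The sum \<open>x \<oplus> y\<close> now lies in the gap behind
        \<open>z\<close>, whose moment multiplies the collected argument.\<close>
      case False
      then obtain j where i: "i = Suc (length zs + j)"
        by (metis add_Suc_right less_imp_Suc_add not_le_imp_less)
      have "z \<otimes> Mo (zs @ (x \<oplus> y) # take j as2) = z \<otimes> Mo (zs @ x # take j as2) \<oplus> z \<otimes> Mo (zs @ y # take j as2)"
        by (subst Mo_add) (auto simp: set_take_closed alg.r_distr)
      then show ?thesis
        using block_sum_prefix_add[of bs "[]" "z \<otimes> Mo (zs @ x # take j as2)" "z \<otimes> Mo (zs @ y # take j as2)" "drop j as2"]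
        by (simp add: g_def i set_drop_closed)
    qed
    have cl: "c (bs @ [z]) \<in> carrier A" by (intro c_closed) auto
    have as: "asum (map (g u) is) \<in> carrier A" if "u \<in> carrier A" for u and "is" :: "nat list"
      using g_closed[OF that] by (intro asum_closed) auto
    have bs: "block_sum c bs (as1 @ u # as2) = c (bs @ [z]) \<otimes> Mo (zs @ u # as2) \<oplus> asum (map (g u) [0..<Suc (length zs + length as2)])" for u
      unfolding Cons g_def by simp
    have m: "Mo (zs @ (x \<oplus> y) # as2) = Mo (zs @ x # as2) \<oplus> Mo (zs @ y # as2)"
      by (intro Mo_add) auto
    show ?thesis
      unfolding bs m g asum_add[OF conjI, OF g_closed[OF assms(2)] g_closed[OF assms(3)]]
      using cl as by (simp add: alg.r_distr alg.a_ac del: upt_Suc)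
  qed
qed

lemma block_sum_balanced:
  assumes "set as2 \<subseteq> carrier A" "x \<in> carrier A" "y \<in> carrier A" "e \<in> Ds" "set as1 \<subseteq> carrier A" "set bs \<subseteq> carrier A"
  shows "block_sum c bs (as1 @ (x \<otimes> e) # y # as2) = block_sum c bs (as1 @ x # (e \<otimes> y) # as2)"
  using assms(5,6)
proof (induction "length as1" arbitrary: bs as1 rule: less_induct)
  case less
  note [simp] = assms(1-4) less.prems Ds_closed[OF assms(4)]
  show ?case
  proof (cases as1)
    case Nil
    have *: "block_sum c (bs @ [x \<otimes> e \<otimes> Mo (take i (y # as2))]) (drop i (y # as2)) =
        block_sum c (bs @ [x \<otimes> Mo (take i ((e \<otimes> y) # as2))]) (drop i ((e \<otimes> y) # as2))" for i
    proof (cases i)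
      case 0
      then show ?thesis using block_sum_balanced_Cons[of bs x y e as2] by simp
    next
      case (Suc j)
      then show ?thesis using Mo_left[of "take j as2" y e] by (simp add: set_take_closed alg.m_assoc)
    qed
    have "c (bs @ [x \<otimes> e]) \<otimes> Mo (y # as2) = c (bs @ [x]) \<otimes> Mo ((e \<otimes> y) # as2)"
      using c_right[of bs x e] c_closed[of "bs @ [x]"] Mo_left[of as2 y e] by (simp add: alg.m_assoc)
    then show ?thesis unfolding Nil append_Nil block_sum.simps * by simp
  next
    case (Cons z zs)
    then have [simp]: "z \<in> carrier A" "set zs \<subseteq> carrier A" using less.prems by auto
    let ?L = "zs @ (x \<otimes> e) # y # as2" and ?R = "zs @ x # (e \<otimes> y) # as2"
    have *: "block_sum c (bs @ [z \<otimes> Mo (take i ?L)]) (drop i ?L) = block_sum c (bs @ [z \<otimes> Mo (take i ?R)]) (drop i ?R)" for i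
    proof (cases "i \<le> length zs")
      case True
      then show ?thesis
        using less.hyps[of "drop i zs" "bs @ [z \<otimes> Mo (take i zs)]"] Cons by (simp add: set_drop_closed)
    next
      case False
      then obtain j where i: "i = Suc (length zs + j)"
        by (metis add_Suc_right less_imp_Suc_add not_le_imp_less)
      show ?thesis
      \<comment> \<open>For \<open>j = 0\<close> the gap ends with \<open>x\<close>, so
        \<open>e\<close> passes from the gap to the next element of the block; otherwise
        \<open>x\<close> and its successor lie in the same gap.\<close>
      proof (cases j)
        case 0
        have "z \<otimes> Mo (zs @ [x \<otimes> e]) = (z \<otimes> Mo (zs @ [x])) \<otimes> e"
          using Mo_right[of zs x e] by (simp add: alg.m_assoc)
        then show ?thesis
          using 0 i block_sum_balanced_Cons[of bs "z \<otimes> Mo (zs @ [x])" y e as2] by simp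
      next
        case (Suc k)
        then show ?thesis using i Mo_balanced[of zs "take k as2" x y e] by (simp add: set_take_closed)
      qed
    qed
    have "Mo ?L = Mo ?R" by (intro Mo_balanced) auto
    then show ?thesis unfolding Cons append_Cons block_sum.simps * by simp
  qed
qed

lemma block_sum_right:
  assumes "x \<in> carrier A" "e \<in> Ds" "set as \<subseteq> carrier A" "set bs \<subseteq> carrier A"
  shows "block_sum c bs (as @ [x \<otimes> e]) = block_sum c bs (as @ [x]) \<otimes> e"
  using assms(3,4)
proof (induction "length as" arbitrary: bs as rule: less_induct)
  case less
  note [simp] = assms(1,2) less.prems Ds_closed[OF assms(2)]
  show ?case
  proof (cases as)
    case Nil
    then show ?thesis using c_right[of bs x e] c_closed[of "bs @ [x]"] by simp
  next
    case (Cons z zs)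
    then have [simp]: "z \<in> carrier A" "set zs \<subseteq> carrier A" using less.prems by auto
    have *: "block_sum c (bs @ [z \<otimes> Mo (take i (zs @ [x \<otimes> e]))]) (drop i (zs @ [x \<otimes> e])) =
        block_sum c (bs @ [z \<otimes> Mo (take i (zs @ [x]))]) (drop i (zs @ [x])) \<otimes> e"
      if "i \<in> set [0..<Suc (length zs)]" for i
    proof -
      \<comment> \<open>The gaps stop before the last element, which therefore stays in the list
        covered by the induction hypothesis.\<close>
      have "i \<le> length zs" "i - length zs = 0" using that by auto
      then show ?thesis
        using less.hyps[of "drop i zs" "bs @ [z \<otimes> Mo (take i zs)]"] Cons by (simp add: set_drop_closed)
    qed
    have cl: "c (bs @ [z]) \<in> carrier A" by (intro c_closed) auto
    have bc: "block_sum c (bs @ [z \<otimes> Mo (take i (zs @ [x]))]) (drop i (zs @ [x])) \<in> carrier A" for i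
      by (intro block_sum_closed set_drop_closed) auto
    have as: "asum (map (\<lambda>i. block_sum c (bs @ [z \<otimes> Mo (take i (zs @ [x]))]) (drop i (zs @ [x]))) is) \<in> carrier A" for "is" :: "nat list"
      using bc by (intro asum_closed) auto
    have len: "length (zs @ [u]) = Suc (length zs)" for u by simp
    have m: "map (\<lambda>i. block_sum c (bs @ [z \<otimes> Mo (take i (zs @ [x \<otimes> e]))]) (drop i (zs @ [x \<otimes> e]))) [0..<Suc (length zs)] =
        map (\<lambda>i. block_sum c (bs @ [z \<otimes> Mo (take i (zs @ [x]))]) (drop i (zs @ [x])) \<otimes> e) [0..<Suc (length zs)]"
      by (intro map_cong refl *)
    have "block_sum c bs (as @ [x \<otimes> e]) = c (bs @ [z]) \<otimes> (Mo (zs @ [x]) \<otimes> e) \<oplus>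
        asum (map (\<lambda>i. block_sum c (bs @ [z \<otimes> Mo (take i (zs @ [x]))]) (drop i (zs @ [x])) \<otimes> e) [0..<Suc (length zs)])"
      by (simp only: Cons append_Cons block_sum.simps len m Mo_right[OF \<open>set zs \<subseteq> carrier A\<close> assms(1,2)])
    also have "\<dots> = block_sum c bs (as @ [x]) \<otimes> e"
      unfolding Cons append_Cons block_sum.simps len asum_mult_right[symmetric, OF bc \<open>e \<in> carrier A\<close>]
      using cl as by (simp add: alg.l_distr alg.m_assoc del: upt_Suc)
    finally show ?thesis .
  qed
qed

end

lemma block_sum_cong:
  assumes "\<And>ls. length ls \<le> length bs + length as \<Longrightarrow> c ls = c' ls"
  shows "block_sum c bs as = block_sum c' bs as"
  using assms
proof (induction "length as" arbitrary: bs as rule: less_induct)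
  case less
  show ?case
  proof (cases as)
    case (Cons x xs)
    have "block_sum c (bs @ [x \<otimes> Mo (take i xs)]) (drop i xs) = block_sum c' (bs @ [x \<otimes> Mo (take i xs)]) (drop i xs)"
      if "i < length xs" for i
      using less.prems Cons that by (intro less.hyps) auto
    then have m: "map (\<lambda>i. block_sum c (bs @ [x \<otimes> Mo (take i xs)]) (drop i xs)) [0..<length xs] =
        map (\<lambda>i. block_sum c' (bs @ [x \<otimes> Mo (take i xs)]) (drop i xs)) [0..<length xs]"
      by (intro map_cong refl) simp
    have "c (bs @ [x]) = c' (bs @ [x])" using less.prems Cons by simp
    then show ?thesis by (simp only: Cons block_sum.simps m)
  qed simp
qed

text \<open>Only the term in which every gap is empty and the block is everything contains the
  cumulant of full length; all the others have fewer arguments, where \<open>c\<close> and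
  \<open>c'\<close> agree.\<close>

lemma block_sum_top:
  assumes c: "bimodule_map A d p c" and c': "bimodule_map A d p c'"
    and "as \<noteq> []" "set as \<subseteq> carrier A" "set bs \<subseteq> carrier A"
    and "\<And>ls. length ls < length bs + length as \<Longrightarrow> c ls = c' ls"
    and "\<And>ls. length ls = length bs + length as \<Longrightarrow> c' ls = \<zero>"
  shows "block_sum c bs as = c (bs @ as) \<oplus> block_sum c' bs as"
  using assms(3-)
proof (induction as arbitrary: bs)
  case (Cons x xs)
  note [simp] = Cons.prems(2,3)
  have [simp]: "x \<in> carrier A" "set xs \<subseteq> carrier A" using Cons.prems by auto
  show ?case
  proof (cases xs)
    case Nil
    then show ?thesis using Cons.prems(5)[of "bs @ [x]"] c_closed[OF c, of "bs @ [x]"] by simp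
  next
    case (Cons y ys)
    then have "0 < length xs" by simp
    \<comment> \<open>Index 0 is the empty gap, the only one that keeps the total number of
      arguments.\<close>
    then have l: "[0..<length xs] = 0 # [1..<length xs]" by (metis One_nat_def upt_conv_Cons)
    have IH: "block_sum c (bs @ [x]) xs = c (bs @ x # xs) \<oplus> block_sum c' (bs @ [x]) xs"
      using Cons.IH[of "bs @ [x]"] Cons.prems Cons by simp
    have eq: "block_sum c (bs @ [x \<otimes> Mo (take i xs)]) (drop i xs) = block_sum c' (bs @ [x \<otimes> Mo (take i xs)]) (drop i xs)"
      if "i \<in> set [1..<length xs]" for i
      using that Cons.prems(4) by (intro block_sum_cong) auto
    have bc: "block_sum c' (bs @ [x \<otimes> Mo (take i xs)]) (drop i xs) \<in> carrier A" for i
      by (intro block_sum_closed[OF c'] set_drop_closed) auto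
    have as: "asum (map (\<lambda>i. block_sum c' (bs @ [x \<otimes> Mo (take i xs)]) (drop i xs)) is) \<in> carrier A" for "is" :: "nat list"
      using bc by (intro asum_closed) auto
    have c1: "c (bs @ [x]) = c' (bs @ [x])" using Cons by (intro Cons.prems(4)) auto
    have cl: "c' (bs @ [x]) \<in> carrier A" "c (bs @ x # xs) \<in> carrier A"
      using c_closed[OF c', of "bs @ [x]"] c_closed[OF c, of "bs @ x # xs"] by auto
    have b0: "block_sum c' (bs @ [x]) xs \<in> carrier A" using bc[of 0] by simp
    define S where "S = asum (map (\<lambda>i. block_sum c' (bs @ [x \<otimes> Mo (take i xs)]) (drop i xs)) [1..<length xs])"
    have S: "S \<in> carrier A" unfolding S_def by (rule as)
    have m: "map (\<lambda>i. block_sum c (bs @ [x \<otimes> Mo (take i xs)]) (drop i xs)) [1..<length xs] =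
        map (\<lambda>i. block_sum c' (bs @ [x \<otimes> Mo (take i xs)]) (drop i xs)) [1..<length xs]"
      by (intro map_cong refl eq)
    have 1: "block_sum c bs (x # xs) = c (bs @ [x]) \<otimes> Mo xs \<oplus> (block_sum c (bs @ [x]) xs \<oplus> S)"
      by (simp only: block_sum.simps l list.map foldr.simps comp_apply take_0 drop_0 Mo_Nil alg.r_one[OF \<open>x \<in> carrier A\<close>] m S_def)
    have 2: "block_sum c' bs (x # xs) = c' (bs @ [x]) \<otimes> Mo xs \<oplus> (block_sum c' (bs @ [x]) xs \<oplus> S)"
      by (simp only: block_sum.simps l list.map foldr.simps comp_apply take_0 drop_0 Mo_Nil alg.r_one[OF \<open>x \<in> carrier A\<close>] S_def)
    show ?thesis
      unfolding 1 2 IH c1 using S cl b0 by (simp add: alg.a_ac)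
  qed
qed simp

text \<open>Truncation avoids circularity: with the cumulant of order \<open>n + 1\<close> put to
  zero, \<open>block_sum\<close> gives precisely the contributions of lower order, which are
  subtracted from the moment.\<close>

primrec cumulant_upto :: "nat \<Rightarrow> 'u list \<Rightarrow> 'u" where
  "cumulant_upto 0 as = \<zero>"
| "cumulant_upto (Suc n) as =
     (if length as = Suc n then Mo as \<ominus> block_sum (cumulant_upto n) [] as else cumulant_upto n as)"

definition cumulant :: "'u list \<Rightarrow> 'u" where
  "cumulant as = cumulant_upto (length as) as"

lemma minus_add_distrib:
  "a \<in> carrier A \<Longrightarrow> b \<in> carrier A \<Longrightarrow> c \<in> carrier A \<Longrightarrow> e \<in> carrier A \<Longrightarrow>
     (a \<oplus> b) \<ominus> (c \<oplus> e) = (a \<ominus> c) \<oplus> (b \<ominus> e)"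
  by (simp add: alg.minus_eq alg.minus_add alg.a_ac)

lemma minus_l_distr: "a \<in> carrier A \<Longrightarrow> b \<in> carrier A \<Longrightarrow> e \<in> carrier A \<Longrightarrow> e \<otimes> (a \<ominus> b) = e \<otimes> a \<ominus> e \<otimes> b"
  and minus_r_distr: "a \<in> carrier A \<Longrightarrow> b \<in> carrier A \<Longrightarrow> e \<in> carrier A \<Longrightarrow> (a \<ominus> b) \<otimes> e = a \<otimes> e \<ominus> b \<otimes> e"
  by (simp_all add: alg.minus_eq alg.r_distr alg.l_distr alg.r_minus alg.l_minus)

text \<open>In the new order the cumulant is a difference of the moment and
  \<open>block_sum\<close>, and both have the bimodule properties; this is the purpose of the
  \<open>block_sum\<close> lemmas above.\<close>

lemma bimodule_map_cumulant_upto: "bimodule_map A d p (cumulant_upto n)"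
proof (induction n)
  case 0
  show ?case by (simp add: bimodule_map_def Ds_closed)
next
  case (Suc n)
  let ?c = "cumulant_upto n"
  note c = Suc
  show ?case
    unfolding bimodule_map_def
  proof (intro conjI allI ballI impI; (elim conjE)?)
    fix as assume "as \<noteq> []" "set as \<subseteq> carrier A"
    then show "cumulant_upto (Suc n) as \<in> Ds"
      using c_Ds[OF c, of as] block_sum_Ds[OF c, of "[]" as] by (simp add: alg.minus_eq Ds_uminus)
  next
    fix as bs x y assume [simp]: "x \<in> carrier A" "y \<in> carrier A" "set as \<subseteq> carrier A" "set bs \<subseteq> carrier A"
    show "cumulant_upto (Suc n) (as @ (x \<oplus> y) # bs) = cumulant_upto (Suc n) (as @ x # bs) \<oplus> cumulant_upto (Suc n) (as @ y # bs)"
      using c_add[OF c, of as bs x y] Mo_add[of as bs x y] block_sum_add[OF c, of bs x y as "[]"]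
        block_sum_closed[OF c, of "[]" "as @ x # bs"] block_sum_closed[OF c, of "[]" "as @ y # bs"]
      by (simp add: minus_add_distrib)
  next
    fix as bs x y e assume [simp]: "x \<in> carrier A" "y \<in> carrier A" "e \<in> Ds" "set as \<subseteq> carrier A" "set bs \<subseteq> carrier A"
    show "cumulant_upto (Suc n) (as @ (x \<otimes> e) # y # bs) = cumulant_upto (Suc n) (as @ x # (e \<otimes> y) # bs)"
      using c_balanced[OF c, of as bs x y e] Mo_balanced[of as bs x y e] block_sum_balanced[OF c, of bs x y e as "[]"]
      by simp
  next
    fix as x e assume [simp]: "x \<in> carrier A" "e \<in> Ds" "set as \<subseteq> carrier A"
    show "cumulant_upto (Suc n) ((e \<otimes> x) # as) = e \<otimes> cumulant_upto (Suc n) (x # as)"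
      using c_left[OF c, of as x e] Mo_left[of as x e] block_sum_left[OF c, of as x e]
        block_sum_closed[OF c, of "[]" "x # as"]
      by (simp add: minus_l_distr Ds_closed del: alg_prod_simps block_sum.simps)
    show "cumulant_upto (Suc n) (as @ [x \<otimes> e]) = cumulant_upto (Suc n) (as @ [x]) \<otimes> e"
      using c_right[OF c, of as x e] Mo_right[of as x e] block_sum_right[OF c, of x e as "[]"]
        block_sum_closed[OF c, of "[]" "as @ [x]"]
      by (simp add: minus_r_distr Ds_closed)
  qed
qed

lemma cumulant_upto_eq: "length as \<le> n \<Longrightarrow> cumulant_upto n as = cumulant as"
proof (induction n)
  case (Suc n)
  then show ?case by (cases "length as = Suc n") (auto simp: cumulant_def)
qed (simp add: cumulant_def)

lemma cumulant_upto_zero: "n < length as \<Longrightarrow> cumulant_upto n as = \<zero>"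
  by (induction n) auto

lemma bimodule_map_cumulant: "bimodule_map A d p cumulant"
proof -
  have b: "cumulant as = cumulant_upto (length bs) as" if "length as = length bs" for as bs :: "'u list"
    using that by (simp add: cumulant_def)
  show ?thesis
    unfolding bimodule_map_def
  proof (intro conjI allI ballI impI; (elim conjE)?)
    fix as assume "as \<noteq> []" "set as \<subseteq> carrier A"
    then show "cumulant as \<in> Ds" unfolding cumulant_def by (rule c_Ds[OF bimodule_map_cumulant_upto])
  next
    fix as bs x y assume [simp]: "x \<in> carrier A" "y \<in> carrier A" "set as \<subseteq> carrier A" "set bs \<subseteq> carrier A"
    show "cumulant (as @ (x \<oplus> y) # bs) = cumulant (as @ x # bs) \<oplus> cumulant (as @ y # bs)"
      using c_add[OF bimodule_map_cumulant_upto, of as bs x y "length (as @ x # bs)"] by (simp add: cumulant_def del: cumulant_upto.simps)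
  next
    fix as bs x y e assume [simp]: "x \<in> carrier A" "y \<in> carrier A" "e \<in> Ds" "set as \<subseteq> carrier A" "set bs \<subseteq> carrier A"
    show "cumulant (as @ (x \<otimes> e) # y # bs) = cumulant (as @ x # (e \<otimes> y) # bs)"
      using c_balanced[OF bimodule_map_cumulant_upto, of as bs x y e "length (as @ x # y # bs)"] by (simp add: cumulant_def del: cumulant_upto.simps)
  next
    fix as x e assume [simp]: "x \<in> carrier A" "e \<in> Ds" "set as \<subseteq> carrier A"
    show "cumulant ((e \<otimes> x) # as) = e \<otimes> cumulant (x # as)"
      using c_left[OF bimodule_map_cumulant_upto, of as x e "length (x # as)"] by (simp add: cumulant_def del: cumulant_upto.simps)
    show "cumulant (as @ [x \<otimes> e]) = cumulant (as @ [x]) \<otimes> e"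
      using c_right[OF bimodule_map_cumulant_upto, of as x e "length (as @ [x])"] by (simp add: cumulant_def del: cumulant_upto.simps)
  qed
qed

lemma Mo_eq_block_sum:
  assumes "as \<noteq> []" "set as \<subseteq> carrier A"
  shows "Mo as = block_sum cumulant [] as"
proof -
  obtain n where n: "length as = Suc n" using assms(1) by (cases as) auto
  have "block_sum cumulant [] as = cumulant as \<oplus> block_sum (cumulant_upto n) [] as"
    using block_sum_top[OF bimodule_map_cumulant bimodule_map_cumulant_upto assms, of "[]" n]
    by (simp add: n cumulant_upto_eq cumulant_upto_zero)
  moreover have "cumulant as = Mo as \<ominus> block_sum (cumulant_upto n) [] as"
    by (simp add: cumulant_def n)
  ultimately show ?thesis
    using block_sum_closed[OF bimodule_map_cumulant_upto, of "[]" as n] assms(2)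
    by (simp add: alg.minus_eq alg.a_assoc alg.l_neg)
qed

end

section \<open>Noncrossing partitions of intervals\<close>

definition NCi :: "nat \<Rightarrow> nat \<Rightarrow> nat set set set" where
  "NCi l h = {\<sigma>. partition_on {l..<h} \<sigma> \<and> noncrossing \<sigma>}"

text \<open>Written as a union so that it makes sense for every \<open>\<sigma>\<close> and
  coincides with the expression in \<open>nested_cumulant\<close>.\<close>

definition blk :: "nat set set \<Rightarrow> nat \<Rightarrow> nat set" where
  "blk \<sigma> i = \<Union>{V \<in> \<sigma>. i \<in> V}"

text \<open>Rebuilds a partition in which \<open>u\<close> is the successor of \<open>l\<close> in
  its block: \<open>\<sigma>1\<close> lives in the gap between them and \<open>\<sigma>2\<close> on
  the elements from \<open>u\<close> on, with \<open>u\<close> standing in for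
  \<open>l\<close>.\<close>

definition glue :: "nat \<Rightarrow> nat \<Rightarrow> nat set set \<Rightarrow> nat set set \<Rightarrow> nat set set" where
  "glue l u \<sigma>1 \<sigma>2 = \<sigma>1 \<union> (\<lambda>V. if u \<in> V then insert l V else V) ` \<sigma>2"

lemma NCiD:
  assumes "\<sigma> \<in> NCi l h"
  shows "V \<in> \<sigma> \<Longrightarrow> V \<noteq> {}" "V \<in> \<sigma> \<Longrightarrow> x \<in> V \<Longrightarrow> l \<le> x" "V \<in> \<sigma> \<Longrightarrow> x \<in> V \<Longrightarrow> x < h"
    "l \<le> x \<Longrightarrow> x < h \<Longrightarrow> \<exists>V\<in>\<sigma>. x \<in> V"
    "V \<in> \<sigma> \<Longrightarrow> W \<in> \<sigma> \<Longrightarrow> x \<in> V \<Longrightarrow> x \<in> W \<Longrightarrow> V = W"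
    "V \<in> \<sigma> \<Longrightarrow> W \<in> \<sigma> \<Longrightarrow> a \<in> V \<Longrightarrow> b \<in> W \<Longrightarrow> a' \<in> V \<Longrightarrow> b' \<in> W \<Longrightarrow> a < b \<Longrightarrow> b < a' \<Longrightarrow> a' < b' \<Longrightarrow> V = W"
proof -
  have P: "partition_on {l..<h} \<sigma>" and nc: "noncrossing \<sigma>" using assms by (simp_all add: NCi_def)
  note U = partition_onD1[OF P]
  show "V \<in> \<sigma> \<Longrightarrow> V \<noteq> {}" using partition_onD3[OF P] by blast
  show "V \<in> \<sigma> \<Longrightarrow> x \<in> V \<Longrightarrow> l \<le> x" "V \<in> \<sigma> \<Longrightarrow> x \<in> V \<Longrightarrow> x < h"
    using UnionI[of V \<sigma> x] unfolding U[symmetric] by simp_all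
  show "l \<le> x \<Longrightarrow> x < h \<Longrightarrow> \<exists>V\<in>\<sigma>. x \<in> V"
  proof -
    assume "l \<le> x" "x < h"
    then have "x \<in> \<Union>\<sigma>" unfolding U[symmetric] by simp
    then show ?thesis by blast
  qed
  show "V \<in> \<sigma> \<Longrightarrow> W \<in> \<sigma> \<Longrightarrow> x \<in> V \<Longrightarrow> x \<in> W \<Longrightarrow> V = W"
    using disjointD[OF partition_onD2[OF P], of V W] by blast
  show "V \<in> \<sigma> \<Longrightarrow> W \<in> \<sigma> \<Longrightarrow> a \<in> V \<Longrightarrow> b \<in> W \<Longrightarrow> a' \<in> V \<Longrightarrow> b' \<in> W \<Longrightarrow> a < b \<Longrightarrow> b < a' \<Longrightarrow> a' < b' \<Longrightarrow> V = W"
    using nc[unfolded noncrossing_def, rule_format, of V W a b a' b'] by simp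
qed

lemma NCiI:
  assumes "\<And>V. V \<in> \<sigma> \<Longrightarrow> V \<noteq> {}" "\<And>V x. V \<in> \<sigma> \<Longrightarrow> x \<in> V \<Longrightarrow> l \<le> x \<and> x < h"
    "\<And>x. l \<le> x \<Longrightarrow> x < h \<Longrightarrow> \<exists>V\<in>\<sigma>. x \<in> V"
    "\<And>V W x. V \<in> \<sigma> \<Longrightarrow> W \<in> \<sigma> \<Longrightarrow> x \<in> V \<Longrightarrow> x \<in> W \<Longrightarrow> V = W"
    "\<And>V W a b a' b'. V \<in> \<sigma> \<Longrightarrow> W \<in> \<sigma> \<Longrightarrow> a \<in> V \<Longrightarrow> b \<in> W \<Longrightarrow> a' \<in> V \<Longrightarrow> b' \<in> W \<Longrightarrow> a < b \<Longrightarrow> b < a' \<Longrightarrow> a' < b' \<Longrightarrow> V = W"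
  shows "\<sigma> \<in> NCi l h"
proof -
  have "noncrossing \<sigma>" unfolding noncrossing_def
    by (intro ballI impI, elim conjE) (rule assms(5))
  moreover have "partition_on {l..<h} \<sigma>"
  proof (rule partition_onI)
    show "\<Union>\<sigma> = {l..<h}"
    proof (intro equalityI subsetI)
      fix x assume "x \<in> \<Union>\<sigma>"
      then obtain V where "V \<in> \<sigma>" "x \<in> V" by blast
      then show "x \<in> {l..<h}" using assms(2) by simp
    next
      fix x assume "x \<in> {l..<h}"
      then show "x \<in> \<Union>\<sigma>" using assms(3)[of x] by simp
    qed
    show "disjnt V W" if "V \<in> \<sigma>" "W \<in> \<sigma>" "V \<noteq> W" for V W
      using assms(4)[OF that(1,2)] that(3) unfolding disjnt_iff by blast
    show "{} \<notin> \<sigma>" using assms(1)[of "{}"] by blast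
  qed
  ultimately show ?thesis by (simp add: NCi_def)
qed

lemma finite_NCi [simp]: "finite (NCi l h)"
proof (rule finite_subset)
  show "NCi l h \<subseteq> Pow (Pow {l..<h})"
  proof
    fix \<sigma> assume "\<sigma> \<in> NCi l h"
    then show "\<sigma> \<in> Pow (Pow {l..<h})" using NCiD(2,3) by auto
  qed
qed simp

lemma NCi_empty: "NCi l l = {{}}"
  by (auto simp: NCi_def partition_on_empty noncrossing_def)

lemma insert_singleton_NCi:
  assumes "\<tau> \<in> NCi (Suc l) h" "l < h"
  shows "insert {l} \<tau> \<in> NCi l h"
proof -
  note t = NCiD[OF assms(1)]
  have ge: "l < x" if "V \<in> \<tau>" "x \<in> V" for V x using t(2)[OF that] by simp
  show ?thesis
  proof (rule NCiI)
    fix V assume "V \<in> insert {l} \<tau>"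
    then show "V \<noteq> {}" using t(1) by auto
  next
    fix V x assume "V \<in> insert {l} \<tau>" "x \<in> V"
    then show "l \<le> x \<and> x < h" using ge[of V x] t(3)[of V x] assms(2) by auto
  next
    fix x assume "l \<le> x" "x < h"
    then show "\<exists>V\<in>insert {l} \<tau>. x \<in> V" using t(4)[of x] by (cases "x = l") auto
  next
    fix V W x assume "V \<in> insert {l} \<tau>" "W \<in> insert {l} \<tau>" "x \<in> V" "x \<in> W"
    then show "V = W" using t(5)[of V W x] ge[of V x] ge[of W x] by auto
  next
    fix V W a b a' b' assume 1: "V \<in> insert {l} \<tau>" "W \<in> insert {l} \<tau>" "a \<in> V" "b \<in> W" "a' \<in> V" "b' \<in> W" "a < b" "b < a'" "a' < b'"
    then have "V \<noteq> {l}" "W \<noteq> {l}" by auto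
    then have "V \<in> \<tau>" "W \<in> \<tau>" using 1 by auto
    then show "V = W" using t(6)[of V W a b a' b'] 1 by simp
  qed
qed

lemma glue_cases:
  assumes "V \<in> glue l u \<sigma>1 \<sigma>2"
  obtains "V \<in> \<sigma>1" | V' where "V' \<in> \<sigma>2" "V = (if u \<in> V' then insert l V' else V')"
  using assms unfolding glue_def by blast

context
  fixes l u h :: nat and \<sigma>1 \<sigma>2 :: "nat set set"
  assumes lu: "l < u" "u < h" and s1: "\<sigma>1 \<in> NCi (Suc l) u" and s2: "\<sigma>2 \<in> NCi u h"
begin

lemma s1_bounds: "V \<in> \<sigma>1 \<Longrightarrow> x \<in> V \<Longrightarrow> l < x \<and> x < u"
  using NCiD(2,3)[OF s1, of V x] by simp

lemma s2_bounds: "V \<in> \<sigma>2 \<Longrightarrow> x \<in> V \<Longrightarrow> u \<le> x \<and> x < h"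
  using NCiD(2,3)[OF s2, of V x] by simp

text \<open>A new crossing could involve \<open>l\<close> only as the smallest of its four points.
  Since \<open>l\<close> shares its block with \<open>u\<close>, the crossing would occur in
  \<open>\<sigma>2\<close> already with \<open>u\<close> instead of \<open>l\<close>, unless the
  second block contains \<open>u\<close> and thus is the same.\<close>

lemma glue_NCi: "glue l u \<sigma>1 \<sigma>2 \<in> NCi l h"
proof (rule NCiI)
  let ?f = "\<lambda>V. if u \<in> V then insert l V else V"
  have l2: "l \<notin> V" if "V \<in> \<sigma>2" for V using s2_bounds[OF that, of l] lu by auto
  {
    fix V assume "V \<in> glue l u \<sigma>1 \<sigma>2"
    then show "V \<noteq> {}" using NCiD(1)[OF s1, of "{}"] NCiD(1)[OF s2, of "{}"]
      by (auto elim!: glue_cases split: if_splits)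
  next
    fix V x assume "V \<in> glue l u \<sigma>1 \<sigma>2" "x \<in> V"
    from this(1) show "l \<le> x \<and> x < h"
    proof (cases rule: glue_cases)
      case 1
      then show ?thesis using s1_bounds[of V x] \<open>x \<in> V\<close> lu by simp
    next
      case (2 V')
      then show ?thesis using s2_bounds[of V' x] \<open>x \<in> V\<close> lu by (auto split: if_splits)
    qed
  next
    fix x assume x: "l \<le> x" "x < h"
    show "\<exists>V\<in>glue l u \<sigma>1 \<sigma>2. x \<in> V"
    proof (cases "x < u")
      case True
      show ?thesis
      proof (cases "x = l")
        case True
        obtain V where "V \<in> \<sigma>2" "u \<in> V" using NCiD(4)[OF s2, of u] lu by auto
        then have "insert l V \<in> glue l u \<sigma>1 \<sigma>2" unfolding glue_def by (intro UnI2 image_eqI[of _ _ V]) simp_all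
        then show ?thesis using True by blast
      next
        case False
        then obtain V where "V \<in> \<sigma>1" "x \<in> V" using NCiD(4)[OF s1, of x] True x by auto
        then show ?thesis unfolding glue_def by blast
      qed
    next
      case False
      then obtain V where "V \<in> \<sigma>2" "x \<in> V" using NCiD(4)[OF s2, of x] x by auto
      then have "?f V \<in> glue l u \<sigma>1 \<sigma>2" "x \<in> ?f V" unfolding glue_def by auto
      then show ?thesis by blast
    qed
  next
    fix V W x assume "V \<in> glue l u \<sigma>1 \<sigma>2" "W \<in> glue l u \<sigma>1 \<sigma>2" and x: "x \<in> V" "x \<in> W"
    from this(1) show "V = W"
    proof (cases rule: glue_cases)
      case 1
      from \<open>W \<in> glue l u \<sigma>1 \<sigma>2\<close> show ?thesis
      proof (cases rule: glue_cases)
        case 1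
        then show ?thesis using NCiD(5)[OF s1] \<open>V \<in> \<sigma>1\<close> x by blast
      next
        case (2 W')
        then show ?thesis using s1_bounds[OF \<open>V \<in> \<sigma>1\<close> x(1)] s2_bounds[OF 2(1), of x] x by (auto split: if_splits)
      qed
    next
      case V: (2 V')
      from \<open>W \<in> glue l u \<sigma>1 \<sigma>2\<close> show ?thesis
      proof (cases rule: glue_cases)
        case 1
        then show ?thesis using s1_bounds[OF 1 x(2)] s2_bounds[OF V(1), of x] x V by (auto split: if_splits)
      next
        case W: (2 W')
        have "V' = W'"
        proof (cases "x = l")
          case True
          then have "u \<in> V'" "u \<in> W'" using x V W l2 by (auto split: if_splits)
          then show ?thesis using NCiD(5)[OF s2 V(1) W(1)] by blast
        next
          case False
          then have "x \<in> V'" "x \<in> W'" using x V W by (auto split: if_splits)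
          then show ?thesis using NCiD(5)[OF s2 V(1) W(1)] by blast
        qed
        then show ?thesis using V W by simp
      qed
    qed
  next
    fix V W a b a' b' assume VW: "V \<in> glue l u \<sigma>1 \<sigma>2" "W \<in> glue l u \<sigma>1 \<sigma>2"
      and ab: "a \<in> V" "b \<in> W" "a' \<in> V" "b' \<in> W" "a < b" "b < a'" "a' < b'"
    from VW(1) show "V = W"
    proof (cases rule: glue_cases)
      case V: 1
      from VW(2) show ?thesis
      proof (cases rule: glue_cases)
        case 1
        then show ?thesis using NCiD(6)[OF s1 V 1 ab] by blast
      next
        case (2 W')
        then have "b = l \<or> u \<le> b" using s2_bounds[OF 2(1), of b] ab by (auto split: if_splits)
        then show ?thesis using s1_bounds[OF V ab(1)] s1_bounds[OF V ab(3)] ab by auto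
      qed
    next
      case V: (2 V')
      then have a': "a' = l \<or> u \<le> a'" "a = l \<and> u \<in> V' \<or> a \<in> V'" using s2_bounds[OF V(1), of a'] ab by (auto split: if_splits)
      have "l \<le> a" using a' s2_bounds[OF V(1), of a] lu by auto
      from VW(2) show ?thesis
      proof (cases rule: glue_cases)
        case 1
        then show ?thesis using s1_bounds[OF 1 ab(2)] s1_bounds[OF 1 ab(4)] a' ab by auto
      next
        case W: (2 W')
        have gt: "l < b" "l < a'" "l < b'" using \<open>l \<le> a\<close> ab by auto
        then have in': "b \<in> W'" "a' \<in> V'" "b' \<in> W'" using ab V W by (auto split: if_splits)
        have "V' = W'"
        proof (cases "a \<in> V'")
          case True
          then show ?thesis using NCiD(6)[OF s2 V(1) W(1) True in' ab(5-7)] by blast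
        next
          case False
          then have u: "u \<in> V'" using a' by blast
          show ?thesis
          proof (cases "b = u")
            case True
            then show ?thesis using NCiD(5)[OF s2 V(1) W(1) u] in' by blast
          next
            case False
            then have "u < b" using s2_bounds[OF W(1) in'(1)] by simp
            then show ?thesis using NCiD(6)[OF s2 V(1) W(1) u in' _ ab(6,7)] by blast
          qed
        qed
        then show ?thesis using V W by simp
      qed
    qed
  }
qed

lemma blk_glue_l: "blk (glue l u \<sigma>1 \<sigma>2) l = insert l (blk \<sigma>2 u)"
proof -
  obtain V where V: "V \<in> \<sigma>2" "u \<in> V" using NCiD(4)[OF s2, of u] lu by auto
  have "{W \<in> glue l u \<sigma>1 \<sigma>2. l \<in> W} = {insert l V}"
  proof (intro equalityI subsetI)
    fix W assume "W \<in> {W \<in> glue l u \<sigma>1 \<sigma>2. l \<in> W}"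
    then have W: "W \<in> glue l u \<sigma>1 \<sigma>2" "l \<in> W" by auto
    from W(1) show "W \<in> {insert l V}"
    proof (cases rule: glue_cases)
      case 1
      then show ?thesis using s1_bounds[OF 1 W(2)] by simp
    next
      case (2 W')
      moreover have "l \<notin> W'" using s2_bounds[OF 2(1), of l] lu by auto
      ultimately have "u \<in> W'" "W = insert l W'" using W(2) by (auto split: if_splits)
      then show ?thesis using NCiD(5)[OF s2 2(1) V(1) _ V(2)] by auto
    qed
  next
    fix W assume "W \<in> {insert l V}"
    then show "W \<in> {W \<in> glue l u \<sigma>1 \<sigma>2. l \<in> W}" using V unfolding glue_def by force
  qed
  moreover have "{W \<in> \<sigma>2. u \<in> W} = {V}" using V NCiD(5)[OF s2] by blast
  ultimately show ?thesis by (simp add: blk_def)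
qed

lemma blk_glue_low: "l < i \<Longrightarrow> i < u \<Longrightarrow> blk (glue l u \<sigma>1 \<sigma>2) i = blk \<sigma>1 i"
proof -
  assume i: "l < i" "i < u"
  have "{W \<in> glue l u \<sigma>1 \<sigma>2. i \<in> W} = {W \<in> \<sigma>1. i \<in> W}"
  proof (intro equalityI subsetI)
    fix W assume "W \<in> {W \<in> glue l u \<sigma>1 \<sigma>2. i \<in> W}"
    then have W: "W \<in> glue l u \<sigma>1 \<sigma>2" "i \<in> W" by auto
    from W(1) show "W \<in> {W \<in> \<sigma>1. i \<in> W}"
    proof (cases rule: glue_cases)
      case (2 W')
      then show ?thesis using W(2) i s2_bounds[OF 2(1), of i] by (auto split: if_splits)
    qed (use W in simp)
  qed (simp add: glue_def)
  then show ?thesis by (simp add: blk_def)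
qed

text \<open>Only the part from \<open>i\<close> on is compared, as the block of \<open>u\<close> has
  gained the smaller element \<open>l\<close>.\<close>

lemma blk_glue_high: "u \<le> i \<Longrightarrow> blk (glue l u \<sigma>1 \<sigma>2) i \<inter> {i..} = blk \<sigma>2 i \<inter> {i..}"
proof -
  assume i: "u \<le> i"
  let ?f = "\<lambda>V. if u \<in> V then insert l V else V"
  have "{W \<in> glue l u \<sigma>1 \<sigma>2. i \<in> W} = ?f ` {W \<in> \<sigma>2. i \<in> W}"
  proof (intro equalityI subsetI)
    fix W assume "W \<in> {W \<in> glue l u \<sigma>1 \<sigma>2. i \<in> W}"
    then have W: "W \<in> glue l u \<sigma>1 \<sigma>2" "i \<in> W" by auto
    from W(1) show "W \<in> ?f ` {W \<in> \<sigma>2. i \<in> W}"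
    proof (cases rule: glue_cases)
      case 1
      then show ?thesis using s1_bounds[OF 1 W(2)] i by simp
    next
      case (2 W')
      then have "i \<in> W'" using W(2) i lu by (auto split: if_splits)
      then show ?thesis using 2 by blast
    qed
  next
    fix W assume "W \<in> ?f ` {W \<in> \<sigma>2. i \<in> W}"
    then obtain W' where "W' \<in> \<sigma>2" "i \<in> W'" "W = ?f W'" by blast
    then show "W \<in> {W \<in> glue l u \<sigma>1 \<sigma>2. i \<in> W}" unfolding glue_def by simp
  qed
  then show ?thesis using i lu by (auto simp: blk_def split: if_splits)
qed

text \<open>Gives injectivity of gluing for fixed \<open>u\<close>; the index \<open>u\<close>
  itself is recovered by \<open>Min_blk_glue\<close>.\<close>

lemma glue_recover:
  "\<sigma>1 = {V \<in> glue l u \<sigma>1 \<sigma>2. V \<subseteq> {l<..<u}}"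
  "\<sigma>2 = (\<lambda>V. V - {l}) ` {V \<in> glue l u \<sigma>1 \<sigma>2. \<not> V \<subseteq> {l<..<u}}"
proof -
  let ?f = "\<lambda>V. if u \<in> V then insert l V else V"
  have 1: "V \<subseteq> {l<..<u}" if "V \<in> \<sigma>1" for V using s1_bounds[OF that] by auto
  have 2: "\<not> ?f V \<subseteq> {l<..<u}" "?f V - {l} = V" if V: "V \<in> \<sigma>2" for V
  proof -
    obtain x where x: "x \<in> V" using NCiD(1)[OF s2 V] by blast
    then have "x \<in> ?f V" "u \<le> x" using s2_bounds[OF V x] by auto
    then show "\<not> ?f V \<subseteq> {l<..<u}" by force
    have "l \<notin> V" using s2_bounds[OF V, of l] lu by auto
    then show "?f V - {l} = V" by auto
  qed
  show "\<sigma>1 = {V \<in> glue l u \<sigma>1 \<sigma>2. V \<subseteq> {l<..<u}}"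
    using 1 2(1) unfolding glue_def by blast
  have "{V \<in> glue l u \<sigma>1 \<sigma>2. \<not> V \<subseteq> {l<..<u}} = ?f ` \<sigma>2"
    using 1 2(1) unfolding glue_def by blast
  moreover have "(\<lambda>V. ?f V - {l}) ` \<sigma>2 = (\<lambda>V. V) ` \<sigma>2" by (intro image_cong refl 2(2))
  ultimately show "\<sigma>2 = (\<lambda>V. V - {l}) ` {V \<in> glue l u \<sigma>1 \<sigma>2. \<not> V \<subseteq> {l<..<u}}"
    by (simp only: image_image image_ident)
qed

lemma Min_blk_glue: "Min (blk (glue l u \<sigma>1 \<sigma>2) l - {l}) = u"
proof (rule Min_eqI)
  have "blk \<sigma>2 u \<subseteq> {u..<h}" using s2_bounds by (auto simp: blk_def)
  then show "finite (blk (glue l u \<sigma>1 \<sigma>2) l - {l})" "\<And>y. y \<in> blk (glue l u \<sigma>1 \<sigma>2) l - {l} \<Longrightarrow> u \<le> y"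
    unfolding blk_glue_l by (auto intro: finite_subset)
  obtain V where "V \<in> \<sigma>2" "u \<in> V" using NCiD(4)[OF s2, of u] lu by auto
  then show "u \<in> blk (glue l u \<sigma>1 \<sigma>2) l - {l}" unfolding blk_glue_l using lu by (auto simp: blk_def)
qed

end

lemma blk_insert_singleton:
  assumes "\<tau> \<in> NCi (Suc l) h"
  shows "blk (insert {l} \<tau>) l = {l}" "l < i \<Longrightarrow> blk (insert {l} \<tau>) i = blk \<tau> i"
proof -
  have "l \<notin> V" if "V \<in> \<tau>" for V using NCiD(2)[OF assms that, of l] by auto
  then have "{V \<in> insert {l} \<tau>. l \<in> V} = {{l}}" by auto
  then show "blk (insert {l} \<tau>) l = {l}" by (simp add: blk_def)
  assume "l < i"
  then have "{V \<in> insert {l} \<tau>. i \<in> V} = {V \<in> \<tau>. i \<in> V}" by auto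
  then show "blk (insert {l} \<tau>) i = blk \<tau> i" by (simp add: blk_def)
qed

text \<open>Classification by the successor \<open>u\<close> of \<open>l\<close> in its block; if
  there is none, \<open>{l}\<close> is a block.\<close>

lemma NCi_decompose:
  assumes lh: "l < h"
  shows "NCi l h = insert {l} ` NCi (Suc l) h \<union>
    (\<Union>u\<in>{l<..<h}. (\<lambda>(\<sigma>1, \<sigma>2). glue l u \<sigma>1 \<sigma>2) ` (NCi (Suc l) u \<times> NCi u h))" (is "_ = ?A \<union> ?U")
proof (intro equalityI subsetI)
  fix \<sigma> assume s: "\<sigma> \<in> NCi l h"
  note D = NCiD[OF s]
  obtain V0 where V0: "V0 \<in> \<sigma>" "l \<in> V0" using D(4)[of l] lh by auto
  show "\<sigma> \<in> ?A \<union> ?U"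
  proof (cases "V0 = {l}")
    case True
    have l: "l \<notin> V" if "V \<in> \<sigma> - {{l}}" for V using that D(5)[of V V0 l] V0 True by auto
    have "\<sigma> - {{l}} \<in> NCi (Suc l) h"
    proof (rule NCiI)
      fix V x assume "V \<in> \<sigma> - {{l}}" "x \<in> V"
      then have "x \<noteq> l" "l \<le> x" "x < h" using l[of V] D(2)[of V x] D(3)[of V x] by auto
      then show "Suc l \<le> x \<and> x < h" by simp
    next
      fix x assume x: "Suc l \<le> x" "x < h"
      then obtain V where "V \<in> \<sigma>" "x \<in> V" using D(4)[of x] by auto
      moreover from this have "V \<noteq> {l}" using x by auto
      ultimately show "\<exists>V\<in>\<sigma> - {{l}}. x \<in> V" by blast
    next
      fix V assume "V \<in> \<sigma> - {{l}}"
      then show "V \<noteq> {}" using D(1) by blast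
    next
      fix V W x assume "V \<in> \<sigma> - {{l}}" "W \<in> \<sigma> - {{l}}" "x \<in> V" "x \<in> W"
      then show "V = W" using D(5)[of V W x] by simp
    next
      fix V W a b a' b' assume "V \<in> \<sigma> - {{l}}" "W \<in> \<sigma> - {{l}}" "a \<in> V" "b \<in> W" "a' \<in> V" "b' \<in> W" "a < b" "b < a'" "a' < b'"
      then show "V = W" using D(6)[of V W a b a' b'] by simp
    qed
    moreover have "\<sigma> = insert {l} (\<sigma> - {{l}})" using V0 True by blast
    ultimately show ?thesis by (intro UnI1 image_eqI[of _ _ "\<sigma> - {{l}}"])
  next
    case False
    define u where "u = Min (V0 - {l})"
    have fin: "finite V0" using D(2,3)[OF V0(1)] by (intro finite_subset[of V0 "{l..<h}"]) auto
    have ne: "V0 - {l} \<noteq> {}" using False V0 by blast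
    have uV: "u \<in> V0" "u \<noteq> l" using Min_in[of "V0 - {l}"] fin ne unfolding u_def by auto
    have lu: "l < u" "u < h" using D(2)[OF V0(1) uV(1)] D(3)[OF V0(1) uV(1)] uV(2) by auto
    have umin: "u \<le> x" if "x \<in> V0" "x \<noteq> l" for x using that fin unfolding u_def by (intro Min_le) auto
    define \<sigma>1 where "\<sigma>1 = {V \<in> \<sigma>. V \<subseteq> {l<..<u}}"
    define \<sigma>2 where "\<sigma>2 = (\<lambda>V. V - {l}) ` {V \<in> \<sigma>. \<not> V \<subseteq> {l<..<u}}"
    \<comment> \<open>A further block that leaves the gap lies beyond \<open>u\<close> altogether:
      otherwise it would cross \<open>V0\<close>, which contains \<open>l\<close> and
      \<open>u\<close>.\<close>
    have other: "u < x" if V: "V \<in> \<sigma>" "\<not> V \<subseteq> {l<..<u}" "V \<noteq> V0" "x \<in> V" for V x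
    proof (rule ccontr)
      assume "\<not> u < x"
      have nl: "y \<noteq> l \<and> y \<noteq> u" if "y \<in> V" for y using that D(5)[OF V(1) V0(1), of y] V0 V uV by auto
      have x: "x < u" "l < x" using \<open>\<not> u < x\<close> nl[OF V(4)] D(2)[OF V(1) V(4)] by auto
      obtain y where "y \<in> V" "y \<notin> {l<..<u}" using V(2) by blast
      then have y: "y \<in> V" "\<not> (l < y \<and> y < u)" by auto
      have "u < y" using nl[OF y(1)] D(2)[OF V(1) y(1)] y(2) by auto
      then have "V0 = V" using D(6)[OF V0(1) V(1) V0(2) V(4) uV(1) y(1) x(2,1)] by simp
      then show False using V by blast
    qed
    have V0': "\<not> V0 \<subseteq> {l<..<u}" using V0 by auto
    have s2: "u \<le> x \<and> x < h" if V: "V \<in> \<sigma>" "\<not> V \<subseteq> {l<..<u}" "x \<in> V" "x \<noteq> l" for V x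
      using umin[of x] other[OF V(1,2) _ V(3)] V D(3)[OF V(1,3)] by (cases "V = V0") auto
    have s2E: "\<exists>W\<in>\<sigma>. \<not> W \<subseteq> {l<..<u} \<and> V = W - {l}" if "V \<in> \<sigma>2" for V
      using that unfolding \<sigma>2_def by (elim imageE CollectE conjE) (intro bexI conjI)
    have "\<sigma>1 \<in> NCi (Suc l) u"
    proof (rule NCiI)
      fix x assume x: "Suc l \<le> x" "x < u"
      then obtain V where V: "V \<in> \<sigma>" "x \<in> V" using D(4)[of x] lu by auto
      have "V \<subseteq> {l<..<u}"
      proof (rule ccontr)
        assume "\<not> V \<subseteq> {l<..<u}"
        then show False using s2[OF V(1) _ V(2)] x by auto
      qed
      then show "\<exists>V\<in>\<sigma>1. x \<in> V" using V by (auto simp: \<sigma>1_def)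
    next
      fix V x assume "V \<in> \<sigma>1" "x \<in> V"
      then show "Suc l \<le> x \<and> x < u" by (auto simp: \<sigma>1_def)
    next
      fix V assume "V \<in> \<sigma>1"
      then show "V \<noteq> {}" using D(1) by (simp add: \<sigma>1_def)
    next
      fix V W x assume "V \<in> \<sigma>1" "W \<in> \<sigma>1" "x \<in> V" "x \<in> W"
      then show "V = W" using D(5)[of V W x] by (simp add: \<sigma>1_def)
    next
      fix V W a b a' b' assume "V \<in> \<sigma>1" "W \<in> \<sigma>1" "a \<in> V" "b \<in> W" "a' \<in> V" "b' \<in> W" "a < b" "b < a'" "a' < b'"
      then show "V = W" using D(6)[of V W a b a' b'] by (simp add: \<sigma>1_def)
    qed
    moreover have "\<sigma>2 \<in> NCi u h"
    proof (rule NCiI)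
      fix V assume V: "V \<in> \<sigma>2"
      obtain W where W: "W \<in> \<sigma>" "\<not> W \<subseteq> {l<..<u}" "V = W - {l}" using s2E[OF V] by blast
      show "V \<noteq> {}"
      proof (cases "W = V0")
        case True
        then show ?thesis using W ne by simp
      next
        case False
        then have "l \<notin> W" using D(5)[OF W(1) V0(1), of l] V0 by auto
        then show ?thesis using W D(1)[OF W(1)] by simp
      qed
    next
      fix V x assume V: "V \<in> \<sigma>2" "x \<in> V"
      obtain W where "W \<in> \<sigma>" "\<not> W \<subseteq> {l<..<u}" "V = W - {l}" using s2E[OF V(1)] by blast
      then show "u \<le> x \<and> x < h" using s2[of W x] V(2) by simp
    next
      fix x assume x: "u \<le> x" "x < h"
      then have "l \<le> x" using lu by simp
      from D(4)[OF this x(2)] obtain V where V: "V \<in> \<sigma>" "x \<in> V" by (elim bexE)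
      have "\<not> V \<subseteq> {l<..<u}"
      proof
        assume "V \<subseteq> {l<..<u}"
        then have "x \<in> {l<..<u}" using V(2) by (rule subsetD)
        then show False using x by simp
      qed
      then have "V \<in> {V \<in> \<sigma>. \<not> V \<subseteq> {l<..<u}}" using V(1) by simp
      from imageI[OF this, of "\<lambda>V. V - {l}"] have "V - {l} \<in> \<sigma>2" unfolding \<sigma>2_def .
      moreover have "x \<in> V - {l}" using V x lu by simp
      ultimately show "\<exists>V\<in>\<sigma>2. x \<in> V" by (rule bexI[rotated])
    next
      fix V W x assume VW: "V \<in> \<sigma>2" "W \<in> \<sigma>2" and x: "x \<in> V" "x \<in> W"
      obtain V1 where V1: "V1 \<in> \<sigma>" "V = V1 - {l}" using s2E[OF VW(1)] by blast
      obtain W1 where W1: "W1 \<in> \<sigma>" "W = W1 - {l}" using s2E[OF VW(2)] by blast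
      have "x \<in> V1" "x \<in> W1" using x by (simp_all add: V1(2) W1(2))
      then have "V1 = W1" by (rule D(5)[OF V1(1) W1(1)])
      then show "V = W" by (simp only: V1(2) W1(2))
    next
      fix V W a b a' b' assume VW: "V \<in> \<sigma>2" "W \<in> \<sigma>2"
        and *: "a \<in> V" "b \<in> W" "a' \<in> V" "b' \<in> W" "a < b" "b < a'" "a' < b'"
      obtain V1 where V1: "V1 \<in> \<sigma>" "V = V1 - {l}" using s2E[OF VW(1)] by blast
      obtain W1 where W1: "W1 \<in> \<sigma>" "W = W1 - {l}" using s2E[OF VW(2)] by blast
      have "a \<in> V1" "b \<in> W1" "a' \<in> V1" "b' \<in> W1" using *(1-4) by (simp_all add: V1(2) W1(2))
      then have "V1 = W1" by (rule D(6)[OF V1(1) W1(1) _ _ _ _ *(5-7)])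
      then show "V = W" by (simp only: V1(2) W1(2))
    qed
    moreover have "\<sigma> = glue l u \<sigma>1 \<sigma>2"
    proof -
      have f: "(if u \<in> V - {l} then insert l (V - {l}) else V - {l}) = V" if V: "V \<in> \<sigma>" "\<not> V \<subseteq> {l<..<u}" for V
      proof (cases "V = V0")
        case True
        then show ?thesis using uV V0 by auto
      next
        case False
        then have "u \<notin> V" "l \<notin> V" using D(5)[OF V(1) V0(1), of u] D(5)[OF V(1) V0(1), of l] V0 uV by auto
        then show ?thesis by simp
      qed
      have "(\<lambda>V. if u \<in> V then insert l V else V) ` \<sigma>2 = {V \<in> \<sigma>. \<not> V \<subseteq> {l<..<u}}"
      proof -
        have "(\<lambda>V. if u \<in> V - {l} then insert l (V - {l}) else V - {l}) ` {V \<in> \<sigma>. \<not> V \<subseteq> {l<..<u}} = (\<lambda>V. V) ` {V \<in> \<sigma>. \<not> V \<subseteq> {l<..<u}}"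
          using f by (intro image_cong refl) blast
        then show ?thesis unfolding \<sigma>2_def image_image image_ident .
      qed
      then have "glue l u \<sigma>1 \<sigma>2 = {V \<in> \<sigma>. V \<subseteq> {l<..<u}} \<union> {V \<in> \<sigma>. \<not> V \<subseteq> {l<..<u}}"
        by (simp only: glue_def \<sigma>1_def)
      then show ?thesis by blast
    qed
    ultimately have "\<sigma> \<in> (\<lambda>(\<sigma>1, \<sigma>2). glue l u \<sigma>1 \<sigma>2) ` (NCi (Suc l) u \<times> NCi u h)"
      by (intro image_eqI[of _ _ "(\<sigma>1, \<sigma>2)"]) simp_all
    then show ?thesis using lu by (intro UnI2 UN_I[of u]) simp_all
  qed
next
  fix \<sigma> assume "\<sigma> \<in> ?A \<union> ?U"
  then show "\<sigma> \<in> NCi l h"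
  proof
    assume "\<sigma> \<in> ?A"
    then obtain \<tau> where "\<tau> \<in> NCi (Suc l) h" "\<sigma> = insert {l} \<tau>" by (elim imageE)
    then show ?thesis using insert_singleton_NCi[OF _ lh] by simp
  next
    assume "\<sigma> \<in> ?U"
    then obtain u x where u: "u \<in> {l<..<h}" and x: "x \<in> NCi (Suc l) u \<times> NCi u h" "\<sigma> = (\<lambda>(\<sigma>1, \<sigma>2). glue l u \<sigma>1 \<sigma>2) x"
      by (elim UN_E imageE)
    then show ?thesis using glue_NCi[of l u h "fst x" "snd x"] by (simp add: case_prod_unfold mem_Times_iff)
  qed
qed

lemma sum_NCi:
  fixes F :: "nat set set \<Rightarrow> 'a::comm_monoid_add"
  assumes lh: "l < h"
  shows "(\<Sum>\<sigma>\<in>NCi l h. F \<sigma>) = (\<Sum>\<tau>\<in>NCi (Suc l) h. F (insert {l} \<tau>)) +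
    (\<Sum>u\<in>{l<..<h}. \<Sum>\<sigma>1\<in>NCi (Suc l) u. \<Sum>\<sigma>2\<in>NCi u h. F (glue l u \<sigma>1 \<sigma>2))"
proof -
  let ?A = "insert {l} ` NCi (Suc l) h"
  let ?U = "\<lambda>u. (\<lambda>(\<sigma>1, \<sigma>2). glue l u \<sigma>1 \<sigma>2) ` (NCi (Suc l) u \<times> NCi u h)"
  have ne: "{l} \<notin> \<tau>" if "\<tau> \<in> NCi (Suc l) h" for \<tau>
  proof
    assume "{l} \<in> \<tau>"
    from NCiD(2)[OF that this singletonI] show False by simp
  qed
  have injA: "inj_on (insert {l}) (NCi (Suc l) h)"
  proof (rule inj_onI)
    fix a b assume ab: "a \<in> NCi (Suc l) h" "b \<in> NCi (Suc l) h" "insert {l} a = insert {l} b"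
    show "a = b" by (rule iffD1[OF insert_ident[OF ne[OF ab(1)] ne[OF ab(2)]] ab(3)])
  qed
  have injU: "inj_on (\<lambda>(\<sigma>1, \<sigma>2). glue l u \<sigma>1 \<sigma>2) (NCi (Suc l) u \<times> NCi u h)" if "u \<in> {l<..<h}" for u
  proof (rule inj_onI)
    have u: "l < u" "u < h" using that by auto
    fix x y assume x: "x \<in> NCi (Suc l) u \<times> NCi u h" and y: "y \<in> NCi (Suc l) u \<times> NCi u h"
      and eq: "(\<lambda>(\<sigma>1, \<sigma>2). glue l u \<sigma>1 \<sigma>2) x = (\<lambda>(\<sigma>1, \<sigma>2). glue l u \<sigma>1 \<sigma>2) y"
    define g where "g = (\<lambda>(\<sigma>1, \<sigma>2). glue l u \<sigma>1 \<sigma>2) y"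
    have "fst z = {V \<in> g. V \<subseteq> {l<..<u}} \<and> snd z = (\<lambda>V. V - {l}) ` {V \<in> g. \<not> V \<subseteq> {l<..<u}}"
      if "z \<in> NCi (Suc l) u \<times> NCi u h" "(\<lambda>(\<sigma>1, \<sigma>2). glue l u \<sigma>1 \<sigma>2) z = g" for z
    proof -
      have z: "fst z \<in> NCi (Suc l) u" "snd z \<in> NCi u h" and g: "g = glue l u (fst z) (snd z)"
        using that(1) unfolding that(2)[symmetric] by (simp_all add: mem_Times_iff case_prod_unfold)
      show ?thesis unfolding g by (rule conjI[OF glue_recover[OF u z]])
    qed
    note this[OF x eq[folded g_def]] this[OF y g_def[symmetric]]
    then have "fst x = fst y" "snd x = snd y" by argo+
    then show "x = y" by (rule prod_eqI)
  qed
  have disjU: "?U u \<inter> ?U v = {}" if "u \<in> {l<..<h}" "v \<in> {l<..<h}" "u \<noteq> v" for u v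
  proof -
    show ?thesis
    proof (rule equals0I)
      fix \<sigma> assume "\<sigma> \<in> ?U u \<inter> ?U v"
      then obtain x x' where x: "x \<in> NCi (Suc l) u \<times> NCi u h" "\<sigma> = (\<lambda>(\<sigma>1, \<sigma>2). glue l u \<sigma>1 \<sigma>2) x"
        and x': "x' \<in> NCi (Suc l) v \<times> NCi v h" "\<sigma> = (\<lambda>(\<sigma>1, \<sigma>2). glue l v \<sigma>1 \<sigma>2) x'"
        by (elim IntE imageE)
      obtain a b a' b' where "x = (a, b)" "x' = (a', b')" by (cases x; cases x')
      with x x' have "glue l u a b = glue l v a' b'" "a \<in> NCi (Suc l) u" "b \<in> NCi u h" "a' \<in> NCi (Suc l) v" "b' \<in> NCi v h"
        by simp_all
      then show False using Min_blk_glue[of l u h a b] Min_blk_glue[of l v h a' b'] that by simp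
    qed
  qed
  have "(\<Sum>\<sigma>\<in>(\<Union>u\<in>{l<..<h}. ?U u). F \<sigma>) = (\<Sum>u\<in>{l<..<h}. \<Sum>\<sigma>\<in>?U u. F \<sigma>)"
  proof (rule sum.UNION_disjoint)
    show "\<forall>u\<in>{l<..<h}. \<forall>v\<in>{l<..<h}. u \<noteq> v \<longrightarrow> ?U u \<inter> ?U v = {}"
      by (intro ballI impI) (rule disjU)
  qed simp_all
  also have "\<dots> = (\<Sum>u\<in>{l<..<h}. \<Sum>\<sigma>1\<in>NCi (Suc l) u. \<Sum>\<sigma>2\<in>NCi u h. F (glue l u \<sigma>1 \<sigma>2))"
  proof (rule sum.cong[OF refl])
    fix u assume "u \<in> {l<..<h}"
    show "(\<Sum>\<sigma>\<in>?U u. F \<sigma>) = (\<Sum>\<sigma>1\<in>NCi (Suc l) u. \<Sum>\<sigma>2\<in>NCi u h. F (glue l u \<sigma>1 \<sigma>2))"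
      unfolding sum.reindex[OF injU[OF \<open>u \<in> {l<..<h}\<close>]] sum.cartesian_product
      by (simp only: comp_def case_prod_unfold)
  qed
  finally have U: "(\<Sum>\<sigma>\<in>(\<Union>u\<in>{l<..<h}. ?U u). F \<sigma>) = (\<Sum>u\<in>{l<..<h}. \<Sum>\<sigma>1\<in>NCi (Suc l) u. \<Sum>\<sigma>2\<in>NCi u h. F (glue l u \<sigma>1 \<sigma>2))" .
  have "?A \<inter> (\<Union>u\<in>{l<..<h}. ?U u) = {}"
  proof -
    have disj: False if eq: "insert {l} \<tau> = glue l u a b" and \<tau>: "\<tau> \<in> NCi (Suc l) h"
      and uh: "u \<in> {l<..<h}" and ab: "a \<in> NCi (Suc l) u" "b \<in> NCi u h" for \<tau> u a b
    proof -
      have u: "l < u" "u < h" using uh by auto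
      obtain V where "V \<in> b" "u \<in> V" using NCiD(4)[OF ab(2), of u] u by auto
      then have "u \<in> blk b u" unfolding blk_def by blast
      then have "u \<in> blk (glue l u a b) l" unfolding blk_glue_l[OF u ab] by simp
      then show False using blk_insert_singleton(1)[OF \<tau>] u unfolding eq by simp
    qed
    show ?thesis
    proof (rule equals0I)
      fix \<sigma> assume "\<sigma> \<in> ?A \<inter> (\<Union>u\<in>{l<..<h}. ?U u)"
      then obtain \<tau> u x where "\<tau> \<in> NCi (Suc l) h" "\<sigma> = insert {l} \<tau>" "u \<in> {l<..<h}"
        and x: "x \<in> NCi (Suc l) u \<times> NCi u h" "\<sigma> = (\<lambda>(\<sigma>1, \<sigma>2). glue l u \<sigma>1 \<sigma>2) x"
        by (elim IntE imageE UN_E)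
      moreover obtain a b where "x = (a, b)" by (cases x)
      ultimately show False using disj[of \<tau> u a b] by simp
    qed
  qed
  then have "(\<Sum>\<sigma>\<in>NCi l h. F \<sigma>) = (\<Sum>\<sigma>\<in>?A. F \<sigma>) + (\<Sum>\<sigma>\<in>(\<Union>u\<in>{l<..<h}. ?U u). F \<sigma>)"
    unfolding NCi_decompose[OF lh] by (intro sum.union_disjoint) simp_all
  then show ?thesis unfolding U sum.reindex[OF injA] by (simp add: comp_def)
qed

section \<open>Nested cumulants and the moment-cumulant formula\<close>

fun block_args :: "'u star_prob \<Rightarrow> 'u list \<Rightarrow> (nat \<Rightarrow> nat \<Rightarrow> 'u) \<Rightarrow> nat list \<Rightarrow> 'u list" where
  "block_args A as g [] = []"
| "block_args A as g [v] = [as ! v]"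
| "block_args A as g (v # w # vs) = (as ! v \<otimes>\<^bsub>A\<^esub> g (Suc v) w) # block_args A as g (w # vs)"

lemma block_args_eq_map:
  "block_args A as g vs = map (\<lambda>i. if Suc i < length vs then as ! (vs ! i) \<otimes>\<^bsub>A\<^esub> g (Suc (vs ! i)) (vs ! Suc i)
     else as ! (vs ! i)) [0..<length vs]"
proof (induction A as g vs rule: block_args.induct)
  case (3 A as g v w vs)
  have "[0..<length (v # w # vs)] = 0 # map Suc [0..<length (w # vs)]"
    using upt_conv_Cons[of 0 "length (v # w # vs)"] map_Suc_upt[of 0 "length (w # vs)"] by (simp del: upt_Suc)
  then show ?case using 3 by (simp only: block_args.simps list.map map_map comp_def nth_Cons_0 nth_Cons_Suc length_Cons Suc_less_eq zero_less_Suc if_True)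
qed auto

lemma block_args_cong:
  assumes "sorted_wrt (<) vs" "set vs \<subseteq> {l..<h}"
    and "\<And>v w. l \<le> v \<Longrightarrow> v < w \<Longrightarrow> w < h \<Longrightarrow> g (Suc v) w = g' (Suc v) w"
  shows "block_args A as g vs = block_args A as g' vs"
  using assms by (induction A as g vs rule: block_args.induct) auto

lemma length_block_args [simp]: "length (block_args A as g vs) = length vs"
  by (induction A as g vs rule: block_args.induct) auto

lemma sorted_list_of_set_insert_less:
  fixes l :: nat
  assumes "finite S" "\<And>x. x \<in> S \<Longrightarrow> l < x"
  shows "sorted_list_of_set (insert l S) = l # sorted_list_of_set S"
proof -
  have "l \<notin> S" using assms(2)[of l] by blast
  then have "sorted_list_of_set (insert l S) = insort l (sorted_list_of_set S)"
    by (rule sorted_list_of_set_insert[OF assms(1)])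
  also have "\<dots> = l # sorted_list_of_set S"
  proof (rule insort_is_Cons)
    show "\<forall>x\<in>set (sorted_list_of_set S). l \<le> x"
      unfolding set_sorted_list_of_set[OF assms(1)] using assms(2) less_imp_le by blast
  qed
  finally show ?thesis .
qed

definition block_list :: "nat set set \<Rightarrow> nat \<Rightarrow> nat \<Rightarrow> nat list" where
  "block_list \<xi> l h = sorted_list_of_set (insert l (blk \<xi> l \<inter> {l..<h}))"

lemma block_list_props:
  assumes "l < h"
  shows "sorted_wrt (<) (block_list \<xi> l h)" "set (block_list \<xi> l h) \<subseteq> {l..<h}" "block_list \<xi> l h \<noteq> []"
    "last (block_list \<xi> l h) \<in> {l..<h}"
proof -
  show 1: "set (block_list \<xi> l h) \<subseteq> {l..<h}" using assms by (auto simp: block_list_def simp del: sorted_list_of_set_insert_remove)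
  show 2: "block_list \<xi> l h \<noteq> []"
    using sorted_list_of_set_eq_Nil_iff[of "insert l (blk \<xi> l \<inter> {l..<h})"] by (simp add: block_list_def del: sorted_list_of_set_insert_remove)
  show "last (block_list \<xi> l h) \<in> {l..<h}" using last_in_set[OF 2] 1 by blast
  show "sorted_wrt (<) (block_list \<xi> l h)" by (simp add: block_list_def del: sorted_list_of_set_insert_remove)
qed

text \<open>The nested product with additional arguments \<open>bs\<close> in its outermost
  cumulant, the counterpart of the collected arguments of \<open>block_sum\<close>.\<close>

definition nested_prefix ::
    "'u star_prob \<Rightarrow> ('u list \<Rightarrow> 'u) \<Rightarrow> 'u list \<Rightarrow> 'u list \<Rightarrow> nat set set \<Rightarrow> nat \<Rightarrow> nat \<Rightarrow> 'u" where
  "nested_prefix A c as bs \<xi> l h =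
     c (bs @ block_args A as (nested_cumulant A c \<xi> as) (block_list \<xi> l h))
       \<otimes>\<^bsub>A\<^esub> nested_cumulant A c \<xi> as (Suc (last (block_list \<xi> l h))) h"

lemma nested_cumulant_unfold:
  "l < h \<Longrightarrow> nested_cumulant A c \<xi> as l h = nested_prefix A c as [] \<xi> l h"
  by (subst nested_cumulant.simps)
    (simp add: nested_prefix_def block_list_def blk_def Let_def block_args_eq_map del: sorted_list_of_set_insert_remove)

lemma nested_cumulant_empty: "h \<le> l \<Longrightarrow> nested_cumulant A c \<xi> as l h = \<one>\<^bsub>A\<^esub>"
  by (subst nested_cumulant.simps) simp

text \<open>The recursion looks at a block only from its first element in the current interval on,
  so changes further left are invisible. Gluing changes the block of \<open>u\<close> in just this
  way.\<close>

lemma nested_cumulant_cong: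
  assumes "\<And>i. l \<le> i \<Longrightarrow> i < h \<Longrightarrow> blk \<xi> i \<inter> {i..<h} = blk \<tau> i \<inter> {i..<h}"
  shows "nested_cumulant A c \<xi> as l h = nested_cumulant A c \<tau> as l h"
  using assms
proof (induction "h - l" arbitrary: l h rule: less_induct)
  case less
  show ?case
  proof (cases "l < h")
    case True
    have sub: "blk \<xi> i \<inter> {i..<h'} = blk \<tau> i \<inter> {i..<h'}" if "l \<le> i" "i < h'" "h' \<le> h" for i h'
    proof -
      have "blk \<xi> i \<inter> {i..<h'} = (blk \<xi> i \<inter> {i..<h}) \<inter> {i..<h'}" using that by auto
      also have "\<dots> = (blk \<tau> i \<inter> {i..<h}) \<inter> {i..<h'}" using less.prems[of i] that by simp
      also have "\<dots> = blk \<tau> i \<inter> {i..<h'}" using that by auto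
      finally show ?thesis .
    qed
    have bl: "block_list \<xi> l h = block_list \<tau> l h"
      using less.prems[of l] True by (simp add: block_list_def del: sorted_list_of_set_insert_remove)
    have "block_args A as (nested_cumulant A c \<xi> as) (block_list \<tau> l h) = block_args A as (nested_cumulant A c \<tau> as) (block_list \<tau> l h)"
    proof (rule block_args_cong[OF block_list_props(1,2)[OF True]])
      fix v w assume "l \<le> v" "v < w" "w < h"
      then show "nested_cumulant A c \<xi> as (Suc v) w = nested_cumulant A c \<tau> as (Suc v) w"
        using sub by (intro less.hyps) auto
    qed
    moreover have "nested_cumulant A c \<xi> as (Suc (last (block_list \<tau> l h))) h = nested_cumulant A c \<tau> as (Suc (last (block_list \<tau> l h))) h"
      using block_list_props(4)[OF True, of \<tau>] sub True by (intro less.hyps) auto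
    ultimately show ?thesis by (simp add: nested_cumulant_unfold[OF True] nested_prefix_def bl)
  qed (simp add: nested_cumulant_empty)
qed

context rectangular_prob_space
begin

lemma Ds_eqI:
  assumes "x \<in> Ds" "y \<in> Ds" "\<And>k. k < d \<Longrightarrow> state A (p k \<otimes> x) = state A (p k \<otimes> y)"
  shows "x = y"
  using E_eqI[OF Ds_closed[OF assms(1)] Ds_closed[OF assms(2)] assms(3)] assms(1,2) by (simp add: E_Ds)

text \<open>Sums over partitions in the algebra are tested against scalar functionals, because
  \<open>sum_NCi\<close> works in a type class of monoids; \<open>Ds_eqI\<close> leads back to
  D.\<close>

lemma additive_finsum:
  fixes F :: "'u \<Rightarrow> complex"
  assumes add: "\<And>x y. x \<in> carrier A \<Longrightarrow> y \<in> carrier A \<Longrightarrow> F (x \<oplus> y) = F x + F y"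
    and "finite S" "\<And>s. s \<in> S \<Longrightarrow> f s \<in> carrier A"
  shows "F (\<Oplus>s\<in>S. f s) = (\<Sum>s\<in>S. F (f s))"
  using assms(2,3)
proof (induction S rule: finite_induct)
  case empty
  have "F \<zero> = F \<zero> + F \<zero>" using add[of \<zero> \<zero>] by simp
  then show ?case by simp
next
  case (insert x S)
  then show ?case by (subst alg.finsum_insert) (auto simp: add intro!: alg.finsum_closed)
qed

lemma finsum_Ds: "finite S \<Longrightarrow> (\<And>s. s \<in> S \<Longrightarrow> f s \<in> Ds) \<Longrightarrow> (\<Oplus>s\<in>S. f s) \<in> Ds"
proof (induction S rule: finite_induct)
  case (insert x S)
  then show ?case by (subst alg.finsum_insert) (auto simp: Ds_closed)
qed simp

context
  fixes c as
  assumes c: "bimodule_map A d p c"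
    and moment_c: "\<And>bs. bs \<noteq> [] \<Longrightarrow> set bs \<subseteq> carrier A \<Longrightarrow> Mo bs = block_sum c [] bs"
    and as: "set as \<subseteq> carrier A"
begin

lemma block_args_closed:
  assumes "sorted_wrt (<) vs" "set vs \<subseteq> {l..<h}" "h \<le> length as"
    and "\<And>v w. l \<le> v \<Longrightarrow> v < w \<Longrightarrow> w < h \<Longrightarrow> g (Suc v) w \<in> carrier A"
  shows "set (block_args A as g vs) \<subseteq> carrier A"
  using assms(1,2)
proof (induction vs rule: induct_list012)
  case (2 v)
  then show ?case using as assms(3) nth_mem[of v as] by auto
next
  case (3 v w vs)
  moreover have "as ! v \<in> carrier A" using 3 as assms(3) nth_mem[of v as] by auto
  ultimately show ?case using assms(4)[of v w] by auto
qed simp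

lemma nested_Ds: "h \<le> length as \<Longrightarrow> nested_cumulant A c \<xi> as l h \<in> Ds"
proof (induction "h - l" arbitrary: l h rule: less_induct)
  case less
  show ?case
  proof (cases "l < h")
    case True
    have "set (block_args A as (nested_cumulant A c \<xi> as) (block_list \<xi> l h)) \<subseteq> carrier A"
    proof (rule block_args_closed[OF block_list_props(1,2)[OF True] less.prems])
      fix v w assume "l \<le> v" "v < w" "w < h"
      then show "nested_cumulant A c \<xi> as (Suc v) w \<in> carrier A"
        using less.prems by (intro Ds_closed less.hyps) auto
    qed
    moreover have "block_args A as (nested_cumulant A c \<xi> as) (block_list \<xi> l h) \<noteq> []"
      using block_list_props(3)[OF True, of \<xi>] length_block_args by (metis length_0_conv)
    moreover have "nested_cumulant A c \<xi> as (Suc (last (block_list \<xi> l h))) h \<in> Ds"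
      using block_list_props(4)[OF True, of \<xi>] less.prems by (intro less.hyps) auto
    ultimately show ?thesis
      by (auto simp: nested_cumulant_unfold[OF True] nested_prefix_def intro!: Ds_simps c_Ds[OF c])
  qed (simp add: nested_cumulant_empty)
qed

lemma nested_closed: "h \<le> length as \<Longrightarrow> nested_cumulant A c \<xi> as l h \<in> carrier A"
  using nested_Ds Ds_closed by blast

lemma nested_prefix_singleton:
  assumes "\<tau> \<in> NCi (Suc l) h" "l < h"
  shows "nested_prefix A c as bs (insert {l} \<tau>) l h = c (bs @ [as ! l]) \<otimes> nested_cumulant A c \<tau> as (Suc l) h"
proof -
  have "nested_cumulant A c (insert {l} \<tau>) as (Suc l) h = nested_cumulant A c \<tau> as (Suc l) h"
    using blk_insert_singleton(2)[OF assms(1)] by (intro nested_cumulant_cong) auto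
  moreover have "block_list (insert {l} \<tau>) l h = [l]"
  proof -
    have "insert l ({l} \<inter> {l..<h}) = {l}" by auto
    then show ?thesis using blk_insert_singleton(1)[OF assms(1)] by (simp only: block_list_def) simp
  qed
  ultimately show ?thesis by (simp add: nested_prefix_def)
qed

text \<open>The gap between \<open>l\<close> and \<open>u\<close> becomes a factor of the argument
  at \<open>l\<close>, this argument joins the collected ones, and the block continues from
  \<open>u\<close>: the recursion step of \<open>block_sum\<close>.\<close>

lemma nested_prefix_glue:
  assumes lu: "l < u" "u < h" and s: "\<xi>1 \<in> NCi (Suc l) u" "\<xi>2 \<in> NCi u h"
  shows "nested_prefix A c as bs (glue l u \<xi>1 \<xi>2) l h =
    nested_prefix A c as (bs @ [as ! l \<otimes> nested_cumulant A c \<xi>1 as (Suc l) u]) \<xi>2 u h"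
proof -
  let ?\<xi> = "glue l u \<xi>1 \<xi>2"
  have low: "nested_cumulant A c ?\<xi> as (Suc l) u = nested_cumulant A c \<xi>1 as (Suc l) u"
    by (rule nested_cumulant_cong) (simp add: blk_glue_low[OF lu s])
  have high: "nested_cumulant A c ?\<xi> as i j = nested_cumulant A c \<xi>2 as i j" if "u \<le> i" for i j
  proof (rule nested_cumulant_cong)
    fix k assume "i \<le> k" "k < j"
    then have "blk ?\<xi> k \<inter> {k..} = blk \<xi>2 k \<inter> {k..}" using that by (intro blk_glue_high[OF lu s]) simp
    moreover have "{k..<j} = {k..} \<inter> {..<j}" by auto
    ultimately show "blk ?\<xi> k \<inter> {k..<j} = blk \<xi>2 k \<inter> {k..<j}" by (simp only: Int_assoc[symmetric])
  qed
  let ?W = "insert u (blk \<xi>2 u \<inter> {u..<h})"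
  have b2: "blk \<xi>2 u \<subseteq> {u..<h}"
  proof
    fix x assume "x \<in> blk \<xi>2 u"
    then obtain V where "V \<in> \<xi>2" "x \<in> V" unfolding blk_def by blast
    then show "x \<in> {u..<h}" using s2_bounds[OF lu s, of V x] by simp
  qed
  obtain V where V: "V \<in> \<xi>2" "u \<in> V" using NCiD(4)[OF s(2) order_refl lu(2)] by (elim bexE)
  then have ub: "u \<in> blk \<xi>2 u" unfolding blk_def by blast
  have 1: "insert l (blk \<xi>2 u) \<inter> {l..<h} = insert l (blk \<xi>2 u)" using b2 lu by auto
  have 2: "blk \<xi>2 u \<inter> {u..<h} = blk \<xi>2 u" using b2 by blast
  have W: "insert l (insert l (blk \<xi>2 u) \<inter> {l..<h}) = insert l ?W"
    by (simp only: 1 2 insert_absorb[OF ub] insert_absorb2)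
  have bl: "block_list ?\<xi> l h = l # block_list \<xi>2 u h"
    unfolding block_list_def blk_glue_l[OF lu s] W
  proof (rule sorted_list_of_set_insert_less)
    fix x assume "x \<in> ?W"
    then have "u \<le> x" by auto
    then show "l < x" using lu by simp
  qed simp
  obtain ws where ws: "block_list \<xi>2 u h = u # ws"
  proof
    have "?W = insert u (blk \<xi>2 u \<inter> {u<..<h})" by auto
    then show "block_list \<xi>2 u h = u # sorted_list_of_set (blk \<xi>2 u \<inter> {u<..<h})"
      unfolding block_list_def by (simp only:) (rule sorted_list_of_set_insert_less, auto)
  qed
  have args: "block_args A as (nested_cumulant A c ?\<xi> as) (block_list \<xi>2 u h) = block_args A as (nested_cumulant A c \<xi>2 as) (block_list \<xi>2 u h)"
    by (rule block_args_cong[OF block_list_props(1,2)[OF lu(2)]]) (rule high, simp)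
  have "u \<le> last (block_list \<xi>2 u h)" using block_list_props(4)[OF lu(2), of \<xi>2] by simp
  then have last: "nested_cumulant A c ?\<xi> as (Suc (last (block_list \<xi>2 u h))) h = nested_cumulant A c \<xi>2 as (Suc (last (block_list \<xi>2 u h))) h"
    by (intro high) simp
  have "block_args A as (nested_cumulant A c ?\<xi> as) (block_list ?\<xi> l h) =
      (as ! l \<otimes> nested_cumulant A c \<xi>1 as (Suc l) u) # block_args A as (nested_cumulant A c \<xi>2 as) (block_list \<xi>2 u h)"
    using args unfolding bl ws block_args.simps low by simp
  moreover have "last (block_list ?\<xi> l h) = last (block_list \<xi>2 u h)" unfolding bl ws by simp
  ultimately show ?thesis by (simp add: nested_prefix_def last)
qed

lemma state_asum:
  "z \<in> carrier A \<Longrightarrow> (\<And>i. i < n \<Longrightarrow> f i \<in> carrier A) \<Longrightarrow>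
     state A (z \<otimes> asum (map f [0..<n])) = (\<Sum>i<n. state A (z \<otimes> f i))"
  by (subst state_mult_asum) (auto simp: comp_def interv_sum_list_conv_sum_set_nat atLeast0LessThan)

text \<open>Both sides obey the same recursion over the successor of \<open>l\<close>. Summing over
  the partitions of a gap turns its nested cumulants into the moment used by
  \<open>block_sum\<close>; this is the induction hypothesis with empty prefix.\<close>

lemma sum_nested_prefix:
  assumes "l < h" "h \<le> length as" "set bs \<subseteq> carrier A" "z \<in> carrier A"
  shows "(\<Sum>\<xi>\<in>NCi l h. state A (z \<otimes> nested_prefix A c as bs \<xi> l h)) =
    state A (z \<otimes> block_sum c bs (map ((!) as) [l..<h]))"
  using assms
proof (induction "h - l" arbitrary: l h bs z rule: less_induct)
  case less
  note lh = less.prems(1) and h = less.prems(2) and bs = less.prems(3) and z = less.prems(4)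
  have nth: "as ! i \<in> carrier A" if "i < h" for i using that h as nth_mem[of i as] by auto
  define sub where "sub i j = map ((!) as) [i..<j]" for i j
  have sub: "set (sub i j) \<subseteq> carrier A" if "j \<le> h" for i j using nth that by (auto simp: sub_def)
  have sum_nested: "(\<Oplus>\<tau>\<in>NCi i j. nested_cumulant A c \<tau> as i j) = Mo (sub i j)"
    if ij: "l < i" "i \<le> j" "j \<le> h" for i j
  proof (cases "i = j")
    case True
    then show ?thesis by (simp add: NCi_empty nested_cumulant_empty sub_def)
  next
    case False
    show ?thesis
    proof (rule Ds_eqI)
      show "(\<Oplus>\<tau>\<in>NCi i j. nested_cumulant A c \<tau> as i j) \<in> Ds"
        using ij h by (intro finsum_Ds nested_Ds) auto
      fix k assume k: "k < d"
      have "state A (p k \<otimes> (\<Oplus>\<tau>\<in>NCi i j. nested_cumulant A c \<tau> as i j)) =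
          (\<Sum>\<tau>\<in>NCi i j. state A (p k \<otimes> nested_cumulant A c \<tau> as i j))"
        using ij h k by (intro additive_finsum[of "\<lambda>x. state A (p k \<otimes> x)"] nested_closed) (auto simp: alg.r_distr state_add)
      also have "\<dots> = state A (p k \<otimes> block_sum c [] (sub i j))"
        using less.hyps[of j i "[]" "p k"] ij h k False by (simp add: nested_cumulant_unfold sub_def)
      also have "block_sum c [] (sub i j) = Mo (sub i j)"
        using moment_c[of "sub i j"] sub[of j i] ij False by (simp add: sub_def)
      finally show "state A (p k \<otimes> (\<Oplus>\<tau>\<in>NCi i j. nested_cumulant A c \<tau> as i j)) = state A (p k \<otimes> Mo (sub i j))" .
    qed simp
  qed
  have cl: "c (bs @ [as ! l]) \<in> carrier A" using nth[OF lh] bs by (intro c_closed[OF c]) auto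
  have "(\<Sum>\<xi>\<in>NCi l h. state A (z \<otimes> nested_prefix A c as bs \<xi> l h)) =
      (\<Sum>\<tau>\<in>NCi (Suc l) h. state A (z \<otimes> (c (bs @ [as ! l]) \<otimes> nested_cumulant A c \<tau> as (Suc l) h))) +
      (\<Sum>u\<in>{l<..<h}. \<Sum>\<xi>1\<in>NCi (Suc l) u. \<Sum>\<xi>2\<in>NCi u h.
        state A (z \<otimes> nested_prefix A c as (bs @ [as ! l \<otimes> nested_cumulant A c \<xi>1 as (Suc l) u]) \<xi>2 u h))"
    unfolding sum_NCi[OF lh]
    by (intro arg_cong2[of _ _ _ _ "(+)"] sum.cong refl)
      (auto simp: nested_prefix_singleton[OF _ lh] nested_prefix_glue)
  also have "(\<Sum>\<tau>\<in>NCi (Suc l) h. state A (z \<otimes> (c (bs @ [as ! l]) \<otimes> nested_cumulant A c \<tau> as (Suc l) h))) =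
      state A (z \<otimes> (c (bs @ [as ! l]) \<otimes> Mo (sub (Suc l) h)))"
    unfolding sum_nested[OF lessI Suc_leI[OF lh] order_refl, symmetric]
    by (rule additive_finsum[symmetric]) (use cl z h in \<open>auto simp: alg.r_distr state_add intro!: nested_closed\<close>)
  also have "(\<Sum>u\<in>{l<..<h}. \<Sum>\<xi>1\<in>NCi (Suc l) u. \<Sum>\<xi>2\<in>NCi u h.
        state A (z \<otimes> nested_prefix A c as (bs @ [as ! l \<otimes> nested_cumulant A c \<xi>1 as (Suc l) u]) \<xi>2 u h)) =
      (\<Sum>u\<in>{l<..<h}. state A (z \<otimes> block_sum c (bs @ [as ! l \<otimes> Mo (sub (Suc l) u)]) (sub u h)))"
  proof (rule sum.cong[OF refl])
    fix u assume "u \<in> {l<..<h}"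
    then have u: "l < u" "u < h" by auto
    have nc: "nested_cumulant A c \<xi>1 as (Suc l) u \<in> carrier A" for \<xi>1 using u h by (intro nested_closed) auto
    have "(\<Sum>\<xi>1\<in>NCi (Suc l) u. \<Sum>\<xi>2\<in>NCi u h.
        state A (z \<otimes> nested_prefix A c as (bs @ [as ! l \<otimes> nested_cumulant A c \<xi>1 as (Suc l) u]) \<xi>2 u h)) =
       (\<Sum>\<xi>1\<in>NCi (Suc l) u. state A (z \<otimes> block_sum c (bs @ [as ! l \<otimes> nested_cumulant A c \<xi>1 as (Suc l) u]) (sub u h)))"
      unfolding sub_def using u h bs z nth[OF lh] nc by (intro sum.cong refl less.hyps) auto
    \<comment> \<open>Additivity of \<open>block_sum\<close> in a collected argument moves the sum
      over the partitions of the gap inside.\<close>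
    also have "\<dots> = state A (z \<otimes> block_sum c (bs @ [as ! l \<otimes> (\<Oplus>\<tau>\<in>NCi (Suc l) u. nested_cumulant A c \<tau> as (Suc l) u)]) (sub u h))"
    proof (rule additive_finsum[of "\<lambda>x. state A (z \<otimes> block_sum c (bs @ [as ! l \<otimes> x]) (sub u h))", symmetric])
      fix x y assume xy: "x \<in> carrier A" "y \<in> carrier A"
      have s: "set (sub u h) \<subseteq> carrier A" by (rule sub) simp
      have "block_sum c (bs @ [as ! l \<otimes> x \<oplus> as ! l \<otimes> y]) (sub u h) =
          block_sum c (bs @ [as ! l \<otimes> x]) (sub u h) \<oplus> block_sum c (bs @ [as ! l \<otimes> y]) (sub u h)"
        using block_sum_prefix_add[OF c bs, of "[]" "as ! l \<otimes> x" "as ! l \<otimes> y" "sub u h"] xy nth[OF lh] s by simp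
      moreover have "block_sum c (bs @ [as ! l \<otimes> x]) (sub u h) \<in> carrier A" if "x \<in> carrier A" for x
        using that nth[OF lh] bs s by (intro block_sum_closed[OF c]) auto
      ultimately show "state A (z \<otimes> block_sum c (bs @ [as ! l \<otimes> (x \<oplus> y)]) (sub u h)) =
          state A (z \<otimes> block_sum c (bs @ [as ! l \<otimes> x]) (sub u h)) + state A (z \<otimes> block_sum c (bs @ [as ! l \<otimes> y]) (sub u h))"
        using xy z nth[OF lh] by (simp add: alg.r_distr state_add)
    qed (use nc in auto)
    also have "(\<Oplus>\<tau>\<in>NCi (Suc l) u. nested_cumulant A c \<tau> as (Suc l) u) = Mo (sub (Suc l) u)"
      using u by (intro sum_nested) auto
    finally show "(\<Sum>\<xi>1\<in>NCi (Suc l) u. \<Sum>\<xi>2\<in>NCi u h.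
        state A (z \<otimes> nested_prefix A c as (bs @ [as ! l \<otimes> nested_cumulant A c \<xi>1 as (Suc l) u]) \<xi>2 u h)) =
      state A (z \<otimes> block_sum c (bs @ [as ! l \<otimes> Mo (sub (Suc l) u)]) (sub u h))" .
  qed
  also have "\<dots> = (\<Sum>i<h - Suc l. state A (z \<otimes> block_sum c (bs @ [as ! l \<otimes> Mo (take i (sub (Suc l) h))]) (drop i (sub (Suc l) h))))"
  proof (rule sum.reindex_bij_witness[where i = "\<lambda>i. Suc l + i" and j = "\<lambda>u. u - Suc l"])
    fix u assume "u \<in> {l<..<h}"
    then show "state A (z \<otimes> block_sum c (bs @ [as ! l \<otimes> Mo (take (u - Suc l) (sub (Suc l) h))]) (drop (u - Suc l) (sub (Suc l) h))) =
        state A (z \<otimes> block_sum c (bs @ [as ! l \<otimes> Mo (sub (Suc l) u)]) (sub u h))"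
      by (simp add: sub_def take_map drop_map)
  qed auto
  also have "\<dots> = state A (z \<otimes> asum (map (\<lambda>i. block_sum c (bs @ [as ! l \<otimes> Mo (take i (sub (Suc l) h))]) (drop i (sub (Suc l) h))) [0..<h - Suc l]))"
    using z bs nth[OF lh] sub[OF order_refl, of "Suc l"]
    by (intro state_asum[symmetric] block_sum_closed[OF c] set_drop_closed) auto
  also have "state A (z \<otimes> (c (bs @ [as ! l]) \<otimes> Mo (sub (Suc l) h))) + \<dots> = state A (z \<otimes> block_sum c bs (sub l h))"
  proof -
    have l: "sub l h = as ! l # sub (Suc l) h" using lh by (simp add: sub_def upt_conv_Cons)
    have len: "length (sub (Suc l) h) = h - Suc l" by (simp add: sub_def)
    have "asum (map (\<lambda>i. block_sum c (bs @ [as ! l \<otimes> Mo (take i (sub (Suc l) h))]) (drop i (sub (Suc l) h))) [0..<h - Suc l]) \<in> carrier A"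
      using bs nth[OF lh] sub[OF order_refl, of "Suc l"]
      by (intro asum_closed) (auto intro!: block_sum_closed[OF c] set_drop_closed simp del: foldr.simps)
    then show ?thesis using cl z by (simp add: l len alg.r_distr state_add)
  qed
  finally show ?case by (simp add: sub_def)
qed

lemma moment_cumulant_formula:
  assumes "as \<noteq> []"
  shows "Mo as = (\<Oplus>\<xi>\<in>NC (length as). nested_cumulant A c \<xi> as 0 (length as))"
proof -
  have NC: "NC (length as) = NCi 0 (length as)" by (simp add: NC_def NCi_def atLeast0LessThan)
  have m: "map ((!) as) [0..<length as] = as" by (rule map_nth)
  have n: "0 < length as" using assms by simp
  show ?thesis
  proof (rule Ds_eqI)
    show "(\<Oplus>\<xi>\<in>NC (length as). nested_cumulant A c \<xi> as 0 (length as)) \<in> Ds"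
      unfolding NC by (intro finsum_Ds nested_Ds) auto
    fix k assume k: "k < d"
    have "state A (p k \<otimes> (\<Oplus>\<xi>\<in>NC (length as). nested_cumulant A c \<xi> as 0 (length as))) =
        (\<Sum>\<xi>\<in>NCi 0 (length as). state A (p k \<otimes> nested_cumulant A c \<xi> as 0 (length as)))"
      unfolding NC using k by (intro additive_finsum[of "\<lambda>x. state A (p k \<otimes> x)"] nested_closed) (auto simp: alg.r_distr state_add)
    also have "\<dots> = state A (p k \<otimes> block_sum c [] as)"
      using sum_nested_prefix[OF n order_refl, of "[]" "p k"] k unfolding m by (simp add: nested_cumulant_unfold[OF n])
    finally show "state A (p k \<otimes> Mo as) = state A (p k \<otimes> (\<Oplus>\<xi>\<in>NC (length as). nested_cumulant A c \<xi> as 0 (length as)))"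
      using moment_c[OF assms as] by simp
  qed simp
qed

end

theorem D_cumulants_cumulant: "D_cumulants A d p cumulant"
  unfolding D_cumulants_iff
  using bimodule_map_cumulant moment_cumulant_formula[OF bimodule_map_cumulant Mo_eq_block_sum] by blast

end

section \<open>Cumulants of an element with the semicircular moment recursion\<close>

context rectangular_prob_space
begin

context
  fixes y
  assumes y: "y \<in> carrier A" "star A y = y"
    and rec: "\<And>e es. e \<in> Ds \<Longrightarrow> set es \<subseteq> Ds \<Longrightarrow> Mo (map ((\<otimes>) y) (e # es)) =
      asum (map (\<lambda>i. state A (e \<otimes> Mo (map ((\<otimes>) y) (take i es))) \<odot> (es ! i \<otimes> Mo (map ((\<otimes>) y) (drop (Suc i) es)))) [0..<length es])"
begin

lemma asum_zeros: "(\<And>i. i \<in> set is \<Longrightarrow> f i = \<zero>) \<Longrightarrow> asum (map f is) = \<zero>"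
  by (induction "is") simp_all

text \<open>Meant for truncated cumulants: \<open>b\<close> tells whether the second order is
  already included.\<close>

context
  fixes c b
  assumes c_long: "\<And>es. set es \<subseteq> Ds \<Longrightarrow> 3 \<le> length es \<Longrightarrow> c (map ((\<otimes>) y) es) = \<zero>"
    and c_two: "\<And>f g. f \<in> Ds \<Longrightarrow> g \<in> Ds \<Longrightarrow> c [y \<otimes> f, y \<otimes> g] = (if b then state A f \<odot> g else \<zero>)"
    and c_one: "\<And>f. f \<in> Ds \<Longrightarrow> c [y \<otimes> f] = \<zero>"
begin

lemma mult_Mo_take:
  assumes "f \<in> Ds"
  shows "y \<otimes> f \<otimes> Mo (take i (map ((\<otimes>) y) es)) = y \<otimes> (f \<otimes> Mo (map ((\<otimes>) y) (take i es)))"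
    "f \<otimes> Mo (map ((\<otimes>) y) (take i es)) \<in> Ds"
  unfolding take_map
  by (rule alg.m_assoc[OF y(1) Ds_closed[OF assms] E_closed], rule Ds_simps(4)[OF assms E_in])

text \<open>Two collected arguments and at least one more make three, where \<open>c\<close>
  vanishes; gaps are absorbed as elements of D.\<close>

lemma block_sum_semicircular_long:
  assumes "set fs \<subseteq> Ds" "2 \<le> length fs" "set es \<subseteq> Ds"
  shows "block_sum c (map ((\<otimes>) y) fs) (map ((\<otimes>) y) es) = \<zero>"
  using assms
proof (induction "length es" arbitrary: fs es rule: less_induct)
  case less
  show ?case
  proof (cases es)
    case (Cons e es')
    have e: "e \<in> Ds" "set es' \<subseteq> Ds" using less.prems Cons by auto
    have t: "block_sum c (map ((\<otimes>) y) fs @ [y \<otimes> e \<otimes> Mo (take i (map ((\<otimes>) y) es'))]) (drop i (map ((\<otimes>) y) es')) = \<zero>" for i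
    proof -
      let ?g = "e \<otimes> Mo (map ((\<otimes>) y) (take i es'))"
      have "block_sum c (map ((\<otimes>) y) (fs @ [?g])) (map ((\<otimes>) y) (drop i es')) = \<zero>"
      proof (rule less.hyps)
        show "length (drop i es') < length es" using Cons by simp
        show "set (fs @ [?g]) \<subseteq> Ds" using less.prems(1) mult_Mo_take(2)[OF e(1), of i es'] by simp
        show "2 \<le> length (fs @ [?g])" using less.prems(2) by simp
        show "set (drop i es') \<subseteq> Ds" by (rule set_drop_closed[OF e(2)])
      qed
      then show ?thesis unfolding mult_Mo_take(1)[OF e(1)] by (simp only: map_append list.map drop_map)
    qed
    have "c (map ((\<otimes>) y) (fs @ [e])) = \<zero>"
      by (rule c_long) (use less.prems e in auto)
    then have h: "c (map ((\<otimes>) y) fs @ [y \<otimes> e]) = \<zero>" by (simp only: map_append list.map)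
    have "asum (map (\<lambda>i. block_sum c (map ((\<otimes>) y) fs @ [y \<otimes> e \<otimes> Mo (take i (map ((\<otimes>) y) es'))]) (drop i (map ((\<otimes>) y) es'))) [0..<length es']) = \<zero>"
      by (rule asum_zeros) (rule t)
    then show ?thesis unfolding Cons list.map block_sum.simps h length_map
      by (simp only: alg.l_null[OF E_closed] alg.l_zero[OF alg.zero_closed])
  qed simp
qed

text \<open>With one argument collected, the block has to close at the next element
  \<open>g\<close>, since longer blocks contribute zero.\<close>

lemma block_sum_semicircular_pair:
  assumes f: "f \<in> Ds" and g: "g \<in> Ds" and gs: "set gs \<subseteq> Ds"
  shows "block_sum c [y \<otimes> f] (map ((\<otimes>) y) (g # gs)) = (if b then state A f \<odot> (g \<otimes> Mo (map ((\<otimes>) y) gs)) else \<zero>)"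
proof -
  have t: "block_sum c ([y \<otimes> f] @ [y \<otimes> g \<otimes> Mo (take i (map ((\<otimes>) y) gs))]) (drop i (map ((\<otimes>) y) gs)) = \<zero>" for i
  proof -
    have "block_sum c (map ((\<otimes>) y) [f, g \<otimes> Mo (map ((\<otimes>) y) (take i gs))]) (map ((\<otimes>) y) (drop i gs)) = \<zero>"
      by (rule block_sum_semicircular_long) (use f mult_Mo_take(2)[OF g, of i gs] set_drop_closed[OF gs] in simp_all)
    then show ?thesis unfolding mult_Mo_take(1)[OF g] by (simp only: append.simps list.map drop_map)
  qed
  have "asum (map (\<lambda>i. block_sum c ([y \<otimes> f] @ [y \<otimes> g \<otimes> Mo (take i (map ((\<otimes>) y) gs))]) (drop i (map ((\<otimes>) y) gs))) [0..<length gs]) = \<zero>"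
    by (rule asum_zeros) (rule t)
  then have "block_sum c [y \<otimes> f] (map ((\<otimes>) y) (g # gs)) = c [y \<otimes> f, y \<otimes> g] \<otimes> Mo (map ((\<otimes>) y) gs) \<oplus> \<zero>"
    by (simp only: list.map block_sum.simps length_map append.simps)
  also have "c [y \<otimes> f, y \<otimes> g] \<otimes> Mo (map ((\<otimes>) y) gs) = (if b then state A f \<odot> (g \<otimes> Mo (map ((\<otimes>) y) gs)) else \<zero>)"
    unfolding c_two[OF f g] by (cases b) (simp_all only: if_True if_False smult_mult_left[OF Ds_closed[OF g] E_closed] alg.l_null[OF E_closed])
  finally show ?thesis
    by (cases b) (simp_all only: if_True if_False alg.r_zero alg.zero_closed smult_in alg.m_closed Ds_closed[OF g] E_closed)
qed

lemma block_sum_semicircular: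
  assumes e: "e \<in> Ds" and es: "set es \<subseteq> Ds"
  shows "block_sum c [] (map ((\<otimes>) y) (e # es)) = (if b then Mo (map ((\<otimes>) y) (e # es)) else \<zero>)"
proof -
  have t: "block_sum c ([] @ [y \<otimes> e \<otimes> Mo (take i (map ((\<otimes>) y) es))]) (drop i (map ((\<otimes>) y) es)) =
      (if b then state A (e \<otimes> Mo (map ((\<otimes>) y) (take i es))) \<odot> (es ! i \<otimes> Mo (map ((\<otimes>) y) (drop (Suc i) es))) else \<zero>)"
    if "i < length es" for i
  proof -
    have "es ! i \<in> Ds" using that es nth_mem by blast
    then show ?thesis
      unfolding mult_Mo_take(1)[OF e] drop_map Cons_nth_drop_Suc[OF that, symmetric] append_Nil
      by (rule block_sum_semicircular_pair[OF mult_Mo_take(2)[OF e] _ set_drop_closed[OF es]])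
  qed
  have m: "asum (map (\<lambda>i. block_sum c ([] @ [y \<otimes> e \<otimes> Mo (take i (map ((\<otimes>) y) es))]) (drop i (map ((\<otimes>) y) es))) [0..<length es]) =
    (if b then Mo (map ((\<otimes>) y) (e # es)) else \<zero>)"
  proof (cases b)
    case True
    show ?thesis unfolding rec[OF e es] using True t
      by (simp only: if_True) (rule arg_cong[where f = asum], rule map_cong[OF refl], simp only: set_upt atLeastLessThan_iff)
  next
    case False
    show ?thesis using False by (simp only: if_False) (rule asum_zeros, simp only: t set_upt atLeastLessThan_iff if_False)
  qed
  have z: "c ([] @ [y \<otimes> e]) = \<zero>" using c_one[OF e] by (simp only: append_Nil)
  have "block_sum c [] (map ((\<otimes>) y) (e # es)) = c ([] @ [y \<otimes> e]) \<otimes> Mo (map ((\<otimes>) y) es) \<oplus>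
      asum (map (\<lambda>i. block_sum c ([] @ [y \<otimes> e \<otimes> Mo (take i (map ((\<otimes>) y) es))]) (drop i (map ((\<otimes>) y) es))) [0..<length es])"
    by (simp only: list.map block_sum.simps length_map)
  also have "\<dots> = \<zero> \<otimes> Mo (map ((\<otimes>) y) es) \<oplus> (if b then Mo (map ((\<otimes>) y) (e # es)) else \<zero>)"
    unfolding m z by (rule refl)
  also have "\<dots> = (if b then Mo (map ((\<otimes>) y) (e # es)) else \<zero>)"
    by (cases b) (simp_all only: if_True if_False alg.l_null[OF E_closed] alg.l_zero E_closed alg.zero_closed)
  finally show ?thesis .
qed

end

text \<open>Before order two is included the block sums vanish, and the cumulant equals the moment.
  Afterwards the block sum is the whole moment, by its recursion, so nothing is left for the higher
  orders.\<close>

lemma cumulant_upto_semicircular: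
  "set es \<subseteq> Ds \<Longrightarrow> es \<noteq> [] \<Longrightarrow> cumulant_upto n (map ((\<otimes>) y) es) =
     (if length es = 2 \<and> 2 \<le> n then state A (es ! 0) \<odot> es ! 1 else \<zero>)"
proof (induction n arbitrary: es)
  case (Suc n)
  show ?case
  proof (cases "length es = Suc n")
    case False
    then have "cumulant_upto (Suc n) (map ((\<otimes>) y) es) = cumulant_upto n (map ((\<otimes>) y) es)" by simp
    moreover have "(length es = 2 \<and> 2 \<le> n) = (length es = 2 \<and> 2 \<le> Suc n)" using False by auto
    ultimately show ?thesis using Suc.IH[OF Suc.prems] by simp
  next
    case True
    then obtain e es' where es: "es = e # es'" by (cases es) auto
    have e: "e \<in> Ds" "set es' \<subseteq> Ds" using Suc.prems es by auto
    let ?M = "Mo (map ((\<otimes>) y) (e # es'))"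
    have "block_sum (cumulant_upto n) [] (map ((\<otimes>) y) (e # es')) = (if 2 \<le> n then ?M else \<zero>)"
    proof (rule block_sum_semicircular[OF _ _ _ e])
      fix fs assume "set fs \<subseteq> Ds" "3 \<le> length fs"
      then show "cumulant_upto n (map ((\<otimes>) y) fs) = \<zero>"
        using Suc.IH[of fs] by (cases "fs = []") simp_all
    next
      fix f g assume "f \<in> Ds" "g \<in> Ds"
      then show "cumulant_upto n [y \<otimes> f, y \<otimes> g] = (if 2 \<le> n then state A f \<odot> g else \<zero>)" using Suc.IH[of "[f, g]"] by simp
    next
      fix f assume "f \<in> Ds"
      then show "cumulant_upto n [y \<otimes> f] = \<zero>" using Suc.IH[of "[f]"] by simp
    qed
    then have c: "cumulant_upto (Suc n) (map ((\<otimes>) y) es) = ?M \<ominus> (if 2 \<le> n then ?M else \<zero>)"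
      using True[unfolded es] unfolding es by (simp only: cumulant_upto.simps length_map if_True refl)
    show ?thesis
    proof (cases "2 \<le> n")
      case n: True
      then have "cumulant_upto (Suc n) (map ((\<otimes>) y) es) = \<zero>"
        unfolding c by (simp only: if_True alg.minus_eq alg.r_neg[OF E_closed])
      then show ?thesis using True n by simp
    next
      case n: False
      have z: "x \<ominus> \<zero> = x" if "x \<in> carrier A" for x using that by (simp add: alg.minus_eq)
      from n have M: "cumulant_upto (Suc n) (map ((\<otimes>) y) es) = ?M"
        unfolding c by (simp only: if_False z[OF E_closed])
      show ?thesis
      proof (cases es')
        case Nil
        have M0: "?M = \<zero>" unfolding rec[OF e] unfolding Nil by simp
        show ?thesis unfolding M M0 by (simp add: es Nil)
      next
        case (Cons f fs)
        then have "n = Suc (length fs)" using True es by simp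
        then have fs: "fs = []" "n = 1" using n by (cases fs, simp_all)+
        have f: "f \<in> Ds" "f \<in> carrier A" "e \<in> carrier A" using e Cons Ds_closed by auto
        have M1: "?M = state A e \<odot> f" unfolding rec[OF e] unfolding Cons fs using f by simp
        show ?thesis unfolding M M1 by (simp add: es Cons fs)
      qed
    qed
  qed
qed simp

theorem D_semicircularI: "D_semicircular A d p y"
proof -
  have cum: "cumulant (map ((\<otimes>) y) es) = (if length es = 2 then state A (es ! 0) \<odot> es ! 1 else \<zero>)"
    if "set es \<subseteq> Ds" "es \<noteq> []" for es
    using cumulant_upto_semicircular[OF that, of "length es"] unfolding cumulant_def length_map
    by (cases "length es = 2") (simp_all only: refl if_True if_False simp_thms order_refl)
  have r: "y \<otimes> \<one> = y" by (rule alg.r_one[OF y(1)])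
  have "cumulant [y] = \<zero>" using cum[of "[\<one>]"] r by simp
  moreover have "cumulant [y \<otimes> e, y] = state A e \<odot> \<one>" if "e \<in> Ds" for e
    using cum[of "[e, \<one>]"] r that by simp
  moreover have "cumulant (map (\<lambda>e. y \<otimes> e) es) = \<zero>" if "set es \<subseteq> Ds" "3 \<le> length es" for es
    using cum[OF that(1)] that(2) by (cases "es = []") simp_all
  ultimately show ?thesis
    unfolding D_semicircular_def using y D_cumulants_cumulant by blast
qed

end

end

section \<open>The matrix model\<close>

subsection \<open>Block-diagonal matrices\<close>

text \<open>The block label of each diagonal position; elements of D become the diagonal matrices
  whose entries depend on this label only.\<close>

definition block_index :: "(nat \<Rightarrow> nat \<Rightarrow> nat) \<Rightarrow> nat \<Rightarrow> nat \<Rightarrow> nat list" where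
  "block_index q d n = concat (map (\<lambda>k. replicate (q k n) k) [0..<d])"

lemma scalar_diag_block_mat:
  fixes f :: "nat \<Rightarrow> complex" and r :: "nat \<Rightarrow> nat"
  defines "D ks \<equiv> diag_block_mat (map (\<lambda>k. smult_mat (f k) (one_mat (r k))) ks)"
    and "L ks \<equiv> concat (map (\<lambda>k. replicate (r k) k) ks)"
  shows "D ks \<in> carrier_mat (length (L ks)) (length (L ks)) \<and>
    (\<forall>i<length (L ks). \<forall>j<length (L ks). D ks $$ (i, j) = (if i = j then f (L ks ! i) else 0))"
proof (induction ks)
  case Nil
  then show ?case by (simp add: D_def L_def)
next
  case (Cons k ks)
  have len: "length (L (k # ks)) = r k + length (L ks)" by (simp add: L_def)
  have dim: "dim_row (D ks) = length (L ks)" "dim_col (D ks) = length (L ks)" using Cons by auto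
  have D: "D (k # ks) = four_block_mat (smult_mat (f k) (one_mat (r k))) (0\<^sub>m (r k) (length (L ks))) (0\<^sub>m (length (L ks)) (r k)) (D ks)"
    using dim by (simp add: D_def Let_def)
  have nth: "L (k # ks) ! i = (if i < r k then k else L ks ! (i - r k))" for i
    by (simp add: L_def nth_append)
  have "D (k # ks) \<in> carrier_mat (length (L (k # ks))) (length (L (k # ks)))"
    unfolding D len using dim by (intro carrier_matI) simp_all
  moreover have "D (k # ks) $$ (i, j) = (if i = j then f (L (k # ks) ! i) else 0)"
    if "i < length (L (k # ks))" "j < length (L (k # ks))" for i j
    using that Cons dim unfolding D len nth by (auto simp: not_less)
  ultimately show ?case by blast
qed

lemma sum_block_index: "(\<Sum>k\<leftarrow>block_index q d n. g k) = (\<Sum>k<d. of_nat (q k n) * (g k :: 'a::comm_semiring_1))"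
proof -
  have "(\<Sum>k\<leftarrow>concat (map (\<lambda>k. replicate (q k n) k) ks). g k) = (\<Sum>k\<leftarrow>ks. of_nat (q k n) * g k)" for ks
    by (induction ks) (simp_all add: sum_list_replicate)
  then show ?thesis
    by (simp add: block_index_def interv_sum_list_conv_sum_set_nat atLeast0LessThan)
qed

lemma block_index_less: "i < length (block_index q d n) \<Longrightarrow> block_index q d n ! i < d"
  using nth_mem[of i "block_index q d n"] by (auto simp: block_index_def)

lemma length_block_index: "length (block_index q d n) = (\<Sum>k<d. q k n)"
  using sum_block_index[of "\<lambda>_. 1::nat" q d n] by (simp add: sum_list_triv)

lemma mult_mat_index:
  assumes "M \<in> carrier_mat n n" "N \<in> carrier_mat n n" "i < n" "j < n"
  shows "(M * N) $$ (i, j) = (\<Sum>k<n. M $$ (i, k) * N $$ (k, j))"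
  using assms by (auto simp: scalar_prod_def atLeast0LessThan intro!: sum.cong)

lemma mat_adjoint_carrier: "M \<in> carrier_mat n n \<Longrightarrow> mat_adjoint M \<in> carrier_mat n n"
  by (auto simp: mat_adjoint_def)

lemma mat_adjoint_index:
  fixes M :: "complex mat"
  assumes "M \<in> carrier_mat n n" "i < n" "j < n"
  shows "mat_adjoint M $$ (i, j) = cnj (M $$ (j, i))"
  using assms by (simp add: mat_adjoint_def mat_of_rows_def)

lemma foldr_mult_mat:
  assumes "\<And>x. x \<in> set w \<Longrightarrow> m x \<in> carrier_mat n n"
    and "\<And>x i j. x \<in> set w \<Longrightarrow> i < n \<Longrightarrow> j < n \<Longrightarrow> M x i j = m x $$ (i, j)"
  shows "foldr (\<lambda>x Z. m x * Z) w (one_mat n) \<in> carrier_mat n n \<and>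
    (\<forall>i<n. \<forall>j<n. foldr (\<lambda>x Z. m x * Z) w (one_mat n) $$ (i, j) = ent n M w i j)"
  using assms
proof (induction w)
  case (Cons x w)
  let ?Z = "foldr (\<lambda>x Z. m x * Z) w (one_mat n)"
  have IH: "?Z \<in> carrier_mat n n" "\<And>i j. i < n \<Longrightarrow> j < n \<Longrightarrow> ?Z $$ (i, j) = ent n M w i j"
    using Cons by auto
  have mx: "m x \<in> carrier_mat n n" using Cons.prems(1) by simp
  have "(m x * ?Z) $$ (i, j) = ent n M (x # w) i j" if "i < n" "j < n" for i j
    using mult_mat_index[OF mx IH(1) that] that Cons.prems(2)[of x] IH(2) by simp
  then show ?case using mx IH(1) by simp
qed simp

lemma wtr_eq_mat_trace:
  assumes "\<And>x. x \<in> set w \<Longrightarrow> m x \<in> carrier_mat n n"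
    and "\<And>x i j. x \<in> set w \<Longrightarrow> i < n \<Longrightarrow> j < n \<Longrightarrow> M x i j = m x $$ (i, j)"
  shows "wtr n M w = mat_trace (foldr (\<lambda>x Z. m x * Z) w (one_mat n)) / of_nat n"
proof -
  note 1 = foldr_mult_mat[of w m n M, OF assms]
  then have "dim_row (foldr (\<lambda>x Z. m x * Z) w (one_mat n)) = n" by auto
  then show ?thesis using 1 by (simp add: wtr_def mat_trace_def)
qed

locale block_sizes =
  fixes q :: "nat \<Rightarrow> nat \<Rightarrow> nat" and d n :: nat
  assumes sum_q: "(\<Sum>k<d. q k n) = n"
begin

abbreviation "L \<equiv> block_index q d n"

lemma length_L [simp]: "length L = n"
  by (simp add: length_block_index sum_q)

lemma D_mat_carrier [simp]: "D_mat q d n f \<in> carrier_mat n n"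
  and D_mat_index: "i < n \<Longrightarrow> j < n \<Longrightarrow> D_mat q d n f $$ (i, j) = (if i = j then f (L ! i) else 0)"
  using scalar_diag_block_mat[of f "\<lambda>k. q k n" "[0..<d]"]
  by (simp_all add: D_mat_def flip: block_index_def)

lemma D_mat_dim [simp]: "dim_row (D_mat q d n f) = n" "dim_col (D_mat q d n f) = n"
  using D_mat_carrier by blast+

lemma D_mat_mult_index:
  assumes "M \<in> carrier_mat n n" "i < n" "j < n"
  shows "(D_mat q d n f * M) $$ (i, j) = f (L ! i) * M $$ (i, j)"
    and "(M * D_mat q d n f) $$ (i, j) = M $$ (i, j) * f (L ! j)"
proof -
  have "(\<Sum>k<n. D_mat q d n f $$ (i, k) * M $$ (k, j)) = (\<Sum>k<n. if k = i then f (L ! i) * M $$ (i, j) else 0)"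
    using assms by (intro sum.cong) (auto simp: D_mat_index)
  then show "(D_mat q d n f * M) $$ (i, j) = f (L ! i) * M $$ (i, j)"
    using assms by (simp add: mult_mat_index[OF D_mat_carrier assms])
  have "(\<Sum>k<n. M $$ (i, k) * D_mat q d n f $$ (k, j)) = (\<Sum>k<n. if k = j then M $$ (i, j) * f (L ! j) else 0)"
    using assms by (intro sum.cong) (auto simp: D_mat_index)
  then show "(M * D_mat q d n f) $$ (i, j) = M $$ (i, j) * f (L ! j)"
    using assms by (simp add: mult_mat_index[OF assms(1) D_mat_carrier assms(2,3)])
qed

lemma D_mat_mult_D_mat:
  assumes "M \<in> carrier_mat n n"
  shows "D_mat q d n f * (D_mat q d n g * M) = D_mat q d n (\<lambda>k. f k * g k) * M"
proof (rule eq_matI)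
  have gM: "D_mat q d n g * M \<in> carrier_mat n n" using assms by (metis D_mat_carrier mult_carrier_mat)
  fix i j assume "i < dim_row (D_mat q d n (\<lambda>k. f k * g k) * M)" "j < dim_col (D_mat q d n (\<lambda>k. f k * g k) * M)"
  then have ij: "i < n" "j < n" using assms D_mat_carrier[of "\<lambda>k. f k * g k"] by auto
  show "(D_mat q d n f * (D_mat q d n g * M)) $$ (i, j) = (D_mat q d n (\<lambda>k. f k * g k) * M) $$ (i, j)"
    unfolding D_mat_mult_index(1)[OF gM ij] D_mat_mult_index(1)[OF assms ij] by simp
qed (use D_mat_carrier assms in auto)

lemma D_mat_one: "M \<in> carrier_mat n n \<Longrightarrow> D_mat q d n (\<lambda>k. 1) * M = M"
proof (rule eq_matI)
  assume M: "M \<in> carrier_mat n n"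
  fix i j assume "i < dim_row M" "j < dim_col M"
  then show "(D_mat q d n (\<lambda>k. 1) * M) $$ (i, j) = M $$ (i, j)" using M D_mat_mult_index(1)[OF M, of i j] by auto
qed (use D_mat_carrier in auto)

lemma trace_D_mat: "mat_trace (D_mat q d n f) = (\<Sum>k<d. of_nat (q k n) * f k)"
proof -
  have "mat_trace (D_mat q d n f) = (\<Sum>i<n. f (L ! i))"
    using D_mat_carrier[of f] by (simp add: mat_trace_def D_mat_index)
  also have "\<dots> = (\<Sum>k\<leftarrow>L. f k)"
    by (simp add: sum_list_sum_nth atLeast0LessThan)
  finally show ?thesis by (simp add: sum_block_index)
qed

lemma trace_proj:
  assumes "M \<in> carrier_mat n n"
  shows "mat_trace (proj_mat q d n k * M * proj_mat q d n k) = (\<Sum>i<n. if L ! i = k then M $$ (i, i) else 0)"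
proof -
  have c: "proj_mat q d n k * M \<in> carrier_mat n n" unfolding proj_mat_def using assms by (metis D_mat_carrier mult_carrier_mat)
  have "dim_row (proj_mat q d n k * M * proj_mat q d n k) = n" by (simp add: proj_mat_def)
  then show ?thesis unfolding mat_trace_def
    using c assms unfolding proj_mat_def
    by (auto simp: D_mat_mult_index(2)[OF c[unfolded proj_mat_def]] D_mat_mult_index(1)[OF assms] simp del: index_mult_mat(1) intro!: sum.cong)
qed

lemma trace_D_mat_mult:
  assumes "M \<in> carrier_mat n n"
  shows "mat_trace (D_mat q d n f * M) = (\<Sum>k<d. f k * mat_trace (proj_mat q d n k * M * proj_mat q d n k))"
proof -
  have "(\<Sum>k<d. f k * mat_trace (proj_mat q d n k * M * proj_mat q d n k)) =
      (\<Sum>k<d. \<Sum>i<n. if L ! i = k then f (L ! i) * M $$ (i, i) else 0)"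
    unfolding trace_proj[OF assms] by (auto simp: sum_distrib_left intro!: sum.cong)
  also have "\<dots> = (\<Sum>i<n. \<Sum>k<d. if L ! i = k then f (L ! i) * M $$ (i, i) else 0)"
    by (rule sum.swap)
  also have "\<dots> = (\<Sum>i<n. f (L ! i) * M $$ (i, i))"
    using block_index_less[of _ q d n] by (intro sum.cong) (auto simp: sum.delta)
  also have "\<dots> = mat_trace (D_mat q d n f * M)"
    unfolding mat_trace_def using assms D_mat_carrier[of f] by (auto simp: D_mat_mult_index(1)[OF assms] simp del: index_mult_mat(1) intro!: sum.cong)
  finally show ?thesis by simp
qed

end

subsection \<open>Hermitian Gaussian matrices\<close>

type_synonym coordinate = "nat \<times> nat \<times> nat \<times> bool"

text \<open>Hermitian everywhere, whereas the entries \<open>a\<close> have this symmetry only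
  almost everywhere, and built from the upper triangle, whose coordinates are the independent
  variables.\<close>

definition hermitian_entry :: "(coordinate \<Rightarrow> 'w \<Rightarrow> real) \<Rightarrow> nat \<Rightarrow> nat \<Rightarrow> nat \<Rightarrow> 'w \<Rightarrow> complex" where
  "hermitian_entry G s i j \<omega> =
     (if i < j then complex_of_real (G (i, j, s, False) \<omega>) + \<i> * complex_of_real (G (i, j, s, True) \<omega>)
      else if i = j then complex_of_real (G (i, i, s, False) \<omega>)
      else complex_of_real (G (j, i, s, False) \<omega>) + (- \<i>) * complex_of_real (G (j, i, s, True) \<omega>))"

text \<open>The entry is linear in its coordinates; this is its derivative in direction
  \<open>v\<close>.\<close>

definition hermitian_pair :: "(coordinate \<Rightarrow> complex) \<Rightarrow> nat \<Rightarrow> nat \<Rightarrow> nat \<Rightarrow> complex" where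
  "hermitian_pair v s i j =
     (if i < j then v (i, j, s, False) + \<i> * v (i, j, s, True)
      else if i = j then v (i, i, s, False)
      else v (j, i, s, False) + (- \<i>) * v (j, i, s, True))"

definition coordinates :: "nat \<Rightarrow> coordinate set" where
  "coordinates n = {(i, j, s, False) | i j s. i \<le> j \<and> j < n} \<union> {(i, j, s, True) | i j s. i < j \<and> j < n}"

definition coordinate_var :: "nat \<Rightarrow> coordinate \<Rightarrow> real" where
  "coordinate_var n = (\<lambda>(i, j, s, im). if i = j then 1 / real n else 1 / (2 * real n))"

definition delta :: "nat \<Rightarrow> coordinate \<Rightarrow> coordinate \<Rightarrow> complex" where
  "delta n \<gamma> \<beta> = (if \<beta> = \<gamma> then complex_of_real (coordinate_var n \<gamma>) else 0)"

text \<open>The covariances of the entry with the real coordinates, where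
  \<open>delta n \<gamma>\<close> is the covariance vector of the single coordinate
  \<gamma>.\<close>

definition hermitian_cov :: "nat \<Rightarrow> nat \<Rightarrow> nat \<Rightarrow> nat \<Rightarrow> coordinate \<Rightarrow> complex" where
  "hermitian_cov n s i j \<beta> =
     (if i < j then delta n (i, j, s, False) \<beta> + \<i> * delta n (i, j, s, True) \<beta>
      else if i = j then delta n (i, i, s, False) \<beta>
      else delta n (j, i, s, False) \<beta> + (- \<i>) * delta n (j, i, s, True) \<beta>)"

lemma coordinates_iff: "(i, j, s, im) \<in> coordinates n \<longleftrightarrow> j < n \<and> (if im then i < j else i \<le> j)"
  by (auto simp: coordinates_def)

lemma poly_deriv_G:
  assumes "\<gamma> \<in> I"
  shows "poly_deriv G I v (\<lambda>\<omega>. complex_of_real (G \<gamma> \<omega>)) (\<lambda>\<omega>. v \<gamma>)"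
  using poly_deriv.mult[OF assms poly_deriv.const[of G I v 1]] by simp

lemma poly_deriv_hermitian_entry:
  assumes "i < n" "j < n"
  shows "poly_deriv G (coordinates n) v (hermitian_entry G s i j) (\<lambda>\<omega>. hermitian_pair v s i j)"
proof -
  have lin: "poly_deriv G (coordinates n) v (\<lambda>\<omega>. complex_of_real (G \<beta> \<omega>) + c * complex_of_real (G \<gamma> \<omega>)) (\<lambda>\<omega>. v \<beta> + c * v \<gamma>)"
    if "\<beta> \<in> coordinates n" "\<gamma> \<in> coordinates n" for \<beta> \<gamma> c
    using that by (intro poly_deriv.add poly_deriv_smult poly_deriv_G)
  consider "i < j" | "i = j" | "j < i" by linarith
  then show ?thesis
  proof cases
    case 1
    then show ?thesis using lin[of "(i, j, s, False)" "(i, j, s, True)" \<i>] assms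
      by (simp add: hermitian_entry_def[abs_def] hermitian_pair_def coordinates_iff)
  next
    case 2
    then show ?thesis using poly_deriv_G[of "(i, i, s, False)" "coordinates n" G v] assms
      by (simp add: hermitian_entry_def[abs_def] hermitian_pair_def coordinates_iff)
  next
    case 3
    then show ?thesis using lin[of "(j, i, s, False)" "(j, i, s, True)" "- \<i>"] assms
      by (simp add: hermitian_entry_def[abs_def] hermitian_pair_def coordinates_iff)
  qed
qed

lemma delta_tuple:
  "delta n (i, j, s, u) (k, l, t, v) =
     (if i = k \<and> j = l \<and> s = t \<and> u = v then if i = j then 1 / of_nat n else 1 / (2 * of_nat n) else 0)"
proof -
  have c: "complex_of_real (coordinate_var n (i, j, s, u)) = (if i = j then 1 / of_nat n else 1 / (2 * of_nat n))"
  proof (cases "i = j")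
    case True
    have "complex_of_real (1 / real n) = 1 / of_nat n" unfolding of_real_divide of_real_of_nat_eq of_real_1 ..
    then show ?thesis using True unfolding coordinate_var_def prod.case by (simp only: if_True refl)
  next
    case False
    have "complex_of_real (1 / (2 * real n)) = 1 / (2 * of_nat n)"
      unfolding of_real_divide of_real_mult of_real_of_nat_eq of_real_1 of_real_numeral ..
    then show ?thesis using False unfolding coordinate_var_def prod.case by (simp only: if_False)
  qed
  have e: "((k, l, t, v) = (i, j, s, u)) = (i = k \<and> j = l \<and> s = t \<and> u = v)" by (simp only: prod.inject) blast
  show ?thesis unfolding delta_def e c ..
qed

text \<open>The variances 1/(2n) of real and imaginary part add up to 1/n for mirror entries and
  cancel for an off-diagonal entry with itself, since \<i> squares to -1. On the diagonal the
  variance is 1/n directly.\<close>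

lemma hermitian_pair_cov:
  assumes "0 < n"
  shows "hermitian_pair (hermitian_cov n s i j) t k l = (if s = t \<and> k = j \<and> i = l then 1 / of_nat n else 0)"
proof -
  define e :: complex where "e = 1 / (2 * of_nat n)"
  have e: "e + e = 1 / of_nat n"
    using assms unfolding e_def mult_2[symmetric] by simp
  have ii: "\<i> * (\<i> * e) = - e" by (rule complex_i_mult_minus)
  have 1: "hermitian_pair (hermitian_cov n s i j) s j i = 1 / of_nat n"
    by (rule linorder_cases[of i j])
      (simp_all add: hermitian_pair_def hermitian_cov_def delta_tuple e_def[symmetric] ii e del: times_divide_eq_right)
  have 2: "hermitian_pair (hermitian_cov n s i j) s i j = 0" if "i \<noteq> j"
    using that by (cases i j rule: linorder_cases)
      (simp_all add: hermitian_pair_def hermitian_cov_def delta_tuple e_def[symmetric] ii del: times_divide_eq_right)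
  have z: "hermitian_cov n s i j (k', l', t, v) = 0" if "\<not> (s = t \<and> (k' = i \<and> l' = j \<or> k' = j \<and> l' = i))" for k' l' v
    using that by (cases i j rule: linorder_cases) (simp_all add: hermitian_cov_def delta_tuple, argo+)
  consider "s = t" "k = j" "l = i" | "s = t" "k = i" "l = j" "i \<noteq> j"
    | "\<not> (s = t \<and> (k = i \<and> l = j \<or> k = j \<and> l = i))" by blast
  then show ?thesis
  proof cases
    case 1
    then show ?thesis using \<open>hermitian_pair (hermitian_cov n s i j) s j i = 1 / of_nat n\<close> by simp
  next
    case 2
    then show ?thesis using \<open>i \<noteq> j \<Longrightarrow> hermitian_pair (hermitian_cov n s i j) s i j = 0\<close> by simp
  next
    case 3
    have "hermitian_cov n s i j (k, l, t, v) = 0" "hermitian_cov n s i j (l, k, t, v) = 0" for v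
      by (rule z, use 3 in blast)+
    then have "hermitian_pair (hermitian_cov n s i j) t k l = 0"
      by (cases k l rule: linorder_cases) (simp_all add: hermitian_pair_def)
    then show ?thesis using 3 by auto
  qed
qed

lemma hermitian_entry_cnj: "hermitian_entry G s j i \<omega> = cnj (hermitian_entry G s i j \<omega>)"
  by (simp add: hermitian_entry_def)

locale hermitian_gaussian = gaussian_family P G "coordinates n" "coordinate_var n"
  for P :: "'w measure" and G :: "coordinate \<Rightarrow> 'w \<Rightarrow> real" and n :: nat
begin

lemma covariance_vector_hermitian_entry:
  assumes ij: "i < n" "j < n"
  shows "covariance_vector (hermitian_entry G s i j) (hermitian_cov n s i j)"
proof -
  have G: "covariance_vector (\<lambda>\<omega>. complex_of_real (G \<gamma> \<omega>)) (delta n \<gamma>)" if "\<gamma> \<in> coordinates n" for \<gamma>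
    using covariance_vector_G[of \<gamma>] that by (simp add: delta_def[abs_def])
  have lin: "covariance_vector (\<lambda>\<omega>. complex_of_real (G \<beta> \<omega>) + c * complex_of_real (G \<gamma> \<omega>)) (\<lambda>x. delta n \<beta> x + c * delta n \<gamma> x)"
    if "\<beta> \<in> coordinates n" "\<gamma> \<in> coordinates n" for \<beta> \<gamma> c
    using that by (intro covariance_vector_add covariance_vector_smult G)
  consider "i < j" | "i = j" | "j < i" by linarith
  then show ?thesis
  proof cases
    case 1
    then show ?thesis using lin[of "(i, j, s, False)" "(i, j, s, True)" \<i>] ij
      by (simp add: hermitian_entry_def[abs_def] hermitian_cov_def[abs_def] coordinates_iff)
  next
    case 2
    then show ?thesis using G[of "(i, i, s, False)"] ij
      by (simp add: hermitian_entry_def[abs_def] hermitian_cov_def[abs_def] coordinates_iff)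
  next
    case 3
    then show ?thesis using lin[of "(j, i, s, False)" "(j, i, s, True)" "- \<i>"] ij
      by (simp add: hermitian_entry_def[abs_def] hermitian_cov_def[abs_def] coordinates_iff)
  qed
qed

text \<open>Odd powers of the modulus are not polynomials, but its square is the product of the
  entry with its mirror entry. Hence even powers are integrable, and r \<le> 1 + r^2 gives the
  others.\<close>

lemma integrable_hermitian_entry_power:
  assumes ij: "i < n" "j < n"
  shows "integrable P (\<lambda>\<omega>. cmod (hermitian_entry G s i j \<omega>) ^ m)"
    and "hermitian_entry G s i j \<in> borel_measurable P"
proof -
  let ?h = "hermitian_entry G s i j"
  have "G \<gamma> \<in> borel_measurable P" if "\<gamma> \<in> coordinates n" for \<gamma> using G_measurable that by simp
  then show meas: "?h \<in> borel_measurable P"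
    using ij unfolding hermitian_entry_def[abs_def]
    by (cases i j rule: linorder_cases) (auto simp: coordinates_iff intro!: borel_measurable_add borel_measurable_times borel_measurable_of_real)
  have "\<exists>F'. poly_deriv G (coordinates n) (\<lambda>_. 0) (\<lambda>\<omega>. (?h \<omega> * hermitian_entry G s j i \<omega>) ^ k) F'" for k
  proof (induction k)
    case 0
    show ?case using poly_deriv.const[of G "coordinates n" "\<lambda>_. 0" 1] by auto
  next
    case (Suc k)
    then obtain F' where F': "poly_deriv G (coordinates n) (\<lambda>_. 0) (\<lambda>\<omega>. (?h \<omega> * hermitian_entry G s j i \<omega>) ^ k) F'" by blast
    from poly_deriv_times[OF poly_deriv_times[OF poly_deriv_hermitian_entry[OF ij] poly_deriv_hermitian_entry[OF ij(2,1)]] F']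
    show ?case unfolding power_Suc by blast
  qed
  then have "integrable P (\<lambda>\<omega>. (?h \<omega> * hermitian_entry G s j i \<omega>) ^ m)" using integrable_poly by blast
  then have "integrable P (\<lambda>\<omega>. norm ((?h \<omega> * hermitian_entry G s j i \<omega>) ^ m))" by (rule integrable_norm)
  also have "(\<lambda>\<omega>. norm ((?h \<omega> * hermitian_entry G s j i \<omega>) ^ m)) = (\<lambda>\<omega>. cmod (?h \<omega>) ^ m * cmod (?h \<omega>) ^ m)"
    by (simp add: hermitian_entry_cnj[of G s j i] norm_mult norm_power power_mult_distrib)
  finally have "integrable P (\<lambda>\<omega>. 1 + cmod (?h \<omega>) ^ m * cmod (?h \<omega>) ^ m)" by simp
  then show "integrable P (\<lambda>\<omega>. cmod (?h \<omega>) ^ m)"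
  proof (rule Bochner_Integration.integrable_bound)
    show "(\<lambda>\<omega>. cmod (?h \<omega>) ^ m) \<in> borel_measurable P" using meas by measurable
    have "r \<le> 1 + r * r" if "0 \<le> r" for r :: real
    proof -
      have "0 \<le> (1 - r) * (1 - r)" by (rule zero_le_square)
      then have "2 * r \<le> 1 + r * r" by (simp only: algebra_simps)
      then show ?thesis using that by linarith
    qed
    then show "AE \<omega> in P. norm (cmod (?h \<omega>) ^ m) \<le> norm (1 + cmod (?h \<omega>) ^ m * cmod (?h \<omega>) ^ m)"
      by (intro AE_I2) (simp add: abs_of_nonneg)
  qed
qed

end

section \<open>Words in the semicircular extension and words in the matrices\<close>

primrec semicircular_word :: "nat \<Rightarrow> 'c list \<Rightarrow> ('c + nat) list" where
  "semicircular_word s [] = []"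
| "semicircular_word s (x # xs) = Inr s # Inl x # semicircular_word s xs"

text \<open>The words \<open>M\<^bsub>i\<^sub>0\<^esub>\<^sup>\<epsilon>\<^sup>0 d\<^sub>0 \<dots>\<close> in the letters \<open>B j\<close>, \<open>B j\<^sup>*\<close>, elements of \<open>D\<close> and
  Gaussian matrices; the last ones are self-adjoint, so that their exponents are dropped.\<close>

primrec flatten :: "(nat + nat) letter list \<Rightarrow> (((nat \<times> bool) + (nat \<Rightarrow> complex)) + nat) list" where
  "flatten [] = []"
| "flatten (l # w) = (case fst l of Inl j \<Rightarrow> Inl (Inl (j, fst (snd l))) | Inr s \<Rightarrow> Inr s) # Inl (Inr (snd (snd l))) # flatten w"

context rectangular_prob_space
begin

lemma De_indicator:
  assumes k: "k < d"
  shows "De (\<lambda>l. if l = k then 1 else 0) = p k"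
proof -
  have "De (\<lambda>l. if l = k then 1 else 0) = (\<Oplus>l\<in>{..<d}. if k = l then p l else \<zero>)"
    unfolding D_elem_def by (intro alg.finsum_cong') auto
  also have "\<dots> = p k" using k by (intro alg.finsum_singleton) auto
  finally show ?thesis .
qed

lemma D_set_ext: "D_set B d (scalar_emb \<circ> p) = scalar_emb ` Ds"
  unfolding D_set_def D_elem_ext[abs_def] image_image ..

text \<open>Moments with a projection in front see only the conditional expectation onto the base
  algebra, which already lies in D.\<close>

lemma E_code:
  assumes "D_word s w"
  shows "E B d (scalar_emb \<circ> p) (code [(1, w)]) = scalar_emb (cexp w)"
proof -
  interpret B: rectangular_prob_space B d "scalar_emb \<circ> p" by (rule rectangular_ext)
  have c: "cexp w \<in> Ds" by (rule cexp_Ds[OF assms])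
  have 1: "code [(1, w)] \<in> carrier B" unfolding carrier_ext by blast
  have 2: "scalar_emb (cexp w) \<in> carrier B" by (rule scalar_emb_simps(6)[OF cexp_closed])
  have "E B d (scalar_emb \<circ> p) (code [(1, w)]) = E B d (scalar_emb \<circ> p) (scalar_emb (cexp w))"
  proof (rule B.E_eqI[OF 1 2])
    fix k assume k: "k < d"
    have "state B (scalar_emb (p k) \<otimes>\<^bsub>B\<^esub> scalar_emb (cexp w)) = state B (scalar_emb (p k \<otimes> cexp w))"
      by (simp only: scalar_emb_simps(1)[OF proj_in[OF k] cexp_closed])
    also have "\<dots> = state A (p k \<otimes> cexp w)"
      by (rule scalar_emb_simps(5)) (rule alg.m_closed[OF proj_in[OF k] cexp_closed])
    finally show "state B ((scalar_emb \<circ> p) k \<otimes>\<^bsub>B\<^esub> code [(1, w)]) = state B ((scalar_emb \<circ> p) k \<otimes>\<^bsub>B\<^esub> scalar_emb (cexp w))"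
      by (simp add: state_proj_code[OF k] moment_def)
  qed
  also have "\<dots> = scalar_emb (cexp w)" by (rule B.E_Ds) (use c in \<open>simp only: D_set_ext imageI\<close>)
  finally show ?thesis .
qed

lemma D_word_semicircular_word: "set xs \<subseteq> Ds \<Longrightarrow> D_word s (semicircular_word s xs)"
  by (induction xs) auto

lemma alg_prod_semicircular:
  "alg_prod B (map ((\<otimes>\<^bsub>B\<^esub>) (semicircular s)) (map scalar_emb xs)) = code [(1, semicircular_word s xs)]"
  by (induction xs) (simp_all add: alg_prod_def one_ext semicircular_def scalar_emb_def mult_ext)

lemma splits_semicircular_word:
  "splits s (semicircular_word s xs) =
     map (\<lambda>i. (semicircular_word s (take i xs), Inl (xs ! i) # semicircular_word s (drop (Suc i) xs))) [0..<length xs]"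
proof (induction xs)
  case (Cons x xs)
  have "[0..<length (x # xs)] = 0 # map Suc [0..<length xs]"
    using upt_conv_Cons[of 0 "length (x # xs)"] map_Suc_upt[of 0 "length xs"] by (simp del: upt_Suc)
  then show ?case using Cons by (simp add: comp_def case_prod_unfold del: upt_Suc)
qed simp

lemma scalar_emb_asum:
  assumes "set xs \<subseteq> carrier A"
  shows "scalar_emb (asum xs) = foldr (\<oplus>\<^bsub>B\<^esub>) (map scalar_emb xs) \<zero>\<^bsub>B\<^esub>"
  using assms
proof (induction xs)
  case Nil
  interpret B: tracial_star_prob_space B by (rule tracial_star_prob_space_ext)
  have "scalar_emb \<zero> = scalar_emb (0 \<odot> \<zero>)" by simp
  also have "\<dots> = \<zero>\<^bsub>B\<^esub>"
    by (subst scalar_emb_simps(3)) (simp_all only: alg.zero_closed B.smult_0 scalar_emb_simps(6))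
  finally show ?case by simp
next
  case (Cons x xs)
  then have "x \<in> carrier A" "asum xs \<in> carrier A" "set xs \<subseteq> carrier A" by auto
  then show ?case using scalar_emb_simps(2)[of x "asum xs"] Cons.IH by simp
qed

text \<open>On words alternating between the semicircular and D, the recursion of
  \<open>cexp\<close> becomes, through \<open>scalar_emb\<close>, the hypothesis of
  \<open>D_semicircularI\<close>.\<close>

lemma D_semicircular_semicircular: "D_semicircular B d (scalar_emb \<circ> p) (semicircular s)"
proof -
  interpret B: rectangular_prob_space B d "scalar_emb \<circ> p" by (rule rectangular_ext)
  let ?y = "semicircular s"
  let ?M = "\<lambda>xs. E B d (scalar_emb \<circ> p) (alg_prod B (map ((\<otimes>\<^bsub>B\<^esub>) ?y) xs))"
  have M: "?M (map scalar_emb xs) = scalar_emb (cexp (semicircular_word s xs))" if "set xs \<subseteq> Ds" for xs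
    unfolding alg_prod_semicircular by (rule E_code[OF D_word_semicircular_word[OF that]])
  show ?thesis
  proof (rule B.D_semicircularI)
    show "?y \<in> carrier B" unfolding semicircular_def carrier_ext by blast
    show "star B ?y = ?y" by (simp add: semicircular_def star_ext pstar_def)
    fix e' es' assume e': "e' \<in> D_set B d (scalar_emb \<circ> p)" "set es' \<subseteq> D_set B d (scalar_emb \<circ> p)"
    from e'(1) obtain e where e: "e' = scalar_emb e" "e \<in> Ds" unfolding D_set_ext by (rule imageE)
    have "es' \<in> lists (scalar_emb ` Ds)" using e'(2) unfolding D_set_ext by (simp only: in_lists_conv_set subset_iff)  blast
    then obtain es where es: "es' = map scalar_emb es" "set es \<subseteq> Ds"
      unfolding lists_image by (auto simp: in_lists_conv_set)
    have ec: "e \<in> carrier A" by (rule Ds_closed[OF e(2)])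
    let ?t = "\<lambda>i. state A (e \<otimes> cexp (semicircular_word s (take i es))) \<odot> (es ! i \<otimes> cexp (semicircular_word s (drop (Suc i) es)))"
    have nth: "es ! i \<in> carrier A" if "i < length es" for i using that es(2) nth_mem Ds_closed by blast
    have "?M (e' # es') = scalar_emb (cexp (Inr s # Inl e # semicircular_word s es))"
      using M[of "e # es"] e es by simp
    also have "cexp (Inr s # Inl e # semicircular_word s es) = asum (map ?t [0..<length es])"
    proof -
      have "map (\<lambda>i. state A (emb e \<otimes> cexp (semicircular_word s (take i es))) \<odot> (emb (es ! i) \<otimes> cexp (semicircular_word s (drop (Suc i) es)))) [0..<length es] =
          map ?t [0..<length es]"
        by (rule map_cong[OF refl]) (simp only: emb_id[OF ec] emb_id[OF nth] set_upt atLeastLessThan_iff)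
      then show ?thesis
        by (simp only: cexp.simps splits.simps splits_semicircular_word map_map comp_def prod.case append_Nil sum.distinct if_False)
    qed
    also have "scalar_emb \<dots> = foldr (\<oplus>\<^bsub>B\<^esub>) (map scalar_emb (map ?t [0..<length es])) \<zero>\<^bsub>B\<^esub>"
      by (rule scalar_emb_asum) (use nth in auto)
    also have "map scalar_emb (map ?t [0..<length es]) =
        map (\<lambda>i. state B (e' \<otimes>\<^bsub>B\<^esub> ?M (take i es')) \<odot>\<^bsub>B\<^esub> (es' ! i \<otimes>\<^bsub>B\<^esub> ?M (drop (Suc i) es'))) [0..<length es']"
      unfolding map_map es(1) length_map
    proof (rule map_cong[OF refl])
      fix i assume "i \<in> set [0..<length es]"
      then have i: "i < length es" by simp
      let ?u = "cexp (semicircular_word s (take i es))" and ?v = "cexp (semicircular_word s (drop (Suc i) es))"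
      have t: "?M (take i (map scalar_emb es)) = scalar_emb ?u"
        unfolding take_map by (rule M[OF order_trans[OF set_take_subset es(2)]])
      have dr: "?M (drop (Suc i) (map scalar_emb es)) = scalar_emb ?v"
        unfolding drop_map by (rule M[OF order_trans[OF set_drop_subset es(2)]])
      have 1: "state B (scalar_emb e \<otimes>\<^bsub>B\<^esub> scalar_emb ?u) = state A (e \<otimes> ?u)"
        unfolding scalar_emb_simps(1)[OF ec cexp_closed, symmetric] by (rule scalar_emb_simps(5)) (rule alg.m_closed[OF ec cexp_closed])
      have 2: "scalar_emb (es ! i) \<otimes>\<^bsub>B\<^esub> scalar_emb ?v = scalar_emb (es ! i \<otimes> ?v)"
        by (rule scalar_emb_simps(1)[OF nth[OF i] cexp_closed, symmetric])
      have "scalar_emb (?t i) = state A (e \<otimes> ?u) \<odot>\<^bsub>B\<^esub> scalar_emb (es ! i \<otimes> ?v)"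
        by (rule scalar_emb_simps(3)[OF alg.m_closed[OF nth[OF i] cexp_closed]])
      then show "(scalar_emb \<circ> ?t) i = state B (e' \<otimes>\<^bsub>B\<^esub> ?M (take i (map scalar_emb es))) \<odot>\<^bsub>B\<^esub>
          (map scalar_emb es ! i \<otimes>\<^bsub>B\<^esub> ?M (drop (Suc i) (map scalar_emb es)))"
        by (simp only: o_apply t dr e(1) 1 2 nth_map[OF i])
    qed
    finally show "?M (e' # es') =
      foldr (\<oplus>\<^bsub>B\<^esub>) (map (\<lambda>i. state B (e' \<otimes>\<^bsub>B\<^esub> ?M (take i es')) \<odot>\<^bsub>B\<^esub> (es' ! i \<otimes>\<^bsub>B\<^esub> ?M (drop (Suc i) es'))) [0..<length es']) \<zero>\<^bsub>B\<^esub>" .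
  qed
qed

text \<open>The limits of the abstract letters of \<open>flatten\<close>, as letters of the
  extension.\<close>

primrec theta :: "(nat \<Rightarrow> 'u) \<Rightarrow> ((nat \<times> bool) + (nat \<Rightarrow> complex)) + nat \<Rightarrow> 'u + nat" where
  "theta b (Inl c) = Inl (case c of Inl (j, \<epsilon>) \<Rightarrow> if \<epsilon> then star A (b j) else b j | Inr f \<Rightarrow> De f)"
| "theta b (Inr s) = Inr s"

definition joint_limit :: "(nat \<Rightarrow> 'u) \<Rightarrow> nat + nat \<Rightarrow> 'u" where
  "joint_limit b = case_sum (\<lambda>j. scalar_emb (b j)) semicircular"

lemma alg_word_ext:
  assumes b: "\<And>j. b j \<in> carrier A"
  shows "alg_word B d (scalar_emb \<circ> p) (joint_limit b) w = code [(1, map (theta b) (flatten w))]"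
proof (induction w)
  case Nil
  show ?case by (simp add: alg_word_def one_ext)
next
  case (Cons l w)
  obtain i \<epsilon> f where l: "l = (i, \<epsilon>, f)" by (cases l) auto
  have "star B (semicircular s) = semicircular s" for s by (simp add: semicircular_def star_ext pstar_def)
  moreover have "star B (scalar_emb (b j)) = scalar_emb (star A (b j))" for j
    by (rule scalar_emb_simps(4)[OF b, symmetric])
  ultimately have x: "(if \<epsilon> then star B (joint_limit b i) else joint_limit b i) =
      code [(1, [theta b (case i of Inl j \<Rightarrow> Inl (Inl (j, \<epsilon>)) | Inr s \<Rightarrow> Inr s)])]"
    by (cases i) (simp_all add: joint_limit_def scalar_emb_def[symmetric] semicircular_def[symmetric])
  have "alg_word B d (scalar_emb \<circ> p) (joint_limit b) (l # w) =
      (if \<epsilon> then star B (joint_limit b i) else joint_limit b i) \<otimes>\<^bsub>B\<^esub> D_elem B d (scalar_emb \<circ> p) f \<otimes>\<^bsub>B\<^esub>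
        alg_word B d (scalar_emb \<circ> p) (joint_limit b) w"
    by (simp only: alg_word_def l foldr.simps comp_def prod.case)
  also have "\<dots> = code [(1, map (theta b) (flatten (l # w)))]"
    unfolding x Cons.IH D_elem_ext by (simp add: scalar_emb_def mult_ext l fst_conv snd_conv split: sum.split)
  finally show ?case .
qed

lemma E_coeff_code:
  assumes k: "k < d"
  shows "E_coeff B (scalar_emb \<circ> p) (code [(1, w)]) k = moment (p k) w / state A (p k)"
proof -
  interpret B: rectangular_prob_space B d "scalar_emb \<circ> p" by (rule rectangular_ext)
  have "code [(1, w)] \<in> carrier B" unfolding carrier_ext by blast
  then show ?thesis
    by (simp add: B.E_coeff_eq[OF k] state_proj_code[OF k] scalar_emb_simps(5)[OF proj_in[OF k]])
qed

lemma free_subsets_ext: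
  assumes b: "\<And>j. b j \<in> carrier A"
  shows "free_subsets B d (scalar_emb \<circ> p)
    (\<lambda>g. joint_limit b ` (case g of None \<Rightarrow> range Inl | Some s \<Rightarrow> {Inr s}))"
  unfolding free_subsets_def
proof (intro exI conjI allI)
  fix g
  have "semicircular s \<in> {code ps | ps. \<forall>(c, w)\<in>set ps. D_word s w}" for s
    unfolding semicircular_def by (intro CollectI exI[of _ "[(1, [Inr s])]"]) simp
  then show "joint_limit b ` (case g of None \<Rightarrow> range Inl | Some s \<Rightarrow> {Inr s}) \<subseteq> free_component g"
    using b by (cases g) (auto simp: joint_limit_def free_component_def simp del: mem_Collect_eq)
qed (rule free_subalgebras_ext)

end

lemma mat_word_simps:
  "mat_word q d n M [] = one_mat n"
  "mat_word q d n M ((i, \<epsilon>, f) # w) = (if \<epsilon> then mat_adjoint (M i) else M i) * D_mat q d n f * mat_word q d n M w"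
  by (simp_all only: mat_word_def foldr.simps comp_def prod.case id_apply)

context block_sizes
begin

lemma mat_word_carrier:
  assumes "\<And>i. M i \<in> carrier_mat n n"
  shows "mat_word q d n M w \<in> carrier_mat n n"
proof (induction w)
  case (Cons l w)
  obtain i \<epsilon> f where l: "l = (i, \<epsilon>, f)" by (cases l) auto
  have 1: "(if \<epsilon> then mat_adjoint (M i) else M i) \<in> carrier_mat n n"
    by (cases \<epsilon>) (simp_all only: if_True if_False assms mat_adjoint_carrier[OF assms])
  show ?case unfolding l mat_word_simps by (rule mult_carrier_mat[OF mult_carrier_mat[OF 1 D_mat_carrier] Cons])
qed (simp add: mat_word_simps)

lemma measurable_mat_word:
  assumes M: "\<And>i \<omega>. M i \<omega> \<in> carrier_mat n n"
    and meas: "\<And>i k l. k < n \<Longrightarrow> l < n \<Longrightarrow> (\<lambda>\<omega>. M i \<omega> $$ (k, l)) \<in> borel_measurable P"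
  shows "k < n \<Longrightarrow> l < n \<Longrightarrow> (\<lambda>\<omega>. mat_word q d n (\<lambda>i. M i \<omega>) w $$ (k, l)) \<in> borel_measurable P"
proof (induction w arbitrary: k l)
  case Nil
  then show ?case by (simp add: mat_word_simps)
next
  case (Cons x w)
  obtain i \<epsilon> f where x: "x = (i, \<epsilon>, f)" by (cases x) auto
  let ?N = "\<lambda>\<omega>. if \<epsilon> then mat_adjoint (M i \<omega>) else M i \<omega>"
  have N: "?N \<omega> \<in> carrier_mat n n" for \<omega>
    by (cases \<epsilon>) (simp_all only: if_True if_False M mat_adjoint_carrier[OF M])
  have cnj: "(\<lambda>\<omega>. cnj (h \<omega>)) \<in> borel_measurable P" if "h \<in> borel_measurable P" for h :: "_ \<Rightarrow> complex"
    using measurable_compose[OF that borel_measurable_continuous_onI[OF continuous_on_cnj[OF continuous_on_id]]] .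
  have measN: "(\<lambda>\<omega>. ?N \<omega> $$ (k, l)) \<in> borel_measurable P" if "k < n" "l < n" for k l
    using that by (cases \<epsilon>) (simp_all add: mat_adjoint_index[OF M] meas cnj)
  have "(\<lambda>\<omega>. mat_word q d n (\<lambda>i. M i \<omega>) (x # w) $$ (k, l)) =
      (\<lambda>\<omega>. \<Sum>m<n. ?N \<omega> $$ (k, m) * f (L ! m) * mat_word q d n (\<lambda>i. M i \<omega>) w $$ (m, l))"
  proof
    fix \<omega>
    have "mat_word q d n (\<lambda>i. M i \<omega>) (x # w) $$ (k, l) =
        (\<Sum>m<n. (?N \<omega> * D_mat q d n f) $$ (k, m) * mat_word q d n (\<lambda>i. M i \<omega>) w $$ (m, l))"
      unfolding x mat_word_simps
      by (rule mult_mat_index[OF mult_carrier_mat[OF N D_mat_carrier] mat_word_carrier[OF M] Cons.prems])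
    also have "\<dots> = (\<Sum>m<n. ?N \<omega> $$ (k, m) * f (L ! m) * mat_word q d n (\<lambda>i. M i \<omega>) w $$ (m, l))"
      by (rule sum.cong[OF refl]) (simp only: D_mat_mult_index(2)[OF N Cons.prems(1)] lessThan_iff)
    finally show "mat_word q d n (\<lambda>i. M i \<omega>) (x # w) $$ (k, l) =
        (\<Sum>m<n. ?N \<omega> $$ (k, m) * f (L ! m) * mat_word q d n (\<lambda>i. M i \<omega>) w $$ (m, l))" .
  qed
  moreover have "(\<lambda>\<omega>. \<Sum>m<n. ?N \<omega> $$ (k, m) * f (L ! m) * mat_word q d n (\<lambda>i. M i \<omega>) w $$ (m, l)) \<in> borel_measurable P"
  proof (rule borel_measurable_sum)
    fix m assume "m \<in> {..<n}"
    then have m: "m < n" by simp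
    show "(\<lambda>\<omega>. ?N \<omega> $$ (k, m) * f (L ! m) * mat_word q d n (\<lambda>i. M i \<omega>) w $$ (m, l)) \<in> borel_measurable P"
      by (rule borel_measurable_times[OF borel_measurable_times[OF measN[OF Cons.prems(1) m] borel_measurable_const] Cons.IH[OF m Cons.prems(2)]])
  qed
  ultimately show ?case by (simp only:)
qed

lemma trace_proj_eq:
  assumes M: "M \<in> carrier_mat n n" and k: "k < d"
  shows "mat_trace (proj_mat q d n k * M * proj_mat q d n k) = mat_trace (D_mat q d n (\<lambda>l. if l = k then 1 else 0) * M)"
proof -
  have "mat_trace (D_mat q d n (\<lambda>l. if l = k then 1 else 0) * M) =
      (\<Sum>l<d. if l = k then mat_trace (proj_mat q d n l * M * proj_mat q d n l) else 0)"
    unfolding trace_D_mat_mult[OF M] by (rule sum.cong[OF refl]) simp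
  also have "\<dots> = mat_trace (proj_mat q d n k * M * proj_mat q d n k)" using k by simp
  finally show ?thesis ..
qed

end

locale matrix_model = rectangular_prob_space A d p
  for A :: "'u star_prob" (structure) and d :: nat and p :: "nat \<Rightarrow> 'u" +
  fixes q :: "nat \<Rightarrow> nat \<Rightarrow> nat" and P :: "'w measure"
    and a :: "nat \<Rightarrow> nat \<Rightarrow> nat \<Rightarrow> nat \<Rightarrow> 'w \<Rightarrow> complex"
    and Z :: "nat \<Rightarrow> nat \<Rightarrow> complex mat" and b :: "nat \<Rightarrow> 'u"
  assumes d_pos: "0 < d"
    and q_pos: "\<And>n k. n \<ge> d \<Longrightarrow> k < d \<Longrightarrow> 0 < q k n"
    and q_sum: "\<And>n. n \<ge> d \<Longrightarrow> (\<Sum>k<d. q k n) = n"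
    and q_lim: "\<And>k. k < d \<Longrightarrow> (\<lambda>n. of_nat (q k n) / of_nat n) \<longlonglongrightarrow> state A (p k)"
    and prob_P: "prob_space P"
    and a_rv: "\<And>n s i j. n \<ge> d \<Longrightarrow> i < n \<Longrightarrow> j < n \<Longrightarrow> a i j n s \<in> borel_measurable P"
    and a_hermitian: "\<And>n s i j. n \<ge> d \<Longrightarrow> i < n \<Longrightarrow> j < n \<Longrightarrow>
          AE \<omega> in P. a i j n s \<omega> = cnj (a j i n s \<omega>)"
    and a_indep: "\<And>n. n \<ge> d \<Longrightarrow>
          prob_space.indep_vars P (\<lambda>_. borel)
            (\<lambda>(i, j, s, im) \<omega>. if im then Im (a i j n s \<omega>) else Re (a i j n s \<omega>)) (coordinates n)"
    and a_gauss_Re: "\<And>n s i j. n \<ge> d \<Longrightarrow> i < j \<Longrightarrow> j < n \<Longrightarrow>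
          distributed P lborel (\<lambda>\<omega>. Re (a i j n s \<omega>)) (normal_density 0 (sqrt (1 / (2 * real n))))"
    and a_gauss_Im: "\<And>n s i j. n \<ge> d \<Longrightarrow> i < j \<Longrightarrow> j < n \<Longrightarrow>
          distributed P lborel (\<lambda>\<omega>. Im (a i j n s \<omega>)) (normal_density 0 (sqrt (1 / (2 * real n))))"
    and a_gauss_diag: "\<And>n s i. n \<ge> d \<Longrightarrow> i < n \<Longrightarrow>
          distributed P lborel (\<lambda>\<omega>. Re (a i i n s \<omega>)) (normal_density 0 (sqrt (1 / real n)))"
    and Z_dim: "\<And>n j. n \<ge> d \<Longrightarrow> Z j n \<in> carrier_mat n n"
    and Z_conv: "converges_in_D_distribution P q d (\<lambda>j n _. Z j n) A p b"
begin

lemma block_sizes: "d \<le> n \<Longrightarrow> block_sizes q d n"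
  by (simp add: block_sizes_def q_sum)

lemma b_closed [simp]: "b j \<in> carrier A"
  using Z_conv by (simp add: converges_in_D_distribution_def)

definition coordinate_rv :: "nat \<Rightarrow> coordinate \<Rightarrow> 'w \<Rightarrow> real" where
  "coordinate_rv n = (\<lambda>(i, j, s, im) \<omega>. if im then Im (a i j n s \<omega>) else Re (a i j n s \<omega>))"

lemma hermitian_gaussian:
  assumes n: "d \<le> n"
  shows "hermitian_gaussian P (coordinate_rv n) n"
  unfolding hermitian_gaussian_def gaussian_family_def gaussian_family_axioms_def
proof (intro conjI allI impI)
  show "prob_space P" by (rule prob_P)
  show "prob_space.indep_vars P (\<lambda>_. borel) (coordinate_rv n) (coordinates n)"
    unfolding coordinate_rv_def by (rule a_indep[OF n])
  fix \<gamma> :: coordinate assume \<gamma>: "\<gamma> \<in> coordinates n"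
  obtain i j s im where g: "\<gamma> = (i, j, s, im)" by (cases \<gamma>) auto
  show "0 < coordinate_var n \<gamma>" using n d_pos unfolding g coordinate_var_def by simp
  have ij: "j < n" "if im then i < j else i \<le> j" using \<gamma> unfolding g coordinates_iff by auto
  show "distributed P lborel (coordinate_rv n \<gamma>) (normal_density 0 (sqrt (coordinate_var n \<gamma>)))"
  proof (cases im)
    case True
    then show ?thesis using ij a_gauss_Im[OF n, of i j s] unfolding g coordinate_rv_def coordinate_var_def by simp
  next
    case False
    then show ?thesis using ij a_gauss_Re[OF n, of i j s] a_gauss_diag[OF n, of j s]
      unfolding g coordinate_rv_def coordinate_var_def by (cases "i = j") simp_all
  qed
qed

abbreviation herm :: "nat \<Rightarrow> nat \<Rightarrow> nat \<Rightarrow> nat \<Rightarrow> 'w \<Rightarrow> complex" where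
  "herm n s \<equiv> hermitian_entry (coordinate_rv n) s"

text \<open>Only countably many triples of indices occur, so the exceptional null sets of the single
  entries can be united.\<close>

lemma a_eq_herm:
  assumes n: "d \<le> n"
  shows "AE \<omega> in P. \<forall>s i j. i < n \<longrightarrow> j < n \<longrightarrow> a i j n s \<omega> = herm n s i j \<omega>"
proof -
  have "AE \<omega> in P. i < n \<longrightarrow> j < n \<longrightarrow> a i j n s \<omega> = herm n s i j \<omega>" for s i j
  proof (cases "i < n \<and> j < n")
    case True
    then have ij: "i < n" "j < n" by auto
    have G: "coordinate_rv n (i, j, s, im) \<omega> = (if im then Im (a i j n s \<omega>) else Re (a i j n s \<omega>))" for i j im \<omega>
      by (simp add: coordinate_rv_def)
    have c: "complex_of_real (Re z) + \<i> * complex_of_real (Im z) = z" for z by (rule complex_eq[symmetric])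
    from a_hermitian[OF n ij, of s] show ?thesis
    proof (rule AE_mp, intro AE_I2 impI)
      fix \<omega> assume h: "a i j n s \<omega> = cnj (a j i n s \<omega>)"
      consider "i < j" | "i = j" | "j < i" by linarith
      then show "a i j n s \<omega> = herm n s i j \<omega>"
      proof cases
        case 1
        then show ?thesis unfolding hermitian_entry_def G by (simp only: if_True if_False c)
      next
        case 2
        then have "Im (a i i n s \<omega>) = 0" using arg_cong[OF h, of Im] by simp
        then show ?thesis using 2 unfolding hermitian_entry_def G by (simp add: complex_eq_iff)
      next
        case 3
        then have "\<not> i < j" "i \<noteq> j" by auto
        moreover have "complex_of_real (Re (a j i n s \<omega>)) + - \<i> * complex_of_real (Im (a j i n s \<omega>)) = a i j n s \<omega>"
          unfolding h by (simp add: complex_eq_iff)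
        ultimately show ?thesis unfolding hermitian_entry_def G by (simp only: if_False if_True)
      qed
    qed
  qed auto
  then show ?thesis by (simp only: AE_all_countable simp_thms)
qed

fun model :: "nat \<Rightarrow> ((nat \<times> bool) + (nat \<Rightarrow> complex)) + nat \<Rightarrow> nat \<Rightarrow> nat \<Rightarrow> 'w \<Rightarrow> complex" where
  "model n (Inl (Inl (j, \<epsilon>))) i k \<omega> = (if \<epsilon> then mat_adjoint (Z j n) else Z j n) $$ (i, k)"
| "model n (Inl (Inr f)) i k \<omega> = D_mat q d n f $$ (i, k)"
| "model n (Inr s) i k \<omega> = herm n s i k \<omega>"

definition herm_mat :: "nat \<Rightarrow> nat \<Rightarrow> 'w \<Rightarrow> complex mat" where
  "herm_mat s n \<omega> = Matrix.mat n n (\<lambda>(i, k). herm n s i k \<omega>)"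

fun model_mat :: "nat \<Rightarrow> 'w \<Rightarrow> ((nat \<times> bool) + (nat \<Rightarrow> complex)) + nat \<Rightarrow> complex mat" where
  "model_mat n \<omega> (Inl (Inl (j, \<epsilon>))) = (if \<epsilon> then mat_adjoint (Z j n) else Z j n)"
| "model_mat n \<omega> (Inl (Inr f)) = D_mat q d n f"
| "model_mat n \<omega> (Inr s) = herm_mat s n \<omega>"

lemma gaussian_matrices_model:
  assumes n: "d \<le> n"
  shows "gaussian_matrices P (coordinate_rv n) (coordinates n) (coordinate_var n) n (model n) (hermitian_cov n)"
proof -
  interpret hermitian_gaussian P "coordinate_rv n" n by (rule hermitian_gaussian[OF n])
  have n0: "0 < n" using n d_pos by simp
  show ?thesis
  proof (unfold_locales)
    show "0 < n" by (rule n0)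
    fix c i j and \<omega> \<omega>' :: 'w
    show "model n (Inl c) i j \<omega> = model n (Inl c) i j \<omega>'"
      by (cases c) auto
  next
    fix i j s assume ij: "i < n" "j < n"
    show "covariance_vector (model n (Inr s) i j) (hermitian_cov n s i j)"
      using covariance_vector_hermitian_entry[OF ij, of s] unfolding model.simps(3)[abs_def] .
  next
    fix i j k l s t assume "i < n" "j < n" and kl: "k < n" "l < n"
    have "poly_deriv (coordinate_rv n) (coordinates n) (hermitian_cov n s i j) (herm n t k l)
        (\<lambda>\<omega>. hermitian_pair (hermitian_cov n s i j) t k l)"
      by (rule poly_deriv_hermitian_entry[OF kl])
    then show "poly_deriv (coordinate_rv n) (coordinates n) (hermitian_cov n s i j) (model n (Inr t) k l)
        (\<lambda>\<omega>. if s = t \<and> k = j \<and> i = l then 1 / of_nat n else 0)"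
      unfolding hermitian_pair_cov[OF n0] model.simps(3)[abs_def] .
  qed
qed

lemma herm_mat_carrier: "herm_mat s n \<omega> \<in> carrier_mat n n"
  by (simp add: herm_mat_def)

lemma adjoint_herm_mat: "mat_adjoint (herm_mat s n \<omega>) = herm_mat s n \<omega>"
proof (rule eq_matI)
  fix i j assume "i < dim_row (herm_mat s n \<omega>)" "j < dim_col (herm_mat s n \<omega>)"
  then have ij: "i < n" "j < n" by (simp_all add: herm_mat_def)
  show "mat_adjoint (herm_mat s n \<omega>) $$ (i, j) = herm_mat s n \<omega> $$ (i, j)"
    unfolding mat_adjoint_index[OF herm_mat_carrier ij] using ij hermitian_entry_cnj[of "coordinate_rv n" s i j \<omega>]
    by (simp add: herm_mat_def)
qed (use mat_adjoint_carrier[OF herm_mat_carrier] in \<open>auto simp: herm_mat_def\<close>)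

lemma model_mat_carrier:
  assumes n: "d \<le> n"
  shows "model_mat n \<omega> x \<in> carrier_mat n n"
proof -
  interpret block_sizes q d n by (rule block_sizes[OF n])
  show ?thesis
  proof (cases x)
    case (Inl c)
    show ?thesis
    proof (cases c)
      case (Inl jb)
      obtain j \<epsilon> where "jb = (j, \<epsilon>)" by (cases jb)
      then show ?thesis unfolding \<open>x = Inl c\<close> Inl model_mat.simps by (cases \<epsilon>) (simp_all only: model_mat.simps if_True if_False Z_dim[OF n] mat_adjoint_carrier[OF Z_dim[OF n]])
    next
      case (Inr f)
      then show ?thesis using \<open>x = Inl c\<close> by simp
    qed
  next
    case (Inr s)
    then show ?thesis by (simp add: herm_mat_carrier)
  qed
qed

lemma model_eq:
  assumes "i < n" "k < n"
  shows "model n x i k \<omega> = model_mat n \<omega> x $$ (i, k)"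
proof (cases x)
  case (Inl c)
  then show ?thesis by (cases c) auto
qed (use assms in \<open>simp add: herm_mat_def\<close>)

lemma wtr_model:
  assumes n: "d \<le> n"
  shows "wtr n (\<lambda>x i k. model n x i k \<omega>) w = mat_trace (foldr (\<lambda>x M. model_mat n \<omega> x * M) w (one_mat n)) / of_nat n"
  by (rule wtr_eq_mat_trace) (rule model_mat_carrier[OF n], rule model_eq)

abbreviation mats :: "nat \<Rightarrow> 'w \<Rightarrow> nat + nat \<Rightarrow> complex mat" where
  "mats n \<omega> \<equiv> \<lambda>i. case i of Inl j \<Rightarrow> Z j n | Inr s \<Rightarrow> herm_mat s n \<omega>"

lemma mats_carrier: "d \<le> n \<Longrightarrow> mats n \<omega> i \<in> carrier_mat n n"
  by (cases i) (simp_all add: Z_dim herm_mat_carrier)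

lemma mat_word_flatten:
  assumes n: "d \<le> n"
  shows "foldr (\<lambda>x M. model_mat n \<omega> x * M) (flatten w) (one_mat n) = mat_word q d n (mats n \<omega>) w"
proof (induction w)
  case (Cons l w)
  interpret block_sizes q d n by (rule block_sizes[OF n])
  obtain i \<epsilon> f where l: "l = (i, \<epsilon>, f)" by (cases l) auto
  have 1: "model_mat n \<omega> (case i of Inl j \<Rightarrow> Inl (Inl (j, \<epsilon>)) | Inr s \<Rightarrow> Inr s) = (if \<epsilon> then mat_adjoint (mats n \<omega> i) else mats n \<omega> i)"
    by (cases i) (simp_all add: adjoint_herm_mat)
  have 2: "(if \<epsilon> then mat_adjoint (mats n \<omega> i) else mats n \<omega> i) \<in> carrier_mat n n"
    using model_mat_carrier[OF n, of \<omega> "case i of Inl j \<Rightarrow> Inl (Inl (j, \<epsilon>)) | Inr s \<Rightarrow> Inr s"] unfolding 1 .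
  show ?case
    unfolding l flatten.simps foldr.simps comp_def fst_conv snd_conv 1 Cons.IH model_mat.simps mat_word_simps
    by (rule assoc_mult_mat[OF 2 D_mat_carrier mat_word_carrier[OF mats_carrier[OF n]], symmetric])
qed (simp add: mat_word_simps)

text \<open>Consecutive letters from \<open>D\<close> are merged; those in front of the first matrix remain as \<open>f\<close>.\<close>

lemma deterministic_word:
  "\<exists>f w. (\<forall>n\<ge>d. \<forall>\<omega>. foldr (\<lambda>x M. model_mat n \<omega> x * M) (map Inl cs) (one_mat n) = D_mat q d n f * mat_word q d n (\<lambda>j. Z j n) w) \<and>
     cexp (map (theta b) (map Inl cs)) = De f \<otimes> alg_word A d p b w"
proof (induction cs)
  case Nil
  have "foldr (\<lambda>x M. model_mat n \<omega> x * M) (map Inl []) (one_mat n) = D_mat q d n (\<lambda>_. 1) * mat_word q d n (\<lambda>j. Z j n) []"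
    if n: "d \<le> n" for n \<omega>
    using block_sizes.D_mat_one[OF block_sizes[OF n] one_carrier_mat] by (simp add: mat_word_simps)
  moreover have "cexp (map (theta b) (map Inl [])) = De (\<lambda>_. 1) \<otimes> alg_word A d p b []"
    by (simp add: alg_word_def De_one)
  ultimately show ?case by blast
next
  case (Cons c cs)
  then obtain f w where fw: "\<And>n \<omega>. d \<le> n \<Longrightarrow> foldr (\<lambda>x M. model_mat n \<omega> x * M) (map Inl cs) (one_mat n) = D_mat q d n f * mat_word q d n (\<lambda>j. Z j n) w"
    "cexp (map (theta b) (map Inl cs)) = De f \<otimes> alg_word A d p b w" by blast
  have aw: "alg_word A d p b v \<in> carrier A" for v
    by (induction v) (auto simp: alg_word_def)
  show ?case
  proof (cases c)
    case (Inr g)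
    have "foldr (\<lambda>x M. model_mat n \<omega> x * M) (map Inl (c # cs)) (one_mat n) = D_mat q d n (\<lambda>k. g k * f k) * mat_word q d n (\<lambda>j. Z j n) w"
      if n: "d \<le> n" for n \<omega>
    proof -
      interpret block_sizes q d n by (rule block_sizes[OF n])
      show ?thesis unfolding list.map foldr.simps comp_def fw(1)[OF n] Inr model_mat.simps
        by (rule D_mat_mult_D_mat[OF mat_word_carrier[OF Z_dim[OF n]]])
    qed
    moreover have "cexp (map (theta b) (map Inl (c # cs))) = De (\<lambda>k. g k * f k) \<otimes> alg_word A d p b w"
    proof -
      have "cexp (map (theta b) (map Inl (c # cs))) = De g \<otimes> (De f \<otimes> alg_word A d p b w)"
        using fw(2) Inr by simp
      also have "\<dots> = De (\<lambda>k. g k * f k) \<otimes> alg_word A d p b w"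
        unfolding De_De[symmetric] by (rule alg.m_assoc[OF De_closed De_closed aw, symmetric])
      finally show ?thesis .
    qed
    ultimately show ?thesis by blast
  next
    case (Inl jb)
    obtain j \<epsilon> where c: "c = Inl (j, \<epsilon>)" using Inl by (cases jb) auto
    let ?N = "\<lambda>n. if \<epsilon> then mat_adjoint (Z j n) else Z j n"
    let ?y = "if \<epsilon> then star A (b j) else b j"
    have "foldr (\<lambda>x M. model_mat n \<omega> x * M) (map Inl (c # cs)) (one_mat n) = D_mat q d n (\<lambda>_. 1) * mat_word q d n (\<lambda>j. Z j n) ((j, \<epsilon>, f) # w)"
      if n: "d \<le> n" for n \<omega>
    proof -
      interpret block_sizes q d n by (rule block_sizes[OF n])
      have N: "?N n \<in> carrier_mat n n" using model_mat_carrier[OF n, of \<omega> "Inl c"] unfolding c model_mat.simps .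
      have "foldr (\<lambda>x M. model_mat n \<omega> x * M) (map Inl (c # cs)) (one_mat n) = ?N n * (D_mat q d n f * mat_word q d n (\<lambda>j. Z j n) w)"
        unfolding list.map foldr.simps comp_def fw(1)[OF n] c model_mat.simps ..
      also have "\<dots> = mat_word q d n (\<lambda>j. Z j n) ((j, \<epsilon>, f) # w)"
        unfolding mat_word_simps by (rule assoc_mult_mat[OF N D_mat_carrier mat_word_carrier[OF Z_dim[OF n]], symmetric])
      also have "\<dots> = D_mat q d n (\<lambda>_. 1) * mat_word q d n (\<lambda>j. Z j n) ((j, \<epsilon>, f) # w)"
        by (rule D_mat_one[OF mat_word_carrier[OF Z_dim[OF n]], symmetric])
      finally show ?thesis .
    qed
    moreover have "cexp (map (theta b) (map Inl (c # cs))) = De (\<lambda>_. 1) \<otimes> alg_word A d p b ((j, \<epsilon>, f) # w)"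
    proof -
      have y: "?y \<in> carrier A" by simp
      have "cexp (map (theta b) (map Inl (c # cs))) = ?y \<otimes> (De f \<otimes> alg_word A d p b w)"
        unfolding list.map theta.simps cexp.simps fw(2)[unfolded list.map map_map] c sum.case prod.case emb_id[OF y]
        using fw(2) by simp
      also have "\<dots> = ?y \<otimes> De f \<otimes> alg_word A d p b w" by (rule alg.m_assoc[OF y De_closed aw, symmetric])
      also have "\<dots> = alg_word A d p b ((j, \<epsilon>, f) # w)" by (simp only: alg_word_def foldr.simps comp_def prod.case)
      finally show ?thesis unfolding De_one by (simp only: alg.l_one[OF aw])
    qed
    ultimately show ?thesis by blast
  qed
qed

text \<open>The relative block sizes turn the normalization by \<open>q k n\<close> into the one by
  \<open>n\<close>. Convergence in D-distribution speaks of nonempty words; for the empty word the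
  claim is the convergence of the relative block sizes themselves.\<close>

lemma tendsto_trace_word:
  assumes k: "k < d"
  shows "(\<lambda>n. mat_trace (proj_mat q d n k * mat_word q d n (\<lambda>j. Z j n) w * proj_mat q d n k) / of_nat n)
    \<longlonglongrightarrow> state A (p k \<otimes> alg_word A d p b w)"
proof (cases "w = []")
  case True
  have "\<forall>\<^sub>F n in sequentially. of_nat (q k n) / of_nat n =
      mat_trace (proj_mat q d n k * mat_word q d n (\<lambda>j. Z j n) w * proj_mat q d n k) / of_nat n"
  proof (rule eventually_sequentiallyI[of d])
    fix n assume n: "d \<le> n"
    interpret block_sizes q d n by (rule block_sizes[OF n])
    have "D_mat q d n (\<lambda>l. if l = k then 1 else 0) * one_mat n = D_mat q d n (\<lambda>l. if l = k then 1 else 0)"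
      by (rule right_mult_one_mat[OF D_mat_carrier])
    then have "mat_trace (proj_mat q d n k * one_mat n * proj_mat q d n k) = (\<Sum>l<d. of_nat (q l n) * (if l = k then 1 else 0))"
      unfolding trace_proj_eq[OF one_carrier_mat k] by (simp only: trace_D_mat)
    also have "\<dots> = of_nat (q k n)" using k by (simp add: if_distrib[of "\<lambda>x. _ * x"] cong: if_cong)
    finally show "of_nat (q k n) / of_nat n =
        mat_trace (proj_mat q d n k * mat_word q d n (\<lambda>j. Z j n) w * proj_mat q d n k) / of_nat n"
      unfolding True mat_word_simps by (simp only:)
  qed
  then have "(\<lambda>n. mat_trace (proj_mat q d n k * mat_word q d n (\<lambda>j. Z j n) w * proj_mat q d n k) / of_nat n) \<longlonglongrightarrow> state A (p k)"
    using q_lim[OF k] by (rule Lim_transform_eventually[rotated])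
  then show ?thesis using k by (simp add: True alg_word_def)
next
  case False
  have aw: "alg_word A d p b v \<in> carrier A" for v
    by (induction v) (auto simp: alg_word_def)
  interpret prob_space P by (rule prob_P)
  have "(\<lambda>n. mat_E_coeff P q d n (\<lambda>_. mat_word q d n (\<lambda>j. Z j n) w) k) \<longlonglongrightarrow> E_coeff A p (alg_word A d p b w) k"
    using Z_conv False k unfolding converges_in_D_distribution_def by blast
  from tendsto_mult[OF this q_lim[OF k]]
  have "(\<lambda>n. mat_E_coeff P q d n (\<lambda>_. mat_word q d n (\<lambda>j. Z j n) w) k * (of_nat (q k n) / of_nat n))
      \<longlonglongrightarrow> state A (p k \<otimes> alg_word A d p b w)"
    using proj_state_nonzero[OF k] by (simp add: E_coeff_eq[OF k aw])
  moreover have "\<forall>\<^sub>F n in sequentially. mat_E_coeff P q d n (\<lambda>_. mat_word q d n (\<lambda>j. Z j n) w) k * (of_nat (q k n) / of_nat n) =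
      mat_trace (proj_mat q d n k * mat_word q d n (\<lambda>j. Z j n) w * proj_mat q d n k) / of_nat n"
  proof (rule eventually_sequentiallyI[of d])
    fix n assume n: "d \<le> n"
    have "complex_of_nat (q k n) \<noteq> 0" using q_pos[OF n k] by simp
    then show "mat_E_coeff P q d n (\<lambda>_. mat_word q d n (\<lambda>j. Z j n) w) k * (of_nat (q k n) / of_nat n) =
        mat_trace (proj_mat q d n k * mat_word q d n (\<lambda>j. Z j n) w * proj_mat q d n k) / of_nat n"
      by (simp add: mat_E_coeff_def prob_space)
  qed
  ultimately show ?thesis by (rule Lim_transform_eventually)
qed

text \<open>Up to a leading element of D, the word is one to which convergence in D-distribution
  applies, and the trace against that element is a combination of traces over the diagonal
  blocks.\<close>

lemma tendsto_deterministic: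
  "(\<lambda>n. wtr n (\<lambda>x i k. model n x i k \<omega>) (map Inl cs)) \<longlonglongrightarrow> moment \<one> (map (theta b) (map Inl cs))"
proof -
  have aw: "alg_word A d p b v \<in> carrier A" for v
    by (induction v) (auto simp: alg_word_def)
  obtain f w where fw: "\<And>n \<omega>. d \<le> n \<Longrightarrow> foldr (\<lambda>x M. model_mat n \<omega> x * M) (map Inl cs) (one_mat n) = D_mat q d n f * mat_word q d n (\<lambda>j. Z j n) w"
    "cexp (map (theta b) (map Inl cs)) = De f \<otimes> alg_word A d p b w" using deterministic_word by blast
  let ?t = "\<lambda>n k. mat_trace (proj_mat q d n k * mat_word q d n (\<lambda>j. Z j n) w * proj_mat q d n k) / of_nat n"
  have "(\<lambda>n. \<Sum>k<d. f k * ?t n k) \<longlonglongrightarrow> (\<Sum>k<d. f k * state A (p k \<otimes> alg_word A d p b w))"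
    by (intro tendsto_sum tendsto_mult tendsto_const tendsto_trace_word) simp
  moreover have "\<forall>\<^sub>F n in sequentially. (\<Sum>k<d. f k * ?t n k) = wtr n (\<lambda>x i k. model n x i k \<omega>) (map Inl cs)"
  proof (rule eventually_sequentiallyI[of d])
    fix n assume n: "d \<le> n"
    interpret block_sizes q d n by (rule block_sizes[OF n])
    show "(\<Sum>k<d. f k * ?t n k) = wtr n (\<lambda>x i k. model n x i k \<omega>) (map Inl cs)"
      unfolding wtr_model[OF n] fw(1)[OF n] trace_D_mat_mult[OF mat_word_carrier[OF Z_dim[OF n]]]
      by (simp add: sum_divide_distrib)
  qed
  ultimately have "(\<lambda>n. wtr n (\<lambda>x i k. model n x i k \<omega>) (map Inl cs)) \<longlonglongrightarrow> (\<Sum>k<d. f k * state A (p k \<otimes> alg_word A d p b w))"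
    by (rule Lim_transform_eventually)
  also have "(\<Sum>k<d. f k * state A (p k \<otimes> alg_word A d p b w)) = state A (alg_word A d p b w \<otimes> De f)"
    unfolding state_mult_De[OF aw]
    by (rule sum.cong[OF refl]) (use state_tracial[OF proj_in aw] in simp)
  also have "\<dots> = state A (De f \<otimes> alg_word A d p b w)" by (rule state_tracial[OF aw De_closed])
  also have "\<dots> = moment \<one> (map (theta b) (map Inl cs))"
    unfolding moment_def fw(2) using alg.l_one[of "De f \<otimes> alg_word A d p b w"] aw by simp
  finally show ?thesis .
qed

lemma theta_Inr: "theta b x = Inr s \<longleftrightarrow> x = Inr s"
  by (cases x) simp_all

lemma tendsto_wtr:
  "(\<lambda>n. \<integral>\<omega>. wtr n (\<lambda>x i k. model n x i k \<omega>) w \<partial>P) \<longlonglongrightarrow> moment \<one> (map (theta b) w)"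
proof -
  have "(\<lambda>n. \<integral>\<omega>. trprod n (\<lambda>x i k. model n x i k \<omega>) [w] \<partial>P) \<longlonglongrightarrow> (\<Prod>v\<leftarrow>[w]. moment \<one> (map (theta b) v))"
  proof (rule expectation_trprod_tendsto[where N = d and G = coordinate_rv and I = coordinates and vr = coordinate_var and cov = hermitian_cov])
    fix n assume "d \<le> n"
    then show "gaussian_matrices P (coordinate_rv n) (coordinates n) (coordinate_var n) n (model n) (hermitian_cov n)"
      by (rule gaussian_matrices_model)
  next
    fix cs \<omega>
    show "(\<lambda>n. wtr n (\<lambda>x i k. model n x i k \<omega>) (map Inl cs)) \<longlonglongrightarrow> moment \<one> (map (theta b) (map Inl cs))"
      by (rule tendsto_deterministic)
  next
    fix s w
    show "moment \<one> (map (theta b) (Inr s # w)) = split_sum s w (\<lambda>u v. moment \<one> (map (theta b) u) * moment \<one> (map (theta b) v))"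
      using moment_Inr[OF alg.one_closed, of s "map (theta b) w"] by (simp only: list.map theta.simps split_sum_map[OF theta_Inr])
  next
    fix u v
    show "moment \<one> (map (theta b) (u @ v)) = moment \<one> (map (theta b) (v @ u))"
      unfolding map_append by (rule moment_append_commute)
  qed
  then show ?thesis by simp
qed

context
  fixes Y :: "nat \<Rightarrow> nat \<Rightarrow> 'w \<Rightarrow> complex mat"
  assumes Y: "\<And>s n \<omega>. Y s n \<omega> = Matrix.mat n n (\<lambda>(i, j). a i j n s \<omega>)"
begin

abbreviation all_mats :: "nat + nat \<Rightarrow> nat \<Rightarrow> 'w \<Rightarrow> complex mat" where
  "all_mats \<equiv> \<lambda>i. case i of Inl j \<Rightarrow> (\<lambda>n _. Z j n) | Inr s \<Rightarrow> Y s"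

lemma Y_eq_herm:
  assumes n: "d \<le> n"
  shows "AE \<omega> in P. (\<lambda>i. all_mats i n \<omega>) = mats n \<omega>"
  using a_eq_herm[OF n]
proof (rule AE_mp, intro AE_I2 impI ext)
  fix \<omega> i assume h: "\<forall>s i j. i < n \<longrightarrow> j < n \<longrightarrow> a i j n s \<omega> = herm n s i j \<omega>"
  show "all_mats i n \<omega> = mats n \<omega> i"
  proof (cases i)
    case (Inr s)
    have "Y s n \<omega> = herm_mat s n \<omega>" unfolding Y herm_mat_def
      by (rule cong_mat) (use h in \<open>simp_all only: prod.case\<close>)
    then show ?thesis using Inr by simp
  qed simp
qed

lemma all_mats_carrier: "d \<le> n \<Longrightarrow> all_mats i n \<omega> \<in> carrier_mat n n"
  by (cases i) (simp_all add: Z_dim Y)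

lemma all_mats_random:
  assumes n: "d \<le> n"
  shows "all_mats i n \<in> random_mats P n"
proof (cases i)
  case (Inl j)
  interpret prob_space P by (rule prob_P)
  show ?thesis using Z_dim[OF n] unfolding Inl random_mats_def by simp
next
  case (Inr s)
  interpret hermitian_gaussian P "coordinate_rv n" n by (rule hermitian_gaussian[OF n])
  show ?thesis unfolding random_mats_def mem_Collect_eq
  proof (intro conjI allI impI ballI)
    fix \<omega> show "all_mats i n \<omega> \<in> carrier_mat n n" by (rule all_mats_carrier[OF n])
  next
    fix k l assume kl: "k < n" "l < n"
    have e: "(\<lambda>\<omega>. all_mats i n \<omega> $$ (k, l)) = a k l n s" using kl by (simp add: Inr Y fun_eq_iff)
    show "(\<lambda>\<omega>. all_mats i n \<omega> $$ (k, l)) \<in> borel_measurable P" unfolding e by (rule a_rv[OF n kl])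
    fix m
    have "integrable P (\<lambda>\<omega>. cmod (a k l n s \<omega>) ^ m)"
    proof (rule integrable_cong_AE_imp[OF integrable_hermitian_entry_power(1)[OF kl, of s m]])
      show "(\<lambda>\<omega>. cmod (a k l n s \<omega>) ^ m) \<in> borel_measurable P" using a_rv[OF n kl, of s] by measurable
      show "AE \<omega> in P. cmod (herm n s k l \<omega>) ^ m = cmod (a k l n s \<omega>) ^ m"
        using a_eq_herm[OF n] by (rule AE_mp) (use kl in \<open>simp\<close>)
    qed
    then show "integrable P (\<lambda>\<omega>. cmod (all_mats i n \<omega> $$ (k, l)) ^ m)" using fun_cong[OF e] by simp
  qed
qed

text \<open>Passing to exactly Hermitian matrices changes the word on a null set only. By traciality
  the two projections around it merge into one letter from D in front.\<close>

lemma mat_E_coeff_word: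
  assumes n: "d \<le> n" and k: "k < d"
  shows "mat_E_coeff P q d n (\<lambda>\<omega>. mat_word q d n (\<lambda>i. all_mats i n \<omega>) w) k =
    (\<integral>\<omega>. wtr n (\<lambda>x i k. model n x i k \<omega>) (Inl (Inr (\<lambda>l. if l = k then 1 else 0)) # flatten w) \<partial>P) /
      (of_nat (q k n) / of_nat n)"
proof -
  interpret block_sizes q d n by (rule block_sizes[OF n])
  interpret hermitian_gaussian P "coordinate_rv n" n by (rule hermitian_gaussian[OF n])
  let ?tr = "\<lambda>M. mat_trace (proj_mat q d n k * M * proj_mat q d n k)"
  have tr_meas: "(\<lambda>\<omega>. ?tr (W \<omega>)) \<in> borel_measurable P"
    if "\<And>\<omega>. W \<omega> \<in> carrier_mat n n" "\<And>i. i < n \<Longrightarrow> (\<lambda>\<omega>. W \<omega> $$ (i, i)) \<in> borel_measurable P" for W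
    unfolding trace_proj[OF that(1)] using that(2) by (intro borel_measurable_sum) simp
  have "(\<integral>\<omega>. ?tr (mat_word q d n (\<lambda>i. all_mats i n \<omega>) w) \<partial>P) = (\<integral>\<omega>. ?tr (mat_word q d n (mats n \<omega>) w) \<partial>P)"
  proof (rule integral_cong_AE)
    show "(\<lambda>\<omega>. ?tr (mat_word q d n (\<lambda>i. all_mats i n \<omega>) w)) \<in> borel_measurable P"
      using all_mats_random[OF n] unfolding random_mats_def
      by (intro tr_meas mat_word_carrier all_mats_carrier[OF n] measurable_mat_word[where M = "\<lambda>i. all_mats i n"]) simp_all
    have "(\<lambda>\<omega>. mats n \<omega> i $$ (l, m)) \<in> borel_measurable P" if "l < n" "m < n" for i l m
    proof (cases i)
      case (Inr s)
      then have "(\<lambda>\<omega>. mats n \<omega> i $$ (l, m)) = herm n s l m" using that by (simp add: herm_mat_def fun_eq_iff)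
      then show ?thesis using integrable_hermitian_entry_power(2)[OF that, of s] by (simp only:)
    qed simp
    then show "(\<lambda>\<omega>. ?tr (mat_word q d n (mats n \<omega>) w)) \<in> borel_measurable P"
      by (intro tr_meas mat_word_carrier mats_carrier[OF n] measurable_mat_word[where M = "\<lambda>i \<omega>. mats n \<omega> i"])
    show "AE \<omega> in P. ?tr (mat_word q d n (\<lambda>i. all_mats i n \<omega>) w) = ?tr (mat_word q d n (mats n \<omega>) w)"
      using Y_eq_herm[OF n] by (rule AE_mp) (intro AE_I2 impI, simp only:)
  qed
  also have "\<dots> = (\<integral>\<omega>. of_nat n * wtr n (\<lambda>x i k. model n x i k \<omega>) (Inl (Inr (\<lambda>l. if l = k then 1 else 0)) # flatten w) \<partial>P)"
  proof (rule Bochner_Integration.integral_cong[OF refl])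
    fix \<omega>
    have "of_nat n \<noteq> (0::complex)" using n d_pos by simp
    then show "?tr (mat_word q d n (mats n \<omega>) w) =
        of_nat n * wtr n (\<lambda>x i k. model n x i k \<omega>) (Inl (Inr (\<lambda>l. if l = k then 1 else 0)) # flatten w)"
      unfolding trace_proj_eq[OF mat_word_carrier[OF mats_carrier[OF n]] k] wtr_model[OF n] foldr.simps comp_def
        model_mat.simps mat_word_flatten[OF n] by simp
  qed
  finally show ?thesis by (simp add: mat_E_coeff_def)
qed

lemma tendsto_mat_E_coeff:
  assumes k: "k < d"
  shows "(\<lambda>n. mat_E_coeff P q d n (\<lambda>\<omega>. mat_word q d n (\<lambda>i. all_mats i n \<omega>) w) k)
    \<longlonglongrightarrow> moment (p k) (map (theta b) (flatten w)) / state A (p k)"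
proof -
  let ?w = "Inl (Inr (\<lambda>l. if l = k then 1 else 0)) # flatten w"
  have "(\<lambda>n. (\<integral>\<omega>. wtr n (\<lambda>x i k. model n x i k \<omega>) ?w \<partial>P) / (of_nat (q k n) / of_nat n))
      \<longlonglongrightarrow> moment \<one> (map (theta b) ?w) / state A (p k)"
    by (rule tendsto_divide[OF tendsto_wtr q_lim[OF k] proj_state_nonzero[OF k]])
  moreover have "moment \<one> (map (theta b) ?w) = moment (p k) (map (theta b) (flatten w))"
    using k by (simp add: De_indicator)
  moreover have "\<forall>\<^sub>F n in sequentially. (\<integral>\<omega>. wtr n (\<lambda>x i k. model n x i k \<omega>) ?w \<partial>P) / (of_nat (q k n) / of_nat n) =
      mat_E_coeff P q d n (\<lambda>\<omega>. mat_word q d n (\<lambda>i. all_mats i n \<omega>) w) k"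
    by (rule eventually_sequentiallyI[of d]) (rule mat_E_coeff_word[OF _ k, symmetric])
  ultimately show ?thesis by (simp only: Lim_transform_eventually)
qed

end

end

theorem theorem4p1:
  fixes A :: "'u star_prob" and d :: nat and p :: "nat \<Rightarrow> 'u"
    and q :: "nat \<Rightarrow> nat \<Rightarrow> nat"
    and P :: "'w measure"
    and a :: "nat \<Rightarrow> nat \<Rightarrow> nat \<Rightarrow> nat \<Rightarrow> 'w \<Rightarrow> complex"
    and Y :: "nat \<Rightarrow> nat \<Rightarrow> 'w \<Rightarrow> complex mat"
    and B :: "nat \<Rightarrow> nat \<Rightarrow> complex mat"
  assumes space: "rectangular_prob_space A d p"
    and q_pos: "\<And>n k. n \<ge> d \<Longrightarrow> k < d \<Longrightarrow> 0 < q k n"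
    and q_sum: "\<And>n. n \<ge> d \<Longrightarrow> (\<Sum>k<d. q k n) = n"
    and q_lim: "\<And>k. k < d \<Longrightarrow> (\<lambda>n. of_nat (q k n) / of_nat n) \<longlonglongrightarrow> state A (p k)"
    and P: "prob_space P"
    and Y: "\<And>s n \<omega>. Y s n \<omega> = Matrix.mat n n (\<lambda>(i, j). a i j n s \<omega>)"
    and a_rv: "\<And>n s i j. n \<ge> d \<Longrightarrow> i < n \<Longrightarrow> j < n \<Longrightarrow> a i j n s \<in> borel_measurable P"
    and a_hermitian: "\<And>n s i j. n \<ge> d \<Longrightarrow> i < n \<Longrightarrow> j < n \<Longrightarrow>
          AE \<omega> in P. a i j n s \<omega> = cnj (a j i n s \<omega>)"
    and a_indep: "\<And>n. n \<ge> d \<Longrightarrow>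
          prob_space.indep_vars P (\<lambda>_. borel)
            (\<lambda>(i, j, s, im) \<omega>. if im then Im (a i j n s \<omega>) else Re (a i j n s \<omega>))
            ({(i, j, s, False) | i j s. i \<le> j \<and> j < n} \<union> {(i, j, s, True) | i j s. i < j \<and> j < n})"
    and a_gauss_Re: "\<And>n s i j. n \<ge> d \<Longrightarrow> i < j \<Longrightarrow> j < n \<Longrightarrow>
          distributed P lborel (\<lambda>\<omega>. Re (a i j n s \<omega>)) (normal_density 0 (sqrt (1 / (2 * real n))))"
    and a_gauss_Im: "\<And>n s i j. n \<ge> d \<Longrightarrow> i < j \<Longrightarrow> j < n \<Longrightarrow>
          distributed P lborel (\<lambda>\<omega>. Im (a i j n s \<omega>)) (normal_density 0 (sqrt (1 / (2 * real n))))"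
    and a_gauss_diag: "\<And>n s i. n \<ge> d \<Longrightarrow> i < n \<Longrightarrow>
          distributed P lborel (\<lambda>\<omega>. Re (a i i n s \<omega>)) (normal_density 0 (sqrt (1 / real n)))"
    and B_dim: "\<And>n j. n \<ge> d \<Longrightarrow> B j n \<in> carrier_mat n n"
    and B_mult: "\<And>n j k. n \<ge> d \<Longrightarrow> \<exists>l. B l n = B j n * B k n"
    and B_adj: "\<And>n j. n \<ge> d \<Longrightarrow> \<exists>l. B l n = mat_adjoint (B j n)"
    and B_proj: "\<And>n k. n \<ge> d \<Longrightarrow> k < d \<Longrightarrow> \<exists>j. B j n = proj_mat q d n k"
    and B_bounded: "\<And>j. Bseq (\<lambda>n. operator_norm (D_mat q d n (mat_E_coeff P q d n (\<lambda>_. B j n))))"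
    and B_conv: "\<exists>A' \<iota> b. enlargement A A' \<iota> \<and>
          converges_in_D_distribution P q d (\<lambda>j n _. B j n) A' (\<iota> \<circ> p) b"
  shows "\<exists>A' \<iota> x. enlargement A A' \<iota> \<and>
           asymptotically_free P q d
             (\<lambda>i. case i of Inl j \<Rightarrow> (\<lambda>n _. B j n) | Inr s \<Rightarrow> Y s)
             (\<lambda>g. case g of None \<Rightarrow> range Inl | Some s \<Rightarrow> {Inr s})
             A' (\<iota> \<circ> p) x \<and>
           (\<forall>s. D_semicircular A' d (\<iota> \<circ> p) (x (Inr s)))"
proof -
  interpret P: prob_space P by (rule P)
  have d: "0 < d"
  proof (rule ccontr)
    interpret rectangular_prob_space A d p by (rule space)
    assume "\<not> 0 < d"
    then have "\<zero>\<^bsub>A\<^esub> = \<one>\<^bsub>A\<^esub>" using proj_sum by simp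
    then show False using state_one state_zero by simp
  qed
  \<comment> \<open>The limits of the constant matrices live in a first enlargement, and the
    semicircular extension is built over that one.\<close>
  obtain A' \<iota> b where emb: "enlargement A A' \<iota>"
    and conv: "converges_in_D_distribution P q d (\<lambda>j n _. B j n) A' (\<iota> \<circ> p) b"
    using B_conv by blast
  interpret A': rectangular_prob_space A' d "\<iota> \<circ> p"
    by (rule enlargement_rectangular[OF emb space])
  have "p k \<in> carrier A" if "k < d" for k
    by (rule rectangular_prob_space.proj_closed[OF space that])
  then have "state A' ((\<iota> \<circ> p) k) = state A (p k)" if "k < d" for k
    using emb that by (simp add: enlargement_def)
  then interpret m: matrix_model A' d "\<iota> \<circ> p" q P a B b
    using q_lim
    by unfold_locales
      (simp_all add: d q_pos q_sum a_rv a_hermitian a_indep[folded coordinates_def] a_gauss_Re a_gauss_Im a_gauss_diag B_dim conv)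
  let ?B = "A'.semicircular_extension" and ?\<eta> = "A'.scalar_emb"
  let ?x = "A'.joint_limit b"
  have assoc: "(?\<eta> \<circ> \<iota>) \<circ> p = ?\<eta> \<circ> (\<iota> \<circ> p)" by (rule comp_assoc)
  have "enlargement A ?B (?\<eta> \<circ> \<iota>)" by (rule enlargement_trans[OF emb A'.enlargement_ext])
  moreover have "asymptotically_free P q d
      (\<lambda>i. case i of Inl j \<Rightarrow> (\<lambda>n _. B j n) | Inr s \<Rightarrow> Y s)
      (\<lambda>g. case g of None \<Rightarrow> range Inl | Some s \<Rightarrow> {Inr s}) ?B (?\<eta> \<circ> (\<iota> \<circ> p)) ?x"
    unfolding asymptotically_free_def converges_in_D_distribution_def
  proof (intro conjI allI impI)
    fix n i assume "d \<le> n"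
    then show "(case i of Inl j \<Rightarrow> (\<lambda>n _. B j n) | Inr s \<Rightarrow> Y s) n \<in> random_mats P n"
      by (rule m.all_mats_random[OF Y])
  next
    fix i show "?x i \<in> carrier ?B"
      by (cases i) (simp_all add: A'.joint_limit_def A'.scalar_emb_def A'.semicircular_def A'.carrier_ext)
  next
    fix w :: "(nat + nat) letter list" and k assume k: "k < d"
    show "(\<lambda>n. mat_E_coeff P q d n (\<lambda>\<omega>. mat_word q d n (\<lambda>i. (case i of Inl j \<Rightarrow> (\<lambda>n _. B j n) | Inr s \<Rightarrow> Y s) n \<omega>) w) k)
        \<longlonglongrightarrow> E_coeff ?B (?\<eta> \<circ> (\<iota> \<circ> p)) (alg_word ?B d (?\<eta> \<circ> (\<iota> \<circ> p)) ?x w) k"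
      unfolding A'.alg_word_ext[OF m.b_closed] A'.E_coeff_code[OF k]
      by (rule m.tendsto_mat_E_coeff[OF Y k])
  next
    show "free_subsets ?B d (?\<eta> \<circ> (\<iota> \<circ> p)) (\<lambda>g. ?x ` (case g of None \<Rightarrow> range Inl | Some s \<Rightarrow> {Inr s}))"
      by (rule A'.free_subsets_ext[OF m.b_closed])
  qed
  moreover have "D_semicircular ?B d (?\<eta> \<circ> (\<iota> \<circ> p)) (?x (Inr s))" for s
    using A'.D_semicircular_semicircular by (simp add: A'.joint_limit_def)
  ultimately show ?thesis unfolding assoc[symmetric] by blast
qed

end
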